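(* Let $G$ be a finite group of linear automorphisms of the finite dimensional vector space $V$ over a field $k$ and let $M$ be a finite dimensional $kG$-module. Let $W$ be the reflection subgroup of $G$, i.e., the subgroup generated by the elements of $G$ that fix some linear hyperplane of $V$ point-wise. Then $s_{k[V]^G}(k[V]^G(M))$ is a non-negative integer, and $s_{k[V]^G}(k[V]^G(M))=0$ if and only if $W$ acts trivially on $M$.
   Context: $k$ is a field of arbitrary characteristic; $k[V]$ is the coordinate ring of $V$ (polynomial algebra on a basis of $V^*$, standard grading) with the induced $G$-action; $k[V]^G$ is the invariant ring, and $k[V]^G(M):=(k[V]\otimes_k M)^G$ (diagonal action, $M$ in degree $0$) is the module of covariants of type $M$, a graded $k[V]^G$-module. The Hilbert series of a graded module $N$ is $\mathcal H(N;t)=\sum_i\dim_k(N_i)t^i$, viewed as a rational function. For a finitely generated graded $k$-algebra $B$ without zero-divisors with $B_0=k$ and a finitely generated graded $B$-module $N$, the rank $r_B(N)$ and the $s$-invariant $s_B(N)$ are defined by the expansion at $t=1$: $\mathcal H(N;t)/\mathcal H(B;t)=r_B(N)+s_B(N)(t-1)+O((t-1)^2)$. *)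

theory Defs
  imports
    "HOL-Library.Poly_Mapping"
    "HOL-Computational_Algebra.Fraction_Field"
    "HOL-Computational_Algebra.Polynomial_FPS"
    "HOL-Algebra.Generated_Groups"
begin

section \<open>Linear groups and reflections\<close>

definition GL :: "('k::field \<Rightarrow> 'v::ab_group_add \<Rightarrow> 'v) \<Rightarrow> ('v \<Rightarrow> 'v) monoid" where
  "GL sV = \<lparr>carrier = {g. Vector_Spaces.linear sV sV g \<and> bij g}, mult = (\<circ>), one = id\<rparr>"

lemma inv_mem_GL:
  assumes "g \<in> carrier (GL sV)"
  shows "inv_into UNIV g \<in> carrier (GL sV)"
proof -
  have lin: "Vector_Spaces.linear sV sV g" and bij: "bij g"
    using assms by (auto simp: GL_def)
  interpret g: Vector_Spaces.linear sV sV g by (rule lin)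
  have "Vector_Spaces.linear sV sV (inv_into UNIV g)"
  proof (rule Vector_Spaces.linear.intro)
    show "module_hom sV sV (inv_into UNIV g)"
      unfolding module_hom_iff
      using bij g.add g.scale g.vs1.module_axioms
      by (metis bij_inv_eq_iff)
  qed (rule g.vs1.vector_space_axioms)+
  with bij show ?thesis by (simp add: GL_def bij_imp_bij_inv)
qed

lemma group_GL:
  assumes "vector_space sV"
  shows "group (GL sV)"
proof (rule groupI)
  fix g assume "g \<in> carrier (GL sV)"
  then show "\<exists>h\<in>carrier (GL sV). h \<otimes>\<^bsub>GL sV\<^esub> g = \<one>\<^bsub>GL sV\<^esub>"
    using inv_mem_GL[of g sV] by (auto simp: GL_def bij_def intro!: bexI[of _ "inv_into UNIV g"])
qed (use assms in \<open>auto simp: GL_def bij_comp vector_space.linear_id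
      intro: Vector_Spaces.linear_compose\<close>)

definition hyperplane :: "('k::field \<Rightarrow> 'v::ab_group_add \<Rightarrow> 'v) \<Rightarrow> 'v set \<Rightarrow> bool" where
  "hyperplane sV H \<longleftrightarrow>
     module.subspace sV H \<and> vector_space.dim sV H + 1 = vector_space.dim sV UNIV"

definition reflection_subgroup ::
    "('k::field \<Rightarrow> 'v::ab_group_add \<Rightarrow> 'v) \<Rightarrow> ('v \<Rightarrow> 'v) set \<Rightarrow> ('v \<Rightarrow> 'v) set" where
  "reflection_subgroup sV G =
     generate (GL sV) {g \<in> G. \<exists>H. hyperplane sV H \<and> (\<forall>v\<in>H. g v = v)}"


section \<open>The coordinate ring and its group action\<close>

text \<open>A polynomial is a finitely supported function from monomials to coefficients, and the
  exponent of a monomial is a finitely supported function from variables to natural numbers.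
  The variable with index \<open>b\<close> in the basis \<open>BV\<close> of \<open>V\<close> stands for the member
  \<open>v \<mapsto> module.representation sV BV v b\<close> of the dual basis.\<close>

type_synonym 'v monom = "'v \<Rightarrow>\<^sub>0 nat"
type_synonym ('v, 'a) mpoly = "'v monom \<Rightarrow>\<^sub>0 'a"

definition monom_degree :: "'v monom \<Rightarrow> nat" where
  "monom_degree e = (\<Sum>b\<in>Poly_Mapping.keys e. Poly_Mapping.lookup e b)"

definition homogeneous_part :: "('v, 'a::zero) mpoly set \<Rightarrow> nat \<Rightarrow> ('v, 'a) mpoly set" where
  "homogeneous_part N i = {F \<in> N. \<forall>e\<in>Poly_Mapping.keys F. monom_degree e = i}"

text \<open>For coefficients in \<open>k\<close> this is the coordinate ring \<open>k[V]\<close>; for coefficients in a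
  vector space \<open>M\<close> it is \<open>k[V] \<otimes> M\<close>, see below.\<close>

definition polys_over :: "'v set \<Rightarrow> ('v, 'a::zero) mpoly set" where
  "polys_over BV = {F. \<forall>e\<in>Poly_Mapping.keys F. Poly_Mapping.keys e \<subseteq> BV}"

text \<open>An element of the dual space of \<open>V\<close> as a polynomial of degree one.\<close>

definition linear_form :: "'v set \<Rightarrow> ('v \<Rightarrow> 'k::field) \<Rightarrow> ('v, 'k) mpoly" where
  "linear_form BV l = (\<Sum>b\<in>BV. Poly_Mapping.single (Poly_Mapping.single b 1) (l b))"

text \<open>An automorphism \<open>g\<close> sends a functional \<open>l\<close> to \<open>l \<circ> g\<inverse>\<close>; on polynomials it acts by the
  induced substitution.\<close>

definition poly_act_monom ::
    "('k::field \<Rightarrow> 'v::ab_group_add \<Rightarrow> 'v) \<Rightarrow> 'v set \<Rightarrow> ('v \<Rightarrow> 'v) \<Rightarrow> 'v monom \<Rightarrow> ('v, 'k) mpoly" where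
  "poly_act_monom sV BV g e =
     (\<Prod>b\<in>Poly_Mapping.keys e.
        linear_form BV (\<lambda>v. module.representation sV BV (inv_into UNIV g v) b) ^ Poly_Mapping.lookup e b)"

definition poly_act ::
    "('k::field \<Rightarrow> 'v::ab_group_add \<Rightarrow> 'v) \<Rightarrow> 'v set \<Rightarrow> ('v \<Rightarrow> 'v) \<Rightarrow> ('v, 'k) mpoly \<Rightarrow> ('v, 'k) mpoly" where
  "poly_act sV BV g p =
     (\<Sum>e\<in>Poly_Mapping.keys p. Poly_Mapping.single 0 (Poly_Mapping.lookup p e) * poly_act_monom sV BV g e)"

definition invariant_ring ::
    "('k::field \<Rightarrow> 'v::ab_group_add \<Rightarrow> 'v) \<Rightarrow> 'v set \<Rightarrow> ('v \<Rightarrow> 'v) set \<Rightarrow> ('v, 'k) mpoly set" where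
  "invariant_ring sV BV G = {p \<in> polys_over BV. \<forall>g\<in>G. poly_act sV BV g p = p}"

lemma poly_act_superset:
  assumes "finite A" "Poly_Mapping.keys p \<subseteq> A"
  shows "poly_act sV BV g p =
    (\<Sum>e\<in>A. Poly_Mapping.single 0 (Poly_Mapping.lookup p e) * poly_act_monom sV BV g e)"
  unfolding poly_act_def using assms
  by (intro sum.mono_neutral_left) (auto simp: in_keys_iff)

lemma poly_act_single [simp]:
  "poly_act sV BV g (Poly_Mapping.single e c) = Poly_Mapping.single 0 c * poly_act_monom sV BV g e"
  by (subst poly_act_superset[of "{e}"]) auto

lemma poly_act_add: "poly_act sV BV g (p + q) = poly_act sV BV g p + poly_act sV BV g q"
  by (subst (1 2 3) poly_act_superset[of "Poly_Mapping.keys p \<union> Poly_Mapping.keys q"])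
     (auto simp: lookup_add single_add algebra_simps sum.distrib dest: subsetD[OF keys_add])

lemma poly_act_zero [simp]: "poly_act sV BV g 0 = 0"
  by (simp add: poly_act_def)

lemma poly_act_sum: "poly_act sV BV g (\<Sum>i\<in>A. p i) = (\<Sum>i\<in>A. poly_act sV BV g (p i))"
  by (induction A rule: infinite_finite_induct) (auto simp: poly_act_add)

lemma poly_act_monom_add:
  "poly_act_monom sV BV g (e + f) = poly_act_monom sV BV g e * poly_act_monom sV BV g f"
proof -
  let ?P = "\<lambda>e. \<Prod>b\<in>Poly_Mapping.keys e \<union> Poly_Mapping.keys f.
        linear_form BV (\<lambda>v. module.representation sV BV (inv_into UNIV g v) b) ^ Poly_Mapping.lookup e b"
  let ?A = "Poly_Mapping.keys e \<union> Poly_Mapping.keys f"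
  have *: "poly_act_monom sV BV g h = (\<Prod>b\<in>?A.
        linear_form BV (\<lambda>v. module.representation sV BV (inv_into UNIV g v) b) ^ Poly_Mapping.lookup h b)"
    if "Poly_Mapping.keys h \<subseteq> ?A" for h
    unfolding poly_act_monom_def using that
    by (intro prod.mono_neutral_left) (auto simp: in_keys_iff)
  show ?thesis
    using keys_add[of e f] by (simp add: * lookup_add power_add prod.distrib)
qed

lemma mpoly_eq_sum_single: "F = (\<Sum>e\<in>Poly_Mapping.keys F. Poly_Mapping.single e (Poly_Mapping.lookup F e))"
  by (rule poly_mapping_eqI) (auto simp: lookup_sum lookup_single when_def in_keys_iff)

lemma poly_act_mult: "poly_act sV BV g (p * q) = poly_act sV BV g p * poly_act sV BV g q"
proof -
  have single: "poly_act sV BV g (Poly_Mapping.single e c * Poly_Mapping.single f d) =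
      poly_act sV BV g (Poly_Mapping.single e c) * poly_act sV BV g (Poly_Mapping.single f d)"
    for e f c d
  proof -
    have "Poly_Mapping.single (0 :: 'a monom) (c * d) = Poly_Mapping.single 0 c * Poly_Mapping.single 0 d"
      by (simp add: mult_single)
    then show ?thesis
      by (simp only: mult_single[of e] poly_act_single poly_act_monom_add ac_simps)
  qed
  have "poly_act sV BV g (p * q) =
    poly_act sV BV g ((\<Sum>e\<in>Poly_Mapping.keys p. Poly_Mapping.single e (Poly_Mapping.lookup p e)) *
                      (\<Sum>f\<in>Poly_Mapping.keys q. Poly_Mapping.single f (Poly_Mapping.lookup q f)))"
    by (simp flip: mpoly_eq_sum_single)
  also have "\<dots> = poly_act sV BV g (\<Sum>e\<in>Poly_Mapping.keys p. Poly_Mapping.single e (Poly_Mapping.lookup p e)) *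
                  poly_act sV BV g (\<Sum>f\<in>Poly_Mapping.keys q. Poly_Mapping.single f (Poly_Mapping.lookup q f))"
    unfolding sum_product poly_act_sum single ..
  finally show ?thesis
    by (simp flip: mpoly_eq_sum_single)
qed

lemma poly_act_one [simp]: "poly_act sV BV g 1 = 1"
  using poly_act_single[of sV BV g 0 1] by (simp add: poly_act_monom_def del: poly_act_single)

lemma linear_form_cong: "(\<And>b. b \<in> BV \<Longrightarrow> l b = l' b) \<Longrightarrow> linear_form BV l = linear_form BV l'"
  by (simp add: linear_form_def)

lemma poly_act_linear_form:
  assumes fin: "finite_dimensional_vector_space sV BV" and g: "g \<in> carrier (GL sV)"
    and l: "Vector_Spaces.linear sV (*) l"
  shows "poly_act sV BV g (linear_form BV l) = linear_form BV (l \<circ> inv_into UNIV g)"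
proof -
  interpret V: finite_dimensional_vector_space sV BV by (rule fin)
  interpret l: Vector_Spaces.linear sV "(*)" l by (rule l)
  let ?r = "\<lambda>v b. V.representation BV (inv_into UNIV g v) b"
  have "poly_act sV BV g (linear_form BV l) =
      (\<Sum>b\<in>BV. Poly_Mapping.single 0 (l b) * linear_form BV (\<lambda>v. ?r v b))"
    by (subst linear_form_def, simp add: poly_act_sum poly_act_monom_def)
  also have "\<dots> = (\<Sum>b\<in>BV. \<Sum>b'\<in>BV. Poly_Mapping.single (Poly_Mapping.single b' 1) (?r b' b * l b))"
    by (simp add: linear_form_def sum_distrib_left mult_single mult.commute)
  also have "\<dots> = linear_form BV (\<lambda>b'. \<Sum>b\<in>BV. ?r b' b * l b)"
  proof -
    have "(\<Sum>b\<in>A. Poly_Mapping.single x (f b)) = Poly_Mapping.single x (\<Sum>b\<in>A. f b)"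
      for A and f :: "'b \<Rightarrow> 'a" and x :: "'b monom"
      by (induction A rule: infinite_finite_induct) (auto simp: single_add)
    then show ?thesis
      by (subst sum.swap) (simp add: linear_form_def)
  qed
  also have "\<dots> = linear_form BV (l \<circ> inv_into UNIV g)"
  proof (rule linear_form_cong)
    fix b'
    have "inv_into UNIV g b' = (\<Sum>b\<in>BV. sV (?r b' b) b)"
      using V.sum_representation_eq[of BV "inv_into UNIV g b'" BV] V.finite_Basis
        V.independent_Basis V.span_Basis by simp
    then have "l (inv_into UNIV g b') = l (\<Sum>b\<in>BV. sV (?r b' b) b)" by simp
    then show "(\<Sum>b\<in>BV. ?r b' b * l b) = (l \<circ> inv_into UNIV g) b'"
      by (simp add: l.sum l.scale)
  qed
  finally show ?thesis .
qed


section \<open>Tensor product with a module, covariants\<close>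

definition coeff_scale ::
    "('k::field \<Rightarrow> 'm::ab_group_add \<Rightarrow> 'm) \<Rightarrow> 'k \<Rightarrow> ('v, 'm) mpoly \<Rightarrow> ('v, 'm) mpoly" where
  "coeff_scale sM c F = Poly_Mapping.map (sM c) F"

text \<open>Since the monomials are a basis of the polynomials, the \<open>M\<close>-valued polynomials together
  with the following bilinear map are the tensor product of the polynomials with \<open>M\<close>; the
  universal property is proved below.\<close>

definition tensor ::
    "('k::field \<Rightarrow> 'm::ab_group_add \<Rightarrow> 'm) \<Rightarrow> ('v, 'k) mpoly \<Rightarrow> 'm \<Rightarrow> ('v, 'm) mpoly" where
  "tensor sM p m = Poly_Mapping.map (\<lambda>c. sM c m) p"

text \<open>The diagonal action, \<open>g (p \<otimes> m) = g p \<otimes> g m\<close>.\<close>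

definition tensor_act ::
    "('k::field \<Rightarrow> 'v::ab_group_add \<Rightarrow> 'v) \<Rightarrow> 'v set \<Rightarrow> ('k \<Rightarrow> 'm::ab_group_add \<Rightarrow> 'm) \<Rightarrow>
     (('v \<Rightarrow> 'v) \<Rightarrow> 'm \<Rightarrow> 'm) \<Rightarrow> ('v \<Rightarrow> 'v) \<Rightarrow> ('v, 'm) mpoly \<Rightarrow> ('v, 'm) mpoly" where
  "tensor_act sV BV sM \<rho> g F =
     (\<Sum>e\<in>Poly_Mapping.keys F. tensor sM (poly_act sV BV g (Poly_Mapping.single e 1)) (\<rho> g (Poly_Mapping.lookup F e)))"

definition covariants ::
    "('k::field \<Rightarrow> 'v::ab_group_add \<Rightarrow> 'v) \<Rightarrow> 'v set \<Rightarrow> ('v \<Rightarrow> 'v) set \<Rightarrow>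
     ('k \<Rightarrow> 'm::ab_group_add \<Rightarrow> 'm) \<Rightarrow> (('v \<Rightarrow> 'v) \<Rightarrow> 'm \<Rightarrow> 'm) \<Rightarrow> ('v, 'm) mpoly set" where
  "covariants sV BV G sM \<rho> = {F \<in> polys_over BV. \<forall>g\<in>G. tensor_act sV BV sM \<rho> g F = F}"

context vector_space
begin

lemma lookup_coeff_scale: "Poly_Mapping.lookup (coeff_scale scale c F) e = scale c (Poly_Mapping.lookup F e)"
  by (simp add: coeff_scale_def Poly_Mapping.map.rep_eq when_def)

lemma vector_space_coeff_scale:
  "vector_space (coeff_scale scale :: 'a \<Rightarrow> ('v, 'b) mpoly \<Rightarrow> ('v, 'b) mpoly)"
  by unfold_locales
     (auto intro!: poly_mapping_eqI simp: lookup_coeff_scale lookup_add scale_right_distrib scale_left_distrib)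

lemma lookup_tensor: "Poly_Mapping.lookup (tensor scale p m) e = scale (Poly_Mapping.lookup p e) m"
  by (simp add: tensor_def Poly_Mapping.map.rep_eq when_def)

lemma tensor_add_left: "tensor scale (p + q) m = tensor scale p m + tensor scale q m"
  by (rule poly_mapping_eqI) (simp add: lookup_tensor lookup_add scale_left_distrib)

lemma tensor_add_right: "tensor scale p (m + n) = tensor scale p m + tensor scale p n"
  by (rule poly_mapping_eqI) (simp add: lookup_tensor lookup_add scale_right_distrib)

lemma tensor_scale_left:
  "tensor scale (coeff_scale (*) c p) m = coeff_scale scale c (tensor scale p m)"
proof -
  have "Poly_Mapping.lookup (coeff_scale (*) c p) e = c * Poly_Mapping.lookup p e" for e
    by (simp add: coeff_scale_def Poly_Mapping.map.rep_eq when_def)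
  then show ?thesis
    by (intro poly_mapping_eqI) (simp add: lookup_tensor lookup_coeff_scale)
qed

lemma tensor_scale_right: "tensor scale p (scale c m) = coeff_scale scale c (tensor scale p m)"
  by (rule poly_mapping_eqI) (simp add: lookup_tensor lookup_coeff_scale mult.commute)

lemma tensor_zero_left [simp]: "tensor scale 0 m = 0"
  by (rule poly_mapping_eqI) (simp add: lookup_tensor)

lemma tensor_zero_right [simp]: "tensor scale p 0 = 0"
  by (rule poly_mapping_eqI) (simp add: lookup_tensor)

lemma tensor_sum_left: "tensor scale (\<Sum>i\<in>A. p i) m = (\<Sum>i\<in>A. tensor scale (p i) m)"
  by (induction A rule: infinite_finite_induct) (auto simp: tensor_add_left)

lemma tensor_single: "tensor scale (Poly_Mapping.single e c) m = Poly_Mapping.single e (scale c m)"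
  by (rule poly_mapping_eqI) (simp add: lookup_tensor lookup_single when_def)

lemma tensor_universal:
  fixes sT :: "'a \<Rightarrow> 't::ab_group_add \<Rightarrow> 't" and \<beta> :: "('v, 'a) mpoly \<Rightarrow> 'b \<Rightarrow> 't"
  assumes T: "vector_space sT"
    and lin1: "\<And>m. Vector_Spaces.linear (coeff_scale (*)) sT (\<lambda>p. \<beta> p m)"
    and lin2: "\<And>p. Vector_Spaces.linear scale sT (\<beta> p)"
  shows "\<exists>!\<phi>. Vector_Spaces.linear (coeff_scale scale) sT \<phi> \<and> (\<forall>p m. \<phi> (tensor scale p m) = \<beta> p m)"
proof (rule ex_ex1I)
  interpret T: vector_space sT by (rule T)
  interpret L1: Vector_Spaces.linear "coeff_scale (*)" sT "\<lambda>p. \<beta> p m" for m by (rule lin1)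
  interpret L2: Vector_Spaces.linear scale sT "\<beta> p" for p by (rule lin2)
  interpret C: vector_space "coeff_scale scale :: 'a \<Rightarrow> ('v, 'b) mpoly \<Rightarrow> ('v, 'b) mpoly"
    by (rule vector_space_coeff_scale)
  define \<phi> where "\<phi> F = (\<Sum>e\<in>Poly_Mapping.keys F. \<beta> (Poly_Mapping.single e 1) (Poly_Mapping.lookup F e))"
    for F :: "('v, 'b) mpoly"
  have sup: "\<phi> F = (\<Sum>e\<in>A. \<beta> (Poly_Mapping.single e 1) (Poly_Mapping.lookup F e))"
    if "finite A" "Poly_Mapping.keys F \<subseteq> A" for A F
    unfolding \<phi>_def using that by (intro sum.mono_neutral_left) (auto simp: in_keys_iff L2.zero)
  have "\<phi> (F + H) = \<phi> F + \<phi> H" for F H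
    using keys_add[of F H]
    by (subst (1 2 3) sup[of "Poly_Mapping.keys F \<union> Poly_Mapping.keys H"]) (auto simp: lookup_add L2.add sum.distrib)
  moreover have "\<phi> (coeff_scale scale c F) = sT c (\<phi> F)" for c F
    by (subst (1 2) sup[of "Poly_Mapping.keys F"])
       (auto simp: lookup_coeff_scale L2.scale T.scale_sum_right in_keys_iff)
  ultimately have lin: "Vector_Spaces.linear (coeff_scale scale) sT \<phi>"
    by (intro Vector_Spaces.linear.intro C.vector_space_axioms T
        module_hom.intro C.module_axioms T.module_axioms module_hom_axioms.intro)
  have scl: "Poly_Mapping.single e c = coeff_scale (*) c (Poly_Mapping.single e 1)"
    for e :: "'v monom" and c :: 'a
    by (rule poly_mapping_eqI)
       (simp add: coeff_scale_def Poly_Mapping.map.rep_eq lookup_single when_def)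
  have "\<phi> (tensor scale p m) = \<beta> p m" for p m
  proof -
    have "\<phi> (tensor scale p m) = (\<Sum>e\<in>Poly_Mapping.keys p. \<beta> (Poly_Mapping.single e 1) (scale (Poly_Mapping.lookup p e) m))"
      by (subst sup[of "Poly_Mapping.keys p"]) (auto simp: lookup_tensor in_keys_iff)
    also have "\<dots> = (\<Sum>e\<in>Poly_Mapping.keys p. \<beta> (Poly_Mapping.single e (Poly_Mapping.lookup p e)) m)"
      by (intro sum.cong refl, subst (2) scl) (simp add: L2.scale L1.scale)
    also have "\<dots> = \<beta> (\<Sum>e\<in>Poly_Mapping.keys p. Poly_Mapping.single e (Poly_Mapping.lookup p e)) m"
      by (simp add: L1.sum)
    finally show ?thesis by (simp flip: mpoly_eq_sum_single)
  qed
  with lin show "\<exists>\<phi>. Vector_Spaces.linear (coeff_scale scale) sT \<phi> \<and>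
      (\<forall>p m. \<phi> (tensor scale p m) = \<beta> p m)" by blast
next
  fix \<phi> \<psi> :: "('v, 'b) mpoly \<Rightarrow> 't"
  assume 1: "Vector_Spaces.linear (coeff_scale scale) sT \<phi> \<and> (\<forall>p m. \<phi> (tensor scale p m) = \<beta> p m)"
    and 2: "Vector_Spaces.linear (coeff_scale scale) sT \<psi> \<and> (\<forall>p m. \<psi> (tensor scale p m) = \<beta> p m)"
  have eq: "\<chi> F = (\<Sum>e\<in>Poly_Mapping.keys F. \<beta> (Poly_Mapping.single e 1) (Poly_Mapping.lookup F e))"
    if \<chi>: "Vector_Spaces.linear (coeff_scale scale) sT \<chi> \<and> (\<forall>p m. \<chi> (tensor scale p m) = \<beta> p m)"
    for \<chi> :: "('v, 'b) mpoly \<Rightarrow> 't" and F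
  proof -
    interpret X: Vector_Spaces.linear "coeff_scale scale" sT \<chi> using \<chi> by blast
    have "\<chi> F = \<chi> (\<Sum>e\<in>Poly_Mapping.keys F. tensor scale (Poly_Mapping.single e 1) (Poly_Mapping.lookup F e))"
      by (simp add: tensor_single flip: mpoly_eq_sum_single)
    then show ?thesis using \<chi> by (simp add: X.sum)
  qed
  show "\<phi> = \<psi>" using eq[OF 1] eq[OF 2] by auto
qed

lemma tensor_act_add:
  assumes "\<rho> g \<in> carrier (GL scale)"
  shows "tensor_act sV BV scale \<rho> g (F + H) = tensor_act sV BV scale \<rho> g F + tensor_act sV BV scale \<rho> g H"
proof -
  interpret r: Vector_Spaces.linear scale scale "\<rho> g"
    using assms by (simp add: GL_def)
  have sup: "tensor_act sV BV scale \<rho> g F =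
      (\<Sum>e\<in>A. tensor scale (poly_act sV BV g (Poly_Mapping.single e 1)) (\<rho> g (Poly_Mapping.lookup F e)))"
    if "finite A" "Poly_Mapping.keys F \<subseteq> A" for A F
    unfolding tensor_act_def using that
    by (intro sum.mono_neutral_left) (auto simp: in_keys_iff r.zero)
  show ?thesis
    using keys_add[of F H]
    by (subst (1 2 3) sup[of "Poly_Mapping.keys F \<union> Poly_Mapping.keys H"])
       (auto simp: lookup_add r.add tensor_add_right sum.distrib)
qed

lemma tensor_act_tensor:
  assumes "\<rho> g \<in> carrier (GL scale)"
  shows "tensor_act sV BV scale \<rho> g (tensor scale p m) = tensor scale (poly_act sV BV g p) (\<rho> g m)"
proof -
  interpret r: Vector_Spaces.linear scale scale "\<rho> g"
    using assms by (simp add: GL_def)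
  let ?t = "\<lambda>e n. tensor scale (poly_act sV BV g (Poly_Mapping.single e 1)) n"
  have "tensor_act sV BV scale \<rho> g (tensor scale p m) =
      (\<Sum>e\<in>Poly_Mapping.keys p. ?t e (\<rho> g (scale (Poly_Mapping.lookup p e) m)))"
    unfolding tensor_act_def lookup_tensor
    by (rule sum.mono_neutral_left) (auto simp: in_keys_iff lookup_tensor r.zero)
  also have "\<dots> = (\<Sum>e\<in>Poly_Mapping.keys p. tensor scale (poly_act sV BV g (Poly_Mapping.single e (Poly_Mapping.lookup p e))) (\<rho> g m))"
    by (intro sum.cong refl)
       (simp add: r.scale tensor_scale_right coeff_scale_def mult_map_scale_conv_mult
         flip: tensor_scale_left[unfolded coeff_scale_def mult_map_scale_conv_mult])
  also have "\<dots> = tensor scale (poly_act sV BV g (\<Sum>e\<in>Poly_Mapping.keys p. Poly_Mapping.single e (Poly_Mapping.lookup p e))) (\<rho> g m)"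
    by (simp only: tensor_sum_left poly_act_sum)
  finally show ?thesis by (simp flip: mpoly_eq_sum_single)
qed

end


section \<open>Hilbert series and the s-invariant\<close>

definition hilbert_series ::
    "('k::field \<Rightarrow> 'm::ab_group_add \<Rightarrow> 'm) \<Rightarrow> ('v, 'm) mpoly set \<Rightarrow> rat fps" where
  "hilbert_series sM N =
     Abs_fps (\<lambda>i. of_nat (vector_space.dim (coeff_scale sM) (homogeneous_part N i)))"

definition represents_fps :: "rat poly fract \<Rightarrow> rat fps \<Rightarrow> bool" where
  "represents_fps R H \<longleftrightarrow>
     (\<exists>P Q. Q \<noteq> 0 \<and> R = Fraction_Field.Fract P Q \<and> fps_of_poly Q * H = fps_of_poly P)"

lemma represents_fps_unique:
  assumes "represents_fps R H" "represents_fps R' H"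
  shows "R = R'"
proof -
  obtain P Q where PQ: "Q \<noteq> 0" "R = Fraction_Field.Fract P Q" "fps_of_poly Q * H = fps_of_poly P"
    using assms(1) by (auto simp: represents_fps_def)
  obtain P' Q' where PQ': "Q' \<noteq> 0" "R' = Fraction_Field.Fract P' Q'" "fps_of_poly Q' * H = fps_of_poly P'"
    using assms(2) by (auto simp: represents_fps_def)
  have "fps_of_poly (P * Q') = fps_of_poly (P' * Q)"
    by (simp add: fps_of_poly_mult ac_simps flip: PQ(3) PQ'(3))
  then have "P * Q' = P' * Q" by (simp only: fps_of_poly_eq_iff)
  with PQ PQ' show ?thesis by (simp add: eq_fract)
qed

definition fps_to_ratfun :: "rat fps \<Rightarrow> rat poly fract" where
  "fps_to_ratfun H = (THE R. represents_fps R H)"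

text \<open>\<open>X = r + s (t - 1) + O((t - 1)\<^sup>2)\<close>, where the error term is \<open>(t - 1)\<^sup>2\<close> times a rational
  function that is regular at \<open>1\<close>.\<close>

definition expansion_at_1 :: "rat poly fract \<Rightarrow> rat \<Rightarrow> rat \<Rightarrow> bool" where
  "expansion_at_1 X r s \<longleftrightarrow>
     (\<exists>P Q. poly Q 1 \<noteq> 0 \<and>
        X = Fraction_Field.Fract ([:r:] + smult s [:-1, 1:]) 1 + Fraction_Field.Fract ([:-1, 1:] ^ 2 * P) Q)"

lemma expansion_at_1_unique:
  assumes "expansion_at_1 X r s" "expansion_at_1 X r' s'"
  shows "r = r'" "s = s'"
proof -
  define T :: "rat poly" where "T = [:-1, 1:]"
  obtain P Q where PQ: "poly Q 1 \<noteq> 0" "X = Fraction_Field.Fract ([:r:] + smult s T) 1 + Fraction_Field.Fract (T ^ 2 * P) Q"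
    using assms(1) by (auto simp: expansion_at_1_def T_def)
  obtain P' Q' where PQ': "poly Q' 1 \<noteq> 0" "X = Fraction_Field.Fract ([:r':] + smult s' T) 1 + Fraction_Field.Fract (T ^ 2 * P') Q'"
    using assms(2) by (auto simp: expansion_at_1_def T_def)
  have nz: "Q \<noteq> 0" "Q' \<noteq> 0" using PQ(1) PQ'(1) by auto
  have *: "(([:r:] + smult s T) * Q + T ^ 2 * P) * Q' = (([:r':] + smult s' T) * Q' + T ^ 2 * P') * Q"
    using PQ(2) PQ'(2) nz by (simp add: eq_fract)
  then have eq: "([:r - r':] + smult (s - s') T) * (Q * Q') = T ^ 2 * (P' * Q - P * Q')"
  proof -
    have "[:r - r':] = [:r:] - [:r':]" by simp
    with * show ?thesis by (simp only: smult_diff_left) algebra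
  qed
  have T1: "poly T 1 = 0" by (simp add: T_def)
  show r: "r = r'"
    using arg_cong[OF eq, of "\<lambda>p. poly p 1"] PQ(1) PQ'(1) T1 by simp
  have "T * (smult (s - s') (Q * Q')) = T * (T * (P' * Q - P * Q'))"
    using eq r by (simp add: power2_eq_square algebra_simps)
  moreover have "T \<noteq> 0" by (simp add: T_def)
  ultimately have "smult (s - s') (Q * Q') = T * (P' * Q - P * Q')"
    by (simp only: mult_cancel_left) simp
  from arg_cong[OF this, of "\<lambda>p. poly p 1"] show "s = s'"
    using PQ(1) PQ'(1) T1 by simp
qed

definition hilbert_quotient ::
    "('k::field \<Rightarrow> 'm::ab_group_add \<Rightarrow> 'm) \<Rightarrow> ('v, 'k) mpoly set \<Rightarrow> ('v, 'm) mpoly set \<Rightarrow> rat poly fract" where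
  "hilbert_quotient sM B N =
     fps_to_ratfun (hilbert_series sM N) / fps_to_ratfun (hilbert_series (*) B)"

definition s_invariant ::
    "('k::field \<Rightarrow> 'm::ab_group_add \<Rightarrow> 'm) \<Rightarrow> ('v, 'k) mpoly set \<Rightarrow> ('v, 'm) mpoly set \<Rightarrow> rat" where
  "s_invariant sM B N = (THE s. \<exists>r. expansion_at_1 (hilbert_quotient sM B N) r s)"

end

theory Submission
  imports Defs Complex_Main "HOL-Library.Function_Algebras" "Jordan_Normal_Form.Determinant"
begin

text \<open>
  Choose bases of \<open>V\<close> and \<open>M\<close>. The covariants then are the vectors of \<open>m = dim M\<close> polynomials in \<open>n = dim V\<close>
  variables that are fixed by a finite group \<open>\<Gamma>\<close>, and the invariants are the case \<open>m = 1\<close> with trivial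
  coefficients. The quotient of the two Hilbert series tends to \<open>m\<close> at \<open>t = 1\<close>, and its derivative there
  is a sum of local contributions of the primes of height one of the polynomial ring. Only primes that are
  generated by a linear form and have a nontrivial inertia group contribute, and these inertia groups consist
  of reflections.

  The local contributions are made visible by a lattice. Take \<open>m\<close> covariants \<open>F\<close> with nonzero determinant
  \<open>\<Delta>\<close>, such that for each of the finitely many linear forms \<open>l\<close> dividing a difference of two conjugates of a
  variable the power of \<open>l\<close> in \<open>\<Delta>\<close> is as small as it can be for covariants (\<open>exists_minimal_at_all\<close>; extra
  variables make it possible to do this for all \<open>l\<close> at once). Split \<open>\<Delta> = ell * D1\<close>, where \<open>ell\<close> collects these
  linear forms. By Cramer's rule and minimality, every covariant lies in the lattice \<open>lat ell\<close> of the vectors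
  \<open>v\<close> for which \<open>ell\<close> divides all the determinants obtained by putting \<open>v\<close> in the place of one \<open>F k\<close>.

  Over the whole polynomial ring, the covariants generate this lattice up to codimension two, and this
  determines two terms of the expansion at \<open>t = 1\<close>. To measure the submodule that they generate, adjoin \<open>n\<close>
  variables \<open>y\<close>, of which \<open>\<Gamma>\<close> moves none, and consider the powers of the generic element \<open>\<Sum> x y\<close> as
  coefficients (\<open>ext\<close>): they are independent over the invariants, and the error is controlled by the
  differences of the conjugates of the generic element (\<open>lag_in_ext\<close>, \<open>cfam_estimate\<close>). The submodule generated
  by \<open>F\<close> contains \<open>D1\<close> times the lattice, and the one generated by all covariants contains the product of
  these differences times the lattice. These two factors are coprime, so the defect is of order \<open>(1 - t)\<^sup>2\<close> (\<open>pfam_lower\<close>,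
  \<open>lattice_estimate\<close>). Hence, if
  \<open>Q(t) / (1 - t)^K\<close> is the Hilbert series of the lattice, \<open>s = Q'(1)\<close>: an integer, because \<open>Q\<close> has integral
  coefficients, and nonnegative, because the lattice is contained in the free module with series
  \<open>m / (1 - t)^K\<close> (\<open>lattice_limit\<close>).

  If all inertia groups of the linear forms act trivially on \<open>M\<close>, then for each form there are covariants whose
  determinant it does not divide (\<open>covariants_generate_at\<close>); then \<open>ell\<close> is a unit, the lattice is free, and
  \<open>s = 0\<close>. If an element of the inertia group of \<open>l\<close> acts nontrivially, the vectors in the lattice satisfy a
  nontrivial linear congruence modulo \<open>l\<close>, which costs at least one (\<open>lat_drop\<close>).

  Finally, \<open>s\<close> is defined by a rational function, so the Hilbert series have to be rational. This follows from
  Hilbert's basis theorem in a graded form (\<open>hilbert_series_rational\<close>), with the coefficients of the orbit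
  polynomials of the variables as operators; the expansion of a rational function is then determined by its
  limits from the left (\<open>expansion_of_limit\<close>).
\<close>


section \<open>Dimensions of finite-dimensional subspaces\<close>

locale linear_space = vector_space scale
  for scale :: "'a::field \<Rightarrow> 'b::ab_group_add \<Rightarrow> 'b"
begin

definition fin_span :: "'b set \<Rightarrow> bool" where
  "fin_span S \<longleftrightarrow> (\<exists>B. finite B \<and> S \<subseteq> span B)"

lemma fin_span_subset: "fin_span T \<Longrightarrow> S \<subseteq> T \<Longrightarrow> fin_span S"
  unfolding fin_span_def by blast

lemma fin_spanI: "finite B \<Longrightarrow> S \<subseteq> span B \<Longrightarrow> fin_span S"
  unfolding fin_span_def by blast

lemma fin_span_zero [simp]: "fin_span {0}"
  by (rule fin_spanI[of "{}"]) auto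

lemma dim_zero_subspace [simp]: "dim {0} = 0"
  using dim_unique[of "{}" "{0}" 0] by (auto simp: independent_empty)

lemma subspace_basis:
  assumes "subspace S" "fin_span S"
  obtains B where "finite B" "B \<subseteq> S" "independent B" "span B = S" "card B = dim S"
proof -
  obtain B where B: "B \<subseteq> S" "independent B" "S \<subseteq> span B" "card B = dim S"
    using basis_exists by blast
  obtain C where C: "finite C" "S \<subseteq> span C" using assms(2) unfolding fin_span_def by blast
  have "finite B" using independent_span_bound[OF C(1) B(2)] B(1) C(2) by blast
  moreover have "span B = S" using B assms(1) by (metis span_subspace)
  ultimately show ?thesis using B that by blast
qed

lemma dim_subset_fin:
  assumes "fin_span T" "S \<subseteq> T"
  shows "dim S \<le> dim T"
proof -
  obtain B where B: "B \<subseteq> S" "independent B" "S \<subseteq> span B" "card B = dim S"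
    using basis_exists by blast
  obtain D where D: "finite D" "T \<subseteq> span D" using assms(1) unfolding fin_span_def by blast
  obtain C where C: "C \<subseteq> T" "independent C" "T \<subseteq> span C" "card C = dim T"
    using basis_exists by blast
  have fC: "finite C" using independent_span_bound[OF D(1) C(2)] C(1) D(2) by blast
  have "card B \<le> card C"
    using independent_span_bound[OF fC B(2)] B(1) C(3) assms(2) by blast
  then show ?thesis using B C by simp
qed

lemma subspace_eq_of_dim:
  assumes "subspace S" "subspace T" "S \<subseteq> T" "fin_span T" "dim T \<le> dim S"
  shows "S = T"
proof -
  obtain B where B: "finite B" "B \<subseteq> S" "independent B" "span B = S" "card B = dim S"
    using subspace_basis[OF assms(1) fin_span_subset[OF assms(4,3)]] .
  have "x \<in> span B" if "x \<in> T" for x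
  proof (rule ccontr)
    assume x: "x \<notin> span B"
    then have ind: "independent (insert x B)" using B(3) by (rule independent_insertI)
    have sub: "insert x B \<subseteq> T" using that B(2) assms(3) by auto
    have "dim (insert x B) = Suc (card B)"
      using dim_eq_card_independent[OF ind] card_insert_disjoint[OF B(1)] x span_base[of x B] by auto
    moreover have "dim (insert x B) \<le> dim T" by (rule dim_subset_fin[OF assms(4) sub])
    ultimately show False using assms(5) B(5) by simp
  qed
  then show ?thesis using B(4) assms(3) by blast
qed

lemma span_Int_disjoint_bases:
  assumes "independent B" "C \<subseteq> B" "D \<subseteq> B" "C \<inter> D = {}" "x \<in> span C" "x \<in> span D"
  shows "x = 0"
proof -
  have "representation B x = representation C x" "representation B x = representation D x"
    using assms by (auto intro!: representation_extend)
  then have "representation B x b = 0" for b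
    using representation_ne_zero[of C x b] representation_ne_zero[of D x b] assms(4) by auto
  moreover have "x \<in> span B" using assms(2,5) span_mono by blast
  ultimately show ?thesis
    using sum_nonzero_representation_eq[OF assms(1), of x] by simp
qed

lemma complement_projection:
  assumes "subspace Y"
  obtains q where "Vector_Spaces.linear scale scale q" "\<And>x. q x = 0 \<longleftrightarrow> x \<in> Y"
proof -
  interpret P: vector_space_pair scale scale ..
  obtain BY where BY: "BY \<subseteq> Y" "independent BY" "Y \<subseteq> span BY" "card BY = dim Y"
    by (rule basis_exists)
  have spY: "span BY = Y" by (rule span_subspace[OF BY(1,3) assms])
  obtain B where B: "BY \<subseteq> B" "independent B" "UNIV \<subseteq> span B"
    by (rule maximal_independent_subset_extend[OF subset_UNIV BY(2)])
  define q where "q = P.construct B (\<lambda>b. if b \<in> BY then 0 else b)"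
  have lin: "Vector_Spaces.linear scale scale q"
    unfolding q_def by (rule P.linear_construct[OF B(2)])
  interpret q: Vector_Spaces.linear scale scale q by (rule lin)
  have qb: "q b = (if b \<in> BY then 0 else b)" if "b \<in> B" for b
    unfolding q_def by (rule P.construct_basis[OF B(2) that])
  have q0: "q x = 0" if "x \<in> span BY" for x
  proof (rule q.eq_0_on_span[OF _ that])
    show "q b = 0" if "b \<in> BY" for b using qb[of b] that B(1) by (auto split: if_splits)
  qed
  have q1: "q x = x" if "x \<in> span (B - BY)" for x
  proof -
    have "q x = id x"
    proof (rule P.linear_eq_on[OF lin linear_id that])
      show "q b = id b" if "b \<in> B - BY" for b using qb[of b] that by simp
    qed
    then show ?thesis by simp
  qed
  have "q x = 0 \<longleftrightarrow> x \<in> Y" for x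
  proof
    assume x: "q x = 0"
    have "BY \<union> (B - BY) = B" using B(1) by blast
    then have "x \<in> span (BY \<union> (B - BY))" using B(3) by auto
    then obtain y c where yc: "x = y + c" "y \<in> span BY" "c \<in> span (B - BY)"
      unfolding span_Un by (elim CollectE exE conjE)
    then have "c = 0" using x q0[OF yc(2)] q1[OF yc(3)] by (simp add: q.add)
    then show "x \<in> Y" using yc spY by simp
  next
    assume "x \<in> Y"
    then show "q x = 0" using q0[of x] spY by simp
  qed
  then show ?thesis by (rule that[OF lin])
qed

lemma dim_kernel_image:
  assumes lin: "Vector_Spaces.linear scale s2 f" and S: "subspace S" "fin_span S"
  shows "dim S = dim {x \<in> S. f x = 0} + vector_space.dim s2 (f ` S)"
proof -
  interpret f: Vector_Spaces.linear scale s2 f by (rule lin)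
  interpret P: vector_space_pair scale s2 ..
  let ?K = "{x \<in> S. f x = 0}"
  have sK: "subspace ?K"
    using S(1) by (auto simp: subspace_def f.add f.scale f.zero)
  have "fin_span ?K" using S(2) by (rule fin_span_subset) auto
  then obtain BK where BK: "finite BK" "BK \<subseteq> ?K" "independent BK" "span BK = ?K" "card BK = dim ?K"
    using subspace_basis[OF sK] by blast
  obtain B where B: "BK \<subseteq> B" "B \<subseteq> S" "independent B" "S \<subseteq> span B"
    using maximal_independent_subset_extend[of BK S] BK(2,3) by auto
  have spB: "span B = S" using B S(1) by (metis span_subspace)
  have finB: "finite B"
    using S(2) independent_span_bound[OF _ B(3)] B(2) unfolding fin_span_def by blast
  let ?C = "B - BK"
  have inj: "inj_on f (span ?C)"
  proof (subst f.inj_on_iff_eq_0[OF subspace_span], intro ballI impI)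
    fix x assume x: "x \<in> span ?C" "f x = 0"
    then have "x \<in> S" using spB span_mono[of ?C B] by auto
    then have "x \<in> span BK" using BK(4) x by auto
    then show "x = 0" using span_Int_disjoint_bases[OF B(3), of ?C BK x] x B(1) by auto
  qed
  have ind: "f.vs2.independent (f ` ?C)"
    using P.linear_independent_injective_image[OF lin _ inj] B(3) independent_mono by blast
  have "f ` S = f.vs2.span (f ` B)" using spB f.span_image by metis
  also have "\<dots> = f.vs2.span (f ` ?C)"
  proof (rule antisym)
    have "f b \<in> f.vs2.span (f ` ?C)" if "b \<in> B" for b
      using that BK(2) by (cases "b \<in> BK") (auto intro: f.vs2.span_base f.vs2.span_zero simp: subset_iff)
    then show "f.vs2.span (f ` B) \<subseteq> f.vs2.span (f ` ?C)"
      by (intro f.vs2.span_minimal f.vs2.subspace_span) auto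
  qed (auto intro!: f.vs2.span_mono)
  finally have "f.vs2.dim (f ` S) = card (f ` ?C)"
    using f.vs2.dim_span_eq_card_independent[OF ind] by simp
  also have "\<dots> = card ?C"
    by (rule card_image) (use inj span_superset inj_on_subset in blast)
  also have "\<dots> = card B - card BK" using finB B(1) by (simp add: card_Diff_subset BK(1))
  finally have "f.vs2.dim (f ` S) = card B - card BK" .
  moreover have "card B = dim S" using B by (intro basis_card_eq_dim) auto
  moreover have "card BK \<le> card B" using finB B(1) by (rule card_mono)
  ultimately show ?thesis using BK(5) by simp
qed

lemma fin_span_image:
  assumes "Vector_Spaces.linear scale s2 f" "fin_span S"
  shows "linear_space.fin_span s2 (f ` S)"
proof -
  interpret f: Vector_Spaces.linear scale s2 f by fact
  obtain B where "finite B" "S \<subseteq> span B" using assms(2) unfolding fin_span_def by blast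
  then have "f ` S \<subseteq> f.vs2.span (f ` B)" "finite (f ` B)"
    by (auto simp: f.span_image)
  then show ?thesis
    using linear_space.fin_spanI[OF linear_space.intro[OF f.vs2.vector_space_axioms]] by simp
qed

lemma dim_image_inj:
  assumes "Vector_Spaces.linear scale s2 f" "subspace S" "fin_span S" "\<And>x. x \<in> S \<Longrightarrow> f x = 0 \<Longrightarrow> x = 0"
  shows "vector_space.dim s2 (f ` S) = dim S"
proof -
  interpret f: Vector_Spaces.linear scale s2 f by fact
  have "{x \<in> S. f x = 0} = {0}" using assms(2,4) subspace_0 f.zero by auto
  then show ?thesis using dim_kernel_image[OF assms(1-3)] by simp
qed

definition sum_space :: "'b set \<Rightarrow> 'b set \<Rightarrow> 'b set" where
  "sum_space X Y = {x + y |x y. x \<in> X \<and> y \<in> Y}"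

lemma subspace_sum_space: "subspace X \<Longrightarrow> subspace Y \<Longrightarrow> subspace (sum_space X Y)"
  unfolding sum_space_def by (rule subspace_sums)

lemma sum_spaceI: "x \<in> X \<Longrightarrow> y \<in> Y \<Longrightarrow> x + y \<in> sum_space X Y"
  unfolding sum_space_def by blast

lemma sum_space_upper1: "subspace Y \<Longrightarrow> X \<subseteq> sum_space X Y"
  using sum_spaceI[of _ X 0 Y] by (auto dest: subspace_0)

lemma sum_space_upper2: "subspace X \<Longrightarrow> Y \<subseteq> sum_space X Y"
  using sum_spaceI[of 0 X _ Y] by (auto dest: subspace_0)

lemma sum_space_least:
  "subspace Z \<Longrightarrow> X \<subseteq> Z \<Longrightarrow> Y \<subseteq> Z \<Longrightarrow> sum_space X Y \<subseteq> Z"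
proof
  fix z assume Z: "subspace Z" "X \<subseteq> Z" "Y \<subseteq> Z" and z: "z \<in> sum_space X Y"
  obtain x y where xy: "x \<in> X" "y \<in> Y" "z = x + y"
    using z unfolding sum_space_def by (elim CollectE exE conjE)
  show "z \<in> Z" unfolding xy(3)
    by (rule subspace_add[OF Z(1) subsetD[OF Z(2) xy(1)] subsetD[OF Z(3) xy(2)]])
qed

lemma sum_space_zero [simp]: "sum_space {0} X = X" "sum_space X {0} = X"
  unfolding sum_space_def by auto

lemma fin_span_sum_space: "fin_span X \<Longrightarrow> fin_span Y \<Longrightarrow> fin_span (sum_space X Y)"
proof -
  assume "fin_span X" "fin_span Y"
  then obtain B C where "finite B" "X \<subseteq> span B" "finite C" "Y \<subseteq> span C"
    unfolding fin_span_def by blast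
  then have X: "X \<subseteq> span (B \<union> C)" and Y: "Y \<subseteq> span (B \<union> C)" and fin: "finite (B \<union> C)"
    using span_mono[of B "B \<union> C"] span_mono[of C "B \<union> C"] by simp_all
  show ?thesis by (rule fin_spanI[OF fin sum_space_least[OF subspace_span X Y]])
qed

lemma dim_sum_space:
  assumes "subspace X" "fin_span X" "subspace Y" "fin_span Y"
  shows "dim (sum_space X Y) + dim (X \<inter> Y) = dim X + dim Y"
proof -
  obtain q where q: "Vector_Spaces.linear scale scale q" "\<And>x. q x = 0 \<longleftrightarrow> x \<in> Y"
    using complement_projection[OF assms(3)] by blast
  interpret q: Vector_Spaces.linear scale scale q by fact
  have "dim (sum_space X Y) = dim {x \<in> sum_space X Y. q x = 0} + dim (q ` sum_space X Y)"
    using assms by (intro dim_kernel_image[OF q(1)] subspace_sum_space fin_span_sum_space)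
  moreover have "{x \<in> sum_space X Y. q x = 0} = Y"
    using q(2) sum_space_upper2[OF assms(1)] by auto
  moreover have "q ` sum_space X Y = q ` X"
  proof
    show "q ` sum_space X Y \<subseteq> q ` X"
    proof
      fix z assume "z \<in> q ` sum_space X Y"
      then obtain x y where "x \<in> X" "y \<in> Y" "z = q (x + y)" unfolding sum_space_def by auto
      then have "z = q x" using q(2)[of y] by (simp add: q.add)
      then show "z \<in> q ` X" using \<open>x \<in> X\<close> by blast
    qed
    show "q ` X \<subseteq> q ` sum_space X Y" using sum_space_upper1[OF assms(3)] by blast
  qed
  moreover have "dim X = dim {x \<in> X. q x = 0} + dim (q ` X)"
    by (rule dim_kernel_image[OF q(1) assms(1,2)])
  moreover have "{x \<in> X. q x = 0} = X \<inter> Y" using q(2) by auto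
  ultimately show ?thesis by simp
qed

definition sum_spaces :: "('i \<Rightarrow> 'b set) \<Rightarrow> 'i set \<Rightarrow> 'b set" where
  "sum_spaces W J = {(\<Sum>j\<in>J. w j) |w. \<forall>j\<in>J. w j \<in> W j}"

lemma sum_spaces_empty [simp]: "sum_spaces W {} = {0}"
  unfolding sum_spaces_def by auto

lemma sum_spaces_insert:
  assumes "finite J" "i \<notin> J"
  shows "sum_spaces W (insert i J) = sum_space (W i) (sum_spaces W J)"
proof (intro equalityI subsetI)
  fix x assume "x \<in> sum_spaces W (insert i J)"
  then show "x \<in> sum_space (W i) (sum_spaces W J)"
    unfolding sum_spaces_def sum_space_def using assms by auto
next
  fix x assume "x \<in> sum_space (W i) (sum_spaces W J)"
  then obtain v w where vw: "v \<in> W i" "\<forall>j\<in>J. w j \<in> W j" "x = v + (\<Sum>j\<in>J. w j)"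
    unfolding sum_spaces_def sum_space_def by auto
  have "(\<Sum>j\<in>insert i J. (w(i := v)) j) = v + (\<Sum>j\<in>J. (w(i := v)) j)" using assms by simp
  also have "(\<Sum>j\<in>J. (w(i := v)) j) = (\<Sum>j\<in>J. w j)" using assms by (intro sum.cong) auto
  finally show "x \<in> sum_spaces W (insert i J)"
    unfolding sum_spaces_def using vw by (intro CollectI exI[of _ "w(i := v)"]) auto
qed

lemma sum_spacesI:
  assumes "\<And>j. j \<in> J \<Longrightarrow> w j \<in> W j"
  shows "(\<Sum>j\<in>J. w j) \<in> sum_spaces W J"
proof -
  have "\<exists>w'. (\<Sum>j\<in>J. w j) = (\<Sum>j\<in>J. w' j) \<and> (\<forall>j\<in>J. w' j \<in> W j)"
    using assms by (intro exI[of _ w]) simp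
  then show ?thesis unfolding sum_spaces_def by simp
qed

lemma sum_spacesE:
  assumes "x \<in> sum_spaces W J"
  obtains w where "\<And>j. j \<in> J \<Longrightarrow> w j \<in> W j" "x = (\<Sum>j\<in>J. w j)"
  using assms unfolding sum_spaces_def by blast

lemma subspace_sum_spaces:
  assumes "finite J" "\<And>j. j \<in> J \<Longrightarrow> subspace (W j)"
  shows "subspace (sum_spaces W J)"
  using assms
proof (induction J rule: finite_induct)
  case (insert i J)
  then show ?case by (simp add: sum_spaces_insert subspace_sum_space)
qed simp

lemma fin_span_sum_spaces:
  assumes "finite J" "\<And>j. j \<in> J \<Longrightarrow> fin_span (W j)"
  shows "fin_span (sum_spaces W J)"
  using assms
proof (induction J rule: finite_induct)
  case (insert i J)
  then show ?case by (simp add: sum_spaces_insert fin_span_sum_space)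
qed simp

lemma dim_sum_spaces:
  assumes "finite J" "\<And>j. j \<in> J \<Longrightarrow> subspace (W j)" "\<And>j. j \<in> J \<Longrightarrow> fin_span (W j)"
    and "\<And>w. (\<And>j. j \<in> J \<Longrightarrow> w j \<in> W j) \<Longrightarrow> (\<Sum>j\<in>J. w j) = 0 \<Longrightarrow> (\<forall>j\<in>J. w j = 0)"
  shows "dim (sum_spaces W J) = (\<Sum>j\<in>J. dim (W j))"
  using assms
proof (induction J rule: finite_induct)
  case (insert i J)
  have W: "subspace (sum_spaces W J)" "fin_span (sum_spaces W J)"
    using insert by (auto intro!: subspace_sum_spaces fin_span_sum_spaces)
  have ind: "\<forall>j\<in>J. w j = 0" if w: "\<And>j. j \<in> J \<Longrightarrow> w j \<in> W j" "(\<Sum>j\<in>J. w j) = 0" for w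
  proof -
    have "(\<Sum>j\<in>insert i J. (w(i := 0)) j) = (\<Sum>j\<in>J. (w(i := 0)) j)" using insert by simp
    also have "(\<Sum>j\<in>J. (w(i := 0)) j) = (\<Sum>j\<in>J. w j)" using insert by (intro sum.cong) auto
    finally have "\<forall>j\<in>insert i J. (w(i := 0)) j = 0"
      using w insert.prems(1) by (intro insert.prems(3)) (auto intro: subspace_0)
    then show ?thesis using insert.hyps(2) by (metis fun_upd_apply insertCI)
  qed
  have "W i \<inter> sum_spaces W J = {0}"
  proof -
    have "v = 0" if v: "v \<in> W i" "v \<in> sum_spaces W J" for v
    proof -
      obtain w where w: "\<And>j. j \<in> J \<Longrightarrow> w j \<in> W j" "v = (\<Sum>j\<in>J. w j)"
        using sum_spacesE[OF v(2)] by blast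
      have "(\<Sum>j\<in>insert i J. (w(i := - v)) j) = - v + (\<Sum>j\<in>J. (w(i := - v)) j)"
        using insert by simp
      also have "(\<Sum>j\<in>J. (w(i := - v)) j) = v" using insert w by (auto intro!: sum.cong)
      finally have "\<forall>j\<in>insert i J. (w(i := - v)) j = 0"
        using w v insert.prems(1) by (intro insert.prems(3)) (auto intro: subspace_neg)
      then show ?thesis by auto
    qed
    then show ?thesis using insert.prems(1) W(1) subspace_0 by blast
  qed
  then have "dim (sum_spaces W (insert i J)) = dim (W i) + dim (sum_spaces W J)"
    using dim_sum_space[of "W i" "sum_spaces W J"] W insert by (simp add: sum_spaces_insert)
  also have "dim (sum_spaces W J) = (\<Sum>j\<in>J. dim (W j))"
    using ind insert by (intro insert.IH) auto
  finally show ?case using insert by simp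
qed simp

end


section \<open>Polynomial rings: evaluation, degree, linear primes\<close>

abbreviation Const :: "'a \<Rightarrow> ('v, 'a::zero) mpoly" where
  "Const a \<equiv> Poly_Mapping.single 0 a"

abbreviation Var :: "'v \<Rightarrow> ('v, 'a::zero_neq_one) mpoly" where
  "Var v \<equiv> Poly_Mapping.single (Poly_Mapping.single v (Suc 0)) 1"

lemma Const_add: "Const (a + b :: 'a::monoid_add) = Const a + Const b"
  by (simp add: single_add)

lemma Const_mult: "Const (a * b :: 'a::semiring_0) = Const a * Const b"
  by (simp add: mult_single)

lemma Const_sum: "Const (\<Sum>i\<in>I. f i :: 'a::comm_monoid_add) = (\<Sum>i\<in>I. Const (f i))"
  by (induction I rule: infinite_finite_induct) (auto simp: Const_add)

lemma monom_eq_prod_Var: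
  "Poly_Mapping.single e (1::'a::comm_semiring_1) =
    (\<Prod>v\<in>Poly_Mapping.keys e. Var v ^ Poly_Mapping.lookup e v)"
proof -
  have pow: "Var v ^ n = Poly_Mapping.single (Poly_Mapping.single v n) (1::'a)" for v :: 'b and n
  proof (induction n)
    case (Suc n)
    have "Poly_Mapping.single v (Suc 0) + Poly_Mapping.single v n = Poly_Mapping.single v (Suc n)"
      by (simp only: single_add[symmetric] plus_nat.add_Suc plus_nat.add_0)
    then show ?case by (simp only: power_Suc Suc.IH mult_single mult_1)
  qed (simp only: power_0 single_zero single_one)
  have *: "(\<Prod>v\<in>A. Var v ^ Poly_Mapping.lookup e v) =
      Poly_Mapping.single (\<Sum>v\<in>A. Poly_Mapping.single v (Poly_Mapping.lookup e v)) (1::'a)"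
    if "finite A" for A
    using that
  proof (induction A rule: finite_induct)
    case (insert v A)
    then show ?case
      by (simp only: prod.insert[OF insert.hyps] sum.insert[OF insert.hyps] pow mult_single mult_1)
  qed (simp only: prod.empty sum.empty single_one)
  have "(\<Sum>v\<in>Poly_Mapping.keys e. Poly_Mapping.single v (Poly_Mapping.lookup e v)) = e"
    by (rule mpoly_eq_sum_single[symmetric])
  then show ?thesis by (simp only: *[OF finite_keys])
qed

lemma single_eq_Const_times: "Poly_Mapping.single e (c::'a::comm_semiring_1) = Const c * Poly_Mapping.single e 1"
  by (simp add: mult_single)

lemma polys_over_induct [consumes 1, case_names Const Var add mult]:
  fixes f :: "('v, 'a::comm_semiring_1) mpoly"
  assumes f: "f \<in> polys_over X"
    and const: "\<And>a. P (Const a)" and var: "\<And>v. v \<in> X \<Longrightarrow> P (Var v)"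
    and add: "\<And>f g. P f \<Longrightarrow> P g \<Longrightarrow> P (f + g)" and mult: "\<And>f g. P f \<Longrightarrow> P g \<Longrightarrow> P (f * g)"
  shows "P f"
proof -
  have one: "P 1" using const[of 1] by (simp only: single_one)
  have sum: "P (\<Sum>i\<in>I. h i)" if "finite I" "\<And>i. i \<in> I \<Longrightarrow> P (h i)" for I and h :: "'v monom \<Rightarrow> _"
    using that
  proof (induction I rule: finite_induct)
    case empty
    show ?case using const[of 0] by simp
  next
    case (insert x I)
    then have "P (h x + (\<Sum>i\<in>I. h i))" by (intro add) simp_all
    then show ?case using insert.hyps by simp
  qed
  have pow: "P (h ^ n)" if "P h" for h n
  proof (induction n)
    case (Suc n)
    show ?case unfolding power_Suc by (rule mult[OF that Suc])
  qed (simp add: one)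
  have prod: "P (\<Prod>i\<in>I. h i)" if "finite I" "\<And>i. i \<in> I \<Longrightarrow> P (h i)" for I and h :: "'v \<Rightarrow> _"
    using that
  proof (induction I rule: finite_induct)
    case (insert x I)
    then have "P (h x * (\<Prod>i\<in>I. h i))" by (intro mult) simp_all
    then show ?case using insert.hyps by simp
  qed (simp add: one)
  have "P (Poly_Mapping.single e (Poly_Mapping.lookup f e))" if "e \<in> Poly_Mapping.keys f" for e
    unfolding single_eq_Const_times[of e "Poly_Mapping.lookup f e"] monom_eq_prod_Var[of e]
    by (rule mult[OF const prod[OF finite_keys pow[OF var]]])
       (use f that in \<open>auto simp: polys_over_def\<close>)
  then have "P (\<Sum>e\<in>Poly_Mapping.keys f. Poly_Mapping.single e (Poly_Mapping.lookup f e))"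
    by (rule sum[OF finite_keys])
  then show ?thesis by (simp only: mpoly_eq_sum_single[symmetric])
qed

lemma polys_over_UNIV [simp]: "f \<in> polys_over UNIV"
  by (simp add: polys_over_def)

lemma mpoly_induct [case_names Const Var add mult]:
  fixes f :: "('v, 'a::comm_semiring_1) mpoly"
  assumes "\<And>a. P (Const a)" "\<And>v. P (Var v)"
    "\<And>f g. P f \<Longrightarrow> P g \<Longrightarrow> P (f + g)" "\<And>f g. P f \<Longrightarrow> P g \<Longrightarrow> P (f * g)"
  shows "P f"
  using polys_over_induct[of f UNIV P] assms by simp

lemma polys_over_Const [simp]: "Const a \<in> polys_over X"
  by (simp add: polys_over_def)

lemma polys_over_zero [simp]: "0 \<in> polys_over X"
  by (simp add: polys_over_def)

lemma polys_over_one [simp]: "(1 :: ('v, 'a::comm_semiring_1) mpoly) \<in> polys_over X"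
  using polys_over_Const[of "1::'a" X] by (simp add: single_one)

lemma polys_over_Var: "v \<in> X \<Longrightarrow> Var v \<in> polys_over X"
  by (simp add: polys_over_def)

lemma polys_over_add: "f \<in> polys_over X \<Longrightarrow> g \<in> polys_over X \<Longrightarrow> f + g \<in> polys_over X"
  using keys_add[of f g] by (auto simp: polys_over_def)

lemma polys_over_uminus: "f \<in> polys_over X \<Longrightarrow> - f \<in> polys_over X"
  for f :: "('v, 'a::ab_group_add) mpoly"
  by (simp add: polys_over_def)

lemma polys_over_diff: "f \<in> polys_over X \<Longrightarrow> g \<in> polys_over X \<Longrightarrow> f - g \<in> polys_over X"
  for f g :: "('v, 'a::ab_group_add) mpoly"
  using keys_diff[of f g] by (auto simp: polys_over_def)

lemma polys_over_mult:
  fixes f g :: "('v, 'a::comm_semiring_1) mpoly"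
  assumes "f \<in> polys_over X" "g \<in> polys_over X"
  shows "f * g \<in> polys_over X"
  unfolding polys_over_def
proof (intro CollectI ballI)
  fix e assume "e \<in> Poly_Mapping.keys (f * g)"
  then obtain a b where "a \<in> Poly_Mapping.keys f" "b \<in> Poly_Mapping.keys g" "e = a + b"
    using keys_mult[of f g] by auto
  then show "Poly_Mapping.keys e \<subseteq> X"
    using assms keys_add[of a b] unfolding polys_over_def by blast
qed

lemma polys_over_sum: "(\<And>i. i \<in> I \<Longrightarrow> h i \<in> polys_over X) \<Longrightarrow> (\<Sum>i\<in>I. h i) \<in> polys_over X"
  by (induction I rule: infinite_finite_induct) (auto intro: polys_over_add)

lemma polys_over_prod:
  "(\<And>i. i \<in> I \<Longrightarrow> h i \<in> polys_over X) \<Longrightarrow> (\<Prod>i\<in>I. h i :: ('v, 'a::comm_semiring_1) mpoly) \<in> polys_over X"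
  by (induction I rule: infinite_finite_induct) (auto intro: polys_over_mult)

lemma polys_over_power: "f \<in> polys_over X \<Longrightarrow> f ^ n \<in> polys_over X"
  for f :: "('v, 'a::comm_semiring_1) mpoly"
  by (induction n) (auto intro: polys_over_mult)

lemma polys_over_mono: "X \<subseteq> Y \<Longrightarrow> f \<in> polys_over X \<Longrightarrow> f \<in> polys_over Y"
  unfolding polys_over_def by blast

lemma polys_over_linear_form: "B \<subseteq> X \<Longrightarrow> linear_form B l \<in> polys_over X"
  unfolding linear_form_def by (intro polys_over_sum) (auto simp: polys_over_def)

lemma linear_form_eq: "linear_form B l = (\<Sum>b\<in>B. Const (l b) * Var b)"
  by (simp add: linear_form_def mult_single)

subsection \<open>Evaluation\<close>

definition evalp :: "('a::comm_ring_1 \<Rightarrow> 'r::comm_ring_1) \<Rightarrow> ('v \<Rightarrow> 'r) \<Rightarrow> ('v, 'a) mpoly \<Rightarrow> 'r" where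
  "evalp c s f = (\<Sum>e\<in>Poly_Mapping.keys f. c (Poly_Mapping.lookup f e) *
      (\<Prod>v\<in>Poly_Mapping.keys e. s v ^ Poly_Mapping.lookup e v))"

locale coeff_hom =
  fixes c :: "'a::comm_ring_1 \<Rightarrow> 'r::comm_ring_1"
  assumes c_add: "c (a + b) = c a + c b" and c_mult: "c (a * b) = c a * c b" and c_one: "c 1 = 1"
begin

lemma c_zero: "c 0 = 0"
  using c_add[of 0 0] by simp

lemma evalp_superset:
  assumes "finite A" "Poly_Mapping.keys f \<subseteq> A"
  shows "evalp c s f = (\<Sum>e\<in>A. c (Poly_Mapping.lookup f e) *
      (\<Prod>v\<in>Poly_Mapping.keys e. s v ^ Poly_Mapping.lookup e v))"
  unfolding evalp_def using assms
  by (intro sum.mono_neutral_left) (auto simp: in_keys_iff c_zero)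

lemma evalp_add: "evalp c s (f + g) = evalp c s f + evalp c s g"
  by (subst (1 2 3) evalp_superset[of "Poly_Mapping.keys f \<union> Poly_Mapping.keys g"])
     (auto simp: lookup_add c_add algebra_simps sum.distrib dest: subsetD[OF keys_add])

lemma evalp_zero [simp]: "evalp c s 0 = 0"
  by (simp add: evalp_def)

lemma evalp_sum: "evalp c s (\<Sum>i\<in>I. f i) = (\<Sum>i\<in>I. evalp c s (f i))"
  by (induction I rule: infinite_finite_induct) (auto simp: evalp_add)

lemma evalp_single: "evalp c s (Poly_Mapping.single e a) =
    c a * (\<Prod>v\<in>Poly_Mapping.keys e. s v ^ Poly_Mapping.lookup e v)"
  by (subst evalp_superset[of "{e}"]) auto

lemma evalp_Const [simp]: "evalp c s (Const a) = c a"
  by (simp add: evalp_single)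

lemma evalp_Var [simp]: "evalp c s (Var v) = s v"
  by (simp add: evalp_single c_one)

lemma evalp_one [simp]: "evalp c s 1 = 1"
  using evalp_Const[of s 1] by (simp add: c_one single_one)

lemma evalp_mult: "evalp c s (f * g) = evalp c s f * evalp c s g"
proof -
  let ?m = "\<lambda>e. \<Prod>v\<in>Poly_Mapping.keys e. s v ^ Poly_Mapping.lookup e v"
  have m: "?m (e + e') = ?m e * ?m e'" for e e'
  proof -
    let ?A = "Poly_Mapping.keys e \<union> Poly_Mapping.keys e'"
    have *: "?m h = (\<Prod>v\<in>?A. s v ^ Poly_Mapping.lookup h v)" if "Poly_Mapping.keys h \<subseteq> ?A" for h
      using that by (intro prod.mono_neutral_left) (auto simp: in_keys_iff)
    show ?thesis
      using *[of "e + e'"] *[of e] *[of e'] keys_add[of e e']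
      by (simp add: lookup_add power_add prod.distrib)
  qed
  have "evalp c s (f * g) =
    evalp c s ((\<Sum>e\<in>Poly_Mapping.keys f. Poly_Mapping.single e (Poly_Mapping.lookup f e)) *
               (\<Sum>e\<in>Poly_Mapping.keys g. Poly_Mapping.single e (Poly_Mapping.lookup g e)))"
    by (simp flip: mpoly_eq_sum_single)
  also have "\<dots> = (\<Sum>e\<in>Poly_Mapping.keys f. \<Sum>e'\<in>Poly_Mapping.keys g.
      (c (Poly_Mapping.lookup f e) * ?m e) * (c (Poly_Mapping.lookup g e') * ?m e'))"
    by (simp add: sum_product evalp_sum mult_single evalp_single m c_mult ac_simps)
  also have "\<dots> = evalp c s f * evalp c s g"
    unfolding evalp_def sum_product ..
  finally show ?thesis .
qed

lemma evalp_power: "evalp c s (f ^ n) = evalp c s f ^ n"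
  by (induction n) (auto simp: evalp_mult)

lemma evalp_prod: "evalp c s (\<Prod>i\<in>I. f i) = (\<Prod>i\<in>I. evalp c s (f i))"
  by (induction I rule: infinite_finite_induct) (auto simp: evalp_mult)

lemma evalp_uminus: "evalp c s (- f) = - evalp c s f"
  using evalp_add[of s f "- f"] by (simp add: eq_neg_iff_add_eq_0 add.commute)

lemma evalp_diff: "evalp c s (f - g) = evalp c s f - evalp c s g"
  using evalp_add[of s f "- g"] by (simp add: evalp_uminus)

lemma evalp_dvd: "f dvd g \<Longrightarrow> evalp c s f dvd evalp c s g"
  by (metis dvdE dvd_triv_left evalp_mult)

lemma evalp_diff_dvd:
  assumes "f \<in> polys_over X" "\<And>v. v \<in> X \<Longrightarrow> d dvd s v - s' v"
  shows "d dvd evalp c s f - evalp c s' f"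
  using assms(1)
proof (induction rule: polys_over_induct)
  case (add f g)
  have "evalp c s (f + g) - evalp c s' (f + g) =
      (evalp c s f - evalp c s' f) + (evalp c s g - evalp c s' g)"
    by (simp add: evalp_add)
  then show ?case using add by simp
next
  case (mult f g)
  have "evalp c s (f * g) - evalp c s' (f * g) =
      (evalp c s f - evalp c s' f) * evalp c s g + evalp c s' f * (evalp c s g - evalp c s' g)"
    by (simp add: evalp_mult algebra_simps)
  then show ?case using mult by simp
qed (auto simp: assms(2))

lemma evalp_cong:
  assumes "f \<in> polys_over X" "\<And>v. v \<in> X \<Longrightarrow> s v = s' v"
  shows "evalp c s f = evalp c s' f"
  using evalp_diff_dvd[of f X 0 s s'] assms by simp

end

interpretation Cst: coeff_hom "Poly_Mapping.single 0 :: 'a::comm_ring_1 \<Rightarrow> ('v, 'a) mpoly"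
  by unfold_locales (auto simp: single_add mult_single single_one)

text \<open>Substitution of polynomials for the variables.\<close>

abbreviation subst :: "('v \<Rightarrow> ('w, 'a::comm_ring_1) mpoly) \<Rightarrow> ('v, 'a) mpoly \<Rightarrow> ('w, 'a) mpoly" where
  "subst \<equiv> evalp (Poly_Mapping.single 0)"

lemma subst_Var [simp]: "subst Var f = f"
  by (induction f rule: mpoly_induct) (auto simp: Cst.evalp_add Cst.evalp_mult)

lemma subst_subst: "subst s (subst t f) = subst (\<lambda>v. subst s (t v)) f"
  by (induction f rule: mpoly_induct) (auto simp: Cst.evalp_add Cst.evalp_mult)

lemma subst_id_on: "f \<in> polys_over X \<Longrightarrow> (\<And>v. v \<in> X \<Longrightarrow> s v = Var v) \<Longrightarrow> subst s f = f"
  using Cst.evalp_cong[of f X s Var] by simp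

lemma subst_polys_over:
  assumes "f \<in> polys_over X" "\<And>v. v \<in> X \<Longrightarrow> s v \<in> polys_over Y"
  shows "subst s f \<in> polys_over Y"
  using assms(1)
  by (induction rule: polys_over_induct)
     (auto simp: Cst.evalp_add Cst.evalp_mult assms(2) intro: polys_over_add polys_over_mult)

subsection \<open>Homogeneous polynomials\<close>

definition homog :: "nat \<Rightarrow> ('v, 'a::zero) mpoly \<Rightarrow> bool" where
  "homog d f \<longleftrightarrow> (\<forall>e\<in>Poly_Mapping.keys f. monom_degree e = d)"

lemma homogeneous_part_eq: "homogeneous_part N i = {f \<in> N. homog i f}"
  by (simp add: homogeneous_part_def homog_def)

lemma monom_degree_superset:
  "finite A \<Longrightarrow> Poly_Mapping.keys e \<subseteq> A \<Longrightarrow> monom_degree e = (\<Sum>b\<in>A. Poly_Mapping.lookup e b)"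
  unfolding monom_degree_def by (intro sum.mono_neutral_left) (auto simp: in_keys_iff)

lemma monom_degree_add: "monom_degree (e + f) = monom_degree e + monom_degree f"
  using keys_add[of e f]
  by (simp add: monom_degree_superset[of "Poly_Mapping.keys e \<union> Poly_Mapping.keys f"] lookup_add sum.distrib)

lemma monom_degree_zero [simp]: "monom_degree 0 = 0"
  by (simp add: monom_degree_def)

lemma homog_zero [simp]: "homog d 0"
  by (simp add: homog_def)

lemma homog_Const [simp]: "homog 0 (Const a)"
  by (simp add: homog_def)

lemma homog_one [simp]: "homog 0 (1 :: ('v, 'a::comm_semiring_1) mpoly)"
  using homog_Const[of "1::'a"] by (simp add: single_one)

lemma homog_Var [simp]: "homog (Suc 0) (Var v)"
  by (simp add: homog_def monom_degree_def)

lemma homog_add: "homog d f \<Longrightarrow> homog d g \<Longrightarrow> homog d (f + g)"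
  using keys_add[of f g] by (auto simp: homog_def)

lemma homog_uminus: "homog d f \<Longrightarrow> homog d (- f)" for f :: "('v, 'a::ab_group_add) mpoly"
  by (simp add: homog_def)

lemma homog_diff: "homog d f \<Longrightarrow> homog d g \<Longrightarrow> homog d (f - g)" for f :: "('v, 'a::ab_group_add) mpoly"
  using keys_diff[of f g] by (auto simp: homog_def)

lemma homog_sum: "(\<And>i. i \<in> I \<Longrightarrow> homog d (h i)) \<Longrightarrow> homog d (\<Sum>i\<in>I. h i)"
  by (induction I rule: infinite_finite_induct) (auto intro: homog_add)

lemma homog_mult:
  fixes f g :: "('v, 'a::comm_semiring_1) mpoly"
  assumes "homog d f" "homog d' g"
  shows "homog (d + d') (f * g)"
  unfolding homog_def
proof
  fix e assume "e \<in> Poly_Mapping.keys (f * g)"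
  then obtain a b where "a \<in> Poly_Mapping.keys f" "b \<in> Poly_Mapping.keys g" "e = a + b"
    using keys_mult[of f g] by auto
  then show "monom_degree e = d + d'" using assms by (simp add: homog_def monom_degree_add)
qed

lemma homog_mult_eq:
  fixes f g :: "('v, 'a::comm_semiring_1) mpoly"
  shows "homog d f \<Longrightarrow> homog d' g \<Longrightarrow> i = d + d' \<Longrightarrow> homog i (f * g)"
  using homog_mult by blast

lemma homog_Const_mult: "homog d f \<Longrightarrow> homog d (Const c * f)"
  for f :: "('v, 'a::comm_semiring_1) mpoly"
  using homog_mult[OF homog_Const] by fastforce

lemma homog_power: "homog d f \<Longrightarrow> homog (n * d) (f ^ n)"
  for f :: "('v, 'a::comm_semiring_1) mpoly"
  by (induction n) (auto intro: homog_mult_eq)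

lemma homog_prod:
  "(\<And>i. i \<in> I \<Longrightarrow> homog (d i) (h i)) \<Longrightarrow> homog (\<Sum>i\<in>I. d i) (\<Prod>i\<in>I. h i :: ('v, 'a::comm_semiring_1) mpoly)"
  by (induction I rule: infinite_finite_induct) (auto intro: homog_mult)

lemma homog_linear_form: "homog (Suc 0) (linear_form B l)"
  unfolding linear_form_def by (intro homog_sum) (simp add: homog_def monom_degree_def)

definition comp :: "nat \<Rightarrow> ('v, 'a::comm_monoid_add) mpoly \<Rightarrow> ('v, 'a) mpoly" where
  "comp d f = (\<Sum>e\<in>{e \<in> Poly_Mapping.keys f. monom_degree e = d}. Poly_Mapping.single e (Poly_Mapping.lookup f e))"

lemma lookup_comp: "Poly_Mapping.lookup (comp d f) e = (if monom_degree e = d then Poly_Mapping.lookup f e else 0)"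
  unfolding comp_def by (auto simp: lookup_sum lookup_single when_def in_keys_iff sum.delta')

lemma keys_comp: "Poly_Mapping.keys (comp d f) = {e \<in> Poly_Mapping.keys f. monom_degree e = d}"
  by (auto simp: in_keys_iff lookup_comp split: if_splits)

lemma homog_comp [simp]: "homog d (comp d f)"
  by (simp add: homog_def keys_comp)

lemma comp_homog: "homog d f \<Longrightarrow> comp d f = f"
  by (rule poly_mapping_eqI) (auto simp: lookup_comp homog_def in_keys_iff)

lemma comp_add: "comp d (f + g) = comp d f + comp d g"
  by (rule poly_mapping_eqI) (auto simp: lookup_comp lookup_add)

lemma comp_zero [simp]: "comp d 0 = 0"
  by (rule poly_mapping_eqI) (auto simp: lookup_comp)

lemma comp_mult:
  fixes a f :: "('v, 'a::comm_ring_1) mpoly"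
  assumes "homog d a"
  shows "comp (d + i) (a * f) = a * comp i f"
proof -
  have "comp (d + i) (a * (f - comp i f)) = 0"
  proof (rule poly_mapping_eqI)
    fix e
    have "e \<notin> Poly_Mapping.keys (a * (f - comp i f))" if e: "monom_degree e = d + i"
    proof
      assume "e \<in> Poly_Mapping.keys (a * (f - comp i f))"
      then obtain x y where xy: "x \<in> Poly_Mapping.keys a" "y \<in> Poly_Mapping.keys (f - comp i f)" "e = x + y"
        using keys_mult[of a "f - comp i f"] by auto
      then have "monom_degree y = i" using assms e by (simp add: homog_def monom_degree_add)
      then show False using xy(2) by (simp add: in_keys_iff lookup_minus lookup_comp)
    qed
    then show "Poly_Mapping.lookup (comp (d + i) (a * (f - comp i f))) e = Poly_Mapping.lookup 0 e"
      by (simp add: lookup_comp in_keys_iff)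
  qed
  moreover have "comp (d + i) (a * f) = comp (d + i) (a * comp i f) + comp (d + i) (a * (f - comp i f))"
    by (simp add: algebra_simps flip: comp_add)
  moreover have "comp (d + i) (a * comp i f) = a * comp i f"
    by (intro comp_homog homog_mult assms homog_comp)
  ultimately show ?thesis by simp
qed

lemma homog_cofactor:
  fixes a b :: "(nat, 'k::field) mpoly"
  assumes "homog d a" "homog (d + i) (a * b)" "a \<noteq> 0"
  shows "homog i b"
proof -
  have "a * comp i b = a * b" using comp_mult[OF assms(1)] comp_homog[OF assms(2)] by simp
  then show ?thesis using assms(3) by (metis homog_comp mult_left_cancel)
qed

lemma homog_cofactor_ge:
  fixes a b :: "(nat, 'k::field) mpoly"
  assumes "homog d a" "homog n (a * b)" "a * b \<noteq> 0"
  shows "d \<le> n"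
proof -
  obtain e where e: "e \<in> Poly_Mapping.keys (a * b)" using assms(3) keys_eq_empty by blast
  then obtain x y where "x \<in> Poly_Mapping.keys a" "y \<in> Poly_Mapping.keys b" "e = x + y"
    using keys_mult[of a b] by auto
  then show ?thesis using assms e by (auto simp: homog_def monom_degree_add)
qed

lemma subst_homog:
  assumes "homog d f" "f \<in> polys_over X" "\<And>v. v \<in> X \<Longrightarrow> homog (Suc 0) (s v)"
  shows "homog d (subst s f)"
  unfolding evalp_def
proof (intro homog_sum homog_Const_mult)
  fix e assume e: "e \<in> Poly_Mapping.keys f"
  then have "Poly_Mapping.keys e \<subseteq> X" using assms(2) by (auto simp: polys_over_def)
  then have "homog (\<Sum>v\<in>Poly_Mapping.keys e. Poly_Mapping.lookup e v * Suc 0)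
      (\<Prod>v\<in>Poly_Mapping.keys e. s v ^ Poly_Mapping.lookup e v)"
    using assms(3) by (intro homog_prod homog_power) auto
  then show "homog d (\<Prod>v\<in>Poly_Mapping.keys e. s v ^ Poly_Mapping.lookup e v)"
    using e assms(1) by (simp add: homog_def monom_degree_def)
qed

subsection \<open>Linear forms are prime\<close>

lemma linear_form_nonzero_iff: "finite B \<Longrightarrow> linear_form B l \<noteq> 0 \<longleftrightarrow> (\<exists>b\<in>B. l b \<noteq> 0)"
proof
  assume B: "finite B" "\<exists>b\<in>B. l b \<noteq> 0"
  then obtain b where b: "b \<in> B" "l b \<noteq> 0" by blast
  have "Poly_Mapping.lookup (linear_form B l) (Poly_Mapping.single b 1) =
      (\<Sum>b'\<in>B. if b' = b then l b' else 0)"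
    unfolding linear_form_def lookup_sum
    by (intro sum.cong refl) (auto simp: lookup_single when_def dest: arg_cong[where f = Poly_Mapping.keys])
  also have "\<dots> = l b" using B(1) b(1) by simp
  finally show "linear_form B l \<noteq> 0" using b(2) by auto
next
  assume B: "finite B" and nz: "linear_form B l \<noteq> 0"
  show "\<exists>b\<in>B. l b \<noteq> 0"
  proof (rule ccontr)
    assume "\<not> (\<exists>b\<in>B. l b \<noteq> 0)"
    then have "linear_form B l = 0" unfolding linear_form_def by (intro sum.neutral) simp
    then show False using nz by simp
  qed
qed

lemma linear_form_dvd_iff:
  fixes l :: "nat \<Rightarrow> 'k::field"
  assumes B: "finite B" "b0 \<in> B" "l b0 \<noteq> 0"
  defines "s \<equiv> (\<lambda>v. if v = b0 then - (\<Sum>b\<in>B - {b0}. Const (l b / l b0) * Var b) else Var v)"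
  shows "linear_form B l dvd f \<longleftrightarrow> subst s f = 0"
proof
  have split: "linear_form B l = Const (l b0) * Var b0 + (\<Sum>b\<in>B - {b0}. Const (l b) * Var b)"
    using B(1,2) by (simp add: linear_form_eq sum.remove)
  have scale: "Const (l b0) * (\<Sum>b\<in>B - {b0}. Const (l b / l b0) * Var b) =
      (\<Sum>b\<in>B - {b0}. Const (l b) * Var b)"
    using B(3) by (auto simp: sum_distrib_left mult.assoc[symmetric] simp flip: Const_mult intro!: sum.cong)
  have diff: "linear_form B l dvd s v - Var v" for v
  proof (cases "v = b0")
    case True
    have "Const (- 1 / l b0) * linear_form B l =
        Const (- 1 / l b0) * Const (l b0) * (Var b0 + (\<Sum>b\<in>B - {b0}. Const (l b / l b0) * Var b))"
      unfolding split scale[symmetric] by (simp add: algebra_simps)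
    also have "Const (- 1 / l b0) * Const (l b0) = (- 1 :: (nat, 'k) mpoly)"
      using B(3) by (simp add: single_one single_uminus flip: Const_mult)
    finally have "s v - Var v = Const (- 1 / l b0) * linear_form B l"
      using True by (simp add: s_def)
    then show ?thesis by simp
  qed (simp add: s_def)
  show "subst s f = 0" if "linear_form B l dvd f"
  proof -
    have "subst s (linear_form B l) = 0"
      unfolding split
    proof -
      have "subst s (\<Sum>b\<in>B - {b0}. Const (l b) * Var b) = (\<Sum>b\<in>B - {b0}. Const (l b) * Var b)"
        unfolding Cst.evalp_sum by (intro sum.cong refl) (auto simp: Cst.evalp_mult s_def)
      then show "subst s (Const (l b0) * Var b0 + (\<Sum>b\<in>B - {b0}. Const (l b) * Var b)) = 0"
        by (simp add: Cst.evalp_add Cst.evalp_mult) (simp add: s_def scale)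
    qed
    then show ?thesis using Cst.evalp_dvd[OF that, of s] by simp
  qed
  show "linear_form B l dvd f" if "subst s f = 0"
    using Cst.evalp_diff_dvd[of f UNIV "linear_form B l" s Var] diff that by simp
qed

lemma prime_elem_linear_form:
  fixes l :: "nat \<Rightarrow> 'k::field"
  assumes "finite B" "linear_form B l \<noteq> 0"
  shows "prime_elem (linear_form B l)"
proof -
  obtain b0 where b0: "b0 \<in> B" "l b0 \<noteq> 0" using assms linear_form_nonzero_iff by blast
  show ?thesis
    unfolding prime_elem_def linear_form_dvd_iff[of B b0 l, OF assms(1) b0] using assms(2)
    by (simp add: Cst.evalp_mult)
qed

subsection \<open>A regularity criterion\<close>

lemma const_poly_dvd_coeff: "[:D:] dvd p \<Longrightarrow> D dvd coeff p k" for D :: "'a::comm_ring_1"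
  by (auto elim!: dvdE)

lemma dvd_power_times_coeffs:
  fixes S :: "'a::comm_ring_1 poly"
  assumes "[:D:] dvd [:c, u:] * S"
  shows "D dvd u ^ Suc (degree S) * coeff S k"
proof -
  let ?N = "Suc (degree S)"
  have "[:D:] dvd [:0, u:] ^ n * S - [:- c:] ^ n * S" for n
  proof (induction n)
    case (Suc n)
    have "[:0, u:] = [:c, u:] + [:- c:]" by simp
    then have "[:0, u:] ^ Suc n * S - [:- c:] ^ Suc n * S =
        [:0, u:] ^ n * ([:c, u:] * S) + [:- c:] * ([:0, u:] ^ n * S - [:- c:] ^ n * S)"
      by (simp only: power_Suc ring_distribs ac_simps) (simp add: algebra_simps)
    moreover have "[:D:] dvd [:0, u:] ^ n * ([:c, u:] * S)" using assms by (rule dvd_mult)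
    moreover have "[:D:] dvd [:- c:] * ([:0, u:] ^ n * S - [:- c:] ^ n * S)" using Suc by (rule dvd_mult)
    ultimately show ?case by (simp only: dvd_add)
  qed simp
  then have "D dvd coeff ([:0, u:] ^ ?N * S - [:- c:] ^ ?N * S) (?N + k)"
    by (rule const_poly_dvd_coeff)
  moreover have "[:0, u:] ^ n = monom (u ^ n) n" for n
  proof -
    have "[:0, u:] = monom u 1" by (simp add: monom_altdef)
    then show ?thesis by (simp add: monom_power)
  qed
  moreover have "[:- c:] ^ n = [:(- c) ^ n:]" for n by (simp add: poly_const_pow)
  ultimately show ?thesis
    by (simp add: coeff_monom_mult coeff_eq_0 del: power_Suc)
qed

text \<open>The polynomial ring as a polynomial ring in the single variable \<open>y\<close>.\<close>

definition as_poly :: "'v \<Rightarrow> ('v, 'a::comm_ring_1) mpoly \<Rightarrow> ('v, 'a) mpoly poly" where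
  "as_poly y = evalp (\<lambda>a. [:Const a:]) (\<lambda>v. if v = y then [:0, 1:] else [:Var v:])"

interpretation Cpoly: coeff_hom "\<lambda>a::'a::comm_ring_1. [:Const a:] :: ('v, 'a) mpoly poly"
  by unfold_locales (auto simp: single_add mult_single single_one one_pCons mult.commute)

lemma as_poly_eval: "poly (as_poly y f) (Var y) = f"
  unfolding as_poly_def
  by (induction f rule: mpoly_induct) (auto simp: Cpoly.evalp_add Cpoly.evalp_mult)

lemma as_poly_const:
  assumes "f \<in> polys_over (- {y})"
  shows "as_poly y f = [:f:]"
  using assms unfolding as_poly_def
  by (induction rule: polys_over_induct) (auto simp: Cpoly.evalp_add Cpoly.evalp_mult)

lemma dvd_power_of_linear_coeff:
  fixes D c u s :: "('v, 'a::comm_ring_1) mpoly"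
  assumes over: "D \<in> polys_over (- {y})" "c \<in> polys_over (- {y})" "u \<in> polys_over (- {y})"
    and dvd: "D dvd (c + u * Var y) * s"
  obtains N where "D dvd u ^ N * s"
proof -
  let ?S = "as_poly y s"
  have "as_poly y D dvd as_poly y ((c + u * Var y) * s)"
    unfolding as_poly_def by (rule Cpoly.evalp_dvd[OF dvd])
  also have "as_poly y ((c + u * Var y) * s) = (as_poly y c + as_poly y u * as_poly y (Var y)) * ?S"
    by (simp add: as_poly_def Cpoly.evalp_add Cpoly.evalp_mult)
  also have "as_poly y (Var y) = [:0, 1:]" by (simp add: as_poly_def)
  finally have "[:D:] dvd [:c, u:] * ?S" using over by (simp add: as_poly_const)
  then have *: "D dvd u ^ Suc (degree ?S) * coeff ?S k" for k by (rule dvd_power_times_coeffs)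
  have "u ^ Suc (degree ?S) * s = u ^ Suc (degree ?S) * poly ?S (Var y)" by (simp add: as_poly_eval)
  also have "\<dots> = (\<Sum>k\<le>degree ?S. (u ^ Suc (degree ?S) * coeff ?S k) * Var y ^ k)"
    unfolding poly_altdef sum_distrib_left by (simp add: mult.assoc)
  finally have "D dvd u ^ Suc (degree ?S) * s"
    using * by (metis (no_types, lifting) dvd_mult2 dvd_sum)
  then show ?thesis by (rule that)
qed


section \<open>Graded subspaces of a free module and their Hilbert series\<close>

type_synonym 'k pvec = "nat \<Rightarrow> (nat, 'k) mpoly"

declare plus_fun_apply [simp del] zero_fun_apply [simp del] minus_apply [simp del] uminus_apply [simp del]

lemmas fun_apply = plus_fun_apply zero_fun_apply minus_apply uminus_apply

definition smul :: "(nat, 'k::field) mpoly \<Rightarrow> 'k pvec \<Rightarrow> 'k pvec" where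
  "smul a F = (\<lambda>j. a * F j)"

definition scl :: "'k::field \<Rightarrow> 'k pvec \<Rightarrow> 'k pvec" where
  "scl c F = smul (Const c) F"

lemma smul_apply: "smul a F j = a * F j"
  by (simp add: smul_def)

lemma scl_apply: "scl c F j = Const c * F j"
  by (simp add: scl_def smul_apply)

definition vsubst :: "(nat \<Rightarrow> (nat, 'k::field) mpoly) \<Rightarrow> 'k pvec \<Rightarrow> 'k pvec" where
  "vsubst s F = (\<lambda>j. subst s (F j))"

lemma vsubst_apply: "vsubst s F j = subst s (F j)"
  by (simp add: vsubst_def)

lemmas pv = smul_apply scl_apply vsubst_apply fun_apply

lemma smul_add: "smul a (F + G) = smul a F + smul a G"
  by (rule ext) (simp add: algebra_simps pv)

lemma smul_zero [simp]: "smul a 0 = 0" "smul 0 F = 0"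
  by (auto simp: fun_eq_iff pv)

lemma smul_one [simp]: "smul 1 F = F"
  by (auto simp: fun_eq_iff pv)

lemma smul_smul: "smul a (smul b F) = smul (a * b) F"
  by (auto simp: fun_eq_iff pv algebra_simps)

lemma smul_commute: "smul a (smul b F) = smul b (smul a F)"
  by (auto simp: fun_eq_iff pv algebra_simps)

lemma smul_add_left: "smul (a + b) F = smul a F + smul b F"
  by (auto simp: fun_eq_iff pv algebra_simps)

lemma smul_uminus_left: "smul (- a) F = - smul a F"
  by (auto simp: fun_eq_iff pv algebra_simps)

lemma sum_apply: "(\<Sum>i\<in>I. F i) j = (\<Sum>i\<in>I. F i j)" for F :: "'i \<Rightarrow> 'k::field pvec"
  by (induction I rule: infinite_finite_induct) (auto simp: fun_apply)

lemma smul_sum: "smul a (\<Sum>i\<in>I. F i) = (\<Sum>i\<in>I. smul a (F i))"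
  by (rule ext) (simp add: pv sum_apply sum_distrib_left)

lemma smul_sum_left: "smul (\<Sum>i\<in>I. a i) F = (\<Sum>i\<in>I. smul (a i) F)"
  by (rule ext) (simp add: pv sum_apply sum_distrib_right)

lemma smul_eq_0D: "smul a F = 0 \<Longrightarrow> a \<noteq> 0 \<Longrightarrow> F = 0"
  by (auto simp: fun_eq_iff pv)

lemma smul_cancel: "a \<noteq> 0 \<Longrightarrow> smul a F = smul a G \<longleftrightarrow> F = G"
  by (auto simp: fun_eq_iff pv)

interpretation UU: linear_space "scl :: 'k::field \<Rightarrow> 'k pvec \<Rightarrow> 'k pvec"
  by unfold_locales (auto simp: fun_eq_iff pv algebra_simps single_add single_one mult_single simp flip: mult.assoc)

lemma subspaceI:
  assumes "0 \<in> S" "\<And>F G. F \<in> S \<Longrightarrow> G \<in> S \<Longrightarrow> F + G \<in> S" "\<And>c F. F \<in> S \<Longrightarrow> scl c F \<in> S"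
  shows "UU.subspace S"
  using assms by (simp add: UU.subspace_def)

abbreviation pvlin :: "('k::field pvec \<Rightarrow> 'k pvec) \<Rightarrow> bool" where
  "pvlin \<equiv> Vector_Spaces.linear scl scl"

lemma pvlinI:
  assumes "\<And>F G. f (F + G) = f F + f G" "\<And>c F. f (scl c F) = scl c (f F)"
  shows "pvlin f"
  using assms by (simp add: Vector_Spaces.linear_iff UU.vector_space_axioms)

lemma pvlin_smul: "pvlin (smul a)"
  by (rule pvlinI) (auto simp: fun_eq_iff pv algebra_simps)

lemma subspace_image_smul: "UU.subspace S \<Longrightarrow> UU.subspace (smul a ` S)"
  using module_hom.subspace_image[of scl scl "smul a" S] pvlin_smul[of a]
  by (simp add: Vector_Spaces.linear_def)

lemma fin_span_image_smul: "UU.fin_span S \<Longrightarrow> UU.fin_span (smul a ` S)"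
  by (rule UU.fin_span_image[OF pvlin_smul])

lemma dim_image_smul:
  "UU.subspace S \<Longrightarrow> UU.fin_span S \<Longrightarrow> a \<noteq> 0 \<Longrightarrow> UU.dim (smul a ` S) = UU.dim S"
  by (rule UU.dim_image_inj[OF pvlin_smul]) (auto dest: smul_eq_0D)

text \<open>The degree \<open>i\<close> part of the free module of rank \<open>m\<close> over the polynomials in the first \<open>K\<close> variables.\<close>

definition graded_free :: "nat \<Rightarrow> nat \<Rightarrow> nat \<Rightarrow> 'k::field pvec set" where
  "graded_free m K i = {F. (\<forall>j. F j \<in> polys_over {..<K} \<and> homog i (F j)) \<and> (\<forall>j\<ge>m. F j = 0)}"

lemma subspace_graded_free: "UU.subspace (graded_free m K i)"
  by (rule subspaceI)
     (auto simp: graded_free_def pv intro: polys_over_add homog_add polys_over_mult homog_Const_mult)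

lemma graded_free_smul:
  assumes "F \<in> graded_free m K i" "a \<in> polys_over {..<K}" "homog d a"
  shows "smul a F \<in> graded_free m K (d + i)"
  using assms by (auto simp: graded_free_def pv intro: polys_over_mult homog_mult)

lemma graded_free_mono: "K \<le> K' \<Longrightarrow> graded_free m K i \<subseteq> graded_free m K' i"
  by (auto simp: graded_free_def pv intro: polys_over_mono[rotated])

lemma graded_free_sum:
  "(\<And>x. x \<in> I \<Longrightarrow> F x \<in> graded_free m K i) \<Longrightarrow> (\<Sum>x\<in>I. F x) \<in> graded_free m K i"
  by (rule UU.subspace_sum[OF subspace_graded_free])

lemma pvlin_vsubst: "pvlin (vsubst s)"
  by (rule pvlinI) (auto simp: fun_eq_iff pv Cst.evalp_add Cst.evalp_mult)

abbreviation zero_var :: "nat \<Rightarrow> nat \<Rightarrow> (nat, 'k::field) mpoly" where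
  "zero_var K \<equiv> Var(K := 0)"

lemma Var_nonzero [simp]: "(Var v :: ('v, 'a::zero_neq_one) mpoly) \<noteq> 0"
  by (metis lookup_single_eq lookup_zero zero_neq_one)

lemma Var_dvd_of_zero_var: "subst (zero_var K) f = 0 \<Longrightarrow> Var K dvd f" for f :: "(nat, 'k::field) mpoly"
  using Cst.evalp_diff_dvd[of f UNIV "Var K" "zero_var K" Var] by (simp add: dvd_minus_iff)

lemma zero_var_over: "f \<in> polys_over {..<Suc K} \<Longrightarrow> subst (zero_var K) f \<in> polys_over {..<K}"
  by (erule subst_polys_over) (auto simp: intro!: polys_over_Var)

lemma zero_var_id: "f \<in> polys_over {..<K} \<Longrightarrow> subst (zero_var K) f = f"
  by (erule subst_id_on) auto

lemma polys_over_cofactor: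
  fixes a b :: "(nat, 'k::field) mpoly"
  assumes "a * b \<in> polys_over X" "a \<in> polys_over X" "a \<noteq> 0"
  shows "b \<in> polys_over X"
proof -
  let ?s = "\<lambda>v. if v \<in> X then Var v else (0 :: (nat, 'k) mpoly)"
  have "a * subst ?s b = subst ?s (a * b)"
    by (simp add: Cst.evalp_mult subst_id_on[OF assms(2)])
  also have "\<dots> = a * b" by (rule subst_id_on[OF assms(1)]) auto
  finally have "subst ?s b = b" using assms(3) by simp
  moreover have "subst ?s b \<in> polys_over X"
    by (rule subst_polys_over[of b UNIV]) (auto intro: polys_over_Var)
  ultimately show ?thesis by simp
qed

lemma graded_free_cofactor:
  assumes "smul a F \<in> graded_free m K (d + i)" "a \<in> polys_over {..<K}" "homog d a" "a \<noteq> 0"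
  shows "F \<in> graded_free m K i"
proof -
  have 1: "a * F j \<in> polys_over {..<K}" "homog (d + i) (a * F j)" for j
    using assms(1) by (auto simp: graded_free_def pv)
  have "F j = 0" if "j \<ge> m" for j
    using assms(1,4) that by (auto simp: graded_free_def pv)
  then show ?thesis
    using polys_over_cofactor[OF 1(1) assms(2,4)] homog_cofactor[OF assms(3) 1(2) assms(4)]
    by (simp add: graded_free_def)
qed

text \<open>Setting a variable to zero has kernel the multiples of that variable. This is how the
  Hilbert series of a polynomial extension is computed.\<close>

lemma zero_var_exact:
  fixes Y :: "'k::field pvec set" and m :: nat
  assumes Y: "UU.subspace Y" "\<And>F. F \<in> Y \<Longrightarrow> vsubst (zero_var K) F \<in> Y"
    and mul: "\<And>F. smul (Var K) F \<in> Y \<longleftrightarrow> F \<in> Y"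
  defines "X \<equiv> \<lambda>K i. Y \<inter> graded_free m K i"
  shows "vsubst (zero_var K) ` X (Suc K) i = X K i"
    and "{F \<in> X (Suc K) (Suc i). vsubst (zero_var K) F = 0} = smul (Var K) ` X (Suc K) i"
    and "{F \<in> X (Suc K) 0. vsubst (zero_var K) F = 0} = {0}"
proof -
  have "vsubst (zero_var K) F \<in> X K i" if "F \<in> X (Suc K) i" for F i
  proof -
    have F: "F \<in> Y" "\<And>j. F j \<in> polys_over {..<Suc K}" "\<And>j. homog i (F j)" "\<And>j. m \<le> j \<Longrightarrow> F j = 0"
      using that by (auto simp: X_def graded_free_def)
    have "homog i (subst (zero_var K) (F j))" for j
      by (rule subst_homog[OF F(3), where X = UNIV]) auto
    then show ?thesis
      using Y(2)[OF F(1)] zero_var_over[OF F(2)] F(4) by (simp add: X_def graded_free_def pv)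
  qed
  moreover have "F \<in> vsubst (zero_var K) ` X (Suc K) i" if F: "F \<in> X K i" for F
  proof -
    have "vsubst (zero_var K) F = F"
      using F by (auto simp: X_def graded_free_def pv fun_eq_iff pv zero_var_id)
    moreover have "F \<in> X (Suc K) i" using F graded_free_mono[of K "Suc K" m i] by (auto simp: X_def)
    ultimately show ?thesis by (metis imageI)
  qed
  ultimately show "vsubst (zero_var K) ` X (Suc K) i = X K i" by blast
  have ex: "\<exists>F'. F = smul (Var K) F'" if "vsubst (zero_var K) F = 0" for F :: "'k pvec"
  proof -
    have "\<forall>j. \<exists>a. F j = Var K * a"
    proof
      fix j
      have "subst (zero_var K) (F j) = 0" using that by (simp add: fun_eq_iff pv)
      then show "\<exists>a. F j = Var K * a" using Var_dvd_of_zero_var[of K "F j"] by (simp add: dvd_def)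
    qed
    then obtain F' where "\<forall>j. F j = Var K * F' j" by metis
    then show ?thesis by (intro exI[of _ F']) (auto simp: fun_eq_iff pv)
  qed
  have over: "Var K \<in> polys_over {..<Suc K}" by (rule polys_over_Var) simp
  show "{F \<in> X (Suc K) (Suc i). vsubst (zero_var K) F = 0} = smul (Var K) ` X (Suc K) i" (is "?L = ?R")
  proof (intro equalityI subsetI)
    fix F assume F: "F \<in> ?L"
    then obtain F' where F': "F = smul (Var K) F'" using ex by blast
    have "F' \<in> graded_free m (Suc K) i"
      by (rule graded_free_cofactor[of "Var K" _ _ _ "Suc 0"])
         (use F F' over in \<open>auto simp: X_def\<close>)
    then show "F \<in> ?R" using F F' mul by (auto simp: X_def)
  next
    fix F assume "F \<in> ?R"
    then obtain F' where F': "F = smul (Var K) F'" "F' \<in> X (Suc K) i" by blast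
    have "smul (Var K) F' \<in> graded_free m (Suc K) (Suc 0 + i)"
      using F' over by (intro graded_free_smul) (auto simp: X_def)
    moreover have "vsubst (zero_var K) (smul (Var K) F') = 0"
      by (auto simp: fun_eq_iff pv Cst.evalp_mult)
    ultimately show "F \<in> ?L" using F' mul by (simp add: X_def)
  qed
  show "{F \<in> X (Suc K) 0. vsubst (zero_var K) F = 0} = {0}" (is "?L = _")
  proof (intro equalityI subsetI)
    fix F assume F: "F \<in> ?L"
    then obtain F' where F': "F = smul (Var K) F'" using ex by blast
    have "F j = 0" for j
    proof (rule ccontr)
      assume "F j \<noteq> 0"
      moreover have "homog 0 (F j)" using F by (auto simp: X_def graded_free_def pv)
      ultimately have "Suc 0 \<le> 0"
        using homog_cofactor_ge[of "Suc 0" "Var K" 0 "F' j"] F' by (simp add: pv)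
      then show False by simp
    qed
    then show "F \<in> {0}" by (auto simp: fun_eq_iff pv)
  next
    fix F :: "'k pvec" assume "F \<in> {0}"
    moreover have "vsubst (zero_var K) (0 :: 'k pvec) = 0" by (auto simp: fun_eq_iff pv)
    ultimately show "F \<in> ?L"
      using UU.subspace_0[OF Y(1)] UU.subspace_0[OF subspace_graded_free] by (simp add: X_def)
  qed
qed

lemma graded_free_0_Suc: "graded_free m 0 (Suc i) = {0}"
proof -
  have "F = 0" if F: "F \<in> graded_free m 0 (Suc i)" for F :: "'a pvec"
  proof (rule ext)
    fix j
    have "Poly_Mapping.keys (F j) = {}"
    proof (rule ccontr)
      assume "Poly_Mapping.keys (F j) \<noteq> {}"
      then obtain e where e: "e \<in> Poly_Mapping.keys (F j)" by blast
      then have "Poly_Mapping.keys e = {}" "monom_degree e = Suc i"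
        using F by (auto simp: graded_free_def pv polys_over_def homog_def)
      then show False by (simp add: monom_degree_def)
    qed
    then show "F j = 0 j" by (simp add: pv)
  qed
  then show ?thesis using UU.subspace_0[OF subspace_graded_free] by blast
qed

definition uvec :: "nat \<Rightarrow> 'k::field pvec" where
  "uvec j = (\<lambda>i. if i = j then 1 else 0)"

lemma graded_free_0_0: "graded_free m 0 0 = UU.span (uvec ` {..<m})"
proof (intro equalityI subsetI)
  fix F :: "'a pvec" assume F: "F \<in> graded_free m 0 0"
  have c: "\<exists>c. F j = Const c" for j
  proof -
    have "F j = Const (Poly_Mapping.lookup (F j) 0)"
    proof (rule poly_mapping_eqI)
      fix e
      show "Poly_Mapping.lookup (F j) e = Poly_Mapping.lookup (Const (Poly_Mapping.lookup (F j) 0)) e"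
      proof (cases "e \<in> Poly_Mapping.keys (F j)")
        case True
        then have "Poly_Mapping.keys e = {}" using F by (auto simp: graded_free_def pv polys_over_def)
        then have "e = 0" by simp
        then show ?thesis by simp
      qed (auto simp: in_keys_iff lookup_single when_def)
    qed
    then show ?thesis by blast
  qed
  then obtain c where c: "\<And>j. F j = Const (c j)" by metis
  have "F = (\<Sum>j<m. scl (c j) (uvec j))"
  proof (rule ext)
    fix i
    have "(\<Sum>j<m. scl (c j) (uvec j)) i = (\<Sum>j<m. if j = i then F i else 0)"
      unfolding sum_apply by (intro sum.cong refl) (auto simp: uvec_def c pv)
    also have "\<dots> = F i" using F by (auto simp: graded_free_def pv)
    finally show "F i = (\<Sum>j<m. scl (c j) (uvec j)) i" ..
  qed
  also have "\<dots> \<in> UU.span (uvec ` {..<m})"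
    by (intro UU.span_sum UU.span_scale UU.span_base) simp
  finally show "F \<in> UU.span (uvec ` {..<m})" .
next
  fix F :: "'a pvec" assume "F \<in> UU.span (uvec ` {..<m})"
  moreover have "UU.span (uvec ` {..<m}) \<subseteq> (graded_free m 0 0 :: 'a pvec set)"
    by (rule UU.span_minimal[OF _ subspace_graded_free]) (auto simp: graded_free_def pv uvec_def)
  ultimately show "F \<in> graded_free m 0 0" by blast
qed

lemma dim_graded_free_0_0: "UU.dim (graded_free m 0 0 :: 'k::field pvec set) = m"
proof -
  have inj: "inj_on (uvec :: nat \<Rightarrow> 'k pvec) {..<m}"
  proof (rule inj_onI)
    fix i j assume "(uvec i :: 'k pvec) = uvec j"
    then have "(uvec i :: 'k pvec) i = uvec j i" by simp
    then show "i = j" by (simp add: uvec_def split: if_splits)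
  qed
  have "UU.independent (uvec ` {..<m} :: 'k pvec set)"
  proof (rule UU.independent_if_scalars_zero)
    fix f :: "'k pvec \<Rightarrow> 'k" and x :: "'k pvec"
    assume 0: "(\<Sum>x\<in>uvec ` {..<m}. scl (f x) x) = 0" and "x \<in> uvec ` {..<m}"
    then obtain i where i: "i < m" "x = uvec i" by auto
    have "0 = (\<Sum>j<m. scl (f (uvec j)) (uvec j)) i"
      using 0 by (simp add: sum.reindex[OF inj] pv)
    also have "\<dots> = (\<Sum>j<m. if j = i then Const (f (uvec i)) else 0)"
      unfolding sum_apply by (intro sum.cong refl) (auto simp: uvec_def pv)
    also have "\<dots> = Const (f x)" using i by simp
    finally have "Const (f x) = (0 :: (nat, 'k) mpoly)" ..
    then show "f x = 0" by (metis lookup_single_eq lookup_zero)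
  qed simp
  then have "UU.dim (graded_free m 0 0 :: 'k pvec set) = card (uvec ` {..<m} :: 'k pvec set)"
    unfolding graded_free_0_0 by (rule UU.dim_span_eq_card_independent)
  then show ?thesis using card_image[OF inj] by simp
qed

lemma fin_span_zero_var:
  fixes X :: "'k::field pvec set"
  assumes "UU.fin_span (vsubst s ` X)" "UU.fin_span {F \<in> X. vsubst s F = 0}"
    and "vsubst s ` X \<subseteq> X" "UU.subspace X" "\<And>F. F \<in> X \<Longrightarrow> vsubst s (vsubst s F) = vsubst s F"
  shows "UU.fin_span X"
proof -
  interpret s: Vector_Spaces.linear scl scl "vsubst s" by (rule pvlin_vsubst)
  have "X \<subseteq> UU.sum_space (vsubst s ` X) {F \<in> X. vsubst s F = 0}"
  proof
    fix F assume F: "F \<in> X"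
    have "F - vsubst s F \<in> {F \<in> X. vsubst s F = 0}"
      using F assms(3,5) UU.subspace_diff[OF assms(4), of F "vsubst s F"] by (auto simp: s.diff)
    then have "vsubst s F + (F - vsubst s F) \<in> UU.sum_space (vsubst s ` X) {F \<in> X. vsubst s F = 0}"
      using F by (intro UU.sum_spaceI) auto
    then show "F \<in> UU.sum_space (vsubst s ` X) {F \<in> X. vsubst s F = 0}" by simp
  qed
  then show ?thesis by (rule UU.fin_span_subset[OF UU.fin_span_sum_space[OF assms(1,2)]])
qed

lemma fin_span_graded_free: "UU.fin_span (graded_free m K i :: 'k::field pvec set)"
proof (induction K arbitrary: i)
  case 0
  show ?case
  proof (cases i)
    case 0
    then show ?thesis unfolding 0 graded_free_0_0 by (intro UU.fin_spanI[of "uvec ` {..<m}"]) auto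
  qed (simp add: graded_free_0_Suc)
next
  case (Suc K)
  have zz: "vsubst (zero_var K) (vsubst (zero_var K) F) = vsubst (zero_var K) F" for F :: "'k pvec"
    by (auto simp: fun_eq_iff pv subst_subst)
       (metis (mono_tags, lifting) Cst.evalp_Var Cst.evalp_zero fun_upd_apply)
  note ex = zero_var_exact[of UNIV K m, simplified]
  have sub: "vsubst (zero_var K) ` graded_free m (Suc K) i \<subseteq> (graded_free m (Suc K) i :: 'k pvec set)" for i
    unfolding ex(1) by (rule graded_free_mono) simp
  show ?case
  proof (induction i)
    case 0
    show ?case
      by (rule fin_span_zero_var[of "zero_var K"])
         (use Suc.IH sub zz subspace_graded_free in \<open>auto simp: ex\<close>)
  next
    case (Suc i)
    show ?case
      by (rule fin_span_zero_var[of "zero_var K"])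
         (use Suc.IH \<open>\<And>i. UU.fin_span (graded_free m K i)\<close> sub zz subspace_graded_free
           fin_span_image_smul in \<open>auto simp: ex\<close>)
  qed
qed

lemma fin_span_sub_graded_free: "X \<subseteq> graded_free m K i \<Longrightarrow> UU.fin_span X"
  by (rule UU.fin_span_subset[OF fin_span_graded_free])

lemma dim_zero_var:
  fixes Y :: "'k::field pvec set"
  assumes Y: "UU.subspace Y" "\<And>F. F \<in> Y \<Longrightarrow> vsubst (zero_var K) F \<in> Y"
    and mul: "\<And>F. smul (Var K) F \<in> Y \<longleftrightarrow> F \<in> Y"
  shows "UU.dim (Y \<inter> graded_free m (Suc K) 0) = UU.dim (Y \<inter> graded_free m K 0)"
    and "UU.dim (Y \<inter> graded_free m (Suc K) (Suc i)) =
      UU.dim (Y \<inter> graded_free m K (Suc i)) + UU.dim (Y \<inter> graded_free m (Suc K) i)"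
proof -
  have X: "UU.subspace (Y \<inter> graded_free m (Suc K) i)" "UU.fin_span (Y \<inter> graded_free m (Suc K) i)" for i
    by (rule UU.subspace_inter[OF Y(1) subspace_graded_free], rule fin_span_sub_graded_free) blast
  note ex = zero_var_exact[of Y K m, OF Y mul]
  show "UU.dim (Y \<inter> graded_free m (Suc K) 0) = UU.dim (Y \<inter> graded_free m K 0)"
    using UU.dim_kernel_image[OF pvlin_vsubst[of "zero_var K"] X, of 0] ex(1)[of 0] ex(3) by simp
  show "UU.dim (Y \<inter> graded_free m (Suc K) (Suc i)) =
      UU.dim (Y \<inter> graded_free m K (Suc i)) + UU.dim (Y \<inter> graded_free m (Suc K) i)"
    using UU.dim_kernel_image[OF pvlin_vsubst[of "zero_var K"] X, of "Suc i"] ex(1)[of "Suc i"] ex(2)[of i]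
      dim_image_smul[OF X, of "Var K" i] by simp
qed

subsection \<open>Values of Hilbert series\<close>

definition hval :: "(nat \<Rightarrow> 'k::field pvec set) \<Rightarrow> real \<Rightarrow> real" where
  "hval X t = suminf (\<lambda>i. real (UU.dim (X i)) * t ^ i)"

definition hsum :: "(nat \<Rightarrow> 'k::field pvec set) \<Rightarrow> real \<Rightarrow> bool" where
  "hsum X t \<longleftrightarrow> summable (\<lambda>i. real (UU.dim (X i)) * t ^ i)"

lemma partial_sums_series:
  fixes a b :: "nat \<Rightarrow> real"
  assumes b: "b 0 = a 0" "\<And>i. b (Suc i) = a (Suc i) + b i" and a: "\<And>i. a i \<ge> 0"
    and t: "0 \<le> t" "t < 1" and sm: "summable (\<lambda>i. a i * t ^ i)"
  shows "summable (\<lambda>i. b i * t ^ i)" "suminf (\<lambda>i. b i * t ^ i) = suminf (\<lambda>i. a i * t ^ i) / (1 - t)"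
proof -
  have bs: "b i = (\<Sum>j\<le>i. a j)" for i
    by (induction i) (auto simp: b)
  have n1: "summable (\<lambda>i. norm (a i * t ^ i))" using sm a t by simp
  have n2: "summable (\<lambda>i. norm (t ^ i))" using t by (simp add: summable_geometric)
  have eq: "(\<Sum>j\<le>i. (a j * t ^ j) * t ^ (i - j)) = b i * t ^ i" for i
  proof -
    have "(\<Sum>j\<le>i. (a j * t ^ j) * t ^ (i - j)) = (\<Sum>j\<le>i. a j * t ^ i)"
      by (intro sum.cong refl) (simp add: mult.assoc flip: power_add)
    then show ?thesis by (simp add: bs sum_distrib_right)
  qed
  have "(\<lambda>i. \<Sum>j\<le>i. (a j * t ^ j) * t ^ (i - j)) sums (suminf (\<lambda>i. a i * t ^ i) * suminf (\<lambda>i. t ^ i))"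
    by (rule Cauchy_product_sums[OF n1 n2])
  then have "(\<lambda>i. b i * t ^ i) sums (suminf (\<lambda>i. a i * t ^ i) * suminf (\<lambda>i. t ^ i))" by (simp only: eq)
  moreover have "suminf (\<lambda>i. t ^ i) = 1 / (1 - t)" using t by (intro suminf_geometric) auto
  ultimately have "(\<lambda>i. b i * t ^ i) sums (suminf (\<lambda>i. a i * t ^ i) / (1 - t))" by simp
  then show "summable (\<lambda>i. b i * t ^ i)" "suminf (\<lambda>i. b i * t ^ i) = suminf (\<lambda>i. a i * t ^ i) / (1 - t)"
    by (auto simp: sums_iff)
qed

lemma hval_zero_var:
  fixes Y :: "'k::field pvec set"
  assumes Y: "UU.subspace Y" "\<And>F. F \<in> Y \<Longrightarrow> vsubst (zero_var K) F \<in> Y"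
    and mul: "\<And>F. smul (Var K) F \<in> Y \<longleftrightarrow> F \<in> Y"
    and t: "0 \<le> t" "t < 1" and sm: "hsum (\<lambda>i. Y \<inter> graded_free m K i) t"
  shows "hsum (\<lambda>i. Y \<inter> graded_free m (Suc K) i) t"
    and "hval (\<lambda>i. Y \<inter> graded_free m (Suc K) i) t = hval (\<lambda>i. Y \<inter> graded_free m K i) t / (1 - t)"
  unfolding hval_def hsum_def
  using partial_sums_series[of "\<lambda>i. real (UU.dim (Y \<inter> graded_free m (Suc K) i))"
      "\<lambda>i. real (UU.dim (Y \<inter> graded_free m K i))" t] t sm
  by (simp_all add: dim_zero_var[OF Y mul] hsum_def)

lemma hval_graded_free:
  assumes t: "0 \<le> t" "t < 1"
  shows "hsum (graded_free m K :: nat \<Rightarrow> 'k::field pvec set) t"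
    and "hval (graded_free m K :: nat \<Rightarrow> 'k::field pvec set) t = real m / (1 - t) ^ K"
proof -
  have "hsum (graded_free m K :: nat \<Rightarrow> 'k pvec set) t \<and>
     hval (graded_free m K :: nat \<Rightarrow> 'k pvec set) t = real m / (1 - t) ^ K"
  proof (induction K)
    case 0
    have "(\<lambda>i. real (UU.dim (graded_free m 0 i :: 'k pvec set)) * t ^ i) sums
        (\<Sum>i\<in>{0}. real (UU.dim (graded_free m 0 i :: 'k pvec set)) * t ^ i)"
      by (rule sums_finite) (auto simp: gr0_conv_Suc graded_free_0_Suc)
    then show ?case by (simp add: hsum_def hval_def sums_iff dim_graded_free_0_0)
  next
    case (Suc K)
    then have sm: "hsum (\<lambda>i. UNIV \<inter> graded_free m K i :: 'k pvec set) t" by simp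
    show ?case
      using hval_zero_var[of UNIV K t m, OF _ _ _ t sm] Suc.IH by (simp add: mult.commute)
  qed
  then show "hsum (graded_free m K :: nat \<Rightarrow> 'k pvec set) t"
    "hval (graded_free m K :: nat \<Rightarrow> 'k pvec set) t = real m / (1 - t) ^ K" by auto
qed

definition gfam :: "nat \<Rightarrow> nat \<Rightarrow> (nat \<Rightarrow> 'k::field pvec set) \<Rightarrow> bool" where
  "gfam m K X \<longleftrightarrow> (\<forall>i. UU.subspace (X i) \<and> X i \<subseteq> graded_free m K i)"

lemma gfamD: "gfam m K X \<Longrightarrow> UU.subspace (X i)" "gfam m K X \<Longrightarrow> X i \<subseteq> graded_free m K i"
    "gfam m K X \<Longrightarrow> UU.fin_span (X i)"
  by (auto simp: gfam_def intro: fin_span_sub_graded_free[of _ m K i])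

lemma hsum_gfam:
  assumes "gfam m K X" "0 \<le> t" "t < 1"
  shows "hsum X t"
  unfolding hsum_def
proof (rule summable_comparison_test)
  show "summable (\<lambda>i. real (UU.dim (graded_free m K i :: 'a pvec set)) * t ^ i)"
    using hval_graded_free(1)[OF assms(2,3)] by (simp add: hsum_def)
  have "UU.dim (X i) \<le> UU.dim (graded_free m K i :: 'a pvec set)" for i
    by (rule UU.dim_subset_fin[OF fin_span_graded_free gfamD(2)[OF assms(1)]])
  then show "\<exists>N. \<forall>i\<ge>N. norm (real (UU.dim (X i)) * t ^ i) \<le> real (UU.dim (graded_free m K i :: 'a pvec set)) * t ^ i"
    using assms(2) by (auto intro!: mult_right_mono)
qed


section \<open>The Hilbert basis theorem and rationality of Hilbert series\<close>

lemma sum_spaceE: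
  assumes "F \<in> UU.sum_space X Y"
  obtains x y where "x \<in> X" "y \<in> Y" "F = x + y"
  using assms unfolding UU.sum_space_def by blast

context
  fixes m K :: nat
begin

definition grade_op :: "(nat, 'k::field) mpoly \<times> nat \<Rightarrow> bool" where
  "grade_op zd \<longleftrightarrow> fst zd \<in> polys_over {..<K} \<and> homog (snd zd) (fst zd) \<and> snd zd \<ge> 1"

definition stable_under :: "((nat, 'k::field) mpoly \<times> nat) list \<Rightarrow> (nat \<Rightarrow> 'k pvec set) \<Rightarrow> bool" where
  "stable_under zs X \<longleftrightarrow> gfam m K X \<and> (\<forall>(z, d)\<in>set zs. \<forall>i. \<forall>F\<in>X i. smul z F \<in> X (d + i))"

lemma stable_underD:
  assumes "stable_under zs X"
  shows "gfam m K X" "\<And>z d i F. (z, d) \<in> set zs \<Longrightarrow> F \<in> X i \<Longrightarrow> smul z F \<in> X (d + i)"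
    "UU.subspace (X i)" "UU.fin_span (X i)" "0 \<in> X i"
    "\<And>F G. F \<in> X i \<Longrightarrow> G \<in> X i \<Longrightarrow> F + G \<in> X i" "\<And>F G. F \<in> X i \<Longrightarrow> G \<in> X i \<Longrightarrow> F - G \<in> X i"
    "X i \<subseteq> graded_free m K i"
proof -
  show g: "gfam m K X" using assms by (simp add: stable_under_def)
  show "\<And>z d i F. (z, d) \<in> set zs \<Longrightarrow> F \<in> X i \<Longrightarrow> smul z F \<in> X (d + i)"
    using assms unfolding stable_under_def by blast
  show sub: "UU.subspace (X i)" by (rule gfamD(1)[OF g])
  show "UU.fin_span (X i)" "X i \<subseteq> graded_free m K i" by (rule gfamD(3)[OF g], rule gfamD(2)[OF g])
  show "0 \<in> X i" by (rule UU.subspace_0[OF sub])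
  show "\<And>F G. F \<in> X i \<Longrightarrow> G \<in> X i \<Longrightarrow> F + G \<in> X i" by (rule UU.subspace_add[OF sub])
  show "\<And>F G. F \<in> X i \<Longrightarrow> G \<in> X i \<Longrightarrow> F - G \<in> X i" by (rule UU.subspace_diff[OF sub])
qed

lemma stable_underI:
  assumes "\<And>i. UU.subspace (X i)" "\<And>i. X i \<subseteq> graded_free m K i"
    "\<And>z d i F. (z, d) \<in> set zs \<Longrightarrow> F \<in> X i \<Longrightarrow> smul z F \<in> X (d + i)"
  shows "stable_under zs X"
  using assms unfolding stable_under_def gfam_def by blast

text \<open>The ascending chain condition for stable families between \<open>Y'\<close> and \<open>Y\<close>.\<close>

definition noetherian :: "((nat, 'k::field) mpoly \<times> nat) list \<Rightarrow> (nat \<Rightarrow> 'k pvec set) \<Rightarrow> (nat \<Rightarrow> 'k pvec set) \<Rightarrow> bool" where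
  "noetherian zs Y' Y \<longleftrightarrow> (\<forall>f. (\<forall>k. stable_under zs (f k)) \<longrightarrow> (\<forall>k. Y' \<le> f k) \<longrightarrow> (\<forall>k. f k \<le> Y) \<longrightarrow>
     (\<forall>k. f k \<le> f (Suc k)) \<longrightarrow> (\<exists>N. \<forall>k\<ge>N. f k = f N))"

lemma noetherianD:
  assumes "noetherian zs Y' Y" "\<And>k. stable_under zs (f k)" "\<And>k. Y' \<le> f k" "\<And>k. f k \<le> Y" "\<And>k. f k \<le> f (Suc k)"
  obtains N where "\<And>k. k \<ge> N \<Longrightarrow> f k = f N"
  using assms unfolding noetherian_def by (metis (no_types, lifting))

lemma noetherianI:
  assumes "\<And>f. (\<And>k. stable_under zs (f k)) \<Longrightarrow> (\<And>k. Y' \<le> f k) \<Longrightarrow> (\<And>k. f k \<le> Y) \<Longrightarrow>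
     (\<And>k. f k \<le> f (Suc k)) \<Longrightarrow> (\<exists>N. \<forall>k\<ge>N. f k = f N)"
  shows "noetherian zs Y' Y"
  unfolding noetherian_def using assms by (intro allI impI) (rule assms; simp)

definition hilb :: "(nat \<Rightarrow> 'k::field pvec set) \<Rightarrow> int fps" where
  "hilb X = Abs_fps (\<lambda>i. int (UU.dim (X i)))"

lemma hilb_nth [simp]: "fps_nth (hilb X) i = int (UU.dim (X i))"
  by (simp add: hilb_def)

text \<open>Multiplication by one homogeneous element \<open>z\<close> of degree \<open>d\<close> turns the quotient \<open>Y / Y'\<close> into the
  two quotients \<open>(Y' : z) / Y'\<close> and \<open>Y / (Y' + z Y)\<close>, on which \<open>z\<close> acts as zero.\<close>

definition colon :: "(nat, 'k::field) mpoly \<Rightarrow> nat \<Rightarrow> (nat \<Rightarrow> 'k pvec set) \<Rightarrow> (nat \<Rightarrow> 'k pvec set) \<Rightarrow> nat \<Rightarrow> 'k pvec set" where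
  "colon z d Y' Y i = {F \<in> Y i. smul z F \<in> Y' (d + i)}"

definition adjoin :: "(nat, 'k::field) mpoly \<Rightarrow> nat \<Rightarrow> (nat \<Rightarrow> 'k pvec set) \<Rightarrow> (nat \<Rightarrow> 'k pvec set) \<Rightarrow> nat \<Rightarrow> 'k pvec set" where
  "adjoin z d Y' Y i = (if d \<le> i then UU.sum_space (Y' i) (smul z ` Y (i - d)) else Y' i)"

lemma subspace_colon:
  assumes Y: "UU.subspace (Y i)" and Y': "UU.subspace (Y' (d + i))"
  shows "UU.subspace (colon z d Y' Y i)"
proof (rule subspaceI)
  show "0 \<in> colon z d Y' Y i"
    using UU.subspace_0[OF Y] UU.subspace_0[OF Y'] by (simp add: colon_def)
  show "F + G \<in> colon z d Y' Y i" if "F \<in> colon z d Y' Y i" "G \<in> colon z d Y' Y i" for F G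
    using that UU.subspace_add[OF Y, of F G] UU.subspace_add[OF Y', of "smul z F" "smul z G"]
    by (simp add: colon_def smul_add)
  show "scl c F \<in> colon z d Y' Y i" if "F \<in> colon z d Y' Y i" for c F
    using that UU.subspace_scale[OF Y, of F c] UU.subspace_scale[OF Y', of "smul z F" c]
    by (simp add: colon_def scl_def smul_commute)
qed

lemma dim_colon_adjoin:
  assumes Y: "stable_under ((z, d) # zs) Y" and Y': "stable_under ((z, d) # zs) Y'" and le: "Y' \<le> Y"
  shows "UU.dim (Y i) + UU.dim (Y' (d + i)) = UU.dim (colon z d Y' Y i) + UU.dim (adjoin z d Y' Y (d + i))"
proof -
  let ?K = "colon z d Y' Y i"
  have subK: "UU.subspace ?K"
    by (rule subspace_colon[OF stable_underD(3)[OF Y] stable_underD(3)[OF Y']])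
  have finK: "UU.fin_span ?K"
    by (rule UU.fin_span_subset[OF stable_underD(4)[OF Y, of i]]) (auto simp: colon_def)
  have 1: "UU.dim (Y i) = UU.dim {F \<in> Y i. smul z F = 0} + UU.dim (smul z ` Y i)"
    by (rule UU.dim_kernel_image[OF pvlin_smul stable_underD(3)[OF Y] stable_underD(4)[OF Y]])
  have 2: "UU.dim ?K = UU.dim {F \<in> ?K. smul z F = 0} + UU.dim (smul z ` ?K)"
    by (rule UU.dim_kernel_image[OF pvlin_smul subK finK])
  have 3: "{F \<in> ?K. smul z F = 0} = {F \<in> Y i. smul z F = 0}"
    using stable_underD(5)[OF Y'] by (auto simp: colon_def)
  have 4: "smul z ` ?K = Y' (d + i) \<inter> smul z ` Y i" by (auto simp: colon_def)
  have 5: "UU.dim (UU.sum_space (Y' (d + i)) (smul z ` Y i)) + UU.dim (Y' (d + i) \<inter> smul z ` Y i) =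
      UU.dim (Y' (d + i)) + UU.dim (smul z ` Y i)"
    by (rule UU.dim_sum_space[OF stable_underD(3,4)[OF Y'] subspace_image_smul[OF stable_underD(3)[OF Y]]
          fin_span_image_smul[OF stable_underD(4)[OF Y]]])
  show ?thesis using 1 2 3 4 5 by (simp add: adjoin_def)
qed

lemma stable_under_colon:
  assumes Y: "stable_under ((z, d) # zs) Y" and Y': "stable_under ((z, d) # zs) Y'"
  shows "stable_under zs (colon z d Y' Y)"
proof (rule stable_underI)
  fix i
  show "UU.subspace (colon z d Y' Y i)"
    by (rule subspace_colon[OF stable_underD(3)[OF Y] stable_underD(3)[OF Y']])
  show "colon z d Y' Y i \<subseteq> graded_free m K i"
    using stable_underD(8)[OF Y] by (auto simp: colon_def)
next
  fix a e i F assume a: "(a, e) \<in> set zs" and F: "F \<in> colon z d Y' Y i"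
  have "smul a F \<in> Y (e + i)"
    by (rule stable_underD(2)[OF Y]) (use a F in \<open>auto simp: colon_def\<close>)
  moreover have "smul a (smul z F) \<in> Y' (e + (d + i))"
    by (rule stable_underD(2)[OF Y']) (use a F in \<open>auto simp: colon_def\<close>)
  ultimately show "smul a F \<in> colon z d Y' Y (e + i)"
    by (simp add: colon_def smul_commute[of z a] ac_simps)
qed

lemma stable_under_adjoin:
  assumes Y: "stable_under ((z, d) # zs) Y" and Y': "stable_under ((z, d) # zs) Y'" and le: "Y' \<le> Y"
  shows "stable_under zs (adjoin z d Y' Y)" "adjoin z d Y' Y \<le> Y" "Y' \<le> adjoin z d Y' Y"
    "F \<in> Y i \<Longrightarrow> smul z F \<in> adjoin z d Y' Y (d + i)"
proof -
  have sub: "UU.subspace (adjoin z d Y' Y i)" for i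
    unfolding adjoin_def
    using UU.subspace_sum_space[OF stable_underD(3)[OF Y'] subspace_image_smul[OF stable_underD(3)[OF Y]]]
      stable_underD(3)[OF Y'] by simp
  show up: "Y' \<le> adjoin z d Y' Y"
    unfolding adjoin_def le_fun_def
    using UU.sum_space_upper1[OF subspace_image_smul[OF stable_underD(3)[OF Y]]] by simp
  show mul: "smul z F \<in> adjoin z d Y' Y (d + i)" if "F \<in> Y i" for F i
    unfolding adjoin_def
    using UU.sum_space_upper2[OF stable_underD(3)[OF Y'], of "smul z ` Y i" "d + i"] that by auto
  have img: "smul z ` Y (i - d) \<subseteq> Y i" if "d \<le> i" for i
    using stable_underD(2)[OF Y, of z d _ "i - d"] that by auto
  show below: "adjoin z d Y' Y \<le> Y"
    unfolding adjoin_def le_fun_def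
    using UU.sum_space_least[OF stable_underD(3)[OF Y]] le img by (simp add: le_fun_def)
  show "stable_under zs (adjoin z d Y' Y)"
  proof (rule stable_underI[OF sub])
    fix i
    show "adjoin z d Y' Y i \<subseteq> graded_free m K i"
      using below stable_underD(8)[OF Y, of i] by (auto simp: le_fun_def)
  next
    fix a e i F assume a: "(a, e) \<in> set zs" and F: "F \<in> adjoin z d Y' Y i"
    have inY': "smul a G \<in> adjoin z d Y' Y (e + i)" if "G \<in> Y' i" for G
      using stable_underD(2)[OF Y', of a e G i] a that up by (auto simp: le_fun_def)
    show "smul a F \<in> adjoin z d Y' Y (e + i)"
    proof (cases "d \<le> i")
      case True
      then obtain x y where xy: "x \<in> Y' i" "y \<in> Y (i - d)" "F = x + smul z y"
        using F by (auto simp: adjoin_def elim!: sum_spaceE)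
      have "smul a y \<in> Y (e + (i - d))"
        by (rule stable_underD(2)[OF Y]) (use a xy in auto)
      then have "smul z (smul a y) \<in> adjoin z d Y' Y (d + (e + (i - d)))" by (rule mul)
      moreover have "d + (e + (i - d)) = e + i" using True by simp
      ultimately have "smul a (smul z y) \<in> adjoin z d Y' Y (e + i)" by (simp add: smul_commute)
      then show ?thesis
        unfolding xy(3) smul_add by (rule UU.subspace_add[OF sub inY'[OF xy(1)]])
    qed (use F inY' in \<open>auto simp: adjoin_def\<close>)
  qed
qed

theorem hilbert_serre:
  assumes "noetherian zs Y' Y" "stable_under zs Y'" "stable_under zs Y" "Y' \<le> Y" "\<And>zd. zd \<in> set zs \<Longrightarrow> grade_op zd"
  shows "\<exists>Q :: int poly. prod_list (map (\<lambda>(z, d). 1 - fps_X ^ d) zs) * (hilb Y - hilb Y') = fps_of_poly Q"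
  using assms
proof (induction zs arbitrary: Y' Y)
  case Nil
  define f where "f k = (\<lambda>i. if i < k then Y i else Y' i)" for k
  obtain N where N: "\<And>k. k \<ge> N \<Longrightarrow> f k = f N"
  proof (rule noetherianD[OF Nil.prems(1), of f])
    fix k
    show "stable_under [] (f k)"
      by (rule stable_underI)
         (auto simp: f_def intro: stable_underD(3)[OF Nil.prems(2)] stable_underD(3)[OF Nil.prems(3)]
           subsetD[OF stable_underD(8)[OF Nil.prems(2)]] subsetD[OF stable_underD(8)[OF Nil.prems(3)]])
    show "Y' \<le> f k" "f k \<le> Y" "f k \<le> f (Suc k)" using Nil.prems(4) by (auto simp: f_def le_fun_def)
  qed blast
  have eq: "Y i = Y' i" if "i \<ge> N" for i
  proof -
    have "f (Suc i) i = f N i" using N[of "Suc i"] that by simp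
    then show ?thesis using that by (simp add: f_def)
  qed
  define Q :: "int poly" where "Q = (\<Sum>i<N. monom (fps_nth (hilb Y - hilb Y') i) i)"
  have "hilb Y - hilb Y' = fps_of_poly Q"
  proof (rule fps_ext)
    fix i
    have "coeff Q i = (\<Sum>j<N. if j = i then fps_nth (hilb Y - hilb Y') i else 0)"
      unfolding Q_def coeff_sum by (intro sum.cong refl) auto
    then show "fps_nth (hilb Y - hilb Y') i = fps_nth (fps_of_poly Q) i"
      using eq[of i] by auto
  qed
  then show ?case by auto
next
  case (Cons zd zs)
  obtain z d where zd: "zd = (z, d)" by (cases zd)
  note Y' = Cons.prems(2)[unfolded zd] and Y = Cons.prems(3)[unfolded zd] and le = Cons.prems(4)
  note noeth = Cons.prems(1)[unfolded zd]
  let ?K = "colon z d Y' Y" and ?C = "adjoin z d Y' Y"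
  note C = stable_under_adjoin[OF Y Y' le]
  have stab: "stable_under zs Y" "stable_under zs Y'"
    using Y Y' by (auto simp: stable_under_def)
  have nK: "noetherian zs Y' ?K"
  proof (rule noetherianI)
    fix f assume f: "\<And>k. stable_under zs (f k)" "\<And>k. Y' \<le> f k" "\<And>k. f k \<le> ?K" "\<And>k. f k \<le> f (Suc k)"
    have "stable_under ((z, d) # zs) (f k)" for k
    proof (rule stable_underI[OF stable_underD(3)[OF f(1)] stable_underD(8)[OF f(1)]])
      fix a e i F assume a: "(a, e) \<in> set ((z, d) # zs)" and F: "F \<in> f k i"
      have "smul z F \<in> f k (d + i)"
        using F f(3)[of k] f(2)[of k] by (auto simp: colon_def le_fun_def)
      then show "smul a F \<in> f k (e + i)"
        using a stable_underD(2)[OF f(1) _ F] by auto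
    qed
    moreover have "f k \<le> Y" for k using f(3)[of k] by (auto simp: colon_def le_fun_def)
    ultimately obtain N where "\<And>k. k \<ge> N \<Longrightarrow> f k = f N"
      using noetherianD[OF noeth, of f] f(2,4) by metis
    then show "\<exists>N. \<forall>k\<ge>N. f k = f N" by blast
  qed
  have nC: "noetherian zs ?C Y"
  proof (rule noetherianI)
    fix f assume f: "\<And>k. stable_under zs (f k)" "\<And>k. ?C \<le> f k" "\<And>k. f k \<le> Y" "\<And>k. f k \<le> f (Suc k)"
    have "stable_under ((z, d) # zs) (f k)" for k
    proof (rule stable_underI[OF stable_underD(3)[OF f(1)] stable_underD(8)[OF f(1)]])
      fix a e i F assume a: "(a, e) \<in> set ((z, d) # zs)" and F: "F \<in> f k i"
      have "smul z F \<in> f k (d + i)"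
        using F f(3)[of k] f(2)[of k] C(4)[of F i] by (auto simp: le_fun_def)
      then show "smul a F \<in> f k (e + i)"
        using a stable_underD(2)[OF f(1) _ F] by auto
    qed
    moreover have "Y' \<le> f k" for k using f(2)[of k] C(3) by (rule order.trans[rotated])
    ultimately obtain N where "\<And>k. k \<ge> N \<Longrightarrow> f k = f N"
      using noetherianD[OF noeth, of f] f(3,4) by metis
    then show "\<exists>N. \<forall>k\<ge>N. f k = f N" by blast
  qed
  have "Y' \<le> ?K"
    using le stable_underD(2)[OF Y', of z d] by (auto simp: colon_def le_fun_def)
  with Cons.IH[OF nK stab(2) stable_under_colon[OF Y Y']] Cons.prems(5)
  obtain Q1 :: "int poly" where Q1: "prod_list (map (\<lambda>(z, d). 1 - fps_X ^ d) zs) * (hilb ?K - hilb Y') = fps_of_poly Q1"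
    by auto
  obtain Q2 :: "int poly" where Q2: "prod_list (map (\<lambda>(z, d). 1 - fps_X ^ d) zs) * (hilb Y - hilb ?C) = fps_of_poly Q2"
    using Cons.IH[OF nC C(1) stab(1) C(2)] Cons.prems(5) by auto
  have "(1 - fps_X ^ d) * (hilb Y - hilb Y') = (hilb Y - hilb ?C) - fps_X ^ d * (hilb ?K - hilb Y')"
  proof (rule fps_ext)
    fix i
    show "fps_nth ((1 - fps_X ^ d) * (hilb Y - hilb Y')) i =
        fps_nth ((hilb Y - hilb ?C) - fps_X ^ d * (hilb ?K - hilb Y')) i"
    proof (cases "i < d")
      case True
      then show ?thesis by (simp add: left_diff_distrib fps_X_power_mult_nth adjoin_def)
    next
      case False
      then have "d + (i - d) = i" by simp
      with dim_colon_adjoin[OF Y Y' le, of "i - d"] False show ?thesis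
        by (simp add: left_diff_distrib fps_X_power_mult_nth)
    qed
  qed
  note step = this
  let ?P = "prod_list (map (\<lambda>(z, d). 1 - fps_X ^ d) zs) :: int fps"
  have "prod_list (map (\<lambda>(z, d). 1 - fps_X ^ d) (zd # zs)) * (hilb Y - hilb Y') =
      ?P * ((1 - fps_X ^ d) * (hilb Y - hilb Y'))"
    by (simp add: zd ac_simps)
  also have "\<dots> = ?P * (hilb Y - hilb ?C) - fps_X ^ d * (?P * (hilb ?K - hilb Y'))"
    unfolding step by (simp add: algebra_simps)
  also have "\<dots> = fps_of_poly (Q2 - monom 1 d * Q1)"
    unfolding Q1 Q2 by (simp add: fps_of_poly_diff fps_of_poly_mult fps_of_poly_monom')
  finally show ?case by blast
qed

subsection \<open>The ascending chain condition\<close>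

text \<open>The sums \<open>y\<^sub>0 + z y\<^sub>1 + \<dots> + z\<^bsup>j-1\<^esup> y\<^bsub>j-1\<^esub>\<close> with all \<open>y\<^sub>i\<close> in \<open>Y\<close>.\<close>

primrec level :: "(nat, 'k::field) mpoly \<Rightarrow> nat \<Rightarrow> (nat \<Rightarrow> 'k pvec set) \<Rightarrow> nat \<Rightarrow> nat \<Rightarrow> 'k pvec set" where
  "level z d Y 0 i = {0}"
| "level z d Y (Suc j) i = (if j * d \<le> i then UU.sum_space (level z d Y j i) (smul (z ^ j) ` Y (i - j * d)) else level z d Y j i)"

definition generated :: "(nat, 'k::field) mpoly \<Rightarrow> nat \<Rightarrow> (nat \<Rightarrow> 'k pvec set) \<Rightarrow> nat \<Rightarrow> 'k pvec set" where
  "generated z d Y i = level z d Y (Suc i) i"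

lemma level_Suc_cases:
  assumes "F \<in> level z d Y (Suc j) i"
  obtains "F \<in> level z d Y j i"
    | w y where "w \<in> level z d Y j i" "j * d \<le> i" "y \<in> Y (i - j * d)" "F = w + smul (z ^ j) y"
  using assms by (auto split: if_splits elim!: sum_spaceE)

context
  fixes z :: "(nat, 'k::field) mpoly" and d :: nat and zs and Y :: "nat \<Rightarrow> 'k pvec set"
  assumes z: "grade_op (z, d)" and Y: "stable_under zs Y"
begin

lemma subspace_level: "UU.subspace (level z d Y j i)"
proof (induction j)
  case (Suc j)
  then show ?case
    using UU.subspace_sum_space[OF Suc subspace_image_smul[OF stable_underD(3)[OF Y]]] by simp
qed (auto simp: UU.subspace_def)

lemma level_mono_Suc: "level z d Y j i \<subseteq> level z d Y (Suc j) i"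
  using UU.sum_space_upper1[OF subspace_image_smul[OF stable_underD(3)[OF Y]]] by simp

lemma level_mono: "j \<le> j' \<Longrightarrow> level z d Y j i \<subseteq> level z d Y j' i"
  by (induction rule: dec_induct) (use level_mono_Suc in blast)+

lemma level_generator:
  assumes "y \<in> Y i" shows "smul (z ^ j) y \<in> level z d Y (Suc j) (j * d + i)"
  using UU.sum_space_upper2[OF subspace_level, of "smul (z ^ j) ` Y i" j "j * d + i"] assms by auto

lemma level_in_graded_free: "level z d Y j i \<subseteq> graded_free m K i"
proof (induction j)
  case 0
  then show ?case using UU.subspace_0[OF subspace_graded_free] by simp
next
  case (Suc j)
  have "smul (z ^ j) y \<in> graded_free m K i" if "j * d \<le> i" "y \<in> Y (i - j * d)" for y
  proof -
    have "smul (z ^ j) y \<in> graded_free m K (j * d + (i - j * d))"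
      using z that stable_underD(8)[OF Y]
      by (intro graded_free_smul polys_over_power homog_power) (auto simp: grade_op_def)
    then show ?thesis using that by simp
  qed
  then show ?case
    using UU.sum_space_least[OF subspace_graded_free Suc, of "smul (z ^ j) ` Y (i - j * d)"] Suc by auto
qed

lemma smul_level:
  assumes T: "\<And>i. UU.subspace (T i)" "\<And>i F. F \<in> T i \<Longrightarrow> smul z F \<in> T (d + i)"
    and a: "\<And>i F. F \<in> Y i \<Longrightarrow> smul a F \<in> T (e + i)" and F: "F \<in> level z d Y j i"
  shows "smul a F \<in> T (e + i)"
  using F
proof (induction j arbitrary: F)
  case 0
  then show ?case using UU.subspace_0[OF T(1)] by simp
next
  case (Suc j)
  have pow: "smul (z ^ j) G \<in> T (j * d + i)" if "G \<in> T i" for G i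
    using that
  proof (induction j)
    case (Suc j)
    then have "smul z (smul (z ^ j) G) \<in> T (d + (j * d + i))" by (intro T(2)) auto
    then show ?case by (simp add: smul_smul ac_simps)
  qed simp
  from Suc.prems show ?case
  proof (cases rule: level_Suc_cases)
    case (2 w y)
    have "smul (z ^ j) (smul a y) \<in> T (j * d + (e + (i - j * d)))" by (intro pow a 2)
    then have "smul a (smul (z ^ j) y) \<in> T (e + i)" using 2(2) by (simp add: smul_commute)
    then show ?thesis
      unfolding 2(4) smul_add by (rule UU.subspace_add[OF T(1) Suc.IH[OF 2(1)]])
  qed (rule Suc.IH)
qed

lemma level_stable:
  assumes "(a, e) \<in> set zs" "F \<in> level z d Y j i"
  shows "smul a F \<in> level z d Y j (e + i)"
  using assms(2)
proof (induction j arbitrary: F)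
  case (Suc j)
  from Suc.prems show ?case
  proof (cases rule: level_Suc_cases)
    case 1
    then show ?thesis using Suc.IH level_mono_Suc by blast
  next
    case (2 w y)
    have "smul a y \<in> Y (e + (i - j * d))" by (rule stable_underD(2)[OF Y assms(1) 2(3)])
    then have "smul (z ^ j) (smul a y) \<in> level z d Y (Suc j) (j * d + (e + (i - j * d)))"
      by (rule level_generator)
    moreover have "j * d + (e + (i - j * d)) = e + i" using 2(2) by simp
    ultimately have "smul a (smul (z ^ j) y) \<in> level z d Y (Suc j) (e + i)"
      by (simp only: smul_commute[of a])
    moreover have "smul a w \<in> level z d Y (Suc j) (e + i)"
      using Suc.IH[OF 2(1)] level_mono_Suc by blast
    ultimately show ?thesis
      unfolding 2(4) smul_add by (intro UU.subspace_add[OF subspace_level])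
  qed
qed simp

lemma level_mult:
  assumes "F \<in> level z d Y j i"
  shows "smul z F \<in> level z d Y (Suc j) (d + i)"
  using assms
proof (induction j arbitrary: F)
  case (0 F)
  then show ?case using UU.subspace_0[OF subspace_level, of "Suc 0" "d + i"] by simp
next
  case (Suc j)
  from Suc.prems show ?case
  proof (cases rule: level_Suc_cases)
    case 1
    then show ?thesis using Suc.IH[OF 1] level_mono_Suc[of "Suc j" "d + i"] by blast
  next
    case (2 w y)
    have "smul (z ^ Suc j) y \<in> level z d Y (Suc (Suc j)) (Suc j * d + (i - j * d))"
      by (rule level_generator[OF 2(3)])
    moreover have "Suc j * d + (i - j * d) = d + i" using 2(2) by simp
    ultimately have "smul z (smul (z ^ j) y) \<in> level z d Y (Suc (Suc j)) (d + i)"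
      by (simp only: smul_smul power_Suc)
    moreover have "smul z w \<in> level z d Y (Suc (Suc j)) (d + i)"
      using Suc.IH[OF 2(1)] level_mono_Suc[of "Suc j" "d + i"] by blast
    ultimately show ?thesis
      unfolding 2(4) smul_add by (intro UU.subspace_add[OF subspace_level])
  qed
qed

lemma level_subset_generated: "level z d Y j i \<subseteq> generated z d Y i"
proof (cases "j \<le> Suc i")
  case False
  have "level z d Y (Suc i + k) i = level z d Y (Suc i) i" for k
  proof (induction k)
    case (Suc k)
    have "d \<ge> 1" using z by (simp add: grade_op_def)
    then have "(Suc i + k) * 1 \<le> (Suc i + k) * d" by (rule mult_le_mono2)
    then have "\<not> (Suc i + k) * d \<le> i" by auto
    then show ?case using Suc by (simp del: mult_Suc)
  qed simp
  from this[of "j - Suc i"] False show ?thesis by (simp add: generated_def)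
next
  case True
  then show ?thesis unfolding generated_def by (rule level_mono)
qed

lemma stable_under_generated: "stable_under ((z, d) # zs) (generated z d Y)"
proof (rule stable_underI)
  fix a e i F assume a: "(a, e) \<in> set ((z, d) # zs)" and F: "F \<in> generated z d Y i"
  show "smul a F \<in> generated z d Y (e + i)"
  proof (cases "(a, e) = (z, d)")
    case True
    have "smul z F \<in> level z d Y (Suc (Suc i)) (d + i)"
      using F unfolding generated_def by (rule level_mult)
    then show ?thesis using True level_subset_generated by blast
  next
    case False
    then have "smul a F \<in> level z d Y (Suc i) (e + i)"
      using a F unfolding generated_def by (intro level_stable) auto
    then show ?thesis using level_subset_generated by blast
  qed
qed (auto simp: generated_def intro: subspace_level simp del: level.simps dest: subsetD[OF level_in_graded_free])

lemma subset_generated: "Y \<le> generated z d Y"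
  unfolding le_fun_def
proof
  fix i
  show "Y i \<le> generated z d Y i"
  proof
    fix y assume "y \<in> Y i"
    then have "smul (z ^ 0) y \<in> level z d Y (Suc 0) (0 * d + i)" by (rule level_generator)
    then have "y \<in> level z d Y (Suc 0) i" by (simp only: power_0 smul_one mult_0 add_0)
    then show "y \<in> generated z d Y i" by (rule subsetD[OF level_subset_generated])
  qed
qed

text \<open>Leading coefficients with respect to \<open>z\<close>, as in the proof of the Hilbert basis theorem.\<close>

definition lead :: "(nat \<Rightarrow> 'k pvec set) \<Rightarrow> nat \<Rightarrow> nat \<Rightarrow> 'k pvec set" where
  "lead X j i = {y \<in> Y i. \<exists>w\<in>level z d Y j (j * d + i). smul (z ^ j) y + w \<in> X (j * d + i)}"

lemma stable_under_lead:
  assumes X: "stable_under ((z, d) # zs) X"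
  shows "stable_under zs (lead X j)"
proof (rule stable_underI)
  fix i
  let ?n = "j * d + i"
  show "UU.subspace (lead X j i)"
  proof (rule subspaceI)
    show "0 \<in> lead X j i"
      using stable_underD(5)[OF Y] stable_underD(5)[OF X] UU.subspace_0[OF subspace_level]
      by (auto simp: lead_def intro!: bexI[of _ 0])
  next
    fix F G assume "F \<in> lead X j i" "G \<in> lead X j i"
    then obtain v w where vw: "F \<in> Y i" "G \<in> Y i" "v \<in> level z d Y j ?n" "w \<in> level z d Y j ?n"
      "smul (z ^ j) F + v \<in> X ?n" "smul (z ^ j) G + w \<in> X ?n" by (auto simp: lead_def)
    have "smul (z ^ j) (F + G) + (v + w) = (smul (z ^ j) F + v) + (smul (z ^ j) G + w)"
      by (simp add: smul_add ac_simps)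
    also have "\<dots> \<in> X ?n" by (rule stable_underD(6)[OF X vw(5,6)])
    finally show "F + G \<in> lead X j i"
      using stable_underD(6)[OF Y vw(1,2)] UU.subspace_add[OF subspace_level vw(3,4)]
      unfolding lead_def by blast
  next
    fix c F assume "F \<in> lead X j i"
    then obtain v where v: "F \<in> Y i" "v \<in> level z d Y j ?n" "smul (z ^ j) F + v \<in> X ?n"
      by (auto simp: lead_def)
    have "smul (z ^ j) (scl c F) + scl c v = scl c (smul (z ^ j) F + v)"
      by (simp add: scl_def smul_add smul_commute)
    also have "\<dots> \<in> X ?n" by (rule UU.subspace_scale[OF stable_underD(3)[OF X] v(3)])
    finally show "scl c F \<in> lead X j i"
      using UU.subspace_scale[OF stable_underD(3)[OF Y] v(1)] UU.subspace_scale[OF subspace_level v(2)]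
      unfolding lead_def by blast
  qed
  show "lead X j i \<subseteq> graded_free m K i"
    using stable_underD(8)[OF Y] by (auto simp: lead_def)
next
  fix a e i F assume a: "(a, e) \<in> set zs" and F: "F \<in> lead X j i"
  obtain w where w: "F \<in> Y i" "w \<in> level z d Y j (j * d + i)" "smul (z ^ j) F + w \<in> X (j * d + i)"
    using F by (auto simp: lead_def)
  have "smul a (smul (z ^ j) F + w) \<in> X (e + (j * d + i))"
    by (rule stable_underD(2)[OF X _ w(3)]) (use a in simp)
  then have "smul (z ^ j) (smul a F) + smul a w \<in> X (j * d + (e + i))"
    by (simp add: smul_add smul_commute[of a] ac_simps)
  moreover have "smul a w \<in> level z d Y j (j * d + (e + i))"
    using level_stable[OF a w(2)] by (simp add: ac_simps)
  ultimately show "smul a F \<in> lead X j (e + i)"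
    using stable_underD(2)[OF Y a w(1)] by (auto simp: lead_def)
qed

lemma lead_mono: "X \<le> X' \<Longrightarrow> lead X j \<le> lead X' j"
  unfolding lead_def le_fun_def by blast

lemma lead_Suc:
  assumes X: "stable_under ((z, d) # zs) X"
  shows "lead X j \<le> lead X (Suc j)"
  unfolding le_fun_def
proof (intro allI subsetI)
  fix i F assume "F \<in> lead X j i"
  then obtain w where w: "F \<in> Y i" "w \<in> level z d Y j (j * d + i)" "smul (z ^ j) F + w \<in> X (j * d + i)"
    by (auto simp: lead_def)
  have "smul z (smul (z ^ j) F + w) \<in> X (d + (j * d + i))"
    by (rule stable_underD(2)[OF X _ w(3)]) simp
  then have "smul (z ^ Suc j) F + smul z w \<in> X (Suc j * d + i)"
    by (simp add: smul_add smul_smul ac_simps)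
  moreover have "smul z w \<in> level z d Y (Suc j) (Suc j * d + i)"
    using level_mult[OF w(2)] by (simp only: mult_Suc add.assoc)
  ultimately show "F \<in> lead X (Suc j) i" using w(1) unfolding lead_def by blast
qed

lemma eq_of_lead_eq:
  assumes X: "stable_under ((z, d) # zs) X" and X': "stable_under ((z, d) # zs) X'"
    and le: "X \<le> X'" "X' \<le> generated z d Y" and eq: "\<And>j. lead X' j = lead X j"
  shows "X' = X"
proof -
  have *: "F \<in> X i" if "F \<in> X' i" "F \<in> level z d Y j i" for F i j
    using that
  proof (induction j arbitrary: F)
    case 0
    then show ?case using stable_underD(5)[OF X] by simp
  next
    case (Suc j)
    from Suc.prems(2) show ?case
    proof (cases rule: level_Suc_cases)
      case 1
      then show ?thesis using Suc by blast
    next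
      case (2 w y)
      have n: "j * d + (i - j * d) = i" using 2(2) by simp
      have "y \<in> lead X' j (i - j * d)"
        unfolding lead_def n using 2 Suc.prems(1) by (auto simp: add.commute intro!: bexI[of _ w])
      then have "y \<in> lead X j (i - j * d)" by (simp add: eq)
      then obtain w' where w': "w' \<in> level z d Y j i" "smul (z ^ j) y + w' \<in> X i"
        by (auto simp: lead_def n)
      have d: "w - w' = F - (smul (z ^ j) y + w')" using 2(4) by simp
      have "w - w' \<in> X' i"
        unfolding d using le(1) w'(2) by (intro stable_underD(7)[OF X' Suc.prems(1)]) (auto simp: le_fun_def)
      moreover have "w - w' \<in> level z d Y j i" by (rule UU.subspace_diff[OF subspace_level 2(1) w'(1)])
      ultimately have "w - w' \<in> X i" by (rule Suc.IH)
      then have "(w - w') + (smul (z ^ j) y + w') \<in> X i" by (rule stable_underD(6)[OF X _ w'(2)])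
      then show ?thesis using 2(4) by (simp add: add.commute)
    qed
  qed
  have "X' i \<subseteq> X i" for i
    using le(2) *[of _ i "Suc i"] by (auto simp: le_fun_def generated_def simp del: level.simps)
  then show ?thesis using le(1) by (intro antisym) (auto simp: le_fun_def)
qed

theorem noetherian_generated:
  assumes noeth: "noetherian zs (\<lambda>_. {0}) Y"
  shows "noetherian ((z, d) # zs) (\<lambda>_. {0}) (generated z d Y)"
proof (rule noetherianI)
  fix f assume f: "\<And>k. stable_under ((z, d) # zs) (f k)" "\<And>k. f k \<le> generated z d Y" "\<And>k. f k \<le> f (Suc k)"
  define g where "g k j = lead (f k) j" for k j
  have st: "stable_under zs (g k j)" for k j unfolding g_def by (rule stable_under_lead[OF f(1)])
  have lo: "(\<lambda>_. {0}) \<le> g k j" for k j using stable_underD(5)[OF st] by (simp add: le_fun_def)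
  have hi: "g k j \<le> Y" for k j by (auto simp: g_def lead_def le_fun_def)
  have k1: "g k j \<le> g (Suc k) j" for k j unfolding g_def by (rule lead_mono[OF f(3)])
  have j1: "g k j \<le> g k (Suc j)" for k j unfolding g_def by (rule lead_Suc[OF f(1)])
  have km: "g k j \<le> g k' j" if "k \<le> k'" for k k' j using that by (rule lift_Suc_mono_le[of "\<lambda>k. g k j", OF k1])
  have jm: "g k j \<le> g k j'" if "j \<le> j'" for k j j' using that by (rule lift_Suc_mono_le[of "g k", OF j1])
  have fm: "f k \<le> f k'" if "k \<le> k'" for k k' using that by (rule lift_Suc_mono_le[of f, OF f(3)])
  obtain N0 where N0: "\<And>k. k \<ge> N0 \<Longrightarrow> g k k = g N0 N0"
    by (rule noetherianD[OF noeth, of "\<lambda>k. g k k"]) (use st lo hi order.trans[OF k1 j1] in auto)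
  have "\<exists>N. \<forall>k\<ge>N. g k j = g N j" for j
  proof -
    obtain N where "\<And>k. k \<ge> N \<Longrightarrow> g k j = g N j"
      by (rule noetherianD[OF noeth, of "\<lambda>k. g k j"]) (use st lo hi k1 in auto)
    then show ?thesis by blast
  qed
  then obtain Nj where Nj: "\<And>j k. k \<ge> Nj j \<Longrightarrow> g k j = g (Nj j) j" by metis
  define N where "N = Max (insert N0 (Nj ` {..<N0}))"
  have N: "N0 \<le> N" "\<And>j. j < N0 \<Longrightarrow> Nj j \<le> N" by (auto simp: N_def)
  have stab: "g k j = g N j" if k: "k \<ge> N" for k j
  proof (cases "j < N0")
    case True
    then show ?thesis using Nj[of j k] Nj[of j N] N(2)[OF True] k by simp
  next
    case False
    have "g k j = g N0 N0" if "k \<ge> N0" for k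
    proof (rule antisym)
      have "g k j \<le> g (max k j) (max k j)" using km[of k "max k j" j] jm[of j "max k j" "max k j"] by simp
      then show "g k j \<le> g N0 N0" using N0[of "max k j"] that by simp
      show "g N0 N0 \<le> g k j" using km[OF that, of N0] jm[of N0 j k] False by simp
    qed
    from this[of k] this[of N] show ?thesis using N(1) k by simp
  qed
  have "f k = f N" if "k \<ge> N" for k
    by (rule eq_of_lead_eq[OF f(1) f(1) fm[OF that] f(2)]) (use stab[OF that] in \<open>simp add: g_def\<close>)
  then show "\<exists>N. \<forall>k\<ge>N. f k = f N" by blast
qed

end

lemma noetherian_finite:
  fixes Y :: "nat \<Rightarrow> 'k::field pvec set"
  assumes Y: "gfam m K Y" "\<And>i. i \<ge> D \<Longrightarrow> Y i = {0}"
  shows "noetherian [] (\<lambda>_. {0}) Y"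
proof (rule noetherianI)
  fix f :: "nat \<Rightarrow> nat \<Rightarrow> 'k pvec set"
  assume f: "\<And>k. stable_under [] (f k)" "\<And>k. f k \<le> Y" "\<And>k. f k \<le> f (Suc k)"
  have fm: "f k \<le> f k'" if "k \<le> k'" for k k' using that by (rule lift_Suc_mono_le[of f, OF f(3)])
  define s where "s k = (\<Sum>i<D. UU.dim (f k i))" for k
  have le: "UU.dim (f k i) \<le> UU.dim (f k' i)" if "k \<le> k'" for k k' i
    using fm[OF that] by (intro UU.dim_subset_fin[OF stable_underD(4)[OF f(1)]]) (auto simp: le_fun_def)
  have "s k \<le> (\<Sum>i<D. UU.dim (Y i))" for k
    unfolding s_def using f(2)
    by (intro sum_mono UU.dim_subset_fin[OF gfamD(3)[OF Y(1)]]) (auto simp: le_fun_def)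
  then have "range s \<subseteq> {..(\<Sum>i<D. UU.dim (Y i))}" by (intro image_subsetI) simp
  then have fin: "finite (range s)" by (rule finite_subset) simp
  then have "Max (range s) \<in> range s" by (rule Max_in) simp
  then obtain N where N: "s N = Max (range s)" by (elim imageE) simp
  have "f k = f N" if k: "k \<ge> N" for k
  proof
    fix i
    show "f k i = f N i"
    proof (cases "i < D")
      case True
      have "s k \<le> s N" unfolding N by (rule Max_ge[OF fin]) simp
      moreover have s: "s k = UU.dim (f k i) + (\<Sum>i\<in>{..<D} - {i}. UU.dim (f k i))" for k
        unfolding s_def using True by (intro sum.remove) auto
      moreover have "(\<Sum>i\<in>{..<D} - {i}. UU.dim (f N i)) \<le> (\<Sum>i\<in>{..<D} - {i}. UU.dim (f k i))"
        by (intro sum_mono le k)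
      ultimately have "UU.dim (f k i) \<le> UU.dim (f N i)"
        unfolding s[of k] s[of N] by linarith
      then have "f N i = f k i"
        using fm[OF k]
        by (intro UU.subspace_eq_of_dim[OF stable_underD(3)[OF f(1)] stable_underD(3)[OF f(1)] _
              stable_underD(4)[OF f(1)]]) (simp_all add: le_fun_def)
      then show ?thesis ..
    next
      case False
      have "f k i = {0}" for k
        using f(2)[of k] Y(2)[of i] False stable_underD(5)[OF f(1)[of k], of i] by (auto simp: le_fun_def)
      then show ?thesis by simp
    qed
  qed
  then show "\<exists>N. \<forall>k\<ge>N. f k = f N" by blast
qed

primrec generated_by :: "((nat, 'k::field) mpoly \<times> nat) list \<Rightarrow> (nat \<Rightarrow> 'k pvec set) \<Rightarrow> nat \<Rightarrow> 'k pvec set" where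
  "generated_by [] Y = Y"
| "generated_by (zd # zs) Y = generated (fst zd) (snd zd) (generated_by zs Y)"

lemma generated_by_props:
  assumes "\<And>zd. zd \<in> set zs \<Longrightarrow> grade_op zd" "gfam m K Y"
  shows "stable_under zs (generated_by zs Y)" "Y \<le> generated_by zs Y"
    "noetherian [] (\<lambda>_. {0}) Y \<Longrightarrow> noetherian zs (\<lambda>_. {0}) (generated_by zs Y)"
proof -
  have "stable_under zs (generated_by zs Y) \<and> Y \<le> generated_by zs Y \<and>
    (noetherian [] (\<lambda>_. {0}) Y \<longrightarrow> noetherian zs (\<lambda>_. {0}) (generated_by zs Y))"
    using assms(1)
  proof (induction zs)
    case Nil
    then show ?case using assms(2) by (simp add: stable_under_def)
  next
    case (Cons zd zs)
    obtain z d where zd: "zd = (z, d)" by (cases zd)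
    have op: "grade_op (z, d)" using Cons.prems zd by simp
    have IH: "stable_under zs (generated_by zs Y)" "Y \<le> generated_by zs Y"
      "noetherian [] (\<lambda>_. {0}) Y \<Longrightarrow> noetherian zs (\<lambda>_. {0}) (generated_by zs Y)"
      using Cons by auto
    show ?case
      using stable_under_generated[OF op IH(1)] order.trans[OF IH(2) subset_generated[OF op IH(1)]]
        noetherian_generated[OF op IH(1)] IH(3) by (simp add: zd)
  qed
  then show "stable_under zs (generated_by zs Y)" "Y \<le> generated_by zs Y"
    "noetherian [] (\<lambda>_. {0}) Y \<Longrightarrow> noetherian zs (\<lambda>_. {0}) (generated_by zs Y)" by auto
qed

lemma smul_generated_by:
  assumes zs: "\<And>zd. zd \<in> set zs \<Longrightarrow> grade_op zd" and Y: "gfam m K Y"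
    and T: "\<And>i. UU.subspace (T i)" "\<And>z d i F. (z, d) \<in> set zs \<Longrightarrow> F \<in> T i \<Longrightarrow> smul z F \<in> T (d + i)"
    and a: "\<And>i F. F \<in> Y i \<Longrightarrow> smul a F \<in> T (e + i)" and F: "F \<in> generated_by zs Y i"
  shows "smul a F \<in> T (e + i)"
  using zs T(2) F
proof (induction zs arbitrary: i F)
  case Nil
  then show ?case using a by simp
next
  case (Cons zd zs)
  obtain z d where zd: "zd = (z, d)" by (cases zd)
  have op: "grade_op (z, d)" using Cons.prems zd by simp
  have st: "stable_under zs (generated_by zs Y)"
    by (rule generated_by_props(1)[OF _ Y]) (use Cons.prems in auto)
  show ?case
  proof (rule smul_level[OF op st T(1)])
    show "F \<in> level z d (generated_by zs Y) (Suc i) i"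
      using Cons.prems(3) by (simp add: zd generated_def del: level.simps)
    show "smul z F \<in> T (d + i)" if "F \<in> T i" for i F
      using Cons.prems(2)[of z d F i] that zd by simp
    show "smul a F \<in> T (e + i)" if "F \<in> generated_by zs Y i" for i F
      by (rule Cons.IH) (use Cons.prems that in auto)
  qed
qed

lemma generated_by_eq_graded_free:
  fixes Y :: "nat \<Rightarrow> 'k::field pvec set"
  assumes zs: "\<And>zd. zd \<in> set zs \<Longrightarrow> grade_op zd" and Y: "gfam m K Y"
    and u: "\<And>j. j < m \<Longrightarrow> uvec j \<in> Y 0"
    and X: "\<And>b i F. b < K \<Longrightarrow> F \<in> Y i \<Longrightarrow> smul (Var b) F \<in> generated_by zs Y (Suc i)"
  shows "generated_by zs Y = graded_free m K"
proof
  fix i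
  let ?T = "generated_by zs Y"
  have st: "stable_under zs ?T" by (rule generated_by_props(1)[OF zs Y])
  have mul: "smul (Var b) F \<in> ?T (Suc i)" if b: "b < K" and F: "F \<in> ?T i" for b F i
    using smul_generated_by[of zs Y ?T "Var b" "Suc 0" F i, OF zs Y stable_underD(3)[OF st] stable_underD(2)[OF st]]
      X b F by simp
  have mon: "smul (Poly_Mapping.single e 1) (uvec j) \<in> ?T (monom_degree e)"
    if "Poly_Mapping.keys e \<subseteq> {..<K}" "j < m" for e j
    using that(1)
  proof (induction "monom_degree e" arbitrary: e)
    case 0
    have "Poly_Mapping.lookup e v = 0" for v
      using 0(1) by (cases "v \<in> Poly_Mapping.keys e") (simp_all add: monom_degree_def in_keys_iff)
    then have "e = 0" by (intro poly_mapping_eqI) simp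
    moreover have "uvec j \<in> ?T 0"
      using u[OF that(2)] generated_by_props(2)[OF zs Y] by (auto simp: le_fun_def)
    ultimately show ?case by (simp add: single_one)
  next
    case (Suc n)
    then have "e \<noteq> 0" by auto
    then obtain b where b: "b \<in> Poly_Mapping.keys e" by (metis all_not_in_conv keys_eq_empty)
    define e' where "e' = e - Poly_Mapping.single b (Suc 0)"
    have e: "e = Poly_Mapping.single b (Suc 0) + e'"
      by (rule poly_mapping_eqI)
         (use b in \<open>auto simp: e'_def lookup_add lookup_minus lookup_single when_def in_keys_iff\<close>)
    have deg: "monom_degree e = Suc (monom_degree e')"
      by (subst e) (simp add: monom_degree_add, simp add: monom_degree_def)
    have "Poly_Mapping.keys e' \<subseteq> {..<K}"
      using Suc.prems by (auto simp: e'_def in_keys_iff lookup_minus subset_iff)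
    then have "smul (Poly_Mapping.single e' 1) (uvec j) \<in> ?T (monom_degree e')"
      by (intro Suc.hyps(1)) (use Suc.hyps(2) deg in simp_all)
    then have "smul (Var b) (smul (Poly_Mapping.single e' 1) (uvec j)) \<in> ?T (Suc (monom_degree e'))"
      using b Suc.prems by (intro mul) auto
    moreover have "Var b * Poly_Mapping.single e' 1 = Poly_Mapping.single e (1::'k)"
      by (simp add: mult_single e[symmetric])
    ultimately show ?case by (simp add: smul_smul deg)
  qed
  have "F \<in> ?T i" if F: "F \<in> graded_free m K i" for F
  proof -
    have "F = (\<Sum>j<m. smul (F j) (uvec j))"
    proof (rule ext)
      fix l
      have "(\<Sum>j<m. smul (F j) (uvec j)) l = (\<Sum>j<m. if j = l then F l else 0)"
        unfolding sum_apply by (intro sum.cong refl) (auto simp: uvec_def pv)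
      also have "\<dots> = F l" using F by (auto simp: graded_free_def)
      finally show "F l = (\<Sum>j<m. smul (F j) (uvec j)) l" ..
    qed
    moreover have "smul (F j) (uvec j) \<in> ?T i" if j: "j < m" for j
    proof -
      have "smul (F j) (uvec j) = (\<Sum>e\<in>Poly_Mapping.keys (F j).
          scl (Poly_Mapping.lookup (F j) e) (smul (Poly_Mapping.single e 1) (uvec j)))"
        unfolding scl_def smul_smul smul_sum_left[symmetric] single_eq_Const_times[symmetric]
          mpoly_eq_sum_single[symmetric] ..
      also have "\<dots> \<in> ?T i"
      proof (rule UU.subspace_sum[OF stable_underD(3)[OF st, of i]], rule UU.subspace_scale[OF stable_underD(3)[OF st, of i]])
        fix e assume "e \<in> Poly_Mapping.keys (F j)"
        then have "Poly_Mapping.keys e \<subseteq> {..<K}" "monom_degree e = i"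
          using F by (auto simp: graded_free_def polys_over_def homog_def)
        then show "smul (Poly_Mapping.single e 1) (uvec j) \<in> ?T i" using mon[OF _ j, of e] by simp
      qed
      finally show ?thesis .
    qed
    ultimately show ?thesis
      using UU.subspace_sum[OF stable_underD(3)[OF st, of i], of "{..<m}" "\<lambda>j. smul (F j) (uvec j)"] by simp
  qed
  then show "?T i = graded_free m K i" using stable_underD(8)[OF st] by blast
qed

lemma hilb_zero: "hilb (\<lambda>_. {0}) = 0"
  by (rule fps_ext) simp

text \<open>If the operators \<open>zs\<close> generate everything from finitely many degrees, then every family
  stable under them has a rational Hilbert series.\<close>

theorem hilbert_series_rational:
  fixes Y :: "nat \<Rightarrow> 'k::field pvec set"
  assumes zs: "\<And>zd. zd \<in> set zs \<Longrightarrow> grade_op zd" and Y: "gfam m K Y" "\<And>i. i \<ge> D \<Longrightarrow> Y i = {0}"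
    and u: "\<And>j. j < m \<Longrightarrow> uvec j \<in> Y 0"
    and X: "\<And>b i F. b < K \<Longrightarrow> F \<in> Y i \<Longrightarrow> smul (Var b) F \<in> generated_by zs Y (Suc i)"
    and N: "stable_under zs N"
  shows "\<exists>Q :: int poly. prod_list (map (\<lambda>(z, d). 1 - fps_X ^ d) zs) * hilb N = fps_of_poly Q"
proof -
  have eq: "generated_by zs Y = graded_free m K" by (rule generated_by_eq_graded_free[of zs Y, OF zs Y(1) u X])
  have "noetherian zs (\<lambda>_. {0}) (graded_free m K :: nat \<Rightarrow> 'k pvec set)"
    using generated_by_props(3)[of zs Y, OF zs Y(1) noetherian_finite[of Y D, OF Y]] eq by simp
  moreover have "N \<le> graded_free m K" using stable_underD(8)[OF N] by (simp add: le_fun_def)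
  ultimately have "noetherian zs (\<lambda>_. {0}) N"
    unfolding noetherian_def by (meson order.trans)
  moreover have "stable_under zs (\<lambda>_. {0} :: 'k pvec set)"
    using UU.subspace_0[OF subspace_graded_free] by (intro stable_underI) auto
  moreover have "(\<lambda>_. {0}) \<le> N" using stable_underD(5)[OF N] by (simp add: le_fun_def)
  ultimately show ?thesis
    using hilbert_serre[of zs "\<lambda>_. {0}" N] N zs by (simp add: hilb_zero)
qed

end


section \<open>Determinants of tuples of vectors\<close>

definition tmat :: "nat \<Rightarrow> (nat \<Rightarrow> 'k::field pvec) \<Rightarrow> (nat, 'k) mpoly mat" where
  "tmat m F = mat m m (\<lambda>(i, j). F i j)"

definition dt :: "nat \<Rightarrow> (nat \<Rightarrow> 'k::field pvec) \<Rightarrow> (nat, 'k) mpoly" where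
  "dt m F = det (tmat m F)"

text \<open>Up to the factor \<open>dt m F\<close>, the coordinate functions with respect to the tuple \<open>F\<close>.\<close>

definition num :: "nat \<Rightarrow> (nat \<Rightarrow> 'k::field pvec) \<Rightarrow> nat \<Rightarrow> 'k pvec \<Rightarrow> (nat, 'k) mpoly" where
  "num m F k v = (\<Sum>j<m. v j * cofactor (tmat m F) k j)"

lemma tmat_carrier [simp]: "tmat m F \<in> carrier_mat m m"
  by (simp add: tmat_def)

lemma tmat_index [simp]: "i < m \<Longrightarrow> j < m \<Longrightarrow> tmat m F $$ (i, j) = F i j"
  by (simp add: tmat_def)

lemma num_add: "num m F k (v + w) = num m F k v + num m F k w"
  by (simp add: num_def distrib_right sum.distrib pv)

lemma num_smul: "num m F k (smul a v) = a * num m F k v"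
  by (simp add: num_def sum_distrib_left mult.assoc pv)

lemma num_zero [simp]: "num m F k 0 = 0"
  by (simp add: num_def pv)

lemma num_sum: "num m F k (\<Sum>x\<in>I. v x) = (\<Sum>x\<in>I. num m F k (v x))"
  by (induction I rule: infinite_finite_induct) (auto simp: num_add)

lemma dt_upd:
  assumes "k < m"
  shows "dt m (F(k := v)) = num m F k v"
proof -
  have "dt m (F(k := v)) = (\<Sum>j<m. tmat m (F(k := v)) $$ (k, j) * cofactor (tmat m (F(k := v))) k j)"
    unfolding dt_def by (rule laplace_expansion_row[OF tmat_carrier assms])
  also have "\<dots> = num m F k v"
    unfolding num_def
  proof (intro sum.cong refl)
    fix j assume j: "j \<in> {..<m}"
    have "mat_delete (tmat m (F(k := v))) k j = mat_delete (tmat m F) k j"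
      by (rule eq_matI) (auto simp: mat_delete_def tmat_def)
    then show "tmat m (F(k := v)) $$ (k, j) * cofactor (tmat m (F(k := v))) k j = v j * cofactor (tmat m F) k j"
      using assms j by (simp add: cofactor_def)
  qed
  finally show ?thesis .
qed

lemma num_self:
  assumes "k < m" "i < m"
  shows "num m F k (F i) = (if k = i then dt m F else 0)"
proof -
  let ?A = "tmat m F"
  have "num m F k (F i) = (?A * adj_mat ?A) $$ (i, k)"
    using assms by (simp add: num_def adj_mat_def scalar_prod_def carrier_matD[OF tmat_carrier] lessThan_atLeast0)
  also have "\<dots> = (det ?A \<cdot>\<^sub>m 1\<^sub>m m) $$ (i, k)" using adj_mat(2)[OF tmat_carrier[of m F]] by simp
  finally show ?thesis using assms by (simp add: dt_def)
qed

lemma cramer: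
  assumes "\<And>j. j \<ge> m \<Longrightarrow> v j = 0" "\<And>k j. k < m \<Longrightarrow> j \<ge> m \<Longrightarrow> F k j = 0"
  shows "smul (dt m F) v = (\<Sum>k<m. smul (num m F k v) (F k))"
proof (rule ext)
  fix j
  let ?A = "tmat m F"
  show "smul (dt m F) v j = (\<Sum>k<m. smul (num m F k v) (F k)) j"
  proof (cases "j < m")
    case True
    have "(\<Sum>k<m. num m F k v * F k j) = (\<Sum>k<m. \<Sum>i<m. v i * (cofactor ?A k i * F k j))"
      by (simp add: num_def sum_distrib_right mult.assoc)
    also have "\<dots> = (\<Sum>i<m. v i * (\<Sum>k<m. cofactor ?A k i * F k j))"
      by (subst sum.swap) (simp add: sum_distrib_left)
    also have "\<dots> = (\<Sum>i<m. v i * (adj_mat ?A * ?A) $$ (i, j))"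
      using True by (intro sum.cong refl)
        (simp add: adj_mat_def scalar_prod_def carrier_matD[OF tmat_carrier] lessThan_atLeast0)
    also have "\<dots> = (\<Sum>i<m. if i = j then v j * dt m F else 0)"
      unfolding adj_mat(3)[OF tmat_carrier[of m F]] using True by (intro sum.cong refl) (simp add: dt_def)
    also have "\<dots> = v j * dt m F" using True by simp
    finally show ?thesis by (simp add: sum_apply pv mult.commute)
  qed (use assms in \<open>simp add: sum_apply pv\<close>)
qed

lemma dt_cong: "(\<And>k j. k < m \<Longrightarrow> j < m \<Longrightarrow> F k j = G k j) \<Longrightarrow> dt m F = dt m G"
  unfolding dt_def by (rule arg_cong[where f = det]) (auto intro!: eq_matI simp: tmat_def)

lemma dt_leibniz: "dt m F = (\<Sum>p\<in>{p. p permutes {0..<m}}. signof p * (\<Prod>i = 0..<m. F i (p i)))"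
  unfolding dt_def det_def'[OF tmat_carrier]
proof (intro sum.cong refl arg_cong2[where f = "(*)"] prod.cong)
  fix p i assume p: "p \<in> {p. p permutes {0..<m}}" and i: "i \<in> {0..<m}"
  then have "p i \<in> {0..<m}" using permutes_in_image[of p "{0..<m}" i] by simp
  then show "tmat m F $$ (i, p i) = F i (p i)" using i by simp
qed

lemma subst_dt: "subst s (dt m F) = dt m (\<lambda>k. vsubst s (F k))"
proof -
  have "subst s (signof p * f) = signof p * subst s f" for p :: "nat \<Rightarrow> nat" and f :: "(nat, 'a) mpoly"
    by (cases "sign p = 1") (auto simp: sign_def Cst.evalp_uminus)
  then show ?thesis
    unfolding dt_leibniz Cst.evalp_sum by (simp add: Cst.evalp_prod pv)
qed

lemma homog_signof: "homog d f \<Longrightarrow> homog d (signof p * f)" for f :: "(nat, 'k::field) mpoly"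
  by (auto simp: sign_def homog_uminus)

lemma homog_dt:
  assumes "\<And>k j. k < m \<Longrightarrow> homog (d k) (F k j)"
  shows "homog (\<Sum>k = 0..<m. d k) (dt m F)"
  unfolding dt_leibniz by (intro homog_sum homog_signof homog_prod assms) simp

lemma polys_over_dt:
  assumes "\<And>k j. k < m \<Longrightarrow> F k j \<in> polys_over X"
  shows "dt m F \<in> polys_over X"
proof -
  have "signof p * f \<in> polys_over X" if "f \<in> polys_over X" for p and f :: "(nat, 'a) mpoly"
    using that by (auto simp: sign_def polys_over_uminus)
  note this[intro]
  show ?thesis
    unfolding dt_leibniz by (intro polys_over_sum) (auto intro!: polys_over_prod assms)
qed

lemma dt_uvec: "dt m (\<lambda>k. smul c (uvec k)) = c ^ m"
proof -
  have "tmat m (\<lambda>k. smul c (uvec k)) = c \<cdot>\<^sub>m 1\<^sub>m m"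
    by (rule eq_matI) (auto simp: tmat_def uvec_def pv)
  then show ?thesis by (simp add: dt_def)
qed

text \<open>By multilinearity, if the determinant of a tuple of linear combinations avoids an ideal \<open>(p)\<close>, then so
  does the determinant of some tuple of the vectors that are combined.\<close>

lemma multilinear_choice:
  assumes "\<not> p dvd dt m F" "\<And>k. k < m \<Longrightarrow> F k = (\<Sum>s\<in>J. smul (a k s) (G k s))"
  obtains s where "\<And>k. k < m \<Longrightarrow> s k \<in> J" "\<not> p dvd dt m (\<lambda>k. G k (s k))"
proof -
  have "\<exists>s. (\<forall>k<r. s k \<in> J) \<and> \<not> p dvd dt m (\<lambda>k. if k < r then G k (s k) else F k)" if "r \<le> m" for r
    using that
  proof (induction r)
    case 0
    then show ?case using assms(1) by simp
  next
    case (Suc r)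
    then obtain s where s: "\<forall>k<r. s k \<in> J" "\<not> p dvd dt m (\<lambda>k. if k < r then G k (s k) else F k)" by auto
    let ?H = "\<lambda>k. if k < r then G k (s k) else F k"
    have r: "r < m" using Suc.prems by simp
    have "dt m ?H = dt m (?H(r := F r))" by (rule dt_cong) auto
    also have "\<dots> = (\<Sum>x\<in>J. a r x * num m ?H r (G r x))"
      unfolding dt_upd[OF r] assms(2)[OF r] num_sum num_smul ..
    finally have "\<exists>x\<in>J. \<not> p dvd a r x * num m ?H r (G r x)"
      using s(2) by (metis (no_types, lifting) dvd_sum)
    then obtain x where x: "x \<in> J" "\<not> p dvd a r x * num m ?H r (G r x)" by blast
    from x(2) have x2: "\<not> p dvd num m ?H r (G r x)" using dvd_mult by blast
    have "num m ?H r (G r x) = dt m (?H(r := G r x))" by (rule dt_upd[OF r, symmetric])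
    also have "\<dots> = dt m (\<lambda>k. if k < Suc r then G k ((s(r := x)) k) else F k)"
      by (rule dt_cong) (auto simp: less_Suc_eq)
    finally show ?case using x(1) x2 s(1) by (intro exI[of _ "s(r := x)"]) (auto simp: less_Suc_eq)
  qed
  from this[of m] obtain s where s: "\<forall>k<m. s k \<in> J" "\<not> p dvd dt m (\<lambda>k. if k < m then G k (s k) else F k)" by auto
  moreover have "dt m (\<lambda>k. if k < m then G k (s k) else F k) = dt m (\<lambda>k. G k (s k))" by (rule dt_cong) auto
  ultimately show ?thesis using that by auto
qed

section \<open>Linear group actions and covariants in coordinates\<close>

definition gvar :: "nat \<Rightarrow> ('g \<Rightarrow> nat \<Rightarrow> nat \<Rightarrow> 'k::field) \<Rightarrow> 'g \<Rightarrow> nat \<Rightarrow> (nat, 'k) mpoly" where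
  "gvar n lin g v = (if v < n then linear_form {..<n} (lin g v) else Var v)"

locale lin_action = group \<Gamma> for \<Gamma> :: "('g, 'x) monoid_scheme" (structure) +
  fixes n m :: nat and lin rho :: "'g \<Rightarrow> nat \<Rightarrow> nat \<Rightarrow> 'k::field"
  assumes fin: "finite (carrier \<Gamma>)"
    and gvar_mult: "\<And>g h v. g \<in> carrier \<Gamma> \<Longrightarrow> h \<in> carrier \<Gamma> \<Longrightarrow> v < n \<Longrightarrow>
      subst (gvar n lin g) (gvar n lin h v) = gvar n lin (g \<otimes> h) v"
    and gvar_one: "\<And>v. v < n \<Longrightarrow> gvar n lin \<one> v = Var v"
    and faithful: "\<And>g. g \<in> carrier \<Gamma> \<Longrightarrow> (\<And>v. v < n \<Longrightarrow> gvar n lin g v = Var v) \<Longrightarrow> g = \<one>"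
    and rho_mult: "\<And>g h i j. g \<in> carrier \<Gamma> \<Longrightarrow> h \<in> carrier \<Gamma> \<Longrightarrow> i < m \<Longrightarrow> j < m \<Longrightarrow>
      rho (g \<otimes> h) i j = (\<Sum>l<m. rho g i l * rho h l j)"
    and rho_one: "\<And>i j. i < m \<Longrightarrow> j < m \<Longrightarrow> rho \<one> i j = (if i = j then 1 else 0)"
begin

abbreviation X :: "'g \<Rightarrow> nat \<Rightarrow> (nat, 'k) mpoly" where "X \<equiv> gvar n lin"

definition act :: "'g \<Rightarrow> (nat, 'k) mpoly \<Rightarrow> (nat, 'k) mpoly" where
  "act g = subst (X g)"

lemma X_ge [simp]: "v \<ge> n \<Longrightarrow> X g v = Var v"
  by (simp add: gvar_def)

lemma X_over: "K \<ge> n \<Longrightarrow> v < K \<Longrightarrow> X g v \<in> polys_over {..<K}"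
  by (auto simp: gvar_def intro!: polys_over_linear_form polys_over_Var)

lemma homog_X: "homog (Suc 0) (X g v)"
  by (auto simp: gvar_def intro: homog_linear_form)

lemma act_simps:
  "act g (f + f') = act g f + act g f'" "act g (f * f') = act g f * act g f'" "act g (f - f') = act g f - act g f'"
  "act g 0 = 0" "act g 1 = 1" "act g (Const c) = Const c" "act g (Var v) = X g v" "act g (- f) = - act g f"
  "act g (f ^ i) = act g f ^ i"
  by (simp_all add: act_def Cst.evalp_add Cst.evalp_mult Cst.evalp_diff Cst.evalp_uminus Cst.evalp_power)

lemma act_sum: "act g (\<Sum>i\<in>I. f i) = (\<Sum>i\<in>I. act g (f i))"
  by (simp add: act_def Cst.evalp_sum)

lemma act_prod: "act g (\<Prod>i\<in>I. f i) = (\<Prod>i\<in>I. act g (f i))"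
  by (simp add: act_def Cst.evalp_prod)

lemma act_act: "g \<in> carrier \<Gamma> \<Longrightarrow> h \<in> carrier \<Gamma> \<Longrightarrow> act g (act h f) = act (g \<otimes> h) f"
  unfolding act_def subst_subst
proof (rule Cst.evalp_cong[of f UNIV])
  fix v assume "g \<in> carrier \<Gamma>" "h \<in> carrier \<Gamma>"
  then show "subst (X g) (X h v) = X (g \<otimes> h) v"
    by (cases "v < n") (simp_all add: gvar_mult)
qed simp

lemma act_one: "act \<one> f = f"
  unfolding act_def
proof (rule subst_id_on[of f UNIV])
  show "X \<one> v = Var v" for v by (cases "v < n") (simp_all add: gvar_one)
qed simp

lemma act_inv: "g \<in> carrier \<Gamma> \<Longrightarrow> act g (act (inv g) f) = f" "g \<in> carrier \<Gamma> \<Longrightarrow> act (inv g) (act g f) = f"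
  by (simp_all add: act_act act_one)

lemma act_over: "n \<le> K \<Longrightarrow> f \<in> polys_over {..<K} \<Longrightarrow> act g f \<in> polys_over {..<K}"
  unfolding act_def by (rule subst_polys_over) (auto intro: X_over)

lemma homog_act: "homog d f \<Longrightarrow> homog d (act g f)"
  unfolding act_def by (rule subst_homog[where X = UNIV]) (auto intro: homog_X)

definition T :: "'g \<Rightarrow> 'k pvec \<Rightarrow> 'k pvec" where
  "T g F = (\<lambda>i. if i < m then \<Sum>j<m. Const (rho g i j) * act g (F j) else 0)"

definition vecs :: "'k pvec set" where "vecs = {F. \<forall>j\<ge>m. F j = 0}"

definition cov :: "'k pvec set" where "cov = {F \<in> vecs. \<forall>g\<in>carrier \<Gamma>. T g F = F}"

lemma T_add: "T g (F + G) = T g F + T g G"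
  by (rule ext) (simp add: T_def pv act_simps algebra_simps sum.distrib)

lemma T_zero [simp]: "T g 0 = 0"
  by (rule ext) (simp add: T_def pv act_simps)

lemma T_sum: "T g (\<Sum>i\<in>I. F i) = (\<Sum>i\<in>I. T g (F i))"
  by (induction I rule: infinite_finite_induct) (auto simp: T_add)

lemma T_smul: "T g (smul a F) = smul (act g a) (T g F)"
  by (rule ext) (simp add: T_def pv act_simps sum_distrib_left ac_simps)

lemma T_T:
  assumes "g \<in> carrier \<Gamma>" "h \<in> carrier \<Gamma>"
  shows "T g (T h F) = T (g \<otimes> h) F"
proof (rule ext)
  fix i
  show "T g (T h F) i = T (g \<otimes> h) F i"
  proof (cases "i < m")
    case True
    have "T g (T h F) i = (\<Sum>j<m. \<Sum>l<m. Const (rho g i j) * (Const (rho h j l) * act g (act h (F l))))"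
      using True by (simp add: T_def act_sum act_simps sum_distrib_left)
    also have "\<dots> = (\<Sum>l<m. Const (\<Sum>j<m. rho g i j * rho h j l) * act (g \<otimes> h) (F l))"
      by (subst sum.swap) (simp add: Const_sum sum_distrib_right act_act[OF assms] Const_mult mult.assoc)
    also have "\<dots> = T (g \<otimes> h) F i"
      using True by (simp add: T_def rho_mult[OF assms])
    finally show ?thesis .
  qed (simp add: T_def)
qed

definition trivial :: "'g \<Rightarrow> bool" where
  "trivial g \<longleftrightarrow> (\<forall>i<m. \<forall>j<m. rho g i j = (if i = j then 1 else 0))"

lemma T_trivial: "trivial g \<Longrightarrow> F \<in> vecs \<Longrightarrow> T g F j = act g (F j)"
proof -
  assume g: "trivial g" and F: "F \<in> vecs"
  show "T g F j = act g (F j)"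
  proof (cases "j < m")
    case True
    have "T g F j = (\<Sum>l<m. Const (rho g j l) * act g (F l))" using True by (simp add: T_def)
    also have "\<dots> = (\<Sum>l<m. if l = j then act g (F j) else 0)"
      by (intro sum.cong refl) (use True g in \<open>auto simp: trivial_def single_one\<close>)
    also have "\<dots> = act g (F j)" using True by simp
    finally show ?thesis .
  qed (use F in \<open>simp add: T_def vecs_def act_simps\<close>)
qed

lemma trivial_one: "trivial \<one>"
  by (simp add: trivial_def rho_one)

lemma T_one: "F \<in> vecs \<Longrightarrow> T \<one> F = F"
  by (rule ext) (simp add: T_trivial[OF trivial_one] act_one)

lemma T_vecs [simp]: "T g F \<in> vecs"
  by (simp add: T_def vecs_def)

lemma T_graded: "n \<le> K \<Longrightarrow> F \<in> graded_free m K d \<Longrightarrow> T g F \<in> graded_free m K d"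
  by (auto simp: T_def graded_free_def intro!: polys_over_sum polys_over_mult homog_sum homog_Const_mult
      act_over homog_act)

lemma graded_free_vecs: "F \<in> graded_free m K d \<Longrightarrow> F \<in> vecs"
  by (simp add: graded_free_def vecs_def)

lemma vecs_closed: "0 \<in> vecs" "F \<in> vecs \<Longrightarrow> G \<in> vecs \<Longrightarrow> F + G \<in> vecs" "F \<in> vecs \<Longrightarrow> smul a F \<in> vecs"
  by (auto simp: vecs_def pv)

lemma vecs_sum: "(\<And>i. i \<in> I \<Longrightarrow> F i \<in> vecs) \<Longrightarrow> (\<Sum>i\<in>I. F i) \<in> vecs"
  by (induction I rule: infinite_finite_induct) (auto intro: vecs_closed)

lemma covD: "F \<in> cov \<Longrightarrow> F \<in> vecs" "F \<in> cov \<Longrightarrow> g \<in> carrier \<Gamma> \<Longrightarrow> T g F = F"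
  by (auto simp: cov_def)

lemma covI: "F \<in> vecs \<Longrightarrow> (\<And>g. g \<in> carrier \<Gamma> \<Longrightarrow> T g F = F) \<Longrightarrow> F \<in> cov"
  by (simp add: cov_def)

definition invariant :: "(nat, 'k) mpoly \<Rightarrow> bool" where
  "invariant a \<longleftrightarrow> (\<forall>g\<in>carrier \<Gamma>. act g a = a)"

lemma cov_smul: "invariant a \<Longrightarrow> F \<in> cov \<Longrightarrow> smul a F \<in> cov"
  by (auto simp: cov_def invariant_def T_smul vecs_closed)

lemma subspace_cov: "UU.subspace cov"
  by (rule subspaceI) (auto simp: cov_def vecs_closed T_add scl_def T_smul act_simps)

lemma carrier_mult_image: "g \<in> carrier \<Gamma> \<Longrightarrow> (\<lambda>h. g \<otimes> h) ` carrier \<Gamma> = carrier \<Gamma>"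
proof (intro equalityI subsetI)
  fix h assume g: "g \<in> carrier \<Gamma>" and h: "h \<in> carrier \<Gamma>"
  then have "h = g \<otimes> (inv g \<otimes> h)" by (simp add: m_assoc[symmetric])
  then show "h \<in> (\<lambda>h. g \<otimes> h) ` carrier \<Gamma>" using g h by (intro image_eqI[of _ _ "inv g \<otimes> h"]) auto
qed auto

lemma carrier_mult_inj: "g \<in> carrier \<Gamma> \<Longrightarrow> inj_on (\<lambda>h. g \<otimes> h) (carrier \<Gamma>)"
  by (auto intro: inj_onI)

definition Tr :: "'k pvec \<Rightarrow> 'k pvec" where "Tr F = (\<Sum>g\<in>carrier \<Gamma>. T g F)"

lemma Tr_cov: "Tr F \<in> cov"
proof (rule covI)
  fix g assume g: "g \<in> carrier \<Gamma>"
  have "T g (Tr F) = (\<Sum>h\<in>carrier \<Gamma>. T (g \<otimes> h) F)"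
    unfolding Tr_def T_sum by (intro sum.cong refl) (simp add: T_T g)
  also have "\<dots> = (\<Sum>h\<in>(\<lambda>h. g \<otimes> h) ` carrier \<Gamma>. T h F)"
    by (simp add: sum.reindex[OF carrier_mult_inj[OF g]])
  also have "\<dots> = Tr F" by (simp add: carrier_mult_image[OF g] Tr_def)
  finally show "T g (Tr F) = Tr F" .
qed (simp add: Tr_def vecs_sum)

lemma vsubst_T:
  assumes "\<And>v. v < n \<Longrightarrow> s v = Var v" "\<And>v. v \<ge> n \<Longrightarrow> act g (s v) = s v"
  shows "vsubst s (T g F) = T g (vsubst s F)"
proof -
  have *: "subst s (act g f) = act g (subst s f)" for f
    unfolding act_def subst_subst
  proof (rule Cst.evalp_cong[of f UNIV])
    fix v
    show "subst s (X g v) = subst (X g) (s v)"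
    proof (cases "v < n")
      case True
      have "subst s (X g v) = X g v"
        by (rule subst_id_on[OF X_over[OF order_refl True]]) (use assms(1) in auto)
      then show ?thesis using assms(1) True by simp
    qed (use assms(2)[of v] in \<open>simp add: act_def\<close>)
  qed simp
  show ?thesis
    by (rule ext) (simp add: T_def pv Cst.evalp_sum Cst.evalp_mult *)
qed

lemma vsubst_vecs: "F \<in> vecs \<Longrightarrow> vsubst s F \<in> vecs"
  by (simp add: vecs_def pv)

lemma vsubst_cov:
  assumes "F \<in> cov" "\<And>v. v < n \<Longrightarrow> s v = Var v" "\<And>v g. v \<ge> n \<Longrightarrow> act g (s v) = s v"
  shows "vsubst s F \<in> cov"
proof (rule covI)
  show "vsubst s F \<in> vecs" by (rule vsubst_vecs[OF covD(1)[OF assms(1)]])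
  show "T g (vsubst s F) = vsubst s F" if "g \<in> carrier \<Gamma>" for g
    using vsubst_T[of s g F] assms(2,3) covD(2)[OF assms(1) that] by simp
qed

end


section \<open>Tuples of covariants with large determinant\<close>

definition primal :: "'a::comm_semiring_1 \<Rightarrow> bool" where
  "primal p \<longleftrightarrow> \<not> p dvd 1 \<and> (\<forall>a b. p dvd a * b \<longrightarrow> p dvd a \<or> p dvd b)"

lemma primal_zero: "primal (0 :: 'a::idom)"
  by (auto simp: primal_def)

lemma primal_prime_elem: "prime_elem p \<Longrightarrow> primal p"
  by (auto simp: primal_def prime_elem_def)

lemma primal_prod:
  assumes "primal p" "finite I" "p dvd (\<Prod>i\<in>I. f i)"
  obtains i where "i \<in> I" "p dvd f i"
proof -
  have "\<exists>i\<in>I. p dvd f i"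
    using assms(2,3)
  proof (induction I rule: finite_induct)
    case empty
    then show ?case using assms(1) by (simp add: primal_def)
  next
    case (insert i I)
    then have "p dvd f i \<or> p dvd (\<Prod>i\<in>I. f i)" using assms(1) by (simp add: primal_def)
    then show ?case using insert.IH by blast
  qed
  then show ?thesis using that by blast
qed

lemma primal_power: "primal p \<Longrightarrow> p dvd a ^ k \<Longrightarrow> p dvd a"
proof (induction k)
  case (Suc k)
  then have "p dvd a \<or> p dvd a ^ k" unfolding primal_def power_Suc by blast
  then show ?case using Suc by blast
qed (simp add: primal_def)

text \<open>The coefficients of a product of the linear polynomials \<open>t - a\<^sub>i\<close>.\<close>

definition orbit_poly :: "('i \<Rightarrow> 'a::comm_ring_1) \<Rightarrow> 'i set \<Rightarrow> 'a poly" where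
  "orbit_poly a I = (\<Prod>i\<in>I. [:- a i, 1:])"

lemma orbit_poly_insert:
  "finite I \<Longrightarrow> i \<notin> I \<Longrightarrow> orbit_poly a (insert i I) = [:- a i, 1:] * orbit_poly a I"
  by (simp add: orbit_poly_def)

lemma poly_orbit_poly: "poly (orbit_poly a I) x = (\<Prod>i\<in>I. x - a i)"
  by (simp add: orbit_poly_def poly_prod)

lemma coeff_linear_times:
  "coeff ([:- a, 1:] * q) k = (case k of 0 \<Rightarrow> - a * coeff q 0 | Suc k' \<Rightarrow> coeff q k' - a * coeff q k)"
  for q :: "'a::comm_ring_1 poly"
  by (simp add: coeff_pCons split: nat.splits)

lemma coeff_orbit_poly:
  assumes "finite I"
  shows "coeff (orbit_poly a I) (card I) = 1" "k > card I \<Longrightarrow> coeff (orbit_poly a I) k = 0"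
proof -
  have "coeff (orbit_poly a I) (card I) = 1 \<and> (\<forall>k>card I. coeff (orbit_poly a I) k = 0)"
    using assms
  proof (induction I rule: finite_induct)
    case empty
    then show ?case by (simp add: orbit_poly_def)
  next
    case (insert i I)
    have "card (insert i I) = Suc (card I)" using insert.hyps by (rule card_insert_disjoint)
    then show ?case
      using insert by (auto simp: orbit_poly_insert coeff_linear_times simp del: mult_pCons_left split: nat.splits)
  qed
  then show "coeff (orbit_poly a I) (card I) = 1" "k > card I \<Longrightarrow> coeff (orbit_poly a I) k = 0" by auto
qed

lemma homog_orbit_poly:
  fixes a :: "'i \<Rightarrow> ('v, 'k::field) mpoly"
  assumes "finite I" "\<And>i. i \<in> I \<Longrightarrow> homog d (a i)" "k \<le> card I"
  shows "homog ((card I - k) * d) (coeff (orbit_poly a I) k)"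
  using assms
proof (induction I arbitrary: k rule: finite_induct)
  case empty
  then show ?case by (simp add: orbit_poly_def)
next
  case (insert i I)
  have card: "card (insert i I) = Suc (card I)" using insert.hyps by (rule card_insert_disjoint)
  have IH: "homog ((card I - k) * d) (coeff (orbit_poly a I) k)" if "k \<le> card I" for k
    using insert that by auto
  have IH': "homog ((Suc (card I) - k) * d) (a i * coeff (orbit_poly a I) k)" for k
  proof (cases "k \<le> card I")
    case True
    then show ?thesis
      using homog_mult[OF insert.prems(1)[of i] IH[OF True]] by (simp add: Suc_diff_le)
  qed (simp add: coeff_orbit_poly[OF insert.hyps(1)])
  show ?case
  proof (cases k)
    case 0
    then show ?thesis
      using IH'[of 0] insert.hyps card
      by (simp add: orbit_poly_insert coeff_linear_times homog_uminus del: mult_pCons_left)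
  next
    case (Suc k')
    have "homog ((card I - k') * d) (coeff (orbit_poly a I) k')"
      using insert.prems(2) card Suc by (intro IH) simp
    then show ?thesis
      using IH'[of k] insert.hyps card Suc
      by (simp add: orbit_poly_insert coeff_linear_times homog_diff del: mult_pCons_left)
  qed
qed

lemma polys_over_orbit_poly:
  fixes a :: "'i \<Rightarrow> ('v, 'k::field) mpoly"
  assumes "finite I" "\<And>i. i \<in> I \<Longrightarrow> a i \<in> polys_over Y"
  shows "coeff (orbit_poly a I) k \<in> polys_over Y"
  using assms
proof (induction I arbitrary: k rule: finite_induct)
  case empty
  then show ?case by (simp add: orbit_poly_def)
next
  case (insert i I)
  then have "coeff (orbit_poly a I) k \<in> polys_over Y" "a i * coeff (orbit_poly a I) k \<in> polys_over Y" for k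
    by (auto intro: polys_over_mult)
  then show ?case
    using insert.hyps
    by (auto simp: orbit_poly_insert coeff_linear_times simp del: mult_pCons_left split: nat.splits
        intro!: polys_over_diff polys_over_uminus)
qed

lemma (in lin_action) act_coeff_orbit_poly:
  "act g (coeff (orbit_poly a I) k) = coeff (orbit_poly (\<lambda>i. act g (a i)) I) k"
proof (induction I arbitrary: k rule: infinite_finite_induct)
  case (insert i I)
  then show ?case
    by (auto simp: orbit_poly_insert coeff_linear_times act_simps simp del: mult_pCons_left split: nat.splits)
qed (auto simp: orbit_poly_def act_simps)

lemma orbit_poly_reindex:
  assumes "inj_on h I" "h ` I = I"
  shows "orbit_poly (\<lambda>i. a (h i)) I = orbit_poly a I"
proof -
  have "(\<Prod>i\<in>h ` I. [:- a i, 1:]) = (\<Prod>i\<in>I. [:- a (h i), 1:])"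
    by (simp add: prod.reindex[OF assms(1)])
  then show ?thesis using assms(2) by (simp add: orbit_poly_def)
qed

context lin_action
begin

definition htuple :: "(nat \<Rightarrow> 'k pvec) \<Rightarrow> bool" where
  "htuple F \<longleftrightarrow> (\<forall>k<m. F k \<in> cov \<and> (\<exists>d K. F k \<in> graded_free m K d))"

text \<open>The inertia group of the ideal generated by \<open>p\<close>.\<close>

definition inertia :: "(nat, 'k) mpoly \<Rightarrow> 'g set" where
  "inertia p = {g \<in> carrier \<Gamma>. \<forall>f. p dvd act g f - f}"

lemma inertiaI:
  assumes "g \<in> carrier \<Gamma>" "\<And>v. v < n \<Longrightarrow> p dvd X g v - Var v"
  shows "g \<in> inertia p"
proof -
  have "p dvd act g f - subst Var f" for f
    unfolding act_def
  proof (rule Cst.evalp_diff_dvd[of f UNIV])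
    show "p dvd X g v - Var v" for v using assms(2) by (cases "v < n") auto
  qed simp
  then show ?thesis using assms(1) by (simp add: inertia_def)
qed

lemma inertia_carrier: "g \<in> inertia p \<Longrightarrow> g \<in> carrier \<Gamma>"
  by (simp add: inertia_def)

lemma inertia_one: "\<one> \<in> inertia p"
  by (simp add: inertia_def act_one)

lemma inertia_mult:
  assumes "g \<in> inertia p" "h \<in> inertia p"
  shows "g \<otimes> h \<in> inertia p"
proof -
  have "p dvd act (g \<otimes> h) f - f" for f
  proof -
    have "act (g \<otimes> h) f - f = (act g (act h f) - act h f) + (act h f - f)"
      using assms by (simp add: act_act inertia_def)
    moreover have "p dvd (act g (act h f) - act h f) + (act h f - f)"
      using assms by (intro dvd_add) (simp_all add: inertia_def)
    ultimately show ?thesis by simp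
  qed
  then show ?thesis using assms by (simp add: inertia_def)
qed

lemma inertia_inv:
  assumes "g \<in> inertia p"
  shows "inv g \<in> inertia p"
proof -
  have g: "g \<in> carrier \<Gamma>" using assms by (rule inertia_carrier)
  have "p dvd act (inv g) f - f" for f
  proof -
    have "p dvd act g (act (inv g) f) - act (inv g) f" using assms by (simp add: inertia_def)
    then have "p dvd - (act (inv g) f - f)" by (simp add: act_inv[OF g])
    then show ?thesis by (simp only: dvd_minus_iff)
  qed
  then show ?thesis using g by (simp add: inertia_def)
qed

text \<open>A coset representative modulo the inertia group.\<close>

definition rep :: "(nat, 'k) mpoly \<Rightarrow> 'g \<Rightarrow> 'g" where
  "rep p g = (SOME h. h \<in> carrier \<Gamma> \<and> inv g \<otimes> h \<in> inertia p)"

lemma rep: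
  assumes "g \<in> carrier \<Gamma>"
  shows "rep p g \<in> carrier \<Gamma>" "inv g \<otimes> rep p g \<in> inertia p"
proof -
  have "g \<in> carrier \<Gamma> \<and> inv g \<otimes> g \<in> inertia p" using assms inertia_one by simp
  then have "rep p g \<in> carrier \<Gamma> \<and> inv g \<otimes> rep p g \<in> inertia p"
    unfolding rep_def by (rule someI)
  then show "rep p g \<in> carrier \<Gamma>" "inv g \<otimes> rep p g \<in> inertia p" by auto
qed

lemma rep_eq:
  assumes "g \<in> carrier \<Gamma>" "h \<in> carrier \<Gamma>" "inv g \<otimes> h \<in> inertia p"
  shows "rep p g = rep p h"
proof -
  have *: "inv a \<otimes> x \<in> inertia p"
    if "a \<in> carrier \<Gamma>" "b \<in> carrier \<Gamma>" "x \<in> carrier \<Gamma>" "inv a \<otimes> b \<in> inertia p" "inv b \<otimes> x \<in> inertia p" for a b x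
  proof -
    have "inv a \<otimes> x = (inv a \<otimes> b) \<otimes> (inv b \<otimes> x)"
      using that(1-3) by (simp add: m_assoc) (simp add: m_assoc[symmetric])
    then show ?thesis using inertia_mult[OF that(4,5)] by simp
  qed
  have "inv h \<otimes> g \<in> inertia p"
    using inertia_inv[OF assms(3)] assms(1,2) by (simp add: inv_mult_group)
  then have "(h' \<in> carrier \<Gamma> \<and> inv g \<otimes> h' \<in> inertia p) = (h' \<in> carrier \<Gamma> \<and> inv h \<otimes> h' \<in> inertia p)" for h'
    using *[of g h h'] *[of h g h'] assms by blast
  then show ?thesis unfolding rep_def by simp
qed

lemma rep_idem: "g \<in> carrier \<Gamma> \<Longrightarrow> rep p (rep p g) = rep p g"
  using rep_eq[OF _ rep(1) rep(2)] by metis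

lemma rep_mult:
  assumes "h \<in> carrier \<Gamma>" "g \<in> carrier \<Gamma>" "g' \<in> carrier \<Gamma>"
  shows "rep p (h \<otimes> g) = rep p (h \<otimes> g') \<longleftrightarrow> rep p g = rep p g'"
proof -
  have iff: "rep p a = rep p b \<longleftrightarrow> inv a \<otimes> b \<in> inertia p" if ab: "a \<in> carrier \<Gamma>" "b \<in> carrier \<Gamma>" for a b
  proof
    assume eq: "rep p a = rep p b"
    have "inv a \<otimes> b = (inv a \<otimes> rep p a) \<otimes> inv (inv b \<otimes> rep p b)"
      using ab rep(1)[OF ab(1), of p] rep(1)[OF ab(2), of p] unfolding eq
      by (simp add: inv_mult_group m_assoc) (simp add: m_assoc[symmetric])
    then show "inv a \<otimes> b \<in> inertia p"
      using inertia_mult[OF rep(2)[OF ab(1)] inertia_inv[OF rep(2)[OF ab(2)]]] by simp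
  qed (rule rep_eq[OF ab])
  have "inv (h \<otimes> g) \<otimes> (h \<otimes> g') = inv g \<otimes> g'"
    using assms by (simp add: inv_mult_group m_assoc) (simp add: m_assoc[symmetric])
  then show ?thesis using iff assms by simp
qed

text \<open>Outside of the inertia group, invariants of the inertia group can still be separated modulo \<open>p\<close>: if
  all coefficients of the product of the \<open>t - i x\<close>, \<open>i\<close> in the inertia group, were fixed by \<open>g\<close> modulo \<open>p\<close>,
  then \<open>g x\<close> would be a root of that product modulo \<open>p\<close>, that is, a power of \<open>g x - x\<close> would vanish.\<close>

lemma separating_inertia_invariant:
  assumes p: "primal p" and g: "g \<in> carrier \<Gamma>" "g \<notin> inertia p"
  obtains b d where "\<forall>i\<in>inertia p. act i b = b" "homog d b" "b \<in> polys_over {..<n}"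
    "\<not> p dvd act g b - b"
proof -
  obtain v where v: "v < n" "\<not> p dvd X g v - Var v" using inertiaI[OF g(1)] g(2) by blast
  let ?I = "inertia p" and ?x = "Var v :: (nat, 'k) mpoly"
  have finI: "finite ?I" using fin by (rule finite_subset[rotated]) (auto simp: inertia_def)
  define Q where "Q = orbit_poly (\<lambda>i. act i ?x) ?I"
  have "\<exists>k. \<not> p dvd act g (coeff Q k) - coeff Q k"
  proof (rule ccontr)
    assume "\<not> ?thesis"
    then have all: "p dvd act g (coeff Q k) - coeff Q k" for k by blast
    have "poly Q ?x = 0"
      unfolding Q_def poly_orbit_poly using finI inertia_one[of p] by (intro prod_zero) (auto intro!: bexI[of _ \<one>] simp: act_one)
    then have "act g (\<Sum>k\<le>degree Q. coeff Q k * ?x ^ k) = 0" by (simp add: poly_altdef act_simps)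
    then have "(\<Sum>k\<le>degree Q. act g (coeff Q k) * act g ?x ^ k) = 0" by (simp add: act_sum act_simps(2,9))
    then have "poly Q (act g ?x) = - (\<Sum>k\<le>degree Q. (act g (coeff Q k) - coeff Q k) * act g ?x ^ k)"
      by (simp add: poly_altdef left_diff_distrib sum_subtractf)
    moreover have "p dvd (\<Sum>k\<le>degree Q. (act g (coeff Q k) - coeff Q k) * act g ?x ^ k)"
      by (intro dvd_sum dvd_mult2 all)
    ultimately have "p dvd (\<Prod>i\<in>?I. act g ?x - act i ?x)"
      by (simp add: Q_def poly_orbit_poly)
    then obtain i where i: "i \<in> ?I" "p dvd act g ?x - act i ?x" by (rule primal_prod[OF p finI])
    have "p dvd (act g ?x - act i ?x) + (act i ?x - ?x)"
      using i by (intro dvd_add) (simp_all add: inertia_def)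
    then have "p dvd act g ?x - ?x" by simp
    then show False using v(2) by (simp add: act_simps)
  qed
  then obtain k where k: "\<not> p dvd act g (coeff Q k) - coeff Q k" by blast
  have "act i (coeff Q k) = coeff Q k" if i: "i \<in> ?I" for i
  proof -
    have "act i (coeff Q k) = coeff (orbit_poly (\<lambda>j. act i (act j ?x)) ?I) k"
      unfolding Q_def by (rule act_coeff_orbit_poly)
    also have "orbit_poly (\<lambda>j. act i (act j ?x)) ?I = orbit_poly (\<lambda>j. act (i \<otimes> j) ?x) ?I"
      unfolding orbit_poly_def using i by (intro prod.cong refl) (simp add: act_act inertia_carrier)
    also have "\<dots> = Q"
      unfolding Q_def
    proof (rule orbit_poly_reindex[where a = "\<lambda>j. act j ?x"])
      show inj: "inj_on (\<lambda>j. i \<otimes> j) ?I"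
        using i by (intro inj_onI) (simp add: inertia_carrier)
      show "(\<lambda>j. i \<otimes> j) ` ?I = ?I"
        by (rule endo_inj_surj[OF finI _ inj]) (use inertia_mult[OF i] in auto)
    qed
    finally show ?thesis .
  qed
  moreover have "\<exists>d. homog d (coeff Q k)"
  proof (cases "k \<le> card ?I")
    case True
    then show ?thesis
      unfolding Q_def using homog_orbit_poly[OF finI, of "Suc 0" "\<lambda>i. act i ?x" k] homog_act[OF homog_Var] by blast
  qed (auto simp: Q_def coeff_orbit_poly[OF finI])
  moreover have "coeff Q k \<in> polys_over {..<n}"
    unfolding Q_def using v(1) by (intro polys_over_orbit_poly finI act_over polys_over_Var) auto
  ultimately obtain d where "\<forall>i\<in>inertia p. act i (coeff Q k) = coeff Q k" "homog d (coeff Q k)"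
    "coeff Q k \<in> polys_over {..<n}" by blast
  then show ?thesis using k by (rule that)
qed

definition cTr :: "(nat, 'k) mpoly \<Rightarrow> 'k pvec \<Rightarrow> 'k pvec" where
  "cTr p F = (\<Sum>g\<in>rep p ` carrier \<Gamma>. T g F)"

lemma cTr_cov:
  assumes F: "\<And>i. i \<in> inertia p \<Longrightarrow> T i F = F"
  shows "cTr p F \<in> cov"
proof (rule covI)
  let ?R = "rep p ` carrier \<Gamma>"
  have R: "g \<in> carrier \<Gamma>" "rep p g = g" if "g \<in> ?R" for g
    using that rep(1) rep_idem by auto
  have finR: "finite ?R" using fin by simp
  fix h assume h: "h \<in> carrier \<Gamma>"
  have step: "T h (T g F) = T (rep p (h \<otimes> g)) F" if g: "g \<in> ?R" for g
  proof -
    let ?a = "h \<otimes> g"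
    have a: "?a \<in> carrier \<Gamma>" using h R(1)[OF g] by simp
    have "rep p ?a = ?a \<otimes> (inv ?a \<otimes> rep p ?a)"
      using a rep(1)[OF a, of p] by (simp add: m_assoc[symmetric])
    then have "T (rep p ?a) F = T ?a (T (inv ?a \<otimes> rep p ?a) F)"
      using a rep(1)[OF a, of p] by (simp add: T_T)
    also have "\<dots> = T ?a F" by (simp only: F[OF rep(2)[OF a]])
    finally show ?thesis using h R(1)[OF g] by (simp add: T_T)
  qed
  have inj: "inj_on (\<lambda>g. rep p (h \<otimes> g)) ?R"
  proof (rule inj_onI)
    fix g g' assume g: "g \<in> ?R" "g' \<in> ?R" "rep p (h \<otimes> g) = rep p (h \<otimes> g')"
    then have "rep p g = rep p g'" using rep_mult[OF h R(1)[OF g(1)] R(1)[OF g(2)]] by blast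
    then show "g = g'" using R(2)[OF g(1)] R(2)[OF g(2)] by simp
  qed
  have img: "(\<lambda>g. rep p (h \<otimes> g)) ` ?R = ?R"
  proof (rule endo_inj_surj[OF finR _ inj])
    show "(\<lambda>g. rep p (h \<otimes> g)) ` ?R \<subseteq> ?R" using R(1) h by auto
  qed
  have "T h (cTr p F) = (\<Sum>g\<in>?R. T (rep p (h \<otimes> g)) F)"
    unfolding cTr_def T_sum by (intro sum.cong refl step)
  also have "\<dots> = (\<Sum>g\<in>(\<lambda>g. rep p (h \<otimes> g)) ` ?R. T g F)" by (simp add: sum.reindex[OF inj])
  also have "\<dots> = cTr p F" by (simp only: img cTr_def)
  finally show "T h (cTr p F) = cTr p F" .
qed (simp add: cTr_def vecs_sum)

lemma uvec_vecs: "k < m \<Longrightarrow> uvec k \<in> vecs"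
  by (simp add: uvec_def vecs_def)

lemma uvec_graded: "k < m \<Longrightarrow> uvec k \<in> graded_free m K 0"
  by (simp add: uvec_def graded_free_def)

lemma T_trivial_uvec: "trivial g \<Longrightarrow> k < m \<Longrightarrow> T g (uvec k) = uvec k"
  by (rule ext) (simp add: T_trivial uvec_vecs, simp add: uvec_def act_simps)

text \<open>If the inertia group of \<open>p\<close> acts trivially on the coefficients then the covariants span the free
  module at \<open>p\<close>. For a separating element \<open>b\<^sub>r\<close> for each non-trivial coset \<open>r\<close>, the product of the
  \<open>r b\<^sub>r - h b\<^sub>r\<close> vanishes unless \<open>h\<close> lies in the trivial coset; expanding it writes a multiple of each
  unit vector, by a factor not divisible by \<open>p\<close>, as a combination of relative traces.\<close>

lemma covariants_generate_at:
  assumes p: "primal p" and triv: "\<And>g. g \<in> inertia p \<Longrightarrow> trivial g"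
  obtains F where "htuple F" "\<not> p dvd dt m F"
proof -
  let ?R = "rep p ` carrier \<Gamma>" and ?r1 = "rep p \<one>"
  define R' where "R' = ?R - {?r1}"
  have finR: "finite ?R" "finite R'" using fin by (auto simp: R'_def)
  have R: "g \<in> carrier \<Gamma>" "rep p g = g" if "g \<in> ?R" for g
    using that rep(1) rep_idem by auto
  have r1: "?r1 \<in> inertia p" using rep(2)[OF one_closed, of p] rep(1)[OF one_closed, of p] by simp
  have notI: "g \<notin> inertia p" if "g \<in> R'" for g
  proof
    assume "g \<in> inertia p"
    then have "rep p \<one> = rep p g"
      using that R(1)[of g] by (intro rep_eq) (auto simp: R'_def)
    then show False using that R(2)[of g] by (auto simp: R'_def)
  qed
  have "\<forall>g\<in>R'. \<exists>b d. (\<forall>i\<in>inertia p. act i b = b) \<and> homog d b \<and> b \<in> polys_over {..<n} \<and> \<not> p dvd act g b - b"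
  proof
    fix g assume g: "g \<in> R'"
    then have "g \<in> carrier \<Gamma>" using R(1) by (auto simp: R'_def)
    then obtain b d where "\<forall>i\<in>inertia p. act i b = b" "homog d b" "b \<in> polys_over {..<n}"
      "\<not> p dvd act g b - b"
      using notI[OF g] by (rule separating_inertia_invariant[OF p])
    then show "\<exists>b d. (\<forall>i\<in>inertia p. act i b = b) \<and> homog d b \<and> b \<in> polys_over {..<n} \<and> \<not> p dvd act g b - b"
      by (intro exI[of _ b] exI[of _ d]) simp
  qed
  then obtain b where b': "\<forall>g\<in>R'. \<exists>d. (\<forall>i\<in>inertia p. act i (b g) = b g) \<and> homog d (b g) \<and>
      b g \<in> polys_over {..<n} \<and> \<not> p dvd act g (b g) - b g"
    by (rule bchoice[THEN exE])
  then obtain d where b'': "\<forall>g\<in>R'. (\<forall>i\<in>inertia p. act i (b g) = b g) \<and> homog (d g) (b g) \<and>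
      b g \<in> polys_over {..<n} \<and> \<not> p dvd act g (b g) - b g"
    by (rule bchoice[THEN exE])
  have b: "\<And>g i. g \<in> R' \<Longrightarrow> i \<in> inertia p \<Longrightarrow> act i (b g) = b g"
    "\<And>g. g \<in> R' \<Longrightarrow> homog (d g) (b g)" "\<And>g. g \<in> R' \<Longrightarrow> b g \<in> polys_over {..<n}"
    "\<And>g. g \<in> R' \<Longrightarrow> \<not> p dvd act g (b g) - b g"
    using b'' by simp_all
  define c where "c = (\<Prod>r\<in>R'. act r (b r) - b r)"
  have c: "\<not> p dvd c"
  proof
    assume "p dvd c"
    then obtain r where "r \<in> R'" "p dvd act r (b r) - b r"
      unfolding c_def by (rule primal_prod[OF p finR(2)])
    then show False using b(4) by blast
  qed
  define A where "A S = (\<Prod>r\<in>S. - b r)" for S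
  define C where "C S = (\<Prod>r\<in>R' - S. act r (b r))" for S
  define H where "H S k = cTr p (smul (A S) (uvec k))" for S k
  have prod0: "(\<Prod>r\<in>R'. act r (b r) - act h (b r)) = (if h = ?r1 then c else 0)" if h: "h \<in> ?R" for h
  proof (cases "h = ?r1")
    case True
    then show ?thesis unfolding c_def by (auto intro!: prod.cong simp: b(1) r1)
  next
    case False
    then have "h \<in> R'" using h by (simp add: R'_def)
    then have "(\<Prod>r\<in>R'. act r (b r) - act h (b r)) = 0"
      using finR(2) by (intro prod_zero) auto
    then show ?thesis using False by simp
  qed
  have expand: "smul c (uvec k) = (\<Sum>S\<in>Pow R'. smul (C S) (H S k))" if k: "k < m" for k
  proof -
    have "(\<Sum>S\<in>Pow R'. smul (C S) (H S k)) = (\<Sum>S\<in>Pow R'. \<Sum>h\<in>?R. smul (C S * act h (A S)) (T h (uvec k)))"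
      unfolding H_def cTr_def smul_sum T_smul smul_smul ..
    also have "\<dots> = (\<Sum>h\<in>?R. smul (\<Sum>S\<in>Pow R'. C S * act h (A S)) (T h (uvec k)))"
      by (subst sum.swap) (simp only: smul_sum_left)
    also have "\<dots> = (\<Sum>h\<in>?R. if h = ?r1 then smul c (uvec k) else 0)"
    proof (intro sum.cong refl)
      fix h assume h: "h \<in> ?R"
      have "(\<Sum>S\<in>Pow R'. C S * act h (A S)) = (\<Sum>S\<in>Pow R'. (\<Prod>r\<in>S. - act h (b r)) * (\<Prod>r\<in>R' - S. act r (b r)))"
        by (simp add: C_def A_def act_prod act_simps mult.commute)
      also have "\<dots> = (\<Prod>r\<in>R'. - act h (b r) + act r (b r))" by (rule prod_add[OF finR(2), symmetric])
      also have "\<dots> = (if h = ?r1 then c else 0)" using prod0[OF h] by (simp add: add.commute)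
      finally have "(\<Sum>S\<in>Pow R'. C S * act h (A S)) = (if h = ?r1 then c else 0)" .
      then show "smul (\<Sum>S\<in>Pow R'. C S * act h (A S)) (T h (uvec k)) = (if h = ?r1 then smul c (uvec k) else 0)"
        using T_trivial_uvec[OF triv[OF r1] k] by simp
    qed
    also have "\<dots> = smul c (uvec k)" using finR(1) by simp
    finally show ?thesis ..
  qed
  have "\<not> p dvd dt m (\<lambda>k. smul c (uvec k))"
    using c primal_power[OF p] by (auto simp: dt_uvec)
  then obtain s where s: "\<And>k. k < m \<Longrightarrow> s k \<in> Pow R'" "\<not> p dvd dt m (\<lambda>k. H (s k) k)"
    by (rule multilinear_choice[where J = "Pow R'" and a = "\<lambda>k. C" and G = "\<lambda>k S. H S k"]) (use expand in auto)
  have "htuple (\<lambda>k. H (s k) k)"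
    unfolding htuple_def
  proof (intro allI impI conjI)
    fix k assume k: "k < m"
    have sub: "s k \<subseteq> R'" using s(1)[OF k] by simp
    show "H (s k) k \<in> cov"
      unfolding H_def
    proof (rule cTr_cov)
      fix i assume i: "i \<in> inertia p"
      have "act i (A (s k)) = A (s k)"
        unfolding A_def act_prod using sub i by (intro prod.cong refl) (auto simp: act_simps b(1))
      then show "T i (smul (A (s k)) (uvec k)) = smul (A (s k)) (uvec k)"
        by (simp add: T_smul T_trivial_uvec[OF triv[OF i] k])
    qed
    have "smul (A (s k)) (uvec k) \<in> graded_free m n ((\<Sum>r\<in>s k. d r) + 0)"
      unfolding A_def using sub b(2,3)
      by (intro graded_free_smul uvec_graded k polys_over_prod homog_prod) (auto intro: polys_over_uminus homog_uminus)
    then have "H (s k) k \<in> graded_free m n ((\<Sum>r\<in>s k. d r) + 0)"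
      unfolding H_def cTr_def by (intro graded_free_sum T_graded) auto
    then show "\<exists>d K. H (s k) k \<in> graded_free m K d" by blast
  qed
  then show ?thesis using s(2) by (rule that)
qed

lemma inertia_zero: "inertia 0 = {\<one>}"
proof -
  have "g = \<one>" if "g \<in> inertia 0" for g
  proof (rule faithful)
    show "g \<in> carrier \<Gamma>" using that by (rule inertia_carrier)
    show "X g v = Var v" if "v < n" for v
      using \<open>g \<in> inertia 0\<close> by (auto simp: inertia_def act_simps dest!: spec[of _ "Var v"])
  qed
  then show ?thesis using inertia_one by blast
qed

lemma htuple_nonzero:
  obtains F where "htuple F" "dt m F \<noteq> 0"
proof -
  obtain F where "htuple F" "\<not> 0 dvd dt m F"
    by (rule covariants_generate_at[of 0]) (auto simp: primal_zero inertia_zero trivial_one)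
  then show ?thesis using that by simp
qed

lemma htuple_graded:
  assumes "htuple F"
  obtains K d where "K \<ge> n" "\<forall>k<m. F k \<in> graded_free m K (d k)"
proof -
  have "\<forall>k. \<exists>d K. k < m \<longrightarrow> F k \<in> graded_free m K d" using assms by (auto simp: htuple_def)
  then obtain d where "\<forall>k. \<exists>K. k < m \<longrightarrow> F k \<in> graded_free m K (d k)" by metis
  then obtain K where K: "\<forall>k. k < m \<longrightarrow> F k \<in> graded_free m (K k) (d k)" by metis
  define K' where "K' = Max (insert n (K ` {..<m}))"
  have "K k \<le> K'" if "k < m" for k using that by (auto simp: K'_def)
  then have "\<forall>k<m. F k \<in> graded_free m K' (d k)"
    using K graded_free_mono[of _ K' m] by (meson subsetD)
  moreover have "n \<le> K'" by (simp add: K'_def)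
  ultimately show ?thesis by (rule that[rotated])
qed

text \<open>The determinant of \<open>F\<close> is divisible by a power of \<open>l\<close> only if all determinants of covariants are.\<close>

definition minimal_at :: "(nat, 'k) mpoly \<Rightarrow> (nat \<Rightarrow> 'k pvec) \<Rightarrow> bool" where
  "minimal_at l F \<longleftrightarrow> (\<forall>F' v. htuple F' \<longrightarrow> l ^ v dvd dt m F \<longrightarrow> l ^ v dvd dt m F')"

lemma power_dvd_homog:
  fixes l f :: "(nat, 'k) mpoly"
  assumes "homog (Suc 0) l" "homog D f" "f \<noteq> 0" "l ^ v dvd f"
  shows "v \<le> D"
proof -
  obtain q where "f = l ^ v * q" using assms(4) by (rule dvdE)
  then show ?thesis
    using homog_cofactor_ge[of "v * Suc 0" "l ^ v" D q] homog_power[OF assms(1)] assms(2,3) by simp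
qed

lemma htuple_dt_homog:
  assumes "htuple F"
  obtains D where "homog D (dt m F)"
proof -
  obtain K d where "\<forall>k<m. F k \<in> graded_free m K (d k)" by (rule htuple_graded[OF assms])
  then have "homog (\<Sum>k = 0..<m. d k) (dt m F)" by (intro homog_dt) (auto simp: graded_free_def)
  then show ?thesis by (rule that)
qed

lemma exists_minimal_at:
  assumes l: "homog (Suc 0) l"
  obtains F where "htuple F" "minimal_at l F"
proof -
  obtain F0 where F0: "htuple F0" "dt m F0 \<noteq> 0" by (rule htuple_nonzero)
  obtain D where D: "homog D (dt m F0)" by (rule htuple_dt_homog[OF F0(1)])
  define P where "P v \<longleftrightarrow> (\<exists>F. htuple F \<and> \<not> l ^ Suc v dvd dt m F)" for v
  have "P D" using F0 power_dvd_homog[OF l D F0(2), of "Suc D"] by (auto simp: P_def)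
  then have "P (LEAST v. P v)" by (rule LeastI)
  then obtain F where F: "htuple F" "\<not> l ^ Suc (LEAST v. P v) dvd dt m F" by (auto simp: P_def)
  have "l ^ w dvd dt m F'" if F': "htuple F'" and w: "l ^ w dvd dt m F" for F' w
  proof (rule ccontr)
    assume n: "\<not> l ^ w dvd dt m F'"
    have "w \<noteq> 0" using n by (intro notI) simp
    then obtain w' where w': "w = Suc w'" by (cases w) auto
    then have "P w'" using F' n by (auto simp: P_def)
    then have "(LEAST v. P v) \<le> w'" by (rule Least_le)
    then have "l ^ Suc (LEAST v. P v) dvd l ^ w" unfolding w' by (intro le_imp_power_dvd) simp
    then show False using F(2) w dvd_trans by blast
  qed
  then have "minimal_at l F" by (simp add: minimal_at_def)
  with F(1) show ?thesis by (rule that)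
qed

lemma act_Var_ge: "v \<ge> n \<Longrightarrow> act g (Var v) = Var v"
  by (simp add: act_simps)

text \<open>Tuples that are minimal at different linear forms are combined with new variables \<open>y\<close> and \<open>z\<close> as
  coefficients; setting one of them to one and the other to zero recovers either tuple.\<close>

lemma exists_minimal_at_all:
  assumes S: "finite S" "\<And>l. l \<in> S \<Longrightarrow> homog (Suc 0) l \<and> l \<in> polys_over {..<n}"
  obtains F where "htuple F" "dt m F \<noteq> 0" "\<And>l. l \<in> S \<Longrightarrow> minimal_at l F"
proof -
  have "\<exists>F. htuple F \<and> dt m F \<noteq> 0 \<and> (\<forall>l\<in>S. minimal_at l F)"
    using S
  proof (induction S rule: finite_induct)
    case empty
    obtain F where "htuple F" "dt m F \<noteq> 0" by (rule htuple_nonzero)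
    then show ?case by auto
  next
    case (insert l S)
    have "\<exists>F. htuple F \<and> dt m F \<noteq> 0 \<and> (\<forall>l\<in>S. minimal_at l F)"
      by (rule insert.IH) (use insert.prems in simp)
    then obtain F where F: "htuple F" "dt m F \<noteq> 0" "\<forall>l\<in>S. minimal_at l F" by (elim exE conjE)
    have l: "homog (Suc 0) l" "l \<in> polys_over {..<n}" using insert.prems[of l] by simp_all
    obtain F' where F': "htuple F'" "minimal_at l F'"
      by (rule exists_minimal_at[OF l(1)])
    obtain K1 d1 where K1: "K1 \<ge> n" "\<forall>k<m. F k \<in> graded_free m K1 (d1 k)" by (rule htuple_graded[OF F(1)])
    obtain K2 d2 where K2: "K2 \<ge> n" "\<forall>k<m. F' k \<in> graded_free m K2 (d2 k)" by (rule htuple_graded[OF F'(1)])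
    define y where "y = max K1 K2"
    define z where "z = Suc y"
    have yz: "K1 \<le> y" "K2 \<le> y" "K1 \<le> z" "K2 \<le> z" "n \<le> y" "n \<le> z" "y \<noteq> z" "y < Suc z" "z < Suc z"
      using K1(1) by (auto simp: y_def z_def)
    define G where "G k = smul (Var y ^ Suc (d2 k)) (F k) + smul (Var z ^ Suc (d1 k)) (F' k)" for k
    have inv: "invariant (Var v ^ e)" if "v \<ge> n" for v e
      using that by (simp add: invariant_def act_simps)
    have G: "htuple G"
      unfolding htuple_def
    proof (intro allI impI conjI)
      fix k assume k: "k < m"
      show "G k \<in> cov"
        unfolding G_def
        by (intro UU.subspace_add[OF subspace_cov] cov_smul inv yz)
           (use F(1) F'(1) k in \<open>simp_all add: htuple_def\<close>)
      have "smul (Var y ^ Suc (d2 k)) (F k) \<in> graded_free m (Suc z) (Suc (d2 k) * Suc 0 + d1 k)"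
        by (intro graded_free_smul polys_over_power polys_over_Var homog_power homog_Var
              subsetD[OF graded_free_mono K1(2)[rule_format, OF k]]) (use yz in simp_all)
      moreover have "smul (Var z ^ Suc (d1 k)) (F' k) \<in> graded_free m (Suc z) (Suc (d1 k) * Suc 0 + d2 k)"
        by (intro graded_free_smul polys_over_power polys_over_Var homog_power homog_Var
              subsetD[OF graded_free_mono K2(2)[rule_format, OF k]]) (use yz in simp_all)
      moreover have "Suc (d1 k) * Suc 0 + d2 k = Suc (d2 k) * Suc 0 + d1 k" by simp
      ultimately have "G k \<in> graded_free m (Suc z) (Suc (d2 k) * Suc 0 + d1 k)"
        unfolding G_def by (intro UU.subspace_add[OF subspace_graded_free]) (simp_all only:)
      then show "\<exists>d K. G k \<in> graded_free m K d" by blast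
    qed
    have spec: "subst (Var(y := a, z := b)) (dt m G) = dt m H"
      if ab: "\<And>k. k < m \<Longrightarrow> smul (a ^ Suc (d2 k)) (F k) + smul (b ^ Suc (d1 k)) (F' k) = H k" for a b H
      unfolding subst_dt
    proof (rule dt_cong)
      fix k j assume k: "k < m"
      have over: "F k j \<in> polys_over {..<K1}" "F' k j \<in> polys_over {..<K2}"
        using K1(2)[rule_format, OF k] K2(2)[rule_format, OF k] by (auto simp: graded_free_def)
      have id: "subst (Var(y := a, z := b)) (F k j) = F k j" "subst (Var(y := a, z := b)) (F' k j) = F' k j"
        by (rule subst_id_on[OF over(1)], use yz(1,3) in simp) (rule subst_id_on[OF over(2)], use yz(2,4) in simp)
      have "H k j = a ^ Suc (d2 k) * F k j + b ^ Suc (d1 k) * F' k j"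
        unfolding ab[OF k, symmetric] by (simp add: pv)
      then show "vsubst (Var(y := a, z := b)) (G k) j = H k j"
        using yz(7) by (simp add: G_def pv Cst.evalp_add Cst.evalp_mult Cst.evalp_power id del: power_Suc)
    qed
    have s1: "subst (Var(y := 1, z := 0)) (dt m G) = dt m F" by (rule spec) simp
    have s2: "subst (Var(y := 0, z := 1)) (dt m G) = dt m F'" by (rule spec) simp
    have fixl: "l' ^ v dvd subst (Var(y := a, z := b)) (dt m G)"
      if "l' \<in> insert l S" "l' ^ v dvd dt m G" for l' v a b
    proof -
      have "subst (Var(y := a, z := b)) l' = l'"
        by (rule subst_id_on[of _ "{..<n}"]) (use insert.prems[OF that(1)] yz(5,6) in simp_all)
      then show ?thesis
        using Cst.evalp_dvd[OF that(2), of "Var(y := a, z := b)"] by (simp add: Cst.evalp_power)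
    qed
    have "dt m G \<noteq> 0" using s1 F(2) by (metis Cst.evalp_zero)
    moreover have "minimal_at l' G" if "l' \<in> insert l S" for l'
      unfolding minimal_at_def
    proof (intro allI impI)
      fix H v assume H: "htuple H" and v: "l' ^ v dvd dt m G"
      show "l' ^ v dvd dt m H"
      proof (cases "l' = l")
        case True
        then show ?thesis using fixl[OF that v, of 0 1] s2 F'(2) H by (auto simp: minimal_at_def)
      next
        case False
        then show ?thesis using fixl[OF that v, of 1 0] s1 F(3) H that by (auto simp: minimal_at_def)
      qed
    qed
    ultimately show ?case using G by blast
  qed
  then obtain F where "htuple F" "dt m F \<noteq> 0" "\<forall>l\<in>S. minimal_at l F" by (elim exE conjE)
  then show ?thesis by (intro that[of F]) simp_all
qed

end


section \<open>Splitting the determinant\<close>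

lemma prime_elem_power_dvd_mult:
  fixes l :: "'a::idom"
  assumes "prime_elem l" "\<not> l dvd x" "l ^ w dvd x * a"
  shows "l ^ w dvd a"
  using assms(3)
proof (induction w)
  case (Suc w)
  have "l ^ w dvd x * a" using Suc.prems by (rule dvd_trans[rotated]) simp
  then obtain a' where a': "a = l ^ w * a'" using Suc.IH by (auto elim: dvdE)
  have "l ^ w * l dvd l ^ w * (x * a')" using Suc.prems by (simp add: a' ac_simps)
  then have "l dvd x * a'" using assms(1) by (simp only: dvd_mult_cancel_left) (auto simp: prime_elem_def)
  then have "l dvd a'" using assms(1,2) by (auto simp: prime_elem_def)
  then show ?case unfolding a' power_Suc2 by (rule mult_dvd_mono[OF dvd_refl])
qed simp

lemma split_power:
  fixes l a :: "'a::idom"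
  assumes "\<And>v. l ^ v dvd a \<Longrightarrow> v \<le> D"
  obtains w a' where "a = l ^ w * a'" "\<not> l dvd a'"
proof -
  define w where "w = (GREATEST v. l ^ v dvd a)"
  have "l ^ w dvd a"
    unfolding w_def by (rule GreatestI_nat[of _ 0 D]) (use assms in auto)
  then obtain a' where a': "a = l ^ w * a'" by (rule dvdE)
  have "\<not> l dvd a'"
  proof
    assume "l dvd a'"
    then have "l ^ w * l dvd a" unfolding a' by (rule mult_dvd_mono[OF dvd_refl])
    then have "l ^ Suc w dvd a" by (simp only: power_Suc2)
    then have "Suc w \<le> w"
      unfolding w_def by (rule Greatest_le_nat[of _ _ D]) (use assms in auto)
    then show False by simp
  qed
  with a' show ?thesis by (rule that)
qed

text \<open>The part of \<open>f\<close> made up of the primes in \<open>S\<close>, and the cofactor.\<close>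

lemma split_primes:
  fixes f :: "(nat, 'k::field) mpoly"
  assumes S: "finite S" "\<And>l. l \<in> S \<Longrightarrow> prime_elem l \<and> homog (Suc 0) l \<and> l \<in> polys_over Y"
    and f: "f \<noteq> 0" "homog D f"
  obtains u g du where "f = u * g" "\<forall>l\<in>S. \<not> l dvd g" "homog du u" "u \<in> polys_over Y"
    "\<forall>q. (\<forall>l\<in>S. \<forall>v. l ^ v dvd f \<longrightarrow> l ^ v dvd q) \<longrightarrow> u dvd q"
    "\<forall>x q. (\<forall>l\<in>S. \<not> l dvd x) \<longrightarrow> u dvd x * q \<longrightarrow> u dvd q"
proof -
  have "\<exists>u g du. f = u * g \<and> (\<forall>l\<in>S. \<not> l dvd g) \<and> homog du u \<and> u \<in> polys_over Y \<and>
    (\<forall>q. (\<forall>l\<in>S. \<forall>v. l ^ v dvd f \<longrightarrow> l ^ v dvd q) \<longrightarrow> u dvd q) \<and>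
    (\<forall>x q. (\<forall>l\<in>S. \<not> l dvd x) \<longrightarrow> u dvd x * q \<longrightarrow> u dvd q)"
    using S
  proof (induction S rule: finite_induct)
    case empty
    show ?case by (rule exI[of _ 1], rule exI[of _ f], rule exI[of _ 0]) auto
  next
    case (insert l S)
    have l: "prime_elem l" "homog (Suc 0) l" "l \<in> polys_over Y" using insert.prems[of l] by simp_all
    have "\<exists>u g du. f = u * g \<and> (\<forall>l\<in>S. \<not> l dvd g) \<and> homog du u \<and> u \<in> polys_over Y \<and>
      (\<forall>q. (\<forall>l\<in>S. \<forall>v. l ^ v dvd f \<longrightarrow> l ^ v dvd q) \<longrightarrow> u dvd q) \<and>
      (\<forall>x q. (\<forall>l\<in>S. \<not> l dvd x) \<longrightarrow> u dvd x * q \<longrightarrow> u dvd q)"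
      by (rule insert.IH) (use insert.prems in simp)
    then obtain u g du where u: "f = u * g" "\<forall>l\<in>S. \<not> l dvd g" "homog du u" "u \<in> polys_over Y"
      "\<forall>q. (\<forall>l\<in>S. \<forall>v. l ^ v dvd f \<longrightarrow> l ^ v dvd q) \<longrightarrow> u dvd q"
      "\<forall>x q. (\<forall>l\<in>S. \<not> l dvd x) \<longrightarrow> u dvd x * q \<longrightarrow> u dvd q" by (elim exE conjE)
    have bound: "v \<le> D" if "l ^ v dvd f" for v
    proof -
      obtain q where "f = l ^ v * q" using \<open>l ^ v dvd f\<close> by (rule dvdE)
      then show ?thesis
        using homog_cofactor_ge[of "v * Suc 0" "l ^ v" D q] homog_power[OF l(2)] f by simp
    qed
    obtain w g' where g': "g = l ^ w * g'" "\<not> l dvd g'"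
    proof (rule split_power)
      show "v \<le> D" if "l ^ v dvd g" for v
        by (rule bound) (unfold u(1), rule dvd_mult[OF that])
    qed
    obtain w' u' where u': "u = l ^ w' * u'" "\<not> l dvd u'"
    proof (rule split_power)
      show "v \<le> D" if "l ^ v dvd u" for v
        by (rule bound) (unfold u(1), rule dvd_mult2[OF that])
    qed
    have l0: "l \<noteq> 0" using l(1) by (auto simp: prime_elem_def)
    have 1: "f = (u * l ^ w) * g'" by (simp add: u(1) g'(1) mult.assoc)
    have 2: "\<forall>l'\<in>insert l S. \<not> l' dvd g'"
    proof
      fix l' assume "l' \<in> insert l S"
      then consider "l' = l" | "l' \<in> S" by blast
      then show "\<not> l' dvd g'"
      proof cases
        case 2
        then have "\<not> l' dvd g" using u(2) by (rule bspec[rotated])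
        then show ?thesis unfolding g'(1) using dvd_mult[of l' g' "l ^ w"] by blast
      qed (simp only: g'(2) not_False_eq_True)
    qed
    have 3: "homog (du + w * Suc 0) (u * l ^ w)" by (intro homog_mult u(3) homog_power l(2))
    have 4: "u * l ^ w \<in> polys_over Y" by (intro polys_over_mult u(4) polys_over_power l(3))
    have 5: "u * l ^ w dvd q" if q: "\<forall>l'\<in>insert l S. \<forall>v. l' ^ v dvd f \<longrightarrow> l' ^ v dvd q" for q
    proof -
      have "u dvd q" using q by (intro u(5)[THEN spec, THEN mp]) simp
      then obtain q' where q': "q = u * q'" by (rule dvdE)
      have "f = l ^ (w' + w) * (u' * g')"
        by (subst 1, subst u'(1)) (simp only: power_add ac_simps)
      then have "l ^ (w' + w) dvd f" by (rule dvdI)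
      then have "l ^ (w' + w) dvd q" using q[THEN bspec, OF insertI1] by (elim allE impE)
      moreover have "q = l ^ w' * (u' * q')" by (subst q', subst u'(1)) (simp only: ac_simps)
      ultimately have "l ^ w' * l ^ w dvd l ^ w' * (u' * q')" by (simp only: power_add)
      then have "l ^ w dvd u' * q'" using l0 by (simp only: dvd_mult_cancel_left) simp
      then have "l ^ w dvd q'" by (rule prime_elem_power_dvd_mult[OF l(1) u'(2)])
      then show ?thesis unfolding q' by (rule mult_dvd_mono[OF dvd_refl])
    qed
    have 6: "u * l ^ w dvd q" if x: "\<forall>l'\<in>insert l S. \<not> l' dvd x" and dvd: "u * l ^ w dvd x * q" for x q
    proof -
      have udvd: "u dvd x * q" using dvd by (rule dvd_mult_left)
      have xS: "\<forall>l'\<in>S. \<not> l' dvd x" using x by simp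
      have "u dvd q" by (rule u(6)[THEN spec, THEN spec, THEN mp, THEN mp, OF xS udvd])
      then obtain q' where q': "q = u * q'" by (rule dvdE)
      have "u \<noteq> 0" using f(1) u(1) by auto
      moreover have "u * l ^ w dvd u * (x * q')" using dvd unfolding q' by (simp only: ac_simps)
      ultimately have "l ^ w dvd x * q'" by (simp only: dvd_mult_cancel_left) simp
      then have "l ^ w dvd q'" by (rule prime_elem_power_dvd_mult[OF l(1) x[THEN bspec, OF insertI1]])
      then show ?thesis unfolding q' by (rule mult_dvd_mono[OF dvd_refl])
    qed
    have all5: "\<forall>q. (\<forall>l'\<in>insert l S. \<forall>v. l' ^ v dvd f \<longrightarrow> l' ^ v dvd q) \<longrightarrow> u * l ^ w dvd q"
      using 5 by (intro allI impI)
    have all6: "\<forall>x q. (\<forall>l'\<in>insert l S. \<not> l' dvd x) \<longrightarrow> u * l ^ w dvd x * q \<longrightarrow> u * l ^ w dvd q"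
      using 6 by (intro allI impI)
    show ?case
      by (rule exI[of _ "u * l ^ w"], rule exI[of _ g'], rule exI[of _ "du + w * Suc 0"],
          rule conjI[OF 1 conjI[OF 2 conjI[OF 3 conjI[OF 4 conjI[OF all5 all6]]]]])
  qed
  then show ?thesis by (elim exE conjE) (rule that)
qed

text \<open>A polynomial of degree less than \<open>card A\<close> that vanishes modulo \<open>D\<close> at the nodes \<open>a g\<close>, \<open>g \<in> A\<close>, vanishes
  modulo \<open>D\<close> if the differences of the nodes are regular modulo \<open>D\<close>.\<close>

lemma coeffs_dvd_of_roots:
  fixes p :: "'a::idom poly"
  assumes "finite A" "\<And>k. k \<ge> card A \<Longrightarrow> coeff p k = 0" "\<And>g. g \<in> A \<Longrightarrow> D dvd poly p (a g)"
    and "\<And>g h s. g \<in> A \<Longrightarrow> h \<in> A \<Longrightarrow> g \<noteq> h \<Longrightarrow> D dvd (a g - a h) * s \<Longrightarrow> D dvd s"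
  shows "D dvd coeff p k"
  using assms
proof (induction A arbitrary: p k rule: finite_induct)
  case empty
  then show ?case by simp
next
  case (insert g A)
  have card: "card (insert g A) = Suc (card A)" using insert.hyps by (rule card_insert_disjoint)
  define q where "q = synthetic_div p (a g)"
  have p: "p = [:- a g, 1:] * q + [:poly p (a g):]"
    unfolding q_def using synthetic_div_correct'[of "a g" p] by simp
  have cq: "coeff q k = coeff p (Suc k) + a g * coeff q (Suc k)" for k
    by (subst (1) p) (simp add: coeff_pCons)
  have "coeff q k = 0" if "k \<ge> card A" for k
  proof (rule ccontr)
    assume nz: "coeff q k \<noteq> 0"
    have "coeff q (k + j) \<noteq> 0" for j
    proof (induction j)
      case (Suc j)
      have "coeff p (Suc (k + j)) = 0" using insert.prems(1)[of "Suc (k + j)"] card that by simp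
      then show ?case using Suc cq[of "k + j"] by auto
    qed (simp add: nz)
    then have "k + j \<le> degree q" for j by (rule le_degree)
    from this[of "Suc (degree q)"] show False by simp
  qed
  moreover have "D dvd poly q (a h)" if h: "h \<in> A" for h
  proof (rule insert.prems(3))
    show "h \<in> insert g A" "g \<in> insert g A" "h \<noteq> g" using h insert.hyps by auto
    have "poly p (a h) = (a h - a g) * poly q (a h) + poly p (a g)"
      by (subst (1) p) (simp add: algebra_simps)
    then have "(a h - a g) * poly q (a h) = poly p (a h) - poly p (a g)" by simp
    also have "D dvd \<dots>" using h by (intro dvd_diff insert.prems(2)) auto
    finally show "D dvd (a h - a g) * poly q (a h)" .
  qed
  ultimately have q: "D dvd coeff q k" for k
    by (rule insert.IH) (use insert.prems(3) in auto)
  have "coeff p k = coeff ([:- a g, 1:] * q) k + coeff [:poly p (a g):] k"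
    by (subst (1) p) simp
  moreover have "D dvd coeff ([:- a g, 1:] * q) k"
    unfolding coeff_linear_times using q by (auto split: nat.splits intro!: dvd_diff dvd_mult)
  moreover have "D dvd coeff [:poly p (a g):] k"
    using insert.prems(2)[of g] by (simp add: coeff_pCons split: nat.splits)
  ultimately show ?case by simp
qed

subsection \<open>Shifted families\<close>

definition sh :: "nat \<Rightarrow> (nat \<Rightarrow> 'k::field pvec set) \<Rightarrow> nat \<Rightarrow> 'k pvec set" where
  "sh d X i = (if d \<le> i then X (i - d) else {0})"

lemma hval_sh:
  assumes "hsum X t"
  shows "hsum (sh d X) t" "hval (sh d X) t = t ^ d * hval X t"
proof -
  let ?f = "\<lambda>i. real (UU.dim (sh d X i)) * t ^ i"
  have "(\<lambda>i. t ^ d * (real (UU.dim (X i)) * t ^ i)) sums (t ^ d * hval X t)"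
    using assms unfolding hsum_def hval_def by (intro sums_mult summable_sums)
  moreover have "(\<lambda>i. ?f (i + d)) = (\<lambda>i. t ^ d * (real (UU.dim (X i)) * t ^ i))"
    by (rule ext) (simp add: sh_def power_add ac_simps)
  ultimately have "(\<lambda>i. ?f (i + d)) sums (t ^ d * hval X t)" by simp
  moreover have "(\<Sum>i<d. ?f i) = 0" by (intro sum.neutral) (simp add: sh_def)
  ultimately have "?f sums (t ^ d * hval X t)"
    using sums_iff_shift'[of ?f d "t ^ d * hval X t"] by simp
  then show "hsum (sh d X) t" "hval (sh d X) t = t ^ d * hval X t"
    by (simp_all add: hsum_def hval_def sums_iff)
qed

lemma subspace_sh: "(\<And>i. UU.subspace (X i)) \<Longrightarrow> UU.subspace (sh d X i)"
  by (simp add: sh_def UU.subspace_def)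

lemma fin_span_sh: "(\<And>i. UU.fin_span (X i)) \<Longrightarrow> UU.fin_span (sh d X i)"
  by (simp add: sh_def)

lemma sh_mono: "(\<And>i. X i \<subseteq> Y i) \<Longrightarrow> sh d X i \<subseteq> sh d Y i"
  by (simp add: sh_def)

lemma sh_closed:
  assumes "F \<in> sh d X i" "\<And>i. UU.subspace (Y i)" "\<And>i F. F \<in> X i \<Longrightarrow> f F \<in> Y (d + i)" "f 0 = 0"
  shows "f F \<in> Y i"
  using assms(1) assms(3)[of F "i - d"] UU.subspace_0[OF assms(2)] assms(4)
  by (auto simp: sh_def split: if_splits)

section \<open>Comparison of a lattice with its covariants\<close>

context lin_action
begin

definition forms :: "(nat, 'k) mpoly set" where
  "forms = (\<lambda>(g, h, v). X g v - X h v) ` (carrier \<Gamma> \<times> carrier \<Gamma> \<times> {..<n}) - {0}"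

lemma finite_forms: "finite forms"
  unfolding forms_def using fin by simp

lemma linear_form_diff: "linear_form B l - linear_form B l' = linear_form B (\<lambda>b. l b - l' b)"
  by (simp add: linear_form_def sum_subtractf single_diff)

lemma forms_prime:
  assumes "l \<in> forms"
  shows "prime_elem l" "homog (Suc 0) l" "l \<in> polys_over {..<n}"
proof -
  obtain g h v where l: "l = X g v - X h v" "v < n" "l \<noteq> 0" using assms by (auto simp: forms_def)
  then have "l = linear_form {..<n} (\<lambda>b. lin g v b - lin h v b)" by (simp add: gvar_def linear_form_diff)
  then show "prime_elem l" "homog (Suc 0) l" "l \<in> polys_over {..<n}"
    using l(3) by (auto intro: prime_elem_linear_form homog_linear_form polys_over_linear_form)
qed

lemma X_eq_imp_eq:
  assumes "g \<in> carrier \<Gamma>" "h \<in> carrier \<Gamma>" "\<And>v. v < n \<Longrightarrow> X g v = X h v"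
  shows "g = h"
proof -
  have "inv h \<otimes> g = \<one>"
  proof (rule faithful)
    fix v assume v: "v < n"
    have "X (inv h \<otimes> g) v = act (inv h) (X g v)" using assms(1,2) v by (simp add: act_def gvar_mult)
    also have "\<dots> = act (inv h) (act h (Var v))" using assms(3)[OF v] by (simp add: act_simps)
    also have "\<dots> = Var v" using assms(2) by (simp add: act_inv)
    finally show "X (inv h \<otimes> g) v = Var v" .
  qed (use assms in simp)
  have "g = h \<otimes> (inv h \<otimes> g)" using assms(1,2) by (simp add: m_assoc[symmetric])
  then show ?thesis using \<open>inv h \<otimes> g = \<one>\<close> assms(2) by simp
qed

lemma X_neq:
  assumes "g \<in> carrier \<Gamma>" "h \<in> carrier \<Gamma>" "g \<noteq> h"
  obtains v where "v < n" "X g v \<noteq> X h v"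
proof -
  have "\<exists>v<n. X g v \<noteq> X h v"
  proof (rule ccontr)
    assume "\<not> ?thesis"
    then have "g = h" by (intro X_eq_imp_eq assms) simp
    then show False using assms(3) by simp
  qed
  then show ?thesis by (elim exE conjE) (rule that)
qed

text \<open>An element with generic coefficients \<open>y\<^sub>b\<close>, which here are the variables from \<open>K1\<close> on.\<close>

definition gen :: "nat \<Rightarrow> (nat, 'k) mpoly" where
  "gen K1 = (\<Sum>b<n. Var b * Var (K1 + b))"

lemma act_gen: "n \<le> K1 \<Longrightarrow> act g (gen K1) = (\<Sum>b<n. X g b * Var (K1 + b))"
  by (simp add: gen_def act_sum act_simps)

lemma homog_gen: "homog 2 (gen K1)"
  unfolding gen_def by (intro homog_sum homog_mult_eq[OF homog_Var homog_Var]) simp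

lemma gen_over: "n \<le> K1 \<Longrightarrow> gen K1 \<in> polys_over {..<K1 + n}"
  unfolding gen_def by (intro polys_over_sum polys_over_mult polys_over_Var) auto

text \<open>The differences of the conjugates of the generic element are regular modulo any polynomial in the
  other variables that none of the linear forms divides.\<close>

lemma gen_regular:
  assumes K1: "n \<le> K1" and D: "D \<in> polys_over {..<K1}" "\<And>l. l \<in> forms \<Longrightarrow> \<not> l dvd D"
    and gh: "g \<in> carrier \<Gamma>" "h \<in> carrier \<Gamma>" "g \<noteq> h"
    and dvd: "D dvd (act g (gen K1) - act h (gen K1)) * s"
  shows "D dvd s"
proof -
  obtain b where b: "b < n" "X g b \<noteq> X h b" by (rule X_neq[OF gh])
  define u where "u = X g b - X h b"
  define c where "c = (\<Sum>b'\<in>{..<n} - {b}. (X g b' - X h b') * Var (K1 + b'))"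
  have u: "u \<in> forms" unfolding u_def forms_def using gh b by force
  have "act g (gen K1) - act h (gen K1) = (\<Sum>b'<n. (X g b' - X h b') * Var (K1 + b'))"
    by (simp add: act_gen[OF K1] left_diff_distrib sum_subtractf)
  also have "\<dots> = c + u * Var (K1 + b)" using b(1) by (simp add: c_def u_def sum.remove add.commute)
  finally have dvd': "D dvd (c + u * Var (K1 + b)) * s" using dvd by simp
  have over: "f \<in> polys_over (- {K1 + b})" if "f \<in> polys_over {..<K1}" for f :: "(nat, 'k) mpoly"
    using that by (rule polys_over_mono[rotated]) auto
  have Xo: "X g b' \<in> polys_over {..<K1}" if "b' < n" for g b'
    using that K1 by (intro X_over) auto
  have co: "c \<in> polys_over (- {K1 + b})"
    unfolding c_def by (intro polys_over_sum polys_over_mult polys_over_diff over Xo polys_over_Var) auto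
  have uo: "u \<in> polys_over (- {K1 + b})"
    unfolding u_def using b(1) by (intro polys_over_diff over Xo)
  obtain N where "D dvd u ^ N * s"
    by (rule dvd_power_of_linear_coeff[OF over[OF D(1)] co uo dvd'])
  then obtain q where q: "u ^ N * s = D * q" by (rule dvdE)
  have "u ^ N dvd q"
    by (rule prime_elem_power_dvd_mult[OF forms_prime(1)[OF u] D(2)[OF u]]) (simp flip: q)
  then obtain q' where "q = u ^ N * q'" by (rule dvdE)
  then have "u ^ N * s = u ^ N * (D * q')" using q by (simp add: ac_simps)
  moreover have "u \<noteq> 0" using u by (simp add: forms_def)
  ultimately show ?thesis by simp
qed

lemma gen_distinct:
  assumes K1: "n \<le> K1" and gh: "g \<in> carrier \<Gamma>" "h \<in> carrier \<Gamma>" "g \<noteq> h"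
  shows "act g (gen K1) \<noteq> act h (gen K1)"
proof
  assume eq: "act g (gen K1) = act h (gen K1)"
  obtain b where b: "b < n" "X g b \<noteq> X h b" by (rule X_neq[OF gh])
  let ?s = "\<lambda>v. if v < K1 then Var v else if v = K1 + b then 1 else (0 :: (nat, 'k) mpoly)"
  have *: "subst ?s (act g (gen K1)) = X g b" for g
  proof -
    have id: "subst ?s (X g b') = X g b'" if "b' < n" for b'
      using that K1 by (intro subst_id_on[OF X_over[of K1]]) auto
    have "subst ?s (act g (gen K1)) = (\<Sum>b'<n. if b' = b then X g b else 0)"
      unfolding act_gen[OF K1] Cst.evalp_sum by (intro sum.cong refl) (auto simp: Cst.evalp_mult id)
    then show ?thesis using b(1) by simp
  qed
  show False using *[of g] *[of h] eq b(2) by simp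
qed

lemma carrier_card: "card (carrier \<Gamma>) \<ge> 1"
proof -
  have "carrier \<Gamma> \<noteq> {}" using one_closed by blast
  then show ?thesis using fin by (simp add: Suc_le_eq card_gt_0_iff)
qed

text \<open>The span of the covariants with coefficients \<open>1, x, x\<^sup>2, \<dots>\<close>; here \<open>x\<close> is the generic element.\<close>

definition ext :: "nat \<Rightarrow> (nat \<Rightarrow> 'k pvec set) \<Rightarrow> nat \<Rightarrow> 'k pvec set" where
  "ext K1 Y i = UU.sum_spaces (\<lambda>j. smul (gen K1 ^ j) ` sh (2 * j) Y i) {..<card (carrier \<Gamma>)}"

definition cfam :: "nat \<Rightarrow> nat \<Rightarrow> 'k pvec set" where
  "cfam K i = cov \<inter> graded_free m K i"

lemma gfam_cfam: "gfam m K (cfam K)"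
  unfolding gfam_def cfam_def by (auto intro: UU.subspace_inter[OF subspace_cov subspace_graded_free])

lemma coeff_of_sum:
  assumes K1: "n \<le> K1" and f: "\<And>j. j < card (carrier \<Gamma>) \<Longrightarrow> f j \<in> cov" and g: "g \<in> carrier \<Gamma>"
  shows "T g (\<Sum>j<card (carrier \<Gamma>). smul (gen K1 ^ j) (f j)) =
    (\<Sum>j<card (carrier \<Gamma>). smul (act g (gen K1) ^ j) (f j))"
  unfolding T_sum by (intro sum.cong refl) (simp add: T_smul act_simps covD(2)[OF f g])

text \<open>The coefficients with respect to the powers of \<open>x\<close> are determined modulo \<open>D\<close> by the conjugates, for
  every family of linear functionals \<open>\<phi>\<close>.\<close>

lemma coeffs_of_ext:
  assumes K1: "n \<le> K1" and f: "\<And>j. j < card (carrier \<Gamma>) \<Longrightarrow> f j \<in> cov"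
    and \<phi>: "\<And>a v. \<phi> (smul a v) = a * \<phi> v" "\<And>(w::nat \<Rightarrow> 'k pvec) I. \<phi> (\<Sum>i\<in>I. w i) = (\<Sum>i\<in>I. \<phi> (w i))"
    and D: "\<And>g h s. g \<in> carrier \<Gamma> \<Longrightarrow> h \<in> carrier \<Gamma> \<Longrightarrow> g \<noteq> h \<Longrightarrow>
        D dvd (act g (gen K1) - act h (gen K1)) * s \<Longrightarrow> D dvd s"
    and dvd: "\<And>g. g \<in> carrier \<Gamma> \<Longrightarrow> E * D dvd \<phi> (T g (\<Sum>j<card (carrier \<Gamma>). smul (gen K1 ^ j) (f j)))"
    and E: "E \<noteq> 0" "\<And>j. j < card (carrier \<Gamma>) \<Longrightarrow> E dvd \<phi> (f j)" and j: "j < card (carrier \<Gamma>)"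
  shows "E * D dvd \<phi> (f j)"
proof -
  let ?e = "card (carrier \<Gamma>)"
  have "\<forall>j\<in>{..<?e}. \<exists>q. \<phi> (f j) = E * q" using E(2) by (simp add: dvd_def)
  then obtain q where "\<forall>j\<in>{..<?e}. \<phi> (f j) = E * q j" by (rule bchoice[THEN exE])
  then have q: "\<phi> (f j) = E * q j" if "j < ?e" for j using that by simp
  define p where "p = (\<Sum>j<?e. monom (q j) j)"
  have cp: "coeff p k = (if k < ?e then q k else 0)" for k
  proof -
    have "coeff p k = (\<Sum>j<?e. if j = k then q k else 0)"
      unfolding p_def coeff_sum by (intro sum.cong refl) auto
    then show ?thesis by simp
  qed
  have "D dvd coeff p j"
  proof (rule coeffs_dvd_of_roots[OF fin, of p D "\<lambda>g. act g (gen K1)"])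
    show "coeff p k = 0" if "k \<ge> card (carrier \<Gamma>)" for k using that by (simp add: cp)
    show "D dvd s" if "g \<in> carrier \<Gamma>" "h \<in> carrier \<Gamma>" "g \<noteq> h"
      "D dvd (act g (gen K1) - act h (gen K1)) * s" for g h s using that by (rule D)
    show "D dvd poly p (act g (gen K1))" if g: "g \<in> carrier \<Gamma>" for g
    proof -
      have "\<phi> (T g (\<Sum>j<?e. smul (gen K1 ^ j) (f j))) = E * poly p (act g (gen K1))"
      proof -
        have "T g (\<Sum>j<?e. smul (gen K1 ^ j) (f j)) = (\<Sum>j<?e. smul (act g (gen K1) ^ j) (f j))"
          by (rule coeff_of_sum[OF K1 f g])
        then have "\<phi> (T g (\<Sum>j<?e. smul (gen K1 ^ j) (f j))) = (\<Sum>j<?e. act g (gen K1) ^ j * \<phi> (f j))"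
          by (simp only: \<phi>)
        also have "\<dots> = (\<Sum>j<?e. E * (q j * act g (gen K1) ^ j))"
          by (intro sum.cong refl) (simp add: q ac_simps)
        finally show ?thesis by (simp add: p_def poly_sum poly_monom sum_distrib_left)
      qed
      then have "E * D dvd E * poly p (act g (gen K1))" using dvd[OF g] by simp
      then show ?thesis using E(1) by (simp only: dvd_mult_cancel_left) simp
    qed
  qed
  then have "D dvd q j" using j by (simp add: cp)
  then show ?thesis unfolding q[OF j] by (rule mult_dvd_mono[OF dvd_refl])
qed

lemma ext_props:
  assumes K1: "n \<le> K1" and Y: "\<And>i. UU.subspace (Y i)" "\<And>i. Y i \<subseteq> cfam (K1 + n) i"
  shows "UU.subspace (ext K1 Y i)" "ext K1 Y i \<subseteq> graded_free m (K1 + n) i"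
    "UU.dim (ext K1 Y i) = (\<Sum>j<card (carrier \<Gamma>). UU.dim (sh (2 * j) Y i))"
proof -
  let ?e = "card (carrier \<Gamma>)" and ?W = "\<lambda>j. smul (gen K1 ^ j) ` sh (2 * j) Y i"
  have finY: "UU.fin_span (Y i)" for i
    using Y(2)[of i] by (intro fin_span_sub_graded_free[of _ m "K1 + n" i]) (auto simp: cfam_def)
  have s: "UU.subspace (sh (2 * j) Y i)" "UU.fin_span (sh (2 * j) Y i)" for j
    by (rule subspace_sh[OF Y(1)], rule fin_span_sh[OF finY])
  have W: "UU.subspace (?W j)" "UU.fin_span (?W j)" for j
    by (rule subspace_image_smul[OF s(1)], rule fin_span_image_smul[OF s(2)])
  show "UU.subspace (ext K1 Y i)" unfolding ext_def by (rule UU.subspace_sum_spaces) (auto intro: W)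
  show "ext K1 Y i \<subseteq> graded_free m (K1 + n) i"
  proof
    fix F assume "F \<in> ext K1 Y i"
    then obtain w where w: "\<forall>j\<in>{..<?e}. w j \<in> ?W j" "F = (\<Sum>j<?e. w j)"
      unfolding ext_def UU.sum_spaces_def by blast
    have "w j \<in> graded_free m (K1 + n) i" if "j < ?e" for j
    proof -
      have "w j \<in> ?W j" using w(1) that by simp
      then obtain v where v: "v \<in> sh (2 * j) Y i" "w j = smul (gen K1 ^ j) v" by (elim imageE) simp
      have "smul (gen K1 ^ j) v \<in> graded_free m (K1 + n) i"
      proof (rule sh_closed[OF v(1) subspace_graded_free])
        fix i F assume "F \<in> Y i"
        then have "F \<in> graded_free m (K1 + n) i" using Y(2) by (auto simp: cfam_def)
        then have "smul (gen K1 ^ j) F \<in> graded_free m (K1 + n) (j * 2 + i)"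
          by (intro graded_free_smul polys_over_power gen_over K1 homog_power homog_gen)
        then show "smul (gen K1 ^ j) F \<in> graded_free m (K1 + n) (2 * j + i)" by (simp add: mult.commute)
      qed simp
      then show ?thesis using v(2) by simp
    qed
    then show "F \<in> graded_free m (K1 + n) i" unfolding w(2) by (intro graded_free_sum) auto
  qed
  have "gen K1 ^ j \<noteq> 0" if "j < ?e" for j
  proof (cases "j = 0")
    case False
    then have "?e \<noteq> 1" using that by simp
    then have "carrier \<Gamma> \<noteq> {\<one>}" by auto
    then obtain g where "g \<in> carrier \<Gamma>" "g \<noteq> \<one>" using one_closed by blast
    then have "gen K1 \<noteq> 0" using gen_distinct[OF K1, of g \<one>] by (auto simp: act_simps)
    then show ?thesis by simp
  qed simp
  then have dimW: "UU.dim (?W j) = UU.dim (sh (2 * j) Y i)" if "j < ?e" for j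
    using that by (intro dim_image_smul s) auto
  have "UU.dim (ext K1 Y i) = (\<Sum>j<?e. UU.dim (?W j))"
    unfolding ext_def
  proof (rule UU.dim_sum_spaces)
    fix w assume w: "\<And>j. j \<in> {..<?e} \<Longrightarrow> w j \<in> ?W j" "(\<Sum>j<?e. w j) = 0"
    have "\<forall>j. \<exists>v. j < ?e \<longrightarrow> v \<in> sh (2 * j) Y i \<and> w j = smul (gen K1 ^ j) v" using w(1) by auto
    then obtain f where f: "\<And>j. j < ?e \<Longrightarrow> f j \<in> sh (2 * j) Y i" "\<And>j. j < ?e \<Longrightarrow> w j = smul (gen K1 ^ j) (f j)"
      by metis
    have fcov: "f j \<in> cov" if "j < ?e" for j
      using f(1)[OF that] Y(2)[of "i - 2 * j"] UU.subspace_0[OF subspace_cov]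
      by (auto simp: sh_def cfam_def split: if_splits)
    have sum0: "(\<Sum>j<?e. smul (gen K1 ^ j) (f j)) = 0" using w(2) f(2) by simp
    have "f j l = 0" if j: "j < ?e" for j l
    proof -
      have "1 * 0 dvd f j l"
      proof (rule coeffs_of_ext[where \<phi> = "\<lambda>v. v l" and E = 1 and D = 0 and f = f, OF K1 fcov])
        show "0 dvd s" if "g \<in> carrier \<Gamma>" "h \<in> carrier \<Gamma>" "g \<noteq> h" "0 dvd (act g (gen K1) - act h (gen K1)) * s" for g h s
          using that gen_distinct[OF K1 that(1-3)] by simp
        show "1 * 0 dvd T g (\<Sum>j<?e. smul (gen K1 ^ j) (f j)) l" for g
          unfolding sum0 by (simp add: pv)
      qed (simp_all add: pv sum_apply j)
      then show ?thesis by simp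
    qed
    then show "\<forall>j\<in>{..<?e}. w j = 0" using f(2) by (auto simp: fun_eq_iff pv)
  qed (auto intro: W)
  then show "UU.dim (ext K1 Y i) = (\<Sum>j<?e. UU.dim (sh (2 * j) Y i))" using dimW by simp
qed

text \<open>The common denominator in Lagrange interpolation at the conjugates of the generic element.\<close>

definition lag :: "nat \<Rightarrow> (nat, 'k) mpoly" where
  "lag K1 = (\<Prod>g\<in>carrier \<Gamma> - {\<one>}. gen K1 - act g (gen K1))"

lemma lag_nonzero: "n \<le> K1 \<Longrightarrow> lag K1 \<noteq> 0"
  unfolding lag_def using gen_distinct[of K1 \<one>] fin by (auto simp: act_one)

lemma lag_in_ext:
  assumes K1: "n \<le> K1" and f: "f \<in> graded_free m (K1 + n) i"
  shows "smul (lag K1) f \<in> ext K1 (cfam (K1 + n)) (2 * (card (carrier \<Gamma>) - 1) + i)"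
proof -
  let ?e = "card (carrier \<Gamma>)" and ?x = "gen K1"
  define G' where "G' = carrier \<Gamma> - {\<one>}"
  have finG': "finite G'" using fin by (simp add: G'_def)
  have cardG': "card G' = ?e - 1" unfolding G'_def by (rule card_Diff_singleton) simp
  define c where "c j = coeff (orbit_poly (\<lambda>g. act g ?x) G') j" for j
  have eval: "(\<Sum>j<?e. ?x ^ j * act h (c j)) = (if h = \<one> then lag K1 else 0)" if h: "h \<in> carrier \<Gamma>" for h
  proof -
    let ?Q = "orbit_poly (\<lambda>g. act h (act g ?x)) G'"
    have deg: "degree ?Q < ?e"
    proof -
      have "degree ?Q \<le> card G'" using coeff_orbit_poly(2)[OF finG'] by (intro degree_le) auto
      then show ?thesis using cardG' carrier_card by linarith
    qed
    have "(\<Sum>j<?e. ?x ^ j * act h (c j)) = (\<Sum>j<?e. coeff ?Q j * ?x ^ j)"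
      by (simp add: c_def act_coeff_orbit_poly mult.commute)
    also have "\<dots> = poly ?Q ?x"
      unfolding poly_altdef using deg by (intro sum.mono_neutral_right) (auto simp: coeff_eq_0)
    also have "\<dots> = (\<Prod>g\<in>G'. ?x - act h (act g ?x))" by (rule poly_orbit_poly)
    also have "\<dots> = (if h = \<one> then lag K1 else 0)"
    proof (cases "h = \<one>")
      case True
      then show ?thesis by (simp add: lag_def G'_def act_one)
    next
      case False
      then have "inv h \<in> G'" using h by (simp add: G'_def inv_eq_1_iff)
      moreover have "?x - act h (act (inv h) ?x) = 0" using act_inv(1)[OF h] by simp
      ultimately have "(\<Prod>g\<in>G'. ?x - act h (act g ?x)) = 0" using finG' by (intro prod_zero) blast+
      then show ?thesis using False by simp
    qed
    finally show ?thesis .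
  qed
  have "(\<Sum>j<?e. smul (?x ^ j) (Tr (smul (c j) f))) = (\<Sum>j<?e. \<Sum>h\<in>carrier \<Gamma>. smul (?x ^ j * act h (c j)) (T h f))"
    by (simp add: Tr_def smul_sum T_smul smul_smul)
  also have "\<dots> = (\<Sum>h\<in>carrier \<Gamma>. smul (\<Sum>j<?e. ?x ^ j * act h (c j)) (T h f))"
    by (subst sum.swap) (simp add: smul_sum_left)
  also have "\<dots> = (\<Sum>h\<in>carrier \<Gamma>. if h = \<one> then smul (lag K1) f else 0)"
    by (intro sum.cong refl) (use eval T_one[OF graded_free_vecs[OF f]] in auto)
  also have "\<dots> = smul (lag K1) f" using fin by simp
  finally have eq: "smul (lag K1) f = (\<Sum>j<?e. smul (?x ^ j) (Tr (smul (c j) f)))" ..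
  show ?thesis
    unfolding eq ext_def
  proof (rule UU.sum_spacesI, rule imageI)
    fix j assume j: "j \<in> {..<?e}"
    have "homog ((card G' - j) * 2) (c j)"
      unfolding c_def using j cardG' carrier_card
      by (intro homog_orbit_poly finG' homog_act homog_gen) auto
    moreover have "c j \<in> polys_over {..<K1 + n}"
      unfolding c_def by (intro polys_over_orbit_poly finG' act_over gen_over K1) simp
    ultimately have "smul (c j) f \<in> graded_free m (K1 + n) ((card G' - j) * 2 + i)"
      using f by (intro graded_free_smul)
    then have "Tr (smul (c j) f) \<in> graded_free m (K1 + n) ((card G' - j) * 2 + i)"
      unfolding Tr_def by (intro graded_free_sum T_graded) auto
    moreover have "(card G' - j) * 2 + i = (2 * (?e - 1) + i) - 2 * j" "2 * j \<le> 2 * (?e - 1) + i"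
      using j cardG' carrier_card by auto
    ultimately show "Tr (smul (c j) f) \<in> sh (2 * j) (cfam (K1 + n)) (2 * (?e - 1) + i)"
      using Tr_cov by (simp add: sh_def cfam_def)
  qed
qed

end


lemma hval_sum:
  fixes X :: "nat \<Rightarrow> 'k::field pvec set"
  assumes "finite J" "\<And>j. j \<in> J \<Longrightarrow> hsum (Y j) t" "\<And>i. UU.dim (X i) = (\<Sum>j\<in>J. UU.dim (Y j i))"
  shows "hsum X t" "hval X t = (\<Sum>j\<in>J. hval (Y j) t)"
proof -
  have "(\<lambda>i. \<Sum>j\<in>J. real (UU.dim (Y j i)) * t ^ i) sums (\<Sum>j\<in>J. hval (Y j) t)"
    using assms(2) unfolding hval_def hsum_def by (intro sums_sum summable_sums)
  moreover have "(\<lambda>i. \<Sum>j\<in>J. real (UU.dim (Y j i)) * t ^ i) = (\<lambda>i. real (UU.dim (X i)) * t ^ i)"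
    by (rule ext) (simp add: assms(3) sum_distrib_right)
  ultimately have "(\<lambda>i. real (UU.dim (X i)) * t ^ i) sums (\<Sum>j\<in>J. hval (Y j) t)" by simp
  then show "hsum X t" "hval X t = (\<Sum>j\<in>J. hval (Y j) t)" by (simp_all add: hsum_def hval_def sums_iff)
qed

lemma hval_le:
  assumes "hsum X t" "hsum Y t" "0 \<le> t" "\<And>i. UU.dim (X i) \<le> UU.dim (Y i)"
  shows "hval X t \<le> hval Y t"
  using assms unfolding hsum_def hval_def by (intro suminf_le mult_right_mono) auto

lemma hval_add_eq:
  assumes "hsum X t" "hsum Y t" "hsum Z t" "hsum W t" "\<And>i. UU.dim (X i) + UU.dim (Y i) = UU.dim (Z i) + UU.dim (W i)"
  shows "hval X t + hval Y t = hval Z t + hval W t"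
proof -
  have "(\<lambda>i. real (UU.dim (X i)) * t ^ i + real (UU.dim (Y i)) * t ^ i) =
      (\<lambda>i. real (UU.dim (Z i)) * t ^ i + real (UU.dim (W i)) * t ^ i)"
    unfolding distrib_right[symmetric] of_nat_add[symmetric] assms(5) ..
  then show ?thesis
    using assms(1-4) unfolding hsum_def hval_def by (simp add: suminf_add)
qed

lemma hval_add_le:
  assumes "hsum X t" "hsum Y t" "hsum Z t" "hsum W t" "0 \<le> t"
    "\<And>i. UU.dim (X i) + UU.dim (Y i) \<le> UU.dim (Z i) + UU.dim (W i)"
  shows "hval X t + hval Y t \<le> hval Z t + hval W t"
proof -
  have "real (UU.dim (X i)) * t ^ i + real (UU.dim (Y i)) * t ^ i \<le>
      real (UU.dim (Z i)) * t ^ i + real (UU.dim (W i)) * t ^ i" for i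
    using assms(5) assms(6)[of i] unfolding distrib_right[symmetric] of_nat_add[symmetric]
    by (intro mult_right_mono of_nat_mono zero_le_power)
  then show ?thesis
    using assms(1-4) unfolding hsum_def hval_def
    by (subst (1 2) suminf_add) (auto intro!: suminf_le summable_add)
qed

context lin_action
begin

definition esum :: "real \<Rightarrow> real" where
  "esum t = (\<Sum>j<card (carrier \<Gamma>). t ^ (2 * j))"

lemma hval_ext:
  assumes K1: "n \<le> K1" and Y: "\<And>i. UU.subspace (Y i)" "\<And>i. Y i \<subseteq> cfam (K1 + n) i" and t: "0 \<le> t" "t < 1"
  shows "hsum (ext K1 Y) t" "hval (ext K1 Y) t = esum t * hval Y t"
proof -
  have "gfam m (K1 + n) Y" using Y by (auto simp: gfam_def cfam_def)
  then have Yt: "hsum Y t" using t by (rule hsum_gfam)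
  note h = hval_sum[of "{..<card (carrier \<Gamma>)}" "\<lambda>j. sh (2 * j) Y" t "ext K1 Y", OF _ hval_sh(1)[OF Yt] ext_props(3)[OF K1 Y]]
  show "hsum (ext K1 Y) t" "hval (ext K1 Y) t = esum t * hval Y t"
    using h by (simp_all add: hval_sh(2)[OF Yt] esum_def sum_distrib_right)
qed

text \<open>The upper bound holds because the powers of the generic element are independent over the covariants, the
  lower bound because its product of differences multiplies every vector into their span.\<close>

lemma cfam_estimate:
  assumes K1: "n \<le> K1" and t: "0 \<le> t" "t < 1"
  shows "esum t * hval (cfam (K1 + n)) t \<le> real m / (1 - t) ^ (K1 + n)"
    "t ^ (2 * (card (carrier \<Gamma>) - 1)) * (real m / (1 - t) ^ (K1 + n)) \<le> esum t * hval (cfam (K1 + n)) t"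
proof -
  let ?K = "K1 + n" and ?a = "2 * (card (carrier \<Gamma>) - 1)"
  let ?U = "graded_free m ?K :: nat \<Rightarrow> 'k pvec set" and ?E = "ext K1 (cfam ?K)"
  have Y: "UU.subspace (cfam ?K i)" "cfam ?K i \<subseteq> cfam ?K i" for i using gfamD(1)[OF gfam_cfam] by auto
  note E = hval_ext[OF K1 Y t]
  note U = hval_graded_free[OF t, of m ?K]
  have subE: "UU.subspace (?E i)" "?E i \<subseteq> ?U i" for i using ext_props(1,2)[OF K1 Y] by auto
  have "hval ?E t \<le> hval ?U t"
    by (rule hval_le[OF E(1) U(1) t(1)]) (rule UU.dim_subset_fin[OF fin_span_graded_free subE(2)])
  then show "esum t * hval (cfam ?K) t \<le> real m / (1 - t) ^ ?K" by (simp add: E(2) U(2))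
  have "hval (sh ?a ?U) t \<le> hval ?E t"
  proof (rule hval_le[OF hval_sh(1)[OF U(1)] E(1) t(1)])
    fix i
    have s: "UU.subspace (sh ?a ?U i)" "UU.fin_span (sh ?a ?U i)"
      by (rule subspace_sh[OF subspace_graded_free], rule fin_span_sh[OF fin_span_graded_free])
    have "smul (lag K1) ` sh ?a ?U i \<subseteq> ?E i"
      by (intro image_subsetI) (erule sh_closed, rule subE(1), erule lag_in_ext[OF K1], simp)
    then have "UU.dim (smul (lag K1) ` sh ?a ?U i) \<le> UU.dim (?E i)"
      by (rule UU.dim_subset_fin[OF fin_span_sub_graded_free[OF subE(2)]])
    then show "UU.dim (sh ?a ?U i) \<le> UU.dim (?E i)"
      unfolding dim_image_smul[OF s lag_nonzero[OF K1]] .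
  qed
  then show "t ^ ?a * (real m / (1 - t) ^ ?K) \<le> esum t * hval (cfam ?K) t"
    by (simp add: hval_sh(2)[OF U(1)] E(2) U(2))
qed

end

locale covariant_tuple = lin_action \<Gamma> n m lin rho
  for \<Gamma> :: "('g, 'x) monoid_scheme" (structure) and n m :: nat and lin rho :: "'g \<Rightarrow> nat \<Rightarrow> nat \<Rightarrow> 'k::field" +
  fixes F :: "nat \<Rightarrow> 'k pvec" and d :: "nat \<Rightarrow> nat" and K1 dl :: nat and ell D1 :: "(nat, 'k) mpoly"
  assumes K1: "n \<le> K1" and F_cov: "\<And>k. k < m \<Longrightarrow> F k \<in> cov"
    and F_graded: "\<And>k. k < m \<Longrightarrow> F k \<in> graded_free m K1 (d k)"
    and dt_split: "dt m F = ell * D1" and dt_nonzero: "dt m F \<noteq> 0"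
    and D1_forms: "\<And>l. l \<in> forms \<Longrightarrow> \<not> l dvd D1"
    and ell_over: "ell \<in> polys_over {..<n}" and ell_homog: "homog dl ell"
    and ell_coprime: "\<And>q. ell dvd D1 * q \<Longrightarrow> ell dvd q"
    and ell_num: "\<And>G K i k. G \<in> cov \<Longrightarrow> G \<in> graded_free m K i \<Longrightarrow> k < m \<Longrightarrow> ell dvd num m F k G"
begin

abbreviation K :: nat where "K \<equiv> K1 + n"
abbreviation \<Delta> :: "(nat, 'k) mpoly" where "\<Delta> \<equiv> dt m F"

definition dsum :: nat where "dsum = (\<Sum>k = 0..<m. d k)"

definition dD :: nat where "dD = dsum - dl"

lemma F_graded_K: "k < m \<Longrightarrow> F k \<in> graded_free m K (d k)"
  using F_graded graded_free_mono[of K1 K m "d k"] by auto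

lemma homog_Delta: "homog dsum \<Delta>"
  unfolding dsum_def by (rule homog_dt) (use F_graded in \<open>auto simp: graded_free_def\<close>)

lemma Delta_over: "\<Delta> \<in> polys_over {..<K1}"
  by (rule polys_over_dt) (use F_graded in \<open>auto simp: graded_free_def\<close>)

lemma nonzero: "ell \<noteq> 0" "D1 \<noteq> 0"
  using dt_split dt_nonzero by auto

lemma homog_D1: "homog dD D1" "dsum = dl + dD"
proof -
  have "homog dsum (ell * D1)" using homog_Delta by (simp add: dt_split)
  moreover have "dl \<le> dsum"
    by (rule homog_cofactor_ge[OF ell_homog calculation]) (use nonzero in simp)
  ultimately show "homog dD D1" "dsum = dl + dD"
    using homog_cofactor[OF ell_homog, of dD D1] nonzero by (simp_all add: dD_def)
qed

lemma D1_over: "D1 \<in> polys_over {..<K1}"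
proof (rule polys_over_cofactor)
  show "ell * D1 \<in> polys_over {..<K1}" using Delta_over by (simp add: dt_split)
  show "ell \<in> polys_over {..<K1}" by (rule polys_over_mono[OF _ ell_over]) (use K1 in auto)
qed (rule nonzero)

lemma D1_over_K: "D1 \<in> polys_over {..<K}"
  by (rule polys_over_mono[OF _ D1_over]) auto

lemma D1_regular:
  assumes "g \<in> carrier \<Gamma>" "h \<in> carrier \<Gamma>" "g \<noteq> h" "D1 dvd (act g (gen K1) - act h (gen K1)) * s"
  shows "D1 dvd s"
  by (rule gen_regular[OF K1 D1_over D1_forms assms])

lemma D1_regular_lag:
  assumes "D1 dvd lag K1 * s"
  shows "D1 dvd s"
proof -
  have "D1 dvd s" if "finite I" "I \<subseteq> carrier \<Gamma> - {\<one>}" "D1 dvd (\<Prod>g\<in>I. gen K1 - act g (gen K1)) * s" for I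
    using that
  proof (induction I rule: finite_induct)
    case (insert g I)
    have "D1 dvd (act \<one> (gen K1) - act g (gen K1)) * ((\<Prod>g\<in>I. gen K1 - act g (gen K1)) * s)"
      using insert.prems(2) insert.hyps by (simp add: act_one mult.assoc)
    then have "D1 dvd (\<Prod>g\<in>I. gen K1 - act g (gen K1)) * s"
      by (rule D1_regular[rotated 3]) (use insert.prems(1) in auto)
    then show ?case using insert.prems(1) by (intro insert.IH) auto
  qed simp
  then show ?thesis using assms fin unfolding lag_def by blast
qed

text \<open>The vectors whose coordinates with respect to \<open>F\<close> have denominators dividing \<open>\<Delta> / q\<close>.\<close>

definition lat :: "(nat, 'k) mpoly \<Rightarrow> nat \<Rightarrow> 'k pvec set" where
  "lat q i = {v \<in> graded_free m K i. \<forall>k<m. q dvd num m F k v}"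

lemma lat_graded: "lat q i \<subseteq> graded_free m K i"
  by (auto simp: lat_def)

lemma subspace_lat: "UU.subspace (lat q i)"
proof (rule subspaceI)
  show "0 \<in> lat q i" using UU.subspace_0[OF subspace_graded_free] by (simp add: lat_def)
  show "v + w \<in> lat q i" if "v \<in> lat q i" "w \<in> lat q i" for v w
    using that by (auto simp: lat_def num_add intro: UU.subspace_add[OF subspace_graded_free])
  show "scl c v \<in> lat q i" if "v \<in> lat q i" for c v
    using that num_smul[of m F _ "Const c" v]
    by (auto simp: lat_def scl_def intro: UU.subspace_scale[OF subspace_graded_free, unfolded scl_def])
qed

lemma fin_span_lat: "UU.fin_span (lat q i)"
  by (rule fin_span_sub_graded_free[OF lat_graded])

lemma gfam_lat: "gfam m K (lat q)"
  using subspace_lat lat_graded by (simp add: gfam_def)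

lemma Delta_over_K: "\<Delta> \<in> polys_over {..<K}"
  by (rule polys_over_mono[OF _ Delta_over]) auto

lemma lat_smul:
  assumes "v \<in> lat q i" "a \<in> polys_over {..<K}" "homog e a"
  shows "smul a v \<in> lat q (e + i)"
  using assms graded_free_smul[of v m K i a e] by (simp add: lat_def num_smul)

lemma lat_mono: "q dvd q' \<Longrightarrow> lat q' i \<subseteq> lat q i"
  unfolding lat_def using dvd_trans by blast

lemma cfam_lat: "cfam K i \<subseteq> lat ell i"
  using ell_num by (auto simp: cfam_def lat_def)

lemma D1_lat: "v \<in> lat ell i \<Longrightarrow> smul D1 v \<in> lat \<Delta> (dD + i)"
  using graded_free_smul[OF _ D1_over_K homog_D1(1), of v m i]
  by (simp add: lat_def num_smul dt_split mult_dvd_mono mult.commute[of ell])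

lemma Delta_lat: "v \<in> graded_free m K i \<Longrightarrow> smul \<Delta> v \<in> lat ell (dsum + i)"
  using graded_free_smul[OF _ Delta_over_K homog_Delta, of v m i]
  by (simp add: lat_def num_smul dt_split mult.assoc)

text \<open>The lattice with \<open>q = \<Delta>\<close> is the free module with basis \<open>F\<close>.\<close>

definition combine :: "nat \<Rightarrow> 'k pvec \<Rightarrow> 'k pvec" where
  "combine k f = smul (f 0) (F k)"

definition combos :: "(nat \<Rightarrow> 'k pvec set) \<Rightarrow> nat \<Rightarrow> 'k pvec set" where
  "combos Y i = UU.sum_spaces (\<lambda>k. combine k ` sh (d k) Y i) {..<m}"

lemma pvlin_combine: "pvlin (combine k)"
  by (rule pvlinI) (simp_all add: combine_def pv smul_add_left scl_def smul_smul)

lemma num_combine: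
  assumes "k < m" shows "num m F k (\<Sum>l<m. combine l (f l)) = f k 0 * \<Delta>"
proof -
  have "num m F k (\<Sum>l<m. combine l (f l)) = (\<Sum>l<m. if l = k then f k 0 * \<Delta> else 0)"
    unfolding num_sum combine_def num_smul by (intro sum.cong refl) (use assms in \<open>auto simp: num_self\<close>)
  then show ?thesis using assms by simp
qed

lemma combos_dim:
  assumes Y: "\<And>i. UU.subspace (Y i)" "\<And>i. Y i \<subseteq> graded_free 1 K i"
  shows "UU.dim (combos Y i) = (\<Sum>k<m. UU.dim (sh (d k) Y i))"
proof -
  have fY: "UU.fin_span (Y i)" for i by (rule fin_span_sub_graded_free[OF Y(2)])
  have s: "UU.subspace (sh (d k) Y i)" "UU.fin_span (sh (d k) Y i)" for k
    by (rule subspace_sh[OF Y(1)], rule fin_span_sh[OF fY])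
  have zero: "f = 0" if f: "f \<in> sh (d k) Y i" "f 0 = 0" for f k
  proof (rule ext)
    fix j
    have "f \<in> graded_free 1 K (i - d k)"
      using f(1) Y(2)[of "i - d k"] UU.subspace_0[OF subspace_graded_free] by (auto simp: sh_def split: if_splits)
    then show "f j = 0 j" using f(2) by (cases "j = 0") (simp_all add: graded_free_def pv)
  qed
  have inj: "f = 0" if f: "f \<in> sh (d k) Y i" "combine k f = 0" and k: "k < m" for f k
  proof (rule zero[OF f(1)])
    have "f 0 * \<Delta> = num m F k (combine k f)" using k by (simp add: combine_def num_smul num_self)
    then show "f 0 = 0" using f(2) dt_nonzero by simp
  qed
  have W: "UU.subspace (combine k ` sh (d k) Y i)" "UU.fin_span (combine k ` sh (d k) Y i)" for k
    using module_hom.subspace_image[of scl scl "combine k", OF _ s(1)] pvlin_combine[of k]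
    by (simp add: Vector_Spaces.linear_def, intro UU.fin_span_image[OF pvlin_combine s(2)])
  have "UU.dim (combos Y i) = (\<Sum>k<m. UU.dim (combine k ` sh (d k) Y i))"
    unfolding combos_def
  proof (rule UU.dim_sum_spaces)
    fix w assume w: "\<And>k. k \<in> {..<m} \<Longrightarrow> w k \<in> combine k ` sh (d k) Y i" "(\<Sum>k<m. w k) = 0"
    have "\<forall>k\<in>{..<m}. \<exists>f. f \<in> sh (d k) Y i \<and> w k = combine k f" using w(1) by blast
    then obtain f where f: "\<forall>k\<in>{..<m}. f k \<in> sh (d k) Y i \<and> w k = combine k (f k)" by (rule bchoice[THEN exE])
    have sum0: "(\<Sum>l<m. combine l (f l)) = 0" using w(2) f by simp
    have "f k 0 = 0" if "k < m" for k
      using num_combine[OF that, of f] dt_nonzero unfolding sum0 by simp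
    then show "\<forall>k\<in>{..<m}. w k = 0" using f by (simp add: combine_def)
  qed (auto intro: W)
  also have "\<dots> = (\<Sum>k<m. UU.dim (sh (d k) Y i))"
    by (intro sum.cong refl UU.dim_image_inj[OF pvlin_combine s]) (use inj in auto)
  finally show ?thesis .
qed

lemma combine_graded:
  assumes "k < m" "f \<in> sh (d k) (graded_free 1 K) i"
  shows "combine k f \<in> graded_free m K i"
proof (rule sh_closed[OF assms(2) subspace_graded_free])
  fix i and f :: "'k pvec" assume "f \<in> graded_free 1 K i"
  then have "smul (f 0) (F k) \<in> graded_free m K (i + d k)"
    by (intro graded_free_smul F_graded_K assms(1)) (simp_all add: graded_free_def)
  then show "combine k f \<in> graded_free m K (d k + i)" by (simp add: combine_def add.commute)
qed (simp add: combine_def pv fun_eq_iff)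

definition scalar :: "(nat, 'k) mpoly \<Rightarrow> 'k pvec" where
  "scalar a = (\<lambda>j. if j = 0 then a else 0)"

lemma combine_scalar: "combine k (scalar a) = smul a (F k)"
  by (simp add: combine_def scalar_def)

lemma lat_Delta_expand:
  assumes v: "v \<in> lat \<Delta> i"
  obtains a where "v = (\<Sum>k<m. combine k (scalar (a k)))" "\<forall>k<m. scalar (a k) \<in> sh (d k) (graded_free 1 K) i"
proof -
  have "\<forall>k\<in>{..<m}. \<exists>q. num m F k v = \<Delta> * q" using v by (auto simp: lat_def elim!: dvdE)
  then obtain a where a: "\<forall>k\<in>{..<m}. num m F k v = \<Delta> * a k" by (rule bchoice[THEN exE])
  have vg: "v \<in> graded_free m K i" using v by (simp add: lat_def)
  have "smul \<Delta> v = (\<Sum>k<m. smul (num m F k v) (F k))"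
    by (rule cramer) (use vg F_graded in \<open>auto simp: graded_free_def\<close>)
  also have "\<dots> = smul \<Delta> (\<Sum>k<m. smul (a k) (F k))"
    unfolding smul_sum smul_smul using a by (intro sum.cong refl) simp
  finally have 1: "v = (\<Sum>k<m. combine k (scalar (a k)))"
    using smul_cancel[OF dt_nonzero] by (simp add: combine_scalar)
  have 2: "scalar (a k) \<in> sh (d k) (graded_free 1 K) i" if k: "k < m" for k
  proof (cases "a k = 0")
    case True
    then have "scalar (a k) = 0" by (auto simp: scalar_def fun_eq_iff pv)
    then show ?thesis using UU.subspace_0[OF subspace_sh[OF subspace_graded_free]] by simp
  next
    case False
    have num: "num m F k v = \<Delta> * a k" using a k by simp
    have num': "num m F k v = dt m (F(k := v))" by (rule dt_upd[OF k, symmetric])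
    have h: "homog (\<Sum>l = 0..<m. (d(k := i)) l) (\<Delta> * a k)"
      unfolding num[symmetric] num'
      by (rule homog_dt) (use vg F_graded in \<open>auto simp: graded_free_def\<close>)
    have o: "\<Delta> * a k \<in> polys_over {..<K}"
      unfolding num[symmetric] num'
      by (rule polys_over_dt) (use vg F_graded_K in \<open>auto simp: graded_free_def\<close>)
    have "dsum = d k + (\<Sum>l\<in>{0..<m} - {k}. d l)"
      unfolding dsum_def using k by (intro sum.remove) auto
    moreover have "(\<Sum>l = 0..<m. (d(k := i)) l) = i + (\<Sum>l\<in>{0..<m} - {k}. d l)"
      using k by (subst sum.remove[of _ k]) auto
    moreover have "dsum \<le> (\<Sum>l = 0..<m. (d(k := i)) l)"
      by (rule homog_cofactor_ge[OF homog_Delta h]) (use False dt_nonzero in simp)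
    ultimately have le: "d k \<le> i" and eq: "(\<Sum>l = 0..<m. (d(k := i)) l) = dsum + (i - d k)" by auto
    have "homog (i - d k) (a k)" using homog_cofactor[OF homog_Delta _ dt_nonzero] h unfolding eq by blast
    moreover have "a k \<in> polys_over {..<K}"
      by (rule polys_over_cofactor[OF o polys_over_mono[OF _ Delta_over] dt_nonzero]) auto
    ultimately have "scalar (a k) \<in> graded_free 1 K (i - d k)" by (simp add: scalar_def graded_free_def)
    then show ?thesis using le by (simp add: sh_def)
  qed
  show ?thesis by (rule that[OF 1]) (use 2 in blast)
qed

lemma lat_Delta: "lat \<Delta> i = combos (graded_free 1 K) i"
proof (intro equalityI subsetI)
  fix v assume "v \<in> lat \<Delta> i"
  then obtain a where a: "v = (\<Sum>k<m. combine k (scalar (a k)))" "\<forall>k<m. scalar (a k) \<in> sh (d k) (graded_free 1 K) i"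
    by (rule lat_Delta_expand)
  show "v \<in> combos (graded_free 1 K) i"
    unfolding a(1) combos_def by (intro UU.sum_spacesI imageI) (use a(2) in simp)
next
  fix v assume "v \<in> combos (graded_free 1 K) i"
  then obtain w where w: "\<forall>k\<in>{..<m}. w k \<in> combine k ` sh (d k) (graded_free 1 K) i" "v = (\<Sum>k<m. w k)"
    unfolding combos_def UU.sum_spaces_def by blast
  have "\<forall>k\<in>{..<m}. \<exists>f. f \<in> sh (d k) (graded_free 1 K) i \<and> w k = combine k f" using w(1) by blast
  then obtain f where f: "\<forall>k\<in>{..<m}. f k \<in> sh (d k) (graded_free 1 K) i \<and> w k = combine k (f k)" by (rule bchoice[THEN exE])
  have v: "v = (\<Sum>k<m. combine k (f k))" using w(2) f by simp
  have "v \<in> graded_free m K i"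
    unfolding v using f by (intro graded_free_sum combine_graded) auto
  then show "v \<in> lat \<Delta> i" unfolding lat_def v by (simp add: num_combine)
qed

definition bfam :: "nat \<Rightarrow> 'k pvec set" where
  "bfam i = {f \<in> graded_free 1 K i. invariant (f 0)}"

lemma subspace_bfam: "UU.subspace (bfam i)"
proof (rule subspaceI)
  show "0 \<in> bfam i" using UU.subspace_0[OF subspace_graded_free] by (simp add: bfam_def invariant_def pv act_simps)
  show "v + w \<in> bfam i" if "v \<in> bfam i" "w \<in> bfam i" for v w
    using that by (auto simp: bfam_def invariant_def pv act_simps intro: UU.subspace_add[OF subspace_graded_free])
  show "scl c v \<in> bfam i" if "v \<in> bfam i" for c v
    using that by (auto simp: bfam_def invariant_def pv act_simps intro: UU.subspace_scale[OF subspace_graded_free])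
qed

definition lcov :: "nat \<Rightarrow> 'k pvec set" where
  "lcov i = lat \<Delta> i \<inter> cov"

lemma T_combine: "k < m \<Longrightarrow> g \<in> carrier \<Gamma> \<Longrightarrow> T g (combine k (scalar a)) = combine k (scalar (act g a))"
  by (simp add: combine_scalar T_smul covD(2)[OF F_cov])

lemma T_lat_Delta:
  assumes v: "v = (\<Sum>k<m. combine k (scalar (a k)))" and g: "g \<in> carrier \<Gamma>" and k: "k < m"
  shows "num m F k (T g v) = act g (a k) * \<Delta>"
proof -
  have "T g v = (\<Sum>k<m. combine k (scalar (act g (a k))))"
    unfolding v T_sum by (intro sum.cong refl) (use T_combine g in auto)
  then show ?thesis using num_combine[OF k] by (simp add: scalar_def)
qed

lemma lcov_eq: "lcov i = combos bfam i"
proof (intro equalityI subsetI)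
  fix v assume "v \<in> lcov i"
  then have v: "v \<in> lat \<Delta> i" "v \<in> cov" by (simp_all add: lcov_def)
  obtain a where a: "v = (\<Sum>k<m. combine k (scalar (a k)))" "\<forall>k<m. scalar (a k) \<in> sh (d k) (graded_free 1 K) i"
    by (rule lat_Delta_expand[OF v(1)])
  have "invariant (a k)" if k: "k < m" for k
    unfolding invariant_def
  proof
    fix g assume g: "g \<in> carrier \<Gamma>"
    have "act g (a k) * \<Delta> = num m F k v" using T_lat_Delta[OF a(1) g k] covD(2)[OF v(2) g] by simp
    also have "\<dots> = a k * \<Delta>" using num_combine[OF k, of "\<lambda>k. scalar (a k)"] a(1) by (simp add: scalar_def)
    finally show "act g (a k) = a k" using dt_nonzero by simp
  qed
  then have "scalar (a k) \<in> sh (d k) bfam i" if "k < m" for k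
    using a(2) that by (auto simp: sh_def bfam_def scalar_def)
  then show "v \<in> combos bfam i"
    unfolding a(1) combos_def by (intro UU.sum_spacesI imageI) simp
next
  fix v assume "v \<in> combos bfam i"
  then obtain w where w: "\<forall>k\<in>{..<m}. w k \<in> combine k ` sh (d k) bfam i" "v = (\<Sum>k<m. w k)"
    unfolding combos_def UU.sum_spaces_def by blast
  have "\<forall>k\<in>{..<m}. \<exists>f. f \<in> sh (d k) bfam i \<and> w k = combine k f" using w(1) by blast
  then obtain f where f: "\<forall>k\<in>{..<m}. f k \<in> sh (d k) bfam i \<and> w k = combine k (f k)" by (rule bchoice[THEN exE])
  have v: "v = (\<Sum>k<m. combine k (f k))" using w(2) f by simp
  have sub: "sh (d k) bfam i \<subseteq> sh (d k) (graded_free 1 K) i" for k by (rule sh_mono) (auto simp: bfam_def)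
  have "v \<in> combos (graded_free 1 K) i"
    unfolding v combos_def using f sub by (intro UU.sum_spacesI imageI) blast
  then have "v \<in> lat \<Delta> i" by (simp add: lat_Delta)
  moreover have "v \<in> cov"
    unfolding v
  proof (intro UU.subspace_sum[OF subspace_cov])
    fix k assume k: "k \<in> {..<m}"
    have "invariant (f k 0)"
      using f k by (auto simp: sh_def bfam_def invariant_def pv act_simps split: if_splits)
    then show "combine k (f k) \<in> cov" unfolding combine_def using k by (intro cov_smul F_cov) auto
  qed
  ultimately show "v \<in> lcov i" by (simp add: lcov_def)
qed

lemma lcov_props: "UU.subspace (lcov i)" "lcov i \<subseteq> cfam K i"
  unfolding lcov_def cfam_def by (rule UU.subspace_inter[OF subspace_lat subspace_cov]) (use lat_graded[of \<Delta> i] in blast)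

lemma ext_mem:
  assumes "F' \<in> ext K1 Y i"
  obtains f where "\<forall>j\<in>{..<card (carrier \<Gamma>)}. f j \<in> sh (2 * j) Y i"
    "F' = (\<Sum>j<card (carrier \<Gamma>). smul (gen K1 ^ j) (f j))"
proof -
  let ?e = "card (carrier \<Gamma>)"
  obtain w where w: "\<forall>j\<in>{..<?e}. w j \<in> smul (gen K1 ^ j) ` sh (2 * j) Y i" "F' = (\<Sum>j<?e. w j)"
    using assms unfolding ext_def UU.sum_spaces_def by blast
  have "\<forall>j\<in>{..<?e}. \<exists>f. f \<in> sh (2 * j) Y i \<and> w j = smul (gen K1 ^ j) f" using w(1) by blast
  then obtain f where f: "\<forall>j\<in>{..<?e}. f j \<in> sh (2 * j) Y i \<and> w j = smul (gen K1 ^ j) (f j)" by (rule bchoice[THEN exE])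
  show ?thesis by (rule that[of f]) (use f w(2) in auto)
qed

lemma ext_subset_lat:
  assumes "\<And>i. Y i \<subseteq> lat q i"
  shows "ext K1 Y i \<subseteq> lat q i"
proof
  fix v assume "v \<in> ext K1 Y i"
  then obtain f where f: "\<forall>j\<in>{..<card (carrier \<Gamma>)}. f j \<in> sh (2 * j) Y i"
    "v = (\<Sum>j<card (carrier \<Gamma>). smul (gen K1 ^ j) (f j))" by (rule ext_mem)
  show "v \<in> lat q i"
    unfolding f(2)
  proof (intro UU.subspace_sum[OF subspace_lat])
    fix j assume j: "j \<in> {..<card (carrier \<Gamma>)}"
    show "smul (gen K1 ^ j) (f j) \<in> lat q i"
    proof (rule sh_closed[OF f(1)[THEN bspec, OF j] subspace_lat])
      fix i F' assume "F' \<in> Y i"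
      then have "F' \<in> lat q i" using assms by blast
      then have "smul (gen K1 ^ j) F' \<in> lat q (j * 2 + i)"
        by (rule lat_smul) (intro polys_over_power gen_over K1, intro homog_power homog_gen)
      then show "smul (gen K1 ^ j) F' \<in> lat q (2 * j + i)" by (simp add: mult.commute)
    qed simp
  qed
qed

text \<open>Passing to the lattice generated over the whole ring does not lose information: since \<open>D1\<close> is
  prime to the discriminant of the generic element, the two lattices intersect in the smaller one.\<close>

lemma lat_Int_ext: "lat \<Delta> i \<inter> ext K1 (cfam K) i = ext K1 lcov i"
proof (intro equalityI subsetI)
  fix v assume "v \<in> ext K1 lcov i"
  moreover have "ext K1 lcov i \<subseteq> lat \<Delta> i" by (rule ext_subset_lat) (simp add: lcov_def)
  moreover have "ext K1 lcov i \<subseteq> ext K1 (cfam K) i"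
  proof
    fix v assume "v \<in> ext K1 lcov i"
    then obtain f where f: "\<forall>j\<in>{..<card (carrier \<Gamma>)}. f j \<in> sh (2 * j) lcov i"
      "v = (\<Sum>j<card (carrier \<Gamma>). smul (gen K1 ^ j) (f j))" by (rule ext_mem)
    have "sh (2 * j) lcov i \<subseteq> sh (2 * j) (cfam K) i" for j by (rule sh_mono[OF lcov_props(2)])
    then show "v \<in> ext K1 (cfam K) i"
      unfolding f(2) ext_def using f(1) by (intro UU.sum_spacesI imageI) blast
  qed
  ultimately show "v \<in> lat \<Delta> i \<inter> ext K1 (cfam K) i" by blast
next
  let ?e = "card (carrier \<Gamma>)"
  fix v assume v: "v \<in> lat \<Delta> i \<inter> ext K1 (cfam K) i"
  then obtain f where f: "\<forall>j\<in>{..<?e}. f j \<in> sh (2 * j) (cfam K) i" "v = (\<Sum>j<?e. smul (gen K1 ^ j) (f j))"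
    by (elim IntE ext_mem)
  obtain a where a: "v = (\<Sum>k<m. combine k (scalar (a k)))" by (rule lat_Delta_expand[of v i]) (use v in auto)
  have fcov: "f j \<in> cfam K (i - 2 * j)" if "j < ?e" for j
    using f(1) that UU.subspace_0[OF gfamD(1)[OF gfam_cfam]] by (auto simp: sh_def split: if_splits)
  have "\<Delta> dvd num m F k (f j)" if j: "j < ?e" and k: "k < m" for j k
    unfolding dt_split
  proof (rule coeffs_of_ext[where \<phi> = "num m F k" and f = f, OF K1])
    show "f j \<in> cov" if "j < ?e" for j using fcov[OF that] by (simp add: cfam_def)
    show "D1 dvd s" if "g \<in> carrier \<Gamma>" "h \<in> carrier \<Gamma>" "g \<noteq> h" "D1 dvd (act g (gen K1) - act h (gen K1)) * s" for g h s
      using that by (rule D1_regular)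
    show "ell * D1 dvd num m F k (T g (\<Sum>j<?e. smul (gen K1 ^ j) (f j)))" if g: "g \<in> carrier \<Gamma>" for g
      using T_lat_Delta[OF a g k] by (simp add: f(2) dt_split)
    show "ell dvd num m F k (f j)" if "j < ?e" for j
      using fcov[OF that] k by (intro ell_num[of "f j" K "i - 2 * j"]) (simp_all add: cfam_def)
  qed (simp_all add: num_smul num_sum nonzero j)
  note dvd = this
  have "f j \<in> sh (2 * j) lcov i" if j: "j < ?e" for j
  proof -
    have "f j \<in> lcov (i - 2 * j)"
      using fcov[OF j] dvd[OF j] by (simp add: lcov_def lat_def cfam_def)
    moreover have "f j \<in> sh (2 * j) (cfam K) i" using f(1) j by blast
    ultimately show ?thesis by (simp add: sh_def split: if_splits)
  qed
  then show "v \<in> ext K1 lcov i"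
    unfolding f(2) ext_def by (intro UU.sum_spacesI imageI) simp
qed

definition pfam :: "nat \<Rightarrow> 'k pvec set" where
  "pfam i = UU.sum_space (lat \<Delta> i) (ext K1 (cfam K) i)"

lemma cfam_sub: "UU.subspace (cfam K i)" "cfam K i \<subseteq> cfam K i"
  using gfamD(1)[OF gfam_cfam] by auto

lemma subspace_pfam: "UU.subspace (pfam i)"
  unfolding pfam_def by (rule UU.subspace_sum_space[OF subspace_lat ext_props(1)[OF K1 cfam_sub]])

lemma pfam_lat: "pfam i \<subseteq> lat ell i"
  unfolding pfam_def
  by (rule UU.sum_space_least[OF subspace_lat lat_mono ext_subset_lat[OF cfam_lat]]) (simp add: dt_split)

lemma dim_pfam:
  "UU.dim (pfam i) + UU.dim (ext K1 lcov i) = UU.dim (lat \<Delta> i) + UU.dim (ext K1 (cfam K) i)"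
  unfolding pfam_def lat_Int_ext[symmetric]
  by (rule UU.dim_sum_space[OF subspace_lat fin_span_lat ext_props(1)[OF K1 cfam_sub]
        fin_span_sub_graded_free[OF ext_props(2)[OF K1 cfam_sub]]])

text \<open>The sum of the two submodules contains \<open>D1\<close> times the lattice and the product of the differences of the
  generic element times the lattice. Since these factors are coprime, the two multiples of the lattice meet
  in the multiple by the product, and the defect is that of a complete intersection of codimension two.\<close>

lemma pfam_lower:
  defines "a \<equiv> 2 * (card (carrier \<Gamma>) - 1)"
  shows "UU.dim (sh a (lat ell) i) + UU.dim (sh dD (lat ell) i) \<le> UU.dim (pfam i) + UU.dim (sh (a + dD) (lat ell) i)"
proof -
  let ?X = "smul (lag K1) ` sh a (lat ell) i" and ?Y = "smul D1 ` sh dD (lat ell) i"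
  let ?Z = "smul (lag K1 * D1) ` sh (a + dD) (lat ell) i"
  have s: "UU.subspace (sh e (lat ell) i)" "UU.fin_span (sh e (lat ell) i)" for e
    by (rule subspace_sh[OF subspace_lat], rule fin_span_sh[OF fin_span_lat])
  have lag0: "lag K1 \<noteq> 0" by (rule lag_nonzero[OF K1])
  have dims: "UU.dim ?X = UU.dim (sh a (lat ell) i)" "UU.dim ?Y = UU.dim (sh dD (lat ell) i)"
    "UU.dim ?Z = UU.dim (sh (a + dD) (lat ell) i)"
    by (rule dim_image_smul[OF s lag0], rule dim_image_smul[OF s nonzero(2)])
       (rule dim_image_smul[OF s], use lag0 nonzero in simp)
  have X: "UU.subspace ?X" "UU.fin_span ?X" by (rule subspace_image_smul[OF s(1)], rule fin_span_image_smul[OF s(2)])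
  have Y: "UU.subspace ?Y" "UU.fin_span ?Y" by (rule subspace_image_smul[OF s(1)], rule fin_span_image_smul[OF s(2)])
  have Z: "UU.subspace ?Z" "UU.fin_span ?Z" by (rule subspace_image_smul[OF s(1)], rule fin_span_image_smul[OF s(2)])
  have "?X \<subseteq> pfam i"
  proof (intro image_subsetI)
    fix f assume "f \<in> sh a (lat ell) i"
    then show "smul (lag K1) f \<in> pfam i"
    proof (rule sh_closed[OF _ subspace_pfam])
      fix i f assume "f \<in> lat ell i"
      then have "smul (lag K1) f \<in> ext K1 (cfam K) (a + i)"
        unfolding a_def by (intro lag_in_ext[OF K1] subsetD[OF lat_graded])
      then show "smul (lag K1) f \<in> pfam (a + i)"
        unfolding pfam_def by (rule subsetD[OF UU.sum_space_upper2[OF subspace_lat]])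
    qed simp
  qed
  moreover have "?Y \<subseteq> pfam i"
  proof (intro image_subsetI)
    fix f assume "f \<in> sh dD (lat ell) i"
    then show "smul D1 f \<in> pfam i"
    proof (rule sh_closed[OF _ subspace_pfam])
      fix i f assume "f \<in> lat ell i"
      then have "smul D1 f \<in> lat \<Delta> (dD + i)" by (rule D1_lat)
      then show "smul D1 f \<in> pfam (dD + i)"
        unfolding pfam_def by (rule subsetD[OF UU.sum_space_upper1[OF ext_props(1)[OF K1 cfam_sub]]])
    qed simp
  qed
  ultimately have "UU.sum_space ?X ?Y \<subseteq> pfam i" by (rule UU.sum_space_least[OF subspace_pfam])
  then have le: "UU.dim (UU.sum_space ?X ?Y) \<le> UU.dim (pfam i)"
    by (rule UU.dim_subset_fin[OF UU.fin_span_subset[OF fin_span_lat pfam_lat]])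
  have "?X \<inter> ?Y \<subseteq> ?Z"
  proof
    fix w assume "w \<in> ?X \<inter> ?Y"
    then obtain f h where f: "f \<in> sh a (lat ell) i" "w = smul (lag K1) f"
      and h: "h \<in> sh dD (lat ell) i" "w = smul D1 h" by blast
    show "w \<in> ?Z"
    proof (cases "w = 0")
      case True
      then show ?thesis using UU.subspace_0[OF Z(1)] by simp
    next
      case False
      then have "f \<noteq> 0" using f(2) by auto
      then have fl: "a \<le> i" "f \<in> lat ell (i - a)" using f(1) by (auto simp: sh_def split: if_splits)
      have "D1 dvd f j" for j
      proof (rule D1_regular_lag)
        have "smul (lag K1) f j = smul D1 h j" using f(2) h(2) by simp
        then show "D1 dvd lag K1 * f j" by (simp add: smul_apply)
      qed
      then have "\<forall>j. \<exists>u. f j = D1 * u" unfolding dvd_def by blast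
      then obtain u where u': "\<forall>j. f j = D1 * u j" by (rule choice[THEN exE])
      have u: "f = smul D1 u" by (rule ext) (simp add: u' smul_apply)
      obtain j where j: "f j \<noteq> 0" using \<open>f \<noteq> 0\<close> by (auto simp: fun_eq_iff zero_fun_apply)
      have fg: "f \<in> graded_free m K (i - a)" by (rule subsetD[OF lat_graded fl(2)])
      have "dD \<le> i - a"
        by (rule homog_cofactor_ge[OF homog_D1(1), of _ "u j"])
           (use fg j u' in \<open>simp_all add: graded_free_def\<close>)
      then have deg: "dD + (i - (a + dD)) = i - a" "a + dD \<le> i" using fl(1) by auto
      have "u \<in> graded_free m K (i - (a + dD))"
        by (rule graded_free_cofactor[OF _ D1_over_K homog_D1(1) nonzero(2)]) (use fg in \<open>simp only: u[symmetric] deg(1)\<close>)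
      moreover have "ell dvd num m F k u" if "k < m" for k
        using fl(2) that by - (rule ell_coprime, simp add: lat_def u num_smul)
      ultimately have "u \<in> sh (a + dD) (lat ell) i" using deg by (simp add: sh_def lat_def)
      moreover have "w = smul (lag K1 * D1) u" unfolding f(2) by (subst u) (simp add: smul_smul)
      ultimately show ?thesis by blast
    qed
  qed
  then have "UU.dim (?X \<inter> ?Y) \<le> UU.dim ?Z" by (rule UU.dim_subset_fin[OF Z(2)])
  then show ?thesis using UU.dim_sum_space[OF X Y] dims le by linarith
qed

definition fsum :: "real \<Rightarrow> real" where
  "fsum t = (\<Sum>k<m. t ^ d k)"

text \<open>By inclusion and exclusion, \<open>P\<close> is the series of the sum of the module generated by \<open>F\<close> and of the one
  generated by the covariants. The two factors in the error are both of order \<open>1 - t\<close>.\<close>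

theorem lattice_estimate:
  assumes t: "0 \<le> t" "t < 1"
  defines "P \<equiv> fsum t / (1 - t) ^ K + esum t * hval (cfam K) t - esum t * (fsum t * hval bfam t)"
  shows "P \<le> hval (lat ell) t"
    "hval (lat ell) t - P \<le> hval (lat ell) t * ((1 - t ^ (2 * (card (carrier \<Gamma>) - 1))) * (1 - t ^ dD))"
proof -
  let ?a = "2 * (card (carrier \<Gamma>) - 1)"
  let ?A = "graded_free 1 K :: nat \<Rightarrow> 'k pvec set"
  have A: "hsum ?A t" "hval ?A t = 1 / (1 - t) ^ K" using hval_graded_free[OF t, of 1 K] by auto
  have bsub: "bfam i \<subseteq> ?A i" for i by (auto simp: bfam_def)
  have B: "hsum bfam t"
    by (rule hsum_gfam[OF _ t, of 1 K]) (unfold gfam_def, intro allI conjI subspace_bfam bsub)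
  have L: "hsum (lat q) t" for q by (rule hsum_gfam[OF gfam_lat t])
  have hcombo: "hval (combos Y) t = fsum t * hval Y t" if Y: "\<And>i. UU.subspace (Y i)" "\<And>i. Y i \<subseteq> ?A i" "hsum Y t" for Y
    using hval_sum(2)[of "{..<m}" "\<lambda>k. sh (d k) Y" t "combos Y", OF _ hval_sh(1)[OF Y(3)] combos_dim[OF Y(1,2)]]
    by (simp add: hval_sh(2)[OF Y(3)] fsum_def sum_distrib_right)
  have hL1: "hval (lat \<Delta>) t = fsum t / (1 - t) ^ K"
  proof -
    have "lat \<Delta> = combos ?A" by (rule ext) (rule lat_Delta)
    then show ?thesis using hcombo[OF subspace_graded_free _ A(1)] A(2) by simp
  qed
  have hlcov: "hval lcov t = fsum t * hval bfam t"
  proof -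
    have "lcov = combos bfam" by (rule ext) (rule lcov_eq)
    then show ?thesis using hcombo[OF subspace_bfam bsub B] by simp
  qed
  note E2 = hval_ext[OF K1 cfam_sub t] and E1 = hval_ext[OF K1 lcov_props t]
  have Ps: "hsum pfam t"
    by (rule hsum_gfam[OF _ t, of m K])
       (unfold gfam_def, intro allI conjI subspace_pfam subset_trans[OF pfam_lat lat_graded])
  have "hval pfam t + hval (ext K1 lcov) t = hval (lat \<Delta>) t + hval (ext K1 (cfam K)) t"
    by (rule hval_add_eq[OF Ps E1(1) L E2(1) dim_pfam])
  then have P: "hval pfam t = P" unfolding E1(2) E2(2) hL1 hlcov P_def by linarith
  show "P \<le> hval (lat ell) t"
    unfolding P[symmetric] by (rule hval_le[OF Ps L t(1)]) (rule UU.dim_subset_fin[OF fin_span_lat pfam_lat])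
  have "hval (sh ?a (lat ell)) t + hval (sh dD (lat ell)) t \<le> hval pfam t + hval (sh (?a + dD) (lat ell)) t"
    by (rule hval_add_le[OF hval_sh(1)[OF L] hval_sh(1)[OF L] Ps hval_sh(1)[OF L] t(1) pfam_lower])
  then have "t ^ ?a * hval (lat ell) t + t ^ dD * hval (lat ell) t \<le> P + t ^ ?a * t ^ dD * hval (lat ell) t"
    unfolding hval_sh(2)[OF L] P power_add .
  then show "hval (lat ell) t - P \<le> hval (lat ell) t * ((1 - t ^ ?a) * (1 - t ^ dD))"
    by (simp add: algebra_simps)
qed

end


section \<open>The first two terms of the expansion at \<open>t = 1\<close>\<close>

text \<open>Here \<open>x\<close> stands for the quotient of the Hilbert series. The unknown factor \<open>r\<close> is only known to be
  \<open>1 + O(1 - t)\<close>, but it enters multiplied by \<open>c - f\<close>, which tends to zero.\<close>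

lemma limit_from_estimates:
  fixes x r f \<epsilon> :: "real \<Rightarrow> real" and Q :: "real poly"
  assumes eq: "\<And>t. 0 < t \<Longrightarrow> t < 1 \<Longrightarrow> r t * x t = poly Q t - \<epsilon> t - f t * (1 - r t)"
    and \<epsilon>: "\<And>t. 0 < t \<Longrightarrow> t < 1 \<Longrightarrow> 0 \<le> \<epsilon> t" "\<And>t. 0 < t \<Longrightarrow> t < 1 \<Longrightarrow> \<epsilon> t \<le> c * ((1 - t ^ a) * (1 - t ^ d))"
    and r: "\<And>t. 0 < t \<Longrightarrow> t < 1 \<Longrightarrow> t ^ a \<le> r t" "\<And>t. 0 < t \<Longrightarrow> t < 1 \<Longrightarrow> r t \<le> 1"
    and f: "\<And>t. 0 < t \<Longrightarrow> t < 1 \<Longrightarrow> f t \<le> c" "(f \<longlongrightarrow> c) (at_left 1)"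
    and Q: "poly Q 1 = c" and c: "0 \<le> c"
  shows "((\<lambda>t. (c - x t) / (1 - t)) \<longlongrightarrow> poly (pderiv Q) 1) (at_left 1)"
proof -
  have ev: "\<forall>\<^sub>F t :: real in at_left 1. 0 < t \<and> t < 1"
    using eventually_at_left_real[of 0 1] by simp
  define h where "h t = (c - x t) / (1 - t) * r t" for t
  define g where "g t = (poly Q 1 - poly Q t) / (1 - t)" for t
  have "((\<lambda>t. (poly Q t - poly Q 1) / (t - 1)) \<longlongrightarrow> poly (pderiv Q) 1) (at_left 1)"
    using has_field_derivative_at_within[OF poly_DERIV[of Q 1]] unfolding has_field_derivative_iff .
  moreover have "(\<lambda>t. (poly Q t - poly Q 1) / (t - 1)) = g"
    unfolding g_def by (rule ext) (metis minus_diff_eq minus_divide_divide)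
  ultimately have g: "(g \<longlongrightarrow> poly (pderiv Q) 1) (at_left 1)" by simp
  have bern: "1 - t ^ a \<le> real a * (1 - t)" if "0 < t" for t :: real
    using Bernoulli_inequality[of "t - 1" a] that by (simp add: algebra_simps)
  have bound: "\<bar>h t - g t\<bar> \<le> c * real a * (1 - t ^ d) + (c - f t) * real a" if t: "0 < t" "t < 1" for t
  proof -
    have 1: "(h t - g t) * (1 - t) = \<epsilon> t - (c - f t) * (1 - r t)"
    proof -
      have "(h t - g t) * (1 - t) = (c - x t) * r t - (c - poly Q t)"
      proof -
        have "h t * (1 - t) = (c - x t) * r t" "g t * (1 - t) = c - poly Q t"
          using t by (simp_all add: h_def g_def Q)
        then show ?thesis by (simp add: left_diff_distrib)
      qed
      also have "\<dots> = \<epsilon> t - (c - f t) * (1 - r t)"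
        using eq[OF t] by (simp add: algebra_simps)
      finally show ?thesis .
    qed
    have "c * ((1 - t ^ a) * (1 - t ^ d)) \<le> c * ((real a * (1 - t)) * (1 - t ^ d))"
      using t bern[OF t(1)] by (intro mult_left_mono mult_right_mono c) (simp_all add: power_le_one)
    then have 2: "\<epsilon> t \<le> (c * real a * (1 - t ^ d)) * (1 - t)" using \<epsilon>(2)[OF t] by (simp add: mult_ac)
    have "(c - f t) * (1 - r t) \<le> (c - f t) * (real a * (1 - t))"
      using r(1)[OF t] bern[OF t(1)] f(1)[OF t] by (intro mult_left_mono) auto
    then have 3: "(c - f t) * (1 - r t) \<le> ((c - f t) * real a) * (1 - t)" by (simp add: mult_ac)
    have 4: "0 \<le> (c - f t) * (1 - r t)" using f(1)[OF t] r(2)[OF t] by simp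
    have "\<bar>h t - g t\<bar> * (1 - t) = \<bar>\<epsilon> t - (c - f t) * (1 - r t)\<bar>"
      unfolding 1[symmetric] abs_mult using t by simp
    also have "\<dots> \<le> (c * real a * (1 - t ^ d) + (c - f t) * real a) * (1 - t)"
      unfolding distrib_right using 2 3 4 \<epsilon>(1)[OF t] by linarith
    finally show ?thesis by (rule mult_right_le_imp_le) (use t in simp)
  qed
  have "((\<lambda>t. c * real a * (1 - t ^ d) + (c - f t) * real a) \<longlongrightarrow> c * real a * (1 - 1 ^ d) + (c - c) * real a) (at_left 1)"
    by (intro tendsto_intros f(2))
  then have B: "((\<lambda>t. c * real a * (1 - t ^ d) + (c - f t) * real a) \<longlongrightarrow> 0) (at_left 1)" by simp
  have "((\<lambda>t. \<bar>h t - g t\<bar>) \<longlongrightarrow> 0) (at_left 1)"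
    by (rule tendsto_sandwich[OF _ eventually_mono[OF ev] tendsto_const[of 0] B]) (simp, blast intro: bound)
  then have "((\<lambda>t. h t - g t) \<longlongrightarrow> 0) (at_left 1)" by (rule tendsto_rabs_zero_cancel)
  from tendsto_add[OF this g] have h: "(h \<longlongrightarrow> poly (pderiv Q) 1) (at_left 1)" by simp
  have "((\<lambda>t :: real. t ^ a) \<longlongrightarrow> 1 ^ a) (at_left 1)" by (intro tendsto_intros)
  then have A: "((\<lambda>t :: real. t ^ a) \<longlongrightarrow> 1) (at_left 1)" by simp
  have "(r \<longlongrightarrow> 1) (at_left 1)"
    by (rule tendsto_sandwich[OF eventually_mono[OF ev] eventually_mono[OF ev] A tendsto_const[of 1]])
       (blast intro: r)+
  from tendsto_divide[OF h this] have "((\<lambda>t. h t / r t) \<longlongrightarrow> poly (pderiv Q) 1) (at_left 1)" by simp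
  moreover have "\<forall>\<^sub>F t in at_left 1. h t / r t = (c - x t) / (1 - t)"
    using ev
  proof eventually_elim
    case (elim t)
    then have "0 < r t" using r(1)[of t] zero_less_power[of t a] by linarith
    then show ?case by (simp add: h_def)
  qed
  ultimately show ?thesis by (rule Lim_transform_eventually)
qed

lemma map_poly_of_int_mult:
  "map_poly of_int (P * Q) = (map_poly of_int P * map_poly of_int Q :: 'a::{comm_ring_1,ring_char_0} poly)"
  by (rule poly_eqI) (simp add: coeff_map_poly coeff_mult)

lemma map_poly_of_int_pderiv: "map_poly of_int (pderiv P) = pderiv (map_poly real_of_int P)"
  by (rule poly_eqI) (simp add: coeff_map_poly coeff_pderiv)

lemma poly_map_of_int_power: "poly (map_poly real_of_int (P ^ k)) t = poly (map_poly of_int P) t ^ k"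
  by (induction k) (simp_all add: map_poly_of_int_mult map_poly_1)

lemma poly_sums: "(\<lambda>i. real_of_int (coeff P i) * t ^ i) sums poly (map_poly of_int P) t"
proof -
  let ?P = "map_poly real_of_int P"
  have "(\<lambda>i. coeff ?P i * t ^ i) sums (\<Sum>i\<le>degree ?P. coeff ?P i * t ^ i)"
    by (rule sums_finite) (auto simp: coeff_eq_0)
  then show ?thesis by (simp add: poly_altdef coeff_map_poly)
qed

lemma poly_map_of_int_1: "poly (map_poly real_of_int P) 1 = of_int (poly P 1)"
proof -
  have "(\<lambda>i. real_of_int (coeff P i) * 1 ^ i) sums (\<Sum>i\<le>degree P. real_of_int (coeff P i) * 1 ^ i)"
    by (rule sums_finite) (auto simp: coeff_eq_0)
  then have "poly (map_poly real_of_int P) 1 = (\<Sum>i\<le>degree P. real_of_int (coeff P i) * 1 ^ i)"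
    by (rule sums_unique2[OF poly_sums])
  then show ?thesis by (simp add: poly_altdef)
qed

text \<open>Evaluating an identity between power series and polynomials.\<close>

lemma hval_eval:
  assumes eq: "fps_of_poly P * hilb X = fps_of_poly Q" and X: "hsum X t" and t: "0 \<le> t"
  shows "poly (map_poly of_int P) t * hval X t = poly (map_poly of_int Q) t"
proof -
  let ?a = "\<lambda>i. real_of_int (coeff P i) * t ^ i" and ?b = "\<lambda>i. real (UU.dim (X i)) * t ^ i"
  have "summable (\<lambda>i. norm (?a i))"
    by (rule summable_finite[of "{..degree P}"]) (auto simp: coeff_eq_0)
  moreover have "summable (\<lambda>i. norm (?b i))" using X t by (simp add: hsum_def)
  ultimately have "(\<lambda>k. \<Sum>i\<le>k. ?a i * ?b (k - i)) sums (suminf ?a * suminf ?b)"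
    by (rule Cauchy_product_sums)
  moreover have "(\<Sum>i\<le>k. ?a i * ?b (k - i)) = real_of_int (coeff Q k) * t ^ k" for k
  proof -
    have "(\<Sum>i\<le>k. ?a i * ?b (k - i)) = (\<Sum>i\<le>k. (real_of_int (coeff P i) * real (UU.dim (X (k - i)))) * t ^ k)"
      by (intro sum.cong refl) (simp add: mult_ac flip: power_add)
    also have "\<dots> = real_of_int (\<Sum>i\<le>k. coeff P i * int (UU.dim (X (k - i)))) * t ^ k"
      by (simp add: sum_distrib_right)
    also have "(\<Sum>i\<le>k. coeff P i * int (UU.dim (X (k - i)))) = fps_nth (fps_of_poly P * hilb X) k"
      by (simp add: fps_mult_nth atLeast0AtMost)
    finally show ?thesis by (simp add: eq)
  qed
  ultimately have "(\<lambda>k. real_of_int (coeff Q k) * t ^ k) sums (suminf ?a * suminf ?b)" by simp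
  then have "suminf ?a * suminf ?b = poly (map_poly of_int Q) t" by (rule sums_unique2[OF _ poly_sums])
  moreover have "suminf ?a = poly (map_poly of_int P) t" by (rule sums_unique[OF poly_sums, symmetric])
  ultimately show ?thesis by (simp add: hval_def)
qed

context lin_action
begin

definition ifam :: "nat \<Rightarrow> nat \<Rightarrow> 'k pvec set" where
  "ifam K i = {f \<in> graded_free 1 K i. invariant (f 0)}"

lemma trivial_action: "lin_action \<Gamma> n 1 lin (\<lambda>_ _ _. 1)"
  by unfold_locales (auto simp: fin gvar_mult gvar_one intro: faithful)

lemma trivial_cfam: "lin_action.cfam \<Gamma> n 1 lin (\<lambda>_ _ _. 1) K = ifam K"
proof -
  interpret triv: lin_action \<Gamma> n 1 lin "\<lambda>_ _ _. 1" by (rule trivial_action)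
  have "F \<in> triv.cfam K i \<longleftrightarrow> F \<in> ifam K i" for F i
  proof -
    have "triv.T g F = F \<longleftrightarrow> act g (F 0) = F 0" if F: "F \<in> graded_free 1 K i" for g
    proof -
      have T: "triv.T g F j = (if j = 0 then act g (F 0) else 0)" for j
        unfolding triv.T_def by (simp add: single_one)
      have "F j = 0" if "j \<noteq> 0" for j using F that by (simp add: graded_free_def)
      then show ?thesis unfolding fun_eq_iff T by metis
    qed
    then show ?thesis
      unfolding triv.cfam_def triv.cov_def ifam_def invariant_def using triv.graded_free_vecs[of F K i] by blast
  qed
  then show ?thesis by (auto simp: fun_eq_iff)
qed

lemma cov_smul_Var: "n \<le> v \<Longrightarrow> smul (Var v) F \<in> cov \<longleftrightarrow> F \<in> cov"
proof
  assume v: "n \<le> v" and F: "smul (Var v) F \<in> cov"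
  have "F j = 0" if "j \<ge> m" for j
    using covD(1)[OF F] that by (auto simp: vecs_def smul_apply)
  moreover have "T g F = F" if "g \<in> carrier \<Gamma>" for g
  proof -
    have "smul (Var v) (T g F) = smul (Var v) F"
      using covD(2)[OF F that] v by (simp add: T_smul act_Var_ge)
    then show ?thesis by (simp add: smul_cancel)
  qed
  ultimately show "F \<in> cov" by (auto simp: cov_def vecs_def)
next
  assume "n \<le> v" "F \<in> cov"
  then show "smul (Var v) F \<in> cov" by (intro cov_smul) (simp_all add: invariant_def act_Var_ge)
qed

text \<open>Setting the extra variables to zero one by one shows that each of them contributes a factor \<open>1 / (1 - t)\<close>.\<close>

lemma hval_cfam:
  assumes t: "0 \<le> t" "t < 1"
  shows "hval (cfam (n + e)) t = hval (cfam n) t / (1 - t) ^ e"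
proof (induction e)
  case (Suc e)
  have "vsubst (zero_var (n + e)) F \<in> cov" if "F \<in> cov" for F
    by (rule vsubst_cov[OF that]) (auto simp: act_simps act_Var_ge)
  moreover have "hsum (\<lambda>i. cov \<inter> graded_free m (n + e) i) t"
    using hsum_gfam[OF gfam_cfam t, of "n + e"] unfolding cfam_def .
  ultimately have "hval (cfam (Suc (n + e))) t = hval (cfam (n + e)) t / (1 - t)"
    unfolding cfam_def using hval_zero_var(2)[where K = "n + e" and m = m, OF subspace_cov _ cov_smul_Var t] by simp
  then show ?case by (simp add: Suc)
qed simp

end

context covariant_tuple
begin

lemma bfam_ifam: "bfam = ifam K"
  by (rule ext) (simp add: bfam_def ifam_def)

lemma invariants_estimate:
  assumes t: "0 \<le> t" "t < 1"
  shows "esum t * hval bfam t \<le> 1 / (1 - t) ^ K"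
    "t ^ (2 * (card (carrier \<Gamma>) - 1)) * (1 / (1 - t) ^ K) \<le> esum t * hval bfam t"
proof -
  interpret triv: lin_action \<Gamma> n 1 lin "\<lambda>_ _ _. 1" by (rule trivial_action)
  show "esum t * hval bfam t \<le> 1 / (1 - t) ^ K"
    "t ^ (2 * (card (carrier \<Gamma>) - 1)) * (1 / (1 - t) ^ K) \<le> esum t * hval bfam t"
    using triv.cfam_estimate[OF K1 t] unfolding trivial_cfam bfam_ifam by simp_all
qed

text \<open>The lattice is a module over all polynomials, so the variables can serve as operators of degree one.\<close>

lemma lat_rational:
  obtains Q :: "int poly" where "\<forall>t. 0 \<le> t \<longrightarrow> t < 1 \<longrightarrow> (1 - t) ^ K * hval (lat ell) t = poly (map_poly of_int Q) t"
proof -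
  let ?zs = "map (\<lambda>v. (Var v :: (nat, 'k) mpoly, 1 :: nat)) [0..<K]"
  let ?Y = "\<lambda>i :: nat. if i = 0 then graded_free m K 0 else {0 :: 'k pvec}"
  have ops: "grade_op K zd" if "zd \<in> set ?zs" for zd
    using that by (auto simp: grade_op_def intro: polys_over_Var)
  have Y: "gfam m K ?Y" using subspace_graded_free UU.subspace_0[OF subspace_graded_free] by (auto simp: gfam_def)
  note gen = generated_by_props(1,2)[where zs = ?zs and K = K and m = m and Y = ?Y, OF ops Y]
  have st: "stable_under m K ?zs (lat ell)"
  proof (rule stable_underI[OF subspace_lat lat_graded])
    fix z e i F assume z: "(z, e) \<in> set ?zs" and F: "F \<in> lat ell i"
    show "smul z F \<in> lat ell (e + i)" by (rule lat_smul[OF F]) (use z in \<open>auto intro: polys_over_Var\<close>)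
  qed
  have "\<exists>Q :: int poly. prod_list (map (\<lambda>(z, d). 1 - fps_X ^ d) ?zs) * hilb (lat ell) = fps_of_poly Q"
  proof (rule hilbert_series_rational[where zs = ?zs and K = K and m = m and Y = ?Y and D = 1, OF ops Y])
    show "?Y i = {0}" if "i \<ge> 1" for i using that by simp
    show "uvec j \<in> ?Y 0" if "j < m" for j using uvec_graded[OF that] by simp
    show "stable_under m K ?zs (lat ell)" by (rule st)
    fix b i :: nat and F :: "'k pvec" assume b: "b < K" and F: "F \<in> ?Y i"
    have "F \<in> generated_by ?zs ?Y i" using gen(2) F by (auto simp: le_fun_def)
    moreover have "(Var b, 1) \<in> set ?zs" using b by auto
    ultimately show "smul (Var b) F \<in> generated_by ?zs ?Y (Suc i)"
      using stable_underD(2)[OF gen(1), of "Var b" 1] by simp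
  qed
  then obtain Q :: "int poly" where Q: "prod_list (map (\<lambda>(z, d). 1 - fps_X ^ d) ?zs) * hilb (lat ell) = fps_of_poly Q" ..
  have one: "fps_of_poly [:1, -1:] = (1 - fps_X :: int fps)"
    by (simp add: fps_of_poly_pCons flip: fps_const_neg)
  have "prod_list (map (\<lambda>(z, d). 1 - fps_X ^ d) (map (\<lambda>v. (Var v :: (nat, 'k) mpoly, 1 :: nat)) vs)) =
      fps_of_poly ([:1, -1:] ^ length vs :: int poly)" for vs
    by (induction vs) (simp_all add: fps_of_poly_mult one)
  then have Q': "fps_of_poly ([:1, -1:] ^ K) * hilb (lat ell) = fps_of_poly Q" using Q by simp
  have P: "poly (map_poly of_int ([:1, -1:] ^ K :: int poly)) t = (1 - t) ^ K" for t :: real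
    by (simp add: poly_map_of_int_power map_poly_pCons)
  show ?thesis
    by (rule that[of Q]) (use hval_eval[OF Q' hsum_gfam[OF gfam_lat]] P in simp)
qed

text \<open>The derivative of the numerator at \<open>1\<close> is the wanted integer: the lattice lies between the free module
  and a multiple of it, so the numerator has the value \<open>m\<close> at \<open>1\<close> and is at most \<open>m\<close> before it.\<close>

lemma lattice_limit:
  obtains \<sigma> :: int where "\<sigma> \<ge> 0" "ell dvd 1 \<longrightarrow> \<sigma> = 0"
    "(\<forall>t. 0 < t \<longrightarrow> t < 1 \<longrightarrow> hval (lat ell) t \<le> (real m - (1 - t)) / (1 - t) ^ K) \<longrightarrow> \<sigma> \<ge> 1"
    "((\<lambda>t. (real m - hval (cfam n) t / hval (ifam n) t) / (1 - t)) \<longlongrightarrow> of_int \<sigma>) (at_left 1)"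
proof -
  obtain Q0 :: "int poly" where Q0: "\<forall>t. 0 \<le> t \<longrightarrow> t < 1 \<longrightarrow> (1 - t) ^ K * hval (lat ell) t = poly (map_poly of_int Q0) t"
    by (rule lat_rational)
  define Q :: "real poly" where "Q = map_poly of_int Q0"
  let ?a = "2 * (card (carrier \<Gamma>) - 1)"
  have hL: "hval (lat ell) t = poly Q t / (1 - t) ^ K" if "0 < t" "t < 1" for t
    using Q0[THEN spec, of t] that by (simp add: Q_def field_simps)
  have L: "hsum (lat ell) t" if "0 < t" "t < 1" for t by (rule hsum_gfam[OF gfam_lat]) (use that in auto)
  have Qle: "poly Q t \<le> real m" "t ^ dsum * real m \<le> poly Q t" if t: "0 < t" "t < 1" for t
  proof -
    have t': "0 \<le> t" using t by simp
    note U = hval_graded_free[OF t' t(2), of m K]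
    have "hval (lat ell) t \<le> hval (graded_free m K :: nat \<Rightarrow> 'k pvec set) t"
      by (rule hval_le[OF L[OF t] U(1) t']) (rule UU.dim_subset_fin[OF fin_span_graded_free lat_graded])
    then show "poly Q t \<le> real m" using t by (simp add: U(2) hL[OF t] divide_le_cancel)
    have "hval (sh dsum (graded_free m K :: nat \<Rightarrow> 'k pvec set)) t \<le> hval (lat ell) t"
    proof (rule hval_le[OF hval_sh(1)[OF U(1)] L[OF t] t'])
      fix i
      let ?S = "sh dsum (graded_free m K) i :: 'k pvec set"
      have s: "UU.subspace ?S" "UU.fin_span ?S"
        by (rule subspace_sh[OF subspace_graded_free], rule fin_span_sh[OF fin_span_graded_free])
      have "smul \<Delta> ` ?S \<subseteq> lat ell i"
        by (intro image_subsetI) (erule sh_closed, rule subspace_lat, erule Delta_lat, simp)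
      then have "UU.dim (smul \<Delta> ` ?S) \<le> UU.dim (lat ell i)" by (rule UU.dim_subset_fin[OF fin_span_lat])
      then show "UU.dim ?S \<le> UU.dim (lat ell i)" unfolding dim_image_smul[OF s dt_nonzero] .
    qed
    then show "t ^ dsum * real m \<le> poly Q t" using t by (simp add: hval_sh(2)[OF U(1)] U(2) hL[OF t] divide_le_cancel)
  qed
  have ev: "\<forall>\<^sub>F t :: real in at_left 1. 0 < t \<and> t < 1"
    using eventually_at_left_real[of 0 1] by simp
  have Q1: "poly Q 1 = real m"
  proof (rule tendsto_unique)
    show "(poly Q \<longlongrightarrow> poly Q 1) (at_left 1)" by (intro tendsto_intros)
    have "((\<lambda>t :: real. t ^ dsum * real m) \<longlongrightarrow> 1 ^ dsum * real m) (at_left 1)" by (intro tendsto_intros)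
    then have A: "((\<lambda>t :: real. t ^ dsum * real m) \<longlongrightarrow> real m) (at_left 1)" by simp
    show "(poly Q \<longlongrightarrow> real m) (at_left 1)"
      by (rule tendsto_sandwich[OF eventually_mono[OF ev] eventually_mono[OF ev] A tendsto_const[of "real m"]])
         (blast intro: Qle)+
  qed simp
  define \<sigma> where "\<sigma> = poly (pderiv Q0) 1"
  have D: "poly (pderiv Q) 1 = of_int \<sigma>"
    unfolding Q_def \<sigma>_def map_poly_of_int_pderiv[symmetric] by (rule poly_map_of_int_1)
  have "((\<lambda>t. (poly Q t - poly Q 1) / (t - 1)) \<longlongrightarrow> poly (pderiv Q) 1) (at_left 1)"
    using has_field_derivative_at_within[OF poly_DERIV[of Q 1]] unfolding has_field_derivative_iff .
  then have slope: "((\<lambda>t. (real m - poly Q t) / (1 - t)) \<longlongrightarrow> of_int \<sigma>) (at_left 1)"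
    unfolding D Q1 by (rule Lim_transform_eventually)
      (intro always_eventually allI, metis minus_diff_eq minus_divide_divide)
  show ?thesis
  proof (rule that[of \<sigma>])
    have "(0 :: real) \<le> of_int \<sigma>"
      by (rule tendsto_lowerbound[OF slope eventually_mono[OF ev]]) (use Qle(1) in simp_all)
    then show "\<sigma> \<ge> 0" by simp
    show "ell dvd 1 \<longrightarrow> \<sigma> = 0"
    proof
      assume "ell dvd 1"
      have "lat ell = graded_free m K"
      proof (rule ext)
        fix i
        have "ell dvd x" for x using \<open>ell dvd 1\<close> one_dvd dvd_trans by blast
        then show "lat ell i = graded_free m K i" by (simp add: lat_def)
      qed
      then have Qm: "poly Q t = real m" if "0 < t" "t < 1" for t
        using hL[OF that] hval_graded_free(2)[of t m K, where ?'k = 'k] that by simp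
      have "\<forall>\<^sub>F t in at_left 1. (real m - poly Q t) / (1 - t) = 0"
        by (rule eventually_mono[OF ev]) (simp add: Qm)
      note lim = Lim_transform_eventually[OF slope this]
      have "of_int \<sigma> = (0 :: real)"
        using tendsto_unique[OF trivial_limit_at_left_real lim tendsto_const] by simp
      then show "\<sigma> = 0" by simp
    qed
    show "(\<forall>t. 0 < t \<longrightarrow> t < 1 \<longrightarrow> hval (lat ell) t \<le> (real m - (1 - t)) / (1 - t) ^ K) \<longrightarrow> \<sigma> \<ge> 1"
    proof
      assume *: "\<forall>t. 0 < t \<longrightarrow> t < 1 \<longrightarrow> hval (lat ell) t \<le> (real m - (1 - t)) / (1 - t) ^ K"
      have "1 \<le> (real m - poly Q t) / (1 - t)" if t: "0 < t" "t < 1" for t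
      proof -
        have "poly Q t \<le> real m - (1 - t)" using *[rule_format, OF t] t by (simp add: hL[OF t] divide_le_cancel)
        then show ?thesis using t by (simp add: le_divide_eq)
      qed
      then have "(1 :: real) \<le> of_int \<sigma>"
        by (intro tendsto_lowerbound[OF slope eventually_mono[OF ev]]) simp_all
      then show "\<sigma> \<ge> 1" by simp
    qed
    let ?r = "\<lambda>t. esum t * hval bfam t * (1 - t) ^ K"
    let ?P = "\<lambda>t. fsum t / (1 - t) ^ K + esum t * hval (cfam K) t - esum t * (fsum t * hval bfam t)"
    let ?e = "\<lambda>t. (hval (lat ell) t - ?P t) * (1 - t) ^ K"
    show "((\<lambda>t. (real m - hval (cfam n) t / hval (ifam n) t) / (1 - t)) \<longlongrightarrow> of_int \<sigma>) (at_left 1)"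
      unfolding D[symmetric]
    proof (rule limit_from_estimates[where r = ?r and \<epsilon> = ?e and f = fsum and a = ?a and d = dD and c = "real m"])
      show "((fsum) \<longlongrightarrow> real m) (at_left 1)"
      proof -
        have "((\<lambda>t. \<Sum>k<m. t ^ d k) \<longlongrightarrow> (\<Sum>k<m. 1 ^ d k)) (at_left (1 :: real))" by (intro tendsto_intros)
        then show ?thesis unfolding fsum_def[abs_def] by simp
      qed
      show "poly Q 1 = real m" "0 \<le> real m" by (simp_all add: Q1)
      fix t :: real assume t: "0 < t" "t < 1"
      have t': "0 \<le> t" using t by simp
      have p: "(1 - t) ^ K > 0" using t by simp
      note lo = invariants_estimate[OF t' t(2)] and le = lattice_estimate[OF t' t(2)]
      show r1: "?r t \<le> 1" using lo(1) p by (simp add: pos_le_divide_eq)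
      show r2: "t ^ ?a \<le> ?r t" using lo(2) p by (simp add: pos_divide_le_eq)
      have "fsum t \<le> (\<Sum>k<m. 1)" unfolding fsum_def using t by (intro sum_mono) (simp add: power_le_one)
      then show "fsum t \<le> real m" by simp
      show "0 \<le> ?e t" using le(1) p by simp
      show "?e t \<le> real m * ((1 - t ^ ?a) * (1 - t ^ dD))"
      proof -
        have "?e t \<le> hval (lat ell) t * ((1 - t ^ ?a) * (1 - t ^ dD)) * (1 - t) ^ K"
          by (rule mult_right_mono[OF le(2)]) (use p in simp)
        also have "\<dots> = poly Q t * ((1 - t ^ ?a) * (1 - t ^ dD))" using t by (simp add: hL[OF t])
        also have "\<dots> \<le> real m * ((1 - t ^ ?a) * (1 - t ^ dD))"
          by (rule mult_right_mono[OF Qle(1)[OF t]]) (use t in \<open>simp add: power_le_one\<close>)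
        finally show ?thesis .
      qed
      have "0 < ?r t" using r2 zero_less_power[OF t(1), of ?a] by linarith
      then have b0: "hval bfam t \<noteq> 0" by auto
      have K: "K = n + K1" by simp
      have hb: "hval bfam t = hval (ifam n) t / (1 - t) ^ K1"
        using lin_action.hval_cfam[OF trivial_action t' t(2), of K1] unfolding trivial_cfam bfam_ifam K .
      have hc: "hval (cfam K) t = hval (cfam n) t / (1 - t) ^ K1"
        unfolding K by (rule hval_cfam[OF t' t(2)])
      have q: "hval (cfam n) t / hval (ifam n) t = hval (cfam K) t / hval bfam t"
        unfolding hb hc using t by simp
      have "?r t * (hval (cfam n) t / hval (ifam n) t) = esum t * hval (cfam K) t * (1 - t) ^ K"
        unfolding q using b0 by simp
      also have "\<dots> = poly Q t - ?e t - fsum t * (1 - ?r t)"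
      proof -
        have "poly Q t = hval (lat ell) t * (1 - t) ^ K" using t by (simp add: hL[OF t])
        moreover have "fsum t / (1 - t) ^ K * (1 - t) ^ K = fsum t" using t by simp
        ultimately show ?thesis by (simp only: left_diff_distrib distrib_right) (simp add: algebra_simps)
      qed
      finally show "?r t * (hval (cfam n) t / hval (ifam n) t) = poly Q t - ?e t - fsum t * (1 - ?r t)" .
    qed
  qed
qed

end


context covariant_tuple
begin

text \<open>If an element of the inertia group of \<open>l\<close> acts nontrivially, then the coordinates of the vectors in the
  lattice satisfy a linear congruence modulo \<open>l\<close>.\<close>

lemma lat_congruence:
  assumes l: "l \<in> forms" and w: "w \<in> inertia l" and v: "v \<in> lat ell i" and r: "r < m"
  shows "l dvd (\<Sum>j<m. Const (rho w r j - (if r = j then 1 else 0)) * v j)"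
proof -
  let ?\<phi> = "\<lambda>v :: 'k pvec. \<Sum>j<m. Const (rho w r j - (if r = j then 1 else 0)) * v j"
  have \<phi>F: "l dvd ?\<phi> (F k)" if k: "k < m" for k
  proof -
    have Tr: "F k r = (\<Sum>j<m. Const (rho w r j) * act w (F k j))"
      using fun_cong[OF covD(2)[OF F_cov[OF k] inertia_carrier[OF w]], of r] r unfolding T_def by simp
    have "?\<phi> (F k) = (\<Sum>j<m. Const (rho w r j) * F k j) - (\<Sum>j<m. Const (if r = j then 1 else 0) * F k j)"
      by (simp add: single_diff left_diff_distrib sum_subtractf)
    also have "(\<Sum>j<m. Const (if r = j then 1 else 0) * F k j) = (\<Sum>j<m. if r = j then F k j else 0)"
      by (intro sum.cong refl) (simp add: single_one)
    also have "\<dots> = F k r" using r by simp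
    also have "(\<Sum>j<m. Const (rho w r j) * F k j) - F k r = - (\<Sum>j<m. Const (rho w r j) * (act w (F k j) - F k j))"
      by (subst Tr) (simp only: right_diff_distrib sum_subtractf minus_diff_eq)
    also have "l dvd \<dots>"
      using w unfolding inertia_def by (intro dvd_minus_iff[THEN iffD2] dvd_sum dvd_mult) blast
    finally show ?thesis .
  qed
  have vg: "v \<in> graded_free m K i" by (rule subsetD[OF lat_graded v])
  have "\<forall>k\<in>{..<m}. \<exists>q. num m F k v = ell * q" using v by (auto simp: lat_def elim!: dvdE)
  then obtain q where q: "\<forall>k\<in>{..<m}. num m F k v = ell * q k" by (rule bchoice[THEN exE])
  have "smul \<Delta> v = (\<Sum>k<m. smul (num m F k v) (F k))"
    by (rule cramer) (use vg F_graded in \<open>auto simp: graded_free_def\<close>)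
  also have "\<dots> = smul ell (\<Sum>k<m. smul (q k) (F k))"
    unfolding smul_sum smul_smul using q by (intro sum.cong refl) simp
  finally have "smul ell (smul D1 v) = smul ell (\<Sum>k<m. smul (q k) (F k))"
    unfolding dt_split smul_smul .
  then have eq: "smul D1 v = (\<Sum>k<m. smul (q k) (F k))" by (simp only: smul_cancel[OF nonzero(1)])
  have vj: "D1 * v j = (\<Sum>k<m. q k * F k j)" for j
    using arg_cong[OF eq, of "\<lambda>u. u j"] by (simp add: smul_apply sum_apply)
  have "D1 * ?\<phi> v = (\<Sum>j<m. \<Sum>k<m. q k * (Const (rho w r j - (if r = j then 1 else 0)) * F k j))"
  proof -
    have "D1 * ?\<phi> v = (\<Sum>j<m. Const (rho w r j - (if r = j then 1 else 0)) * (D1 * v j))"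
      unfolding sum_distrib_left by (intro sum.cong refl) (simp only: mult.left_commute)
    then show ?thesis unfolding vj sum_distrib_left by (simp only: mult.left_commute)
  qed
  also have "\<dots> = (\<Sum>k<m. q k * ?\<phi> (F k))"
    unfolding sum_distrib_left by (rule sum.swap)
  also have "l dvd \<dots>" by (rule dvd_sum, rule dvd_mult, rule \<phi>F) simp
  finally show ?thesis using prime_elem_dvd_multD[OF forms_prime(1)[OF l]] D1_forms[OF l] by blast
qed

text \<open>By the congruence, a vector supported in a coordinate with nonzero coefficient lies in the lattice only if
  that coordinate is divisible by \<open>l\<close>. So the lattice misses at least a polynomial ring modulo \<open>l\<close>.\<close>

lemma lat_drop:
  assumes l: "l \<in> forms" and w: "w \<in> inertia l" "\<not> trivial w" and t: "0 < t" "t < 1"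
  shows "hval (lat ell) t \<le> (real m - (1 - t)) / (1 - t) ^ K"
proof -
  have t': "0 \<le> t" using t by simp
  have "\<exists>r<m. \<exists>s<m. rho w r s \<noteq> (if r = s then 1 else 0)" using w(2) unfolding trivial_def by blast
  then obtain r s where r: "r < m" and s: "s < m" and rs': "rho w r s \<noteq> (if r = s then 1 else 0)" by blast
  from rs' have rs: "rho w r s - (if r = s then 1 else 0) \<noteq> 0" unfolding right_minus_eq .
  let ?R = "graded_free 1 K :: nat \<Rightarrow> 'k pvec set" and ?U = "graded_free m K :: nat \<Rightarrow> 'k pvec set"
  let ?\<iota> = "\<lambda>f :: 'k pvec. smul (f 0) (uvec s)"
  have lin: "pvlin ?\<iota>" by (rule pvlinI) (simp_all add: pv smul_add_left scl_def smul_smul)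
  have \<iota>: "?\<iota> f j = (if j = s then f 0 else 0)" for f j by (simp add: smul_apply uvec_def)
  note R = hval_graded_free[OF t' t(2), of 1 K, where ?'k = 'k] and U = hval_graded_free[OF t' t(2), of m K, where ?'k = 'k]
  have L: "hsum (lat ell) t" by (rule hsum_gfam[OF gfam_lat t' t(2)])
  have "hval (lat ell) t + hval ?R t \<le> hval ?U t + hval (sh 1 ?R) t"
  proof (rule hval_add_le[OF L R(1) U(1) hval_sh(1)[OF R(1)] t'])
    fix i
    let ?W = "?\<iota> ` ?R i" and ?Z = "(\<lambda>f. smul l (?\<iota> f)) ` sh 1 ?R i"
    have Rs: "UU.subspace (?R i)" "UU.fin_span (?R i)"
      by (rule subspace_graded_free, rule fin_span_graded_free)
    have inj: "f = 0" if "f \<in> ?R i" "?\<iota> f = 0" for f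
    proof (rule ext)
      fix j
      have "f 0 = 0" using fun_cong[OF that(2), of s] unfolding \<iota> by (simp add: zero_fun_apply)
      then show "f j = 0 j" using that(1) by (cases "j = 0") (simp_all add: graded_free_def zero_fun_apply)
    qed
    have dW: "UU.dim ?W = UU.dim (?R i)" by (rule UU.dim_image_inj[OF lin Rs inj])
    have W: "UU.subspace ?W" "UU.fin_span ?W"
      using module_hom.subspace_image[of scl scl ?\<iota>, OF _ Rs(1)] lin
      by (simp add: Vector_Spaces.linear_def, intro UU.fin_span_image[OF lin Rs(2)])
    have S: "UU.subspace (sh 1 ?R i)" "UU.fin_span (sh 1 ?R i)"
      by (rule subspace_sh[OF subspace_graded_free], rule fin_span_sh[OF fin_span_graded_free])
    have linZ: "pvlin (\<lambda>f :: 'k pvec. smul l (?\<iota> f))"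
      by (rule pvlinI) (simp_all add: pv smul_add_left smul_add scl_def smul_smul mult_ac)
    have dZ: "UU.dim ?Z \<le> UU.dim (sh 1 ?R i)" "UU.fin_span ?Z"
    proof -
      have l0: "l \<noteq> 0" using forms_prime(1)[OF l] by auto
      have "f = 0" if "f \<in> sh 1 ?R i" "smul l (?\<iota> f) = 0" for f
      proof (rule ext)
        fix j
        have "?\<iota> f = 0" using that(2) l0 by (rule smul_eq_0D)
        then have "f 0 = 0" using fun_cong[of "?\<iota> f" 0 s] unfolding \<iota> by (simp add: zero_fun_apply)
        then show "f j = 0 j"
          using that(1) by (cases "j = 0") (auto simp: sh_def graded_free_def zero_fun_apply split: if_splits)
      qed
      then show "UU.dim ?Z \<le> UU.dim (sh 1 ?R i)" using UU.dim_image_inj[OF linZ S] by simp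
      show "UU.fin_span ?Z" by (rule UU.fin_span_image[OF linZ S(2)])
    qed
    have "?W \<subseteq> ?U i"
    proof (rule image_subsetI)
      fix f :: "'k pvec" assume "f \<in> ?R i"
      then have "f 0 \<in> polys_over {..<K}" "homog i (f 0)" by (simp_all add: graded_free_def)
      from graded_free_smul[OF uvec_graded[OF s] this] show "?\<iota> f \<in> ?U i" by simp
    qed
    then have "UU.sum_space (lat ell i) ?W \<subseteq> ?U i"
      by (rule UU.sum_space_least[OF subspace_graded_free lat_graded])
    then have le: "UU.dim (UU.sum_space (lat ell i) ?W) \<le> UU.dim (?U i)"
      by (rule UU.dim_subset_fin[OF fin_span_graded_free])
    have "lat ell i \<inter> ?W \<subseteq> ?Z"
    proof
      fix v assume "v \<in> lat ell i \<inter> ?W"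
      then obtain f where f: "f \<in> ?R i" "v = ?\<iota> f" and v: "v \<in> lat ell i" by blast
      have "(\<Sum>j<m. Const (rho w r j - (if r = j then 1 else 0)) * v j) =
          (\<Sum>j<m. if j = s then Const (rho w r s - (if r = s then 1 else 0)) * f 0 else 0)"
        unfolding f(2) \<iota> by (intro sum.cong refl) simp
      also have "\<dots> = Const (rho w r s - (if r = s then 1 else 0)) * f 0" using s by simp
      finally have eq: "(\<Sum>j<m. Const (rho w r j - (if r = j then 1 else 0)) * v j) =
          Const (rho w r s - (if r = s then 1 else 0)) * f 0" .
      have "l dvd Const (rho w r s - (if r = s then 1 else 0)) * f 0"
        using lat_congruence[OF l w(1) v r] unfolding eq .
      then have "l dvd Const (inverse (rho w r s - (if r = s then 1 else 0))) * (Const (rho w r s - (if r = s then 1 else 0)) * f 0)"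
        by (rule dvd_mult)
      then have "l dvd f 0"
        by (simp only: mult.assoc[symmetric] Const_mult[symmetric] left_inverse[OF rs] single_one mult_1_left)
      then obtain a where a: "f 0 = l * a" by (rule dvdE)
      let ?a = "\<lambda>j. if j = 0 then a else 0 :: (nat, 'k) mpoly"
      have fa: "f = smul l ?a"
      proof (rule ext)
        fix j show "f j = smul l ?a j" using f(1) a by (cases "j = 0") (simp_all add: smul_apply graded_free_def)
      qed
      have lo: "l \<in> polys_over {..<K}" by (rule polys_over_mono[OF _ forms_prime(3)[OF l]]) (use K1 in auto)
      have "?a \<in> sh 1 ?R i"
      proof (cases "f = 0")
        case True
        then have "a = 0" using a forms_prime(1)[OF l] by (auto simp: zero_fun_apply)
        then have z: "?a = 0" by (simp add: fun_eq_iff zero_fun_apply)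
        show ?thesis unfolding z by (rule UU.subspace_0[OF S(1)])
      next
        case False
        have f0: "f 0 \<noteq> 0"
        proof
          assume "f 0 = 0"
          then have "?\<iota> f = 0" by simp
          then show False using inj[OF f(1)] False by blast
        qed
        have h: "homog i (l * a)" using f(1) unfolding a[symmetric] graded_free_def by simp
        have nz: "l * a \<noteq> 0" using f0 unfolding a .
        have i1: "Suc 0 \<le> i" by (rule homog_cofactor_ge[OF forms_prime(2)[OF l] h nz])
        have "smul l ?a \<in> graded_free 1 K (Suc 0 + (i - 1))" using f(1) i1 unfolding fa[symmetric] by simp
        then have "?a \<in> ?R (i - 1)"
          by (rule graded_free_cofactor[OF _ lo forms_prime(2)[OF l]]) (use forms_prime(1)[OF l] in auto)
        then show ?thesis using i1 by (simp add: sh_def)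
      qed
      then show "v \<in> ?Z" by (rule image_eqI[rotated]) (simp add: f(2) a smul_smul)
    qed
    then have "UU.dim (lat ell i \<inter> ?W) \<le> UU.dim ?Z" by (rule UU.dim_subset_fin[OF dZ(2)])
    also note dZ(1)
    finally show "UU.dim (lat ell i) + UU.dim (?R i) \<le> UU.dim (?U i) + UU.dim (sh 1 ?R i)"
      using UU.dim_sum_space[OF subspace_lat[of ell i] fin_span_lat W] le dW by linarith
  qed
  then have "hval (lat ell) t + 1 / (1 - t) ^ K \<le> real m / (1 - t) ^ K + t * (1 / (1 - t) ^ K)"
    unfolding hval_sh(2)[OF R(1)] R(2) U(2) power_one_right of_nat_1 .
  moreover have "(real m - (1 - t)) / (1 - t) ^ K = real m / (1 - t) ^ K + t * (1 / (1 - t) ^ K) - 1 / (1 - t) ^ K"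
    unfolding diff_divide_distrib times_divide_eq_right mult_1_right by linarith
  ultimately show ?thesis by linarith
qed

end

context lin_action
begin

text \<open>Minimality at the forms is what makes the part \<open>ell\<close> of the determinant divide every numerator in
  Cramer's rule: such a numerator is the determinant of another tuple of covariants.\<close>

lemma exists_covariant_tuple:
  obtains F d K1 dl ell D1 where "covariant_tuple \<Gamma> n m lin rho F d K1 dl ell D1"
    "(\<forall>l\<in>forms. \<forall>g\<in>inertia l. trivial g) \<longrightarrow> ell dvd 1"
proof -
  have S: "prime_elem l \<and> homog (Suc 0) l \<and> l \<in> polys_over {..<n}" if "l \<in> forms" for l
    using forms_prime[OF that] by blast
  have S2: "homog (Suc 0) l \<and> l \<in> polys_over {..<n}" if "l \<in> forms" for l
    using forms_prime[OF that] by blast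
  have "\<exists>F. htuple F \<and> dt m F \<noteq> 0 \<and> (\<forall>l\<in>forms. minimal_at l F)"
  proof (rule exists_minimal_at_all[OF finite_forms S2])
    fix F assume "htuple F" "dt m F \<noteq> 0" "\<And>l. l \<in> forms \<Longrightarrow> minimal_at l F"
    then show "\<exists>F. htuple F \<and> dt m F \<noteq> 0 \<and> (\<forall>l\<in>forms. minimal_at l F)"
      by (intro exI[of _ F] conjI ballI)
  qed
  then obtain F where F: "htuple F" "dt m F \<noteq> 0" "\<forall>l\<in>forms. minimal_at l F" by (elim exE conjE)
  obtain K1 d where K1: "n \<le> K1" and d: "\<forall>k<m. F k \<in> graded_free m K1 (d k)"
    by (rule htuple_graded[OF F(1)])
  obtain D where D: "homog D (dt m F)" by (rule htuple_dt_homog[OF F(1)])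
  obtain ell D1 dl where u: "dt m F = ell * D1" "\<forall>l\<in>forms. \<not> l dvd D1" "homog dl ell" "ell \<in> polys_over {..<n}"
    "\<forall>q. (\<forall>l\<in>forms. \<forall>v. l ^ v dvd dt m F \<longrightarrow> l ^ v dvd q) \<longrightarrow> ell dvd q"
    "\<forall>x q. (\<forall>l\<in>forms. \<not> l dvd x) \<longrightarrow> ell dvd x * q \<longrightarrow> ell dvd q"
    by (rule split_primes[OF finite_forms S F(2) D])
  show ?thesis
  proof (rule that[of F d K1 dl ell D1])
    show "covariant_tuple \<Gamma> n m lin rho F d K1 dl ell D1"
    proof (intro covariant_tuple.intro covariant_tuple_axioms.intro lin_action_axioms)
      show "F k \<in> cov" if "k < m" for k using F(1) that by (simp add: htuple_def)
      show "F k \<in> graded_free m K1 (d k)" if "k < m" for k using d that by simp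
      show "\<not> l dvd D1" if "l \<in> forms" for l using u(2) that by blast
      show "ell dvd q" if "ell dvd D1 * q" for q by (rule u(6)[THEN spec, THEN spec, THEN mp, THEN mp, OF u(2) that])
      fix G K i k assume G: "G \<in> cov" "G \<in> graded_free m K i" and k: "k < m"
      have "htuple (F(k := G))" using F(1) G unfolding htuple_def by auto
      then have D: "l ^ v dvd dt m (F(k := G))" if "l \<in> forms" "l ^ v dvd dt m F" for l v
        by (rule F(3)[THEN bspec, OF that(1), unfolded minimal_at_def, rule_format, OF _ that(2)])
      show "ell dvd num m F k G"
        unfolding dt_upd[OF k, symmetric] by (rule u(5)[THEN spec, THEN mp]) (blast intro: D)
    qed (use K1 u(1,3,4) F(2) in simp_all)
    show "(\<forall>l\<in>forms. \<forall>g\<in>inertia l. trivial g) \<longrightarrow> ell dvd 1"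
    proof
      assume triv: "\<forall>l\<in>forms. \<forall>g\<in>inertia l. trivial g"
      have nd: "\<not> l dvd dt m F" if l: "l \<in> forms" for l
      proof -
        have "trivial g" if "g \<in> inertia l" for g using triv l that by blast
        then obtain F' where F': "htuple F'" "\<not> l dvd dt m F'"
          by (rule covariants_generate_at[OF primal_prime_elem[OF forms_prime(1)[OF l]]])
        then show ?thesis using F(3)[THEN bspec, OF l, unfolded minimal_at_def, rule_format, OF F'(1), of 1] by auto
      qed
      have D: "l ^ v dvd 1" if "l \<in> forms" "l ^ v dvd dt m F" for l v
      proof (cases v)
        case (Suc v')
        then have "l dvd dt m F" using that(2) by (auto intro: dvd_mult_left)
        then show ?thesis using nd[OF that(1)] by blast
      qed simp
      show "ell dvd 1" by (rule u(5)[THEN spec, THEN mp]) (blast intro: D)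
    qed
  qed
qed

theorem covariants_limit:
  obtains \<sigma> :: int where "\<sigma> \<ge> 0" "\<sigma> = 0 \<longleftrightarrow> (\<forall>l\<in>forms. \<forall>g\<in>inertia l. trivial g)"
    "((\<lambda>t. (real m - hval (cfam n) t / hval (ifam n) t) / (1 - t)) \<longlongrightarrow> of_int \<sigma>) (at_left 1)"
proof -
  obtain F d K1 dl ell D1 where ct: "covariant_tuple \<Gamma> n m lin rho F d K1 dl ell D1"
    and ell1: "(\<forall>l\<in>forms. \<forall>g\<in>inertia l. trivial g) \<longrightarrow> ell dvd 1" by (rule exists_covariant_tuple)
  interpret ct: covariant_tuple \<Gamma> n m lin rho F d K1 dl ell D1 by (rule ct)
  obtain \<sigma> :: int where \<sigma>: "\<sigma> \<ge> 0" "ell dvd 1 \<longrightarrow> \<sigma> = 0"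
    "(\<forall>t. 0 < t \<longrightarrow> t < 1 \<longrightarrow> hval (ct.lat ell) t \<le> (real m - (1 - t)) / (1 - t) ^ ct.K) \<longrightarrow> \<sigma> \<ge> 1"
    "((\<lambda>t. (real m - hval (cfam n) t / hval (ifam n) t) / (1 - t)) \<longlongrightarrow> of_int \<sigma>) (at_left 1)"
    by (rule ct.lattice_limit)
  have "\<sigma> \<ge> 1" if nontriv: "\<not> (\<forall>l\<in>forms. \<forall>g\<in>inertia l. trivial g)"
  proof -
    obtain l g where lg: "l \<in> forms" "g \<in> inertia l" "\<not> trivial g" using nontriv by blast
    show ?thesis by (rule \<sigma>(3)[THEN mp]) (intro allI impI ct.lat_drop[OF lg])
  qed
  then have "\<sigma> = 0 \<longleftrightarrow> (\<forall>l\<in>forms. \<forall>g\<in>inertia l. trivial g)"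
    using \<sigma>(2) ell1 by (cases "\<forall>l\<in>forms. \<forall>g\<in>inertia l. trivial g") simp_all
  then show ?thesis by (rule that[OF \<sigma>(1) _ \<sigma>(4)])
qed

text \<open>The ring of polynomials is integral over the invariants: every variable is a root of the polynomial
  whose roots are its conjugates.\<close>

lemma Var_power: "Var v ^ k = (Poly_Mapping.single (Poly_Mapping.single v k) 1 :: (nat, 'k) mpoly)"
proof (induction k)
  case (Suc k)
  then show ?case by (simp add: mult_single single_add[symmetric])
qed (simp add: single_one)

lemma Var_integral:
  fixes b :: nat
  defines "op \<equiv> orbit_poly (\<lambda>g. act g (Var b)) (carrier \<Gamma>)"
  shows "Var b ^ card (carrier \<Gamma>) = - (\<Sum>k<card (carrier \<Gamma>). coeff op k * Var b ^ k)"
proof -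
  let ?c = "card (carrier \<Gamma>)"
  have "poly op (Var b) = 0"
    unfolding op_def poly_orbit_poly by (rule prod_zero[OF fin], rule bexI[of _ "\<one>"]) (simp_all add: act_one)
  moreover have "poly op (Var b) = (\<Sum>k\<le>?c. coeff op k * Var b ^ k)"
    unfolding poly_altdef
    by (rule sum.mono_neutral_left)
       (auto simp: op_def coeff_eq_0 intro!: degree_le coeff_orbit_poly(2)[OF fin])
  moreover have "(\<Sum>k\<le>?c. coeff op k * Var b ^ k) = (\<Sum>k<?c. coeff op k * Var b ^ k) + Var b ^ ?c"
    using coeff_orbit_poly(1)[OF fin, of "\<lambda>g. act g (Var b)"] by (simp add: op_def flip: lessThan_Suc_atMost)
  ultimately show ?thesis by (simp add: eq_neg_iff_add_eq_0 add.commute)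
qed

lemma invariant_coeff_orbit_poly: "invariant (coeff (orbit_poly (\<lambda>g. act g (Var b)) (carrier \<Gamma>)) k)"
  unfolding invariant_def
proof
  fix h assume h: "h \<in> carrier \<Gamma>"
  have "act h (coeff (orbit_poly (\<lambda>g. act g (Var b)) (carrier \<Gamma>)) k) =
      coeff (orbit_poly (\<lambda>g. act (h \<otimes> g) (Var b)) (carrier \<Gamma>)) k"
    unfolding act_coeff_orbit_poly
    by (unfold orbit_poly_def, rule arg_cong[where f = "\<lambda>p. coeff p k"], rule prod.cong) (simp_all add: act_act h)
  also have "orbit_poly (\<lambda>g. act (h \<otimes> g) (Var b)) (carrier \<Gamma>) = orbit_poly (\<lambda>g. act g (Var b)) (carrier \<Gamma>)"
    by (rule orbit_poly_reindex[OF carrier_mult_inj[OF h] carrier_mult_image[OF h]])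
  finally show "act h (coeff (orbit_poly (\<lambda>g. act g (Var b)) (carrier \<Gamma>)) k) =
      coeff (orbit_poly (\<lambda>g. act g (Var b)) (carrier \<Gamma>)) k" .
qed

lemma large_exponent:
  assumes "Poly_Mapping.keys e \<subseteq> {..<n}" "monom_degree e > n * c"
  obtains b where "b < n" "c \<le> Poly_Mapping.lookup e b"
proof -
  have "\<exists>b<n. c \<le> Poly_Mapping.lookup e b"
  proof (rule ccontr)
    assume *: "\<not> ?thesis"
    have "monom_degree e = (\<Sum>b<n. Poly_Mapping.lookup e b)" using assms(1) by (intro monom_degree_superset) simp_all
    also have "\<dots> \<le> (\<Sum>b<n. c)" by (intro sum_mono) (use * in \<open>auto simp: not_le intro: less_imp_le\<close>)
    finally show False using assms(2) by simp
  qed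
  then show ?thesis using that by blast
qed

text \<open>In degree greater than \<open>n * card \<Gamma>\<close>, every monomial contains a variable with exponent at least \<open>card \<Gamma>\<close>,
  and that power can be lowered by the integral equation of the variable; so the free module is generated
  over the invariants in low degrees.\<close>

lemma cfam_rational:
  obtains D Q :: "int poly" where "D \<noteq> 0" "fps_of_poly D * hilb (cfam n) = fps_of_poly Q"
proof -
  let ?c = "card (carrier \<Gamma>)"
  let ?op = "\<lambda>b. orbit_poly (\<lambda>g. act g (Var b)) (carrier \<Gamma>)"
  let ?zs = "map (\<lambda>(b, k). (coeff (?op b) k, ?c - k)) (List.product [0..<n] [0..<?c])"
  let ?Y = "\<lambda>i :: nat. if i \<le> n * ?c then graded_free m n i else {0 :: 'k pvec}"
  have zs: "\<exists>b k. b < n \<and> k < ?c \<and> z = coeff (?op b) k \<and> e = ?c - k" if "(z, e) \<in> set ?zs" for z e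
    using that by (auto, blast)
  have coeff_props: "coeff (?op b) k \<in> polys_over {..<n}" "homog (?c - k) (coeff (?op b) k)" if "b < n" "k < ?c" for b k
  proof -
    show "coeff (?op b) k \<in> polys_over {..<n}"
      by (rule polys_over_orbit_poly[OF fin]) (use that in \<open>auto intro!: act_over polys_over_Var\<close>)
    show "homog (?c - k) (coeff (?op b) k)"
      using homog_orbit_poly[where a = "\<lambda>g. act g (Var b)" and k = k, OF fin homog_act[OF homog_Var]] that by simp
  qed
  have ops: "grade_op n zd" if "zd \<in> set ?zs" for zd
  proof -
    obtain z e where zd: "zd = (z, e)" by (cases zd)
    have mem: "(z, e) \<in> set ?zs" using that unfolding zd .
    obtain b k where "b < n" "k < ?c" "z = coeff (?op b) k" "e = ?c - k"
      using zs[OF mem] by blast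
    then show ?thesis using coeff_props[of b k] unfolding zd grade_op_def by auto
  qed
  have Y: "gfam m n ?Y" using subspace_graded_free UU.subspace_0[OF subspace_graded_free] by (auto simp: gfam_def)
  have gen: "stable_under m n ?zs (generated_by ?zs ?Y)" "?Y \<le> generated_by ?zs ?Y"
    by (rule generated_by_props(1)[OF ops Y], assumption) (rule generated_by_props(2)[OF ops Y])
  let ?H = "generated_by ?zs ?Y"
  note stab = stable_underD[OF gen(1)]
  have low: "v \<in> ?H i" if "v \<in> graded_free m n i" "i \<le> n * ?c" for v i
    by (rule subsetD[OF le_funD[OF gen(2), of i]]) (simp add: that)
  have mono: "smul (Poly_Mapping.single e a) (uvec j) \<in> ?H (Suc (n * ?c))"
    if j: "j < m" and e: "Poly_Mapping.keys e \<subseteq> {..<n}" "monom_degree e = Suc (n * ?c)" for j e a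
  proof -
    have e2: "monom_degree e > n * ?c" using e(2) by simp
    obtain b where b: "b < n" "?c \<le> Poly_Mapping.lookup e b" by (rule large_exponent[OF e(1) e2])
    define e' where "e' = e - Poly_Mapping.single b ?c"
    have ee: "e = Poly_Mapping.single b ?c + e'"
      by (rule poly_mapping_eqI) (use b in \<open>auto simp: e'_def lookup_add lookup_minus lookup_single when_def\<close>)
    let ?f = "Poly_Mapping.single e' a"
    have "Poly_Mapping.single e a = Var b ^ ?c * ?f" by (subst ee) (simp add: Var_power mult_single)
    also have "\<dots> = - (\<Sum>k<?c. coeff (?op b) k * (Var b ^ k * ?f))"
      unfolding Var_integral by (simp add: sum_distrib_right mult.assoc)
    finally have eq: "smul (Poly_Mapping.single e a) (uvec j) =
        - (\<Sum>k<?c. smul (coeff (?op b) k) (smul (Var b ^ k * ?f) (uvec j)))"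
      by (simp add: smul_uminus_left smul_sum_left smul_smul)
    have deg: "monom_degree e' + ?c = Suc (n * ?c)"
      using e(2) unfolding ee monom_degree_add by (simp add: monom_degree_def split: if_splits)
    have ek: "Poly_Mapping.keys e' \<subseteq> {..<n}"
    proof
      fix x assume "x \<in> Poly_Mapping.keys e'"
      then have "Poly_Mapping.lookup e x \<noteq> 0" unfolding e'_def in_keys_iff lookup_minus by linarith
      then have "x \<in> Poly_Mapping.keys e" unfolding in_keys_iff .
      then show "x \<in> {..<n}" using e(1) by blast
    qed
    have step: "smul (coeff (?op b) k) (smul (Var b ^ k * ?f) (uvec j)) \<in> ?H (Suc (n * ?c))" if k: "k < ?c" for k
    proof -
      have f: "?f \<in> polys_over {..<n}" "homog (monom_degree e') ?f"
        using ek by (auto simp: polys_over_def homog_def)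
      have "smul (Var b ^ k * ?f) (uvec j) \<in> graded_free m n (k * Suc 0 + monom_degree e' + 0)"
        by (intro graded_free_smul uvec_graded j polys_over_mult polys_over_power polys_over_Var homog_mult homog_power homog_Var f)
           (use b in simp)
      then have A: "smul (Var b ^ k * ?f) (uvec j) \<in> ?H (k + monom_degree e')"
        by (intro low) (use deg k in simp_all)
      have "(b, k) \<in> set (List.product [0..<n] [0..<?c])" using b k by simp
      then have B: "(coeff (?op b) k, ?c - k) \<in> set ?zs" unfolding set_map by (rule image_eqI[rotated]) simp
      have "smul (coeff (?op b) k) (smul (Var b ^ k * ?f) (uvec j)) \<in> ?H (?c - k + (k + monom_degree e'))"
        by (rule stab(2)[OF B A])
      moreover have "?c - k + (k + monom_degree e') = Suc (n * ?c)" using deg k by simp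
      ultimately show ?thesis by simp
    qed
    show ?thesis
      unfolding eq by (rule UU.subspace_neg[OF stab(3)], rule UU.subspace_sum[OF stab(3)], rule step) simp
  qed
  have top: "v \<in> ?H (Suc (n * ?c))" if v: "v \<in> graded_free m n (Suc (n * ?c))" for v
  proof -
    have "v = (\<Sum>j<m. \<Sum>e\<in>Poly_Mapping.keys (v j). smul (Poly_Mapping.single e (Poly_Mapping.lookup (v j) e)) (uvec j))"
    proof (rule ext)
      fix i
      have "(\<Sum>j<m. \<Sum>e\<in>Poly_Mapping.keys (v j). smul (Poly_Mapping.single e (Poly_Mapping.lookup (v j) e)) (uvec j)) i =
          (\<Sum>j<m. (\<Sum>e\<in>Poly_Mapping.keys (v j). Poly_Mapping.single e (Poly_Mapping.lookup (v j) e)) * uvec j i)"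
        by (simp add: sum_apply smul_apply sum_distrib_right)
      also have "\<dots> = (\<Sum>j<m. if j = i then v i else 0)"
        unfolding mpoly_eq_sum_single[symmetric] by (intro sum.cong refl) (simp add: uvec_def)
      also have "\<dots> = v i" using v by (simp add: graded_free_def)
      finally show "v i = (\<Sum>j<m. \<Sum>e\<in>Poly_Mapping.keys (v j). smul (Poly_Mapping.single e (Poly_Mapping.lookup (v j) e)) (uvec j)) i" ..
    qed
    also have "\<dots> \<in> ?H (Suc (n * ?c))"
      by (intro UU.subspace_sum[OF stab(3)] mono)
         (use v in \<open>auto simp: graded_free_def polys_over_def homog_def\<close>)
    finally show ?thesis .
  qed
  have st: "stable_under m n ?zs (cfam n)"
  proof (rule stable_underI[OF gfamD(1,2)[OF gfam_cfam]])
    fix z e i F assume z: "(z, e) \<in> set ?zs" and F: "F \<in> cfam n i"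
    obtain b k where bk: "b < n" "k < ?c" "z = coeff (?op b) k" "e = ?c - k" using zs[OF z] by blast
    show "smul z F \<in> cfam n (e + i)"
      using F unfolding cfam_def bk(3,4)
      by (intro IntI cov_smul invariant_coeff_orbit_poly graded_free_smul coeff_props bk) auto
  qed
  have "\<exists>Q :: int poly. prod_list (map (\<lambda>(z, d). 1 - fps_X ^ d) ?zs) * hilb (cfam n) = fps_of_poly Q"
  proof (rule hilbert_series_rational[where zs = ?zs and K = n and m = m and Y = ?Y and D = "Suc (n * ?c)", OF ops Y])
    show "?Y i = {0}" if "i \<ge> Suc (n * ?c)" for i using that by simp
    show "uvec j \<in> ?Y 0" if "j < m" for j using uvec_graded[OF that] by simp
    show "stable_under m n ?zs (cfam n)" by (rule st)
    fix b i :: nat and F :: "'k pvec" assume b: "b < n" and F: "F \<in> ?Y i"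
    show "smul (Var b) F \<in> ?H (Suc i)"
    proof (cases "i \<le> n * ?c")
      case True
      then have "F \<in> graded_free m n i" using F by simp
      then have g: "smul (Var b) F \<in> graded_free m n (Suc i)"
        using graded_free_smul[of F m n i "Var b" "Suc 0"] b by (simp add: polys_over_Var)
      show ?thesis
      proof (cases "i = n * ?c")
        case True
        then show ?thesis using top g by simp
      qed (use low[OF g] True in simp)
    qed (use F stab(5) in simp)
  qed
  then obtain Q :: "int poly" where Q: "prod_list (map (\<lambda>(z, d). 1 - fps_X ^ d) ?zs) * hilb (cfam n) = fps_of_poly Q" ..
  have "\<exists>D :: int poly. D \<noteq> 0 \<and> prod_list (map (\<lambda>(z, d). 1 - fps_X ^ d) zs) = fps_of_poly D"
    if "\<forall>zd\<in>set zs. snd zd \<ge> 1" for zs :: "((nat, 'k) mpoly \<times> nat) list"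
    using that
  proof (induction zs)
    case Nil
    show ?case by (rule exI[of _ 1]) simp
  next
    case (Cons zd zs)
    obtain D :: "int poly" where D: "D \<noteq> 0" "prod_list (map (\<lambda>(z, d). 1 - fps_X ^ d) zs) = fps_of_poly D"
      using Cons by auto
    obtain z e where zd: "zd = (z, e)" by (cases zd)
    have e: "e \<ge> 1" using Cons.prems zd by simp
    have "coeff (1 - Polynomial.monom 1 e :: int poly) 0 \<noteq> 0" using e by simp
    then have "1 - Polynomial.monom 1 e \<noteq> (0 :: int poly)" by (metis coeff_0)
    moreover have "fps_of_poly (1 - Polynomial.monom 1 e) = (1 - fps_X ^ e :: int fps)"
      by (simp add: fps_of_poly_diff fps_of_poly_monom)
    ultimately show ?case using D by (intro exI[of _ "(1 - Polynomial.monom 1 e) * D"]) (simp add: zd fps_of_poly_mult)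
  qed
  moreover have "\<forall>zd\<in>set ?zs. snd zd \<ge> 1" using ops unfolding grade_op_def by blast
  ultimately obtain D :: "int poly" where "D \<noteq> 0" "prod_list (map (\<lambda>(z, d). 1 - fps_X ^ d) ?zs) = fps_of_poly D" by blast
  then show ?thesis using Q by (intro that[of D Q]) simp_all
qed

end


definition rv :: "rat poly \<Rightarrow> real \<Rightarrow> real" where
  "rv P t = poly (map_poly of_rat P) t"

lemma rv_simps:
  "rv (P * Q) t = rv P t * rv Q t" "rv (P - Q) t = rv P t - rv Q t" "rv (pCons a P) t = of_rat a + t * rv P t"
  "rv 0 t = 0" "rv 1 t = 1" "rv (P ^ k) t = rv P t ^ k"
proof -
  have m: "map_poly of_rat (P * Q) = (map_poly of_rat P * map_poly of_rat Q :: real poly)" for P Q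
    by (rule poly_eqI) (simp add: coeff_map_poly coeff_mult of_rat_sum of_rat_mult)
  have d: "map_poly of_rat (P - Q) = (map_poly of_rat P - map_poly of_rat Q :: real poly)" for P Q
    by (rule poly_eqI) (simp add: coeff_map_poly of_rat_diff)
  show 1: "rv (P * Q) t = rv P t * rv Q t" for P Q by (simp add: rv_def m)
  show "rv (P - Q) t = rv P t - rv Q t" by (simp add: rv_def d)
  show "rv (pCons a P) t = of_rat a + t * rv P t" by (simp add: rv_def map_poly_pCons)
  show "rv 0 t = 0" by (simp add: rv_def)
  show one: "rv 1 t = 1" by (simp add: rv_def map_poly_1)
  show "rv (P ^ k) t = rv P t ^ k" by (induction k) (simp_all add: 1 one)
qed

lemma rv_of_rat: "rv P (of_rat x) = of_rat (poly P x)"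
  by (induction P) (simp_all add: rv_simps of_rat_add of_rat_mult)

lemma rv_1: "rv P 1 = of_rat (poly P 1)"
  using rv_of_rat[of P 1] by simp

lemma rv_map_of_int: "rv (map_poly of_int P) t = poly (map_poly of_int P) t"
  unfolding rv_def
  by (rule arg_cong[where f = "\<lambda>p. poly p t"]) (rule poly_eqI, simp add: coeff_map_poly)

lemma tendsto_rv: "(rv P \<longlongrightarrow> of_rat (poly P 1)) (at_left 1)"
  unfolding rv_1[symmetric] rv_def by (intro tendsto_intros)

lemma factor_at_1:
  fixes P :: "rat poly"
  assumes "P \<noteq> 0"
  obtains i P' where "P = [:-1, 1:] ^ i * P'" "poly P' 1 \<noteq> 0"
proof -
  obtain P' where P': "P = [:-1, 1:] ^ Polynomial.order 1 P * P'" "\<not> [:-1, 1:] dvd P'"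
    using order_decomp[OF assms, of 1] by blast
  then show ?thesis using that[OF P'(1)] by (simp add: poly_eq_0_iff_dvd)
qed

lemma eventually_rv_nonzero:
  assumes "P \<noteq> 0"
  shows "\<forall>\<^sub>F t in at_left 1. rv P t \<noteq> 0"
proof -
  obtain i P' where P: "P = [:-1, 1:] ^ i * P'" "poly P' 1 \<noteq> 0" by (rule factor_at_1[OF assms])
  have "\<forall>\<^sub>F t in at_left 1. rv P' t \<noteq> 0"
    by (rule tendsto_imp_eventually_ne[OF tendsto_rv]) (use P(2) in simp)
  moreover have "\<forall>\<^sub>F t :: real in at_left 1. t \<in> {0<..<1}" by (rule eventually_at_left_real) simp
  ultimately show ?thesis
    by eventually_elim (simp add: P(1) rv_simps)
qed

text \<open>The expansion of a rational function at \<open>1\<close> can be read off from one-sided limits.\<close>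

lemma expansion_of_limit:
  fixes A B :: "rat poly"
  assumes B: "B \<noteq> 0" and lim: "((\<lambda>t. (of_rat c - rv A t / rv B t) / (1 - t)) \<longlongrightarrow> of_rat s) (at_left 1)"
  shows "expansion_at_1 (Fraction_Field.Fract A B) c s"
proof -
  define T where "T = ([:-1, 1:] :: rat poly)"
  define L where "L = [:c:] + Polynomial.smult s T"
  define C where "C = A - L * B"
  have rvT: "rv T t = t - 1" for t by (simp add: T_def rv_simps)
  have Leq: "L = [:c - s, s:]" by (simp add: L_def T_def)
  have rvL: "rv L t = of_rat c + of_rat s * (t - 1)" for t
    by (simp add: Leq rv_simps of_rat_diff algebra_simps)
  have claim: "\<exists>P Q. poly Q 1 \<noteq> 0 \<and> C * Q = T ^ 2 * P * B"
  proof (cases "C = 0")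
    case True
    then show ?thesis by (intro exI[of _ 0] exI[of _ 1]) simp
  next
    case False
    obtain i C' where C': "C = T ^ i * C'" "poly C' 1 \<noteq> 0" unfolding T_def by (rule factor_at_1[OF False])
    obtain j B' where B': "B = T ^ j * B'" "poly B' 1 \<noteq> 0" unfolding T_def by (rule factor_at_1[OF B])
    show ?thesis
    proof (cases "j + 2 \<le> i")
      case True
      then obtain k where k: "i = 2 + k + j" by (metis add.commute add.assoc le_Suc_ex)
      show ?thesis
        by (rule exI[of _ "T ^ k * C'"], rule exI[of _ B'])
           (simp add: B'(2) C'(1) B'(1) k power_add power2_eq_square mult_ac)
    next
      case False
      have ev: "\<forall>\<^sub>F t :: real in at_left 1. t \<in> {0<..<1}" by (rule eventually_at_left_real) simp
      from tendsto_diff[OF lim tendsto_const[of "of_rat s"]]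
      have "((\<lambda>t. (of_rat c - rv A t / rv B t) / (1 - t) - of_rat s) \<longlongrightarrow> 0) (at_left 1)" by simp
      then have 0: "((\<lambda>t. ((of_rat c - rv A t / rv B t) / (1 - t) - of_rat s) * (t - 1) ^ (j + 1 - i)) \<longlongrightarrow> 0 * (1 - 1) ^ (j + 1 - i)) (at_left 1)"
        by (intro tendsto_mult tendsto_intros)
      have "\<forall>\<^sub>F t in at_left 1. ((of_rat c - rv A t / rv B t) / (1 - t) - of_rat s) * (t - 1) ^ (j + 1 - i) = rv C' t / rv B' t"
        using ev eventually_rv_nonzero[OF B]
      proof eventually_elim
        case (elim t)
        have t1: "t - 1 \<noteq> 0" "1 - t \<noteq> 0" using elim(1) by auto
        have CB: "rv C t = rv A t - (of_rat c + of_rat s * (t - 1)) * rv B t" by (simp add: C_def rv_simps rvL)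
        have "(of_rat c - rv A t / rv B t) / (1 - t) - of_rat s = rv C t / (rv B t * (t - 1))"
          unfolding CB using t1 elim(2) by (simp add: divide_simps) (simp add: algebra_simps)
        moreover have "rv B t = (t - 1) ^ j * rv B' t" "rv C t = (t - 1) ^ i * rv C' t"
          by (simp_all add: B'(1) C'(1) rv_simps rvT)
        moreover have "(t - 1) ^ i * (t - 1) ^ (j + 1 - i) = (t - 1) ^ j * (t - 1)"
          using False by (simp flip: power_add power_Suc2)
        ultimately show ?case
          using t1 by (simp add: frac_eq_eq mult_ac)
      qed
      from Lim_transform_eventually[OF 0 this]
      have "((\<lambda>t. rv C' t / rv B' t) \<longlongrightarrow> 0) (at_left 1)" by simp
      moreover have "((\<lambda>t. rv C' t / rv B' t) \<longlongrightarrow> of_rat (poly C' 1) / of_rat (poly B' 1)) (at_left 1)"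
        by (intro tendsto_divide tendsto_rv) (use B'(2) in simp)
      ultimately have "of_rat (poly C' 1) / of_rat (poly B' 1) = (0 :: real)"
        using tendsto_unique[OF trivial_limit_at_left_real] by blast
      then show ?thesis using B'(2) C'(2) by simp
    qed
  qed
  then obtain P Q where PQ: "poly Q 1 \<noteq> 0" "C * Q = T ^ 2 * P * B" by blast
  have Q0: "Q \<noteq> 0" using PQ(1) by auto
  have "A * Q = (L * Q + T ^ 2 * P) * B" using PQ(2) unfolding C_def by (simp add: algebra_simps)
  then have "Fraction_Field.Fract A B = Fraction_Field.Fract L 1 + Fraction_Field.Fract (T ^ 2 * P) Q"
    using B Q0 by (simp add: eq_fract)
  then show ?thesis unfolding expansion_at_1_def L_def T_def using PQ(1) by blast
qed

lemma ratfun_of_hilb: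
  fixes D Q :: "int poly"
  assumes "D \<noteq> 0" "fps_of_poly D * hilb X = fps_of_poly Q"
  shows "fps_to_ratfun (Abs_fps (\<lambda>i. of_nat (UU.dim (X i)))) = Fraction_Field.Fract (map_poly of_int Q) (map_poly of_int D)"
    "map_poly rat_of_int D \<noteq> 0"
proof -
  let ?H = "Abs_fps (\<lambda>i. of_nat (UU.dim (X i))) :: rat fps"
  show D: "map_poly rat_of_int D \<noteq> 0" using assms(1) by (auto simp: poly_eq_iff coeff_map_poly)
  have "fps_of_poly (map_poly of_int D) * ?H = fps_of_poly (map_poly of_int Q)"
  proof (rule fps_ext)
    fix k
    have "fps_nth (fps_of_poly (map_poly of_int D) * ?H) k = of_int (fps_nth (fps_of_poly D * hilb X) k)"
      by (simp add: fps_mult_nth coeff_map_poly)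
    then show "fps_nth (fps_of_poly (map_poly of_int D) * ?H) k = fps_nth (fps_of_poly (map_poly of_int Q)) k"
      by (simp add: assms(2) coeff_map_poly)
  qed
  then have rep: "represents_fps (Fraction_Field.Fract (map_poly of_int Q) (map_poly of_int D)) ?H"
    unfolding represents_fps_def using D by blast
  show "fps_to_ratfun ?H = Fraction_Field.Fract (map_poly of_int Q) (map_poly of_int D)"
    unfolding fps_to_ratfun_def by (rule the_equality[where P = "\<lambda>R. represents_fps R ?H", OF rep represents_fps_unique[OF _ rep]])
qed

lemma (in lin_action) ifam_nonzero: "UU.dim (ifam n 0) \<noteq> 0"
proof -
  let ?u = "uvec 0 :: 'k pvec"
  have "?u \<noteq> 0" by (auto simp: fun_eq_iff uvec_def zero_fun_apply intro!: exI[of _ 0])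
  then have "UU.dim {?u} = 1" by (subst UU.dim_eq_card_independent) (simp_all add: UU.dependent_single)
  moreover have "?u \<in> ifam n 0"
    by (auto simp: ifam_def graded_free_def uvec_def invariant_def act_simps)
  then have "UU.dim {?u} \<le> UU.dim (ifam n 0)"
    by (intro UU.dim_subset_fin[OF fin_span_sub_graded_free[of _ 1 n 0]]) (auto simp: ifam_def)
  ultimately show ?thesis by simp
qed

theorem (in lin_action) covariants_expansion:
  obtains \<sigma> :: int where "\<sigma> \<ge> 0" "\<sigma> = 0 \<longleftrightarrow> (\<forall>l\<in>forms. \<forall>g\<in>inertia l. trivial g)"
    "expansion_at_1 (fps_to_ratfun (Abs_fps (\<lambda>i. of_nat (UU.dim (cfam n i)))) /
        fps_to_ratfun (Abs_fps (\<lambda>i. of_nat (UU.dim (ifam n i))))) (of_nat m) (of_int \<sigma>)"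
proof -
  obtain \<sigma> :: int where \<sigma>: "\<sigma> \<ge> 0" "\<sigma> = 0 \<longleftrightarrow> (\<forall>l\<in>forms. \<forall>g\<in>inertia l. trivial g)"
    "((\<lambda>t. (real m - hval (cfam n) t / hval (ifam n) t) / (1 - t)) \<longlongrightarrow> of_int \<sigma>) (at_left 1)"
    by (rule covariants_limit)
  obtain DN QN :: "int poly" where N: "DN \<noteq> 0" "fps_of_poly DN * hilb (cfam n) = fps_of_poly QN"
    by (rule cfam_rational)
  obtain DB QB :: "int poly" where B: "DB \<noteq> 0" "fps_of_poly DB * hilb (ifam n) = fps_of_poly QB"
    by (rule lin_action.cfam_rational[OF trivial_action, unfolded trivial_cfam])
  have "hilb (ifam n) \<noteq> 0"
  proof
    assume "hilb (ifam n) = 0"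
    from arg_cong[OF this, of "\<lambda>h. fps_nth h 0"] show False using ifam_nonzero by simp
  qed
  then have "fps_of_poly QB \<noteq> 0" unfolding B(2)[symmetric] using B(1) by simp
  then have QB: "QB \<noteq> 0" by auto
  let ?r = "map_poly rat_of_int"
  have nz: "?r DN \<noteq> 0" "?r DB \<noteq> 0" "?r QB \<noteq> 0"
    using N(1) B(1) QB by (auto simp: poly_eq_iff coeff_map_poly)
  have gB: "gfam 1 n (ifam n)"
    using lin_action.gfam_cfam[OF trivial_action, of n] unfolding trivial_cfam .
  have ev: "\<forall>\<^sub>F t :: real in at_left 1. t \<in> {0<..<1}" by (rule eventually_at_left_real) simp
  have "\<forall>\<^sub>F t in at_left 1. (real m - hval (cfam n) t / hval (ifam n) t) / (1 - t) =
      (of_rat (of_nat m) - rv (?r QN * ?r DB) t / rv (?r DN * ?r QB) t) / (1 - t)"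
    using ev eventually_rv_nonzero[OF nz(1)] eventually_rv_nonzero[OF nz(2)] eventually_rv_nonzero[OF nz(3)]
  proof eventually_elim
    case (elim t)
    have t: "0 \<le> t" "t < 1" using elim(1) by auto
    have "rv (?r DN) t * hval (cfam n) t = rv (?r QN) t"
      unfolding rv_map_of_int by (rule hval_eval[OF N(2) hsum_gfam[OF gfam_cfam t] t(1)])
    then have 1: "hval (cfam n) t = rv (?r QN) t / rv (?r DN) t" using elim(2) by (simp add: field_simps)
    have "rv (?r DB) t * hval (ifam n) t = rv (?r QB) t"
      unfolding rv_map_of_int by (rule hval_eval[OF B(2) hsum_gfam[OF gB t] t(1)])
    then have 2: "hval (ifam n) t = rv (?r QB) t / rv (?r DB) t" using elim(3) by (simp add: field_simps)
    show ?case unfolding 1 2 rv_simps by simp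
  qed
  from Lim_transform_eventually[OF \<sigma>(3) this]
  have "((\<lambda>t. (of_rat (of_nat m) - rv (?r QN * ?r DB) t / rv (?r DN * ?r QB) t) / (1 - t)) \<longlongrightarrow> of_rat (of_int \<sigma>)) (at_left 1)"
    by simp
  then have "expansion_at_1 (Fraction_Field.Fract (?r QN * ?r DB) (?r DN * ?r QB)) (of_nat m) (of_int \<sigma>)"
    using nz by (intro expansion_of_limit) simp_all
  moreover have "fps_to_ratfun (Abs_fps (\<lambda>i. of_nat (UU.dim (cfam n i)))) / fps_to_ratfun (Abs_fps (\<lambda>i. of_nat (UU.dim (ifam n i)))) =
      Fraction_Field.Fract (?r QN * ?r DB) (?r DN * ?r QB)"
    unfolding ratfun_of_hilb(1)[OF N] ratfun_of_hilb(1)[OF B] by simp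
  ultimately have "expansion_at_1 (fps_to_ratfun (Abs_fps (\<lambda>i. of_nat (UU.dim (cfam n i)))) /
        fps_to_ratfun (Abs_fps (\<lambda>i. of_nat (UU.dim (ifam n i))))) (of_nat m) (of_int \<sigma>)" by simp
  then show ?thesis by (rule that[OF \<sigma>(1,2)])
qed


section \<open>Coordinates\<close>

text \<open>A form of invariance of dimension that needs no finiteness, for comparing the given spaces with spaces of
  vectors of polynomials.\<close>

lemma dim_linear_image:
  assumes lin: "Vector_Spaces.linear s1 s2 f" and S: "module.subspace s1 S" and inj: "inj_on f S"
  shows "vector_space.dim s2 (f ` S) = vector_space.dim s1 S"
proof -
  interpret f: Vector_Spaces.linear s1 s2 f by (rule lin)
  interpret P: vector_space_pair s1 s2 ..
  obtain B where B: "B \<subseteq> S" "f.vs1.independent B" "S \<subseteq> f.vs1.span B" "card B = f.vs1.dim S"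
    using f.vs1.basis_exists by blast
  have sp: "f.vs1.span B = S" using B(3) f.vs1.span_minimal[OF B(1) S] by blast
  have ind: "f.vs2.independent (f ` B)"
    by (rule P.linear_independent_injective_image[OF lin B(2)]) (simp add: inj sp)
  have "f.vs2.span (f ` B) = f ` S" using P.linear_span_image[OF lin, of B] sp by simp
  then have "f.vs2.span (f ` B) = f.vs2.span (f ` S)" using f.vs2.span_span[of "f ` B"] by metis
  then have "f.vs2.dim (f ` S) = card (f ` B)" by (rule f.vs2.dim_eq_card[OF _ ind])
  also have "\<dots> = card B" by (rule card_image) (rule inj_on_subset[OF inj B(1)])
  finally show ?thesis using B(4) by simp
qed

lemma linear_form_coeffs:
  assumes "finite B" "linear_form B l = linear_form B l'" "b \<in> B"
  shows "l b = l' b"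
proof -
  have "linear_form B (\<lambda>b. l b - l' b) = linear_form B l - linear_form B l'"
    by (simp add: linear_form_def sum_subtractf single_diff)
  then show ?thesis using linear_form_nonzero_iff[OF assms(1), of "\<lambda>b. l b - l' b"] assms(2,3) by auto
qed

locale coords = finite_dimensional_vector_space scale Basis
  for scale :: "'k::field \<Rightarrow> 'b::ab_group_add \<Rightarrow> 'b" and Basis +
  fixes bs :: "nat \<Rightarrow> 'b"
  assumes bs: "bij_betw bs {..<card Basis} Basis"
begin

definition co :: "'b \<Rightarrow> nat \<Rightarrow> 'k" where
  "co x v = representation Basis x (bs v)"

lemma bs_mem: "v < card Basis \<Longrightarrow> bs v \<in> Basis"
  using bs by (auto simp: bij_betw_def)

lemma bs_eq_iff: "v < card Basis \<Longrightarrow> w < card Basis \<Longrightarrow> bs v = bs w \<longleftrightarrow> v = w"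
  using bs by (auto simp: bij_betw_def inj_on_def)

lemma in_span: "x \<in> span Basis"
  by (simp add: span_Basis)

lemma representation_simps:
  "representation Basis (x + y) b = representation Basis x b + representation Basis y b"
  "representation Basis (scale c x) b = c * representation Basis x b"
  "representation Basis 0 b = 0"
  "representation Basis (x - y) b = representation Basis x b - representation Basis y b"
  using representation_add[OF independent_Basis in_span in_span] representation_scale[OF independent_Basis in_span]
    representation_zero representation_diff[OF independent_Basis in_span in_span] by simp_all

lemma co_simps: "co (x + y) v = co x v + co y v" "co (scale c x) v = c * co x v" "co 0 v = 0" "co (x - y) v = co x v - co y v"
  by (simp_all add: co_def representation_simps)

lemma co_sum: "co (\<Sum>i\<in>I. f i) v = (\<Sum>i\<in>I. co (f i) v)"
  by (induction I rule: infinite_finite_induct) (simp_all add: co_simps)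

lemma co_basis: "v < card Basis \<Longrightarrow> w < card Basis \<Longrightarrow> co (bs v) w = (if v = w then 1 else 0)"
  using representation_basis[OF independent_Basis bs_mem, of v] bs_eq_iff[of v w] by (auto simp: co_def)

lemma expand: "x = (\<Sum>v<card Basis. scale (co x v) (bs v))"
proof -
  have "(\<Sum>b\<in>Basis. scale (representation Basis x b) b) = x"
    by (rule sum_representation_eq[OF independent_Basis in_span finite_Basis order_refl])
  then show ?thesis
    unfolding co_def using sum.reindex_bij_betw[OF bs, of "\<lambda>b. scale (representation Basis x b) b"] by simp
qed

lemma co_ext: "(\<And>v. v < card Basis \<Longrightarrow> co x v = co y v) \<Longrightarrow> x = y"
  by (subst (1 2) expand) simp

lemma co_linear:
  assumes "Vector_Spaces.linear scale scale f"
  shows "co (f x) v = (\<Sum>b<card Basis. co x b * co (f (bs b)) v)"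
proof -
  interpret f: Vector_Spaces.linear scale scale f by (rule assms)
  have "f x = f (\<Sum>b<card Basis. scale (co x b) (bs b))" using expand[of x] by simp
  also have "\<dots> = (\<Sum>b<card Basis. scale (co x b) (f (bs b)))" by (simp add: f.sum f.scale)
  finally show ?thesis by (simp add: co_sum co_simps)
qed

definition fn :: "(nat \<Rightarrow> 'k) \<Rightarrow> 'b \<Rightarrow> 'k" where
  "fn a x = (\<Sum>v<card Basis. co x v * a v)"

lemma fn_simps: "fn a (x + y) = fn a x + fn a y" "fn a (scale c x) = c * fn a x" "fn a 0 = 0" "fn a (x - y) = fn a x - fn a y"
  by (simp_all add: fn_def co_simps distrib_right left_diff_distrib sum.distrib sum_subtractf sum_distrib_left mult.assoc)

lemma fn_basis: "v < card Basis \<Longrightarrow> fn a (bs v) = a v"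
proof -
  assume v: "v < card Basis"
  have "fn a (bs v) = (\<Sum>w<card Basis. if v = w then a v else 0)"
    unfolding fn_def by (intro sum.cong refl) (use co_basis[OF v] in auto)
  then show ?thesis using v by simp
qed

lemma hyperplane_kernel:
  assumes b: "b < card Basis" "a b \<noteq> 0"
  shows "hyperplane scale {x. fn a x = 0}"
proof -
  let ?H = "{x. fn a x = 0}"
  have H: "subspace ?H" by (auto simp: subspace_def fn_simps)
  have nb: "bs b \<notin> span ?H" using b by (simp add: span_eq_iff[THEN iffD2, OF H] fn_basis)
  have "x \<in> span (insert (bs b) ?H)" for x
  proof -
    have "x - scale (fn a x / a b) (bs b) \<in> span ?H"
      by (rule span_base) (use b in \<open>simp add: fn_simps fn_basis\<close>)
    then show ?thesis unfolding span_breakdown_eq by blast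
  qed
  then have "span (insert (bs b) ?H) = UNIV" by blast
  then have "dim UNIV = dim (insert (bs b) ?H)" using dim_span[of "insert (bs b) ?H"] by simp
  also have "\<dots> = dim ?H + 1" using nb by (simp add: dim_insert)
  finally show ?thesis using H by (simp add: hyperplane_def)
qed

text \<open>The functionals that vanish on a hyperplane form a line.\<close>

lemma proportional_on_hyperplane:
  assumes H: "hyperplane scale H" and a: "b < card Basis" "a b \<noteq> 0" "\<And>x. x \<in> H \<Longrightarrow> fn a x = 0"
    and a': "\<And>x. x \<in> H \<Longrightarrow> fn a' x = 0"
  obtains c where "\<forall>v<card Basis. a' v = c * a v"
proof -
  have Hs: "subspace H" and Hd: "dim H + 1 = dim UNIV" using H by (simp_all add: hyperplane_def)
  have sp: "span H = H" using Hs by (simp add: span_eq_iff)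
  have nb: "bs b \<notin> span H" using a fn_basis[OF a(1), of a] unfolding sp by auto
  then have "dim (insert (bs b) H) = dim UNIV" using Hd by (simp add: dim_insert)
  then have full: "span (insert (bs b) H) = UNIV" using dim_eq_full[of "insert (bs b) H"] by (simp add: dim_UNIV dimension_def)
  have "a' v = a' b / a b * a v" if v: "v < card Basis" for v
  proof -
    have "bs v \<in> span (insert (bs b) H)" using full by simp
    then obtain k where k: "bs v - scale k (bs b) \<in> H" unfolding span_breakdown_eq sp by blast
    have "a v = k * a b" using a(3)[OF k] v a(1) by (simp add: fn_simps fn_basis)
    moreover have "a' v = k * a' b" using a'[OF k] v a(1) by (simp add: fn_simps fn_basis)
    ultimately show ?thesis using a(2) by simp
  qed
  then show ?thesis by (intro that[of "a' b / a b"]) blast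
qed

end

lemma homog_pvec_linear:
  assumes "vector_space s" "\<And>x y. f (x + y) = f x + f y" "\<And>c x. f (s c x) = scl c (f x)"
  shows "Vector_Spaces.linear s (scl :: 'k::field \<Rightarrow> 'k pvec \<Rightarrow> 'k pvec) f"
proof (rule Vector_Spaces.linear.intro)
  interpret vector_space s by (rule assms(1))
  show "module_hom s scl f"
    unfolding module_hom_iff using module_axioms UU.module_axioms assms(2,3) by blast
qed (rule assms(1), rule UU.vector_space_axioms)

lemma lookup_Const_times: "Poly_Mapping.lookup (Const c * p) e = c * Poly_Mapping.lookup p e" for c :: "'k::field"
  by (simp add: mult_map_scale_conv_mult[symmetric] Poly_Mapping.map.rep_eq when_def)

locale linear_setup = V: coords sV BV bv + M: coords sM BM bm
  for sV :: "'k::field \<Rightarrow> 'v::ab_group_add \<Rightarrow> 'v" and BV bv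
    and sM :: "'k \<Rightarrow> 'm::ab_group_add \<Rightarrow> 'm" and BM bm +
  fixes G :: "('v \<Rightarrow> 'v) set" and \<rho> :: "('v \<Rightarrow> 'v) \<Rightarrow> 'm \<Rightarrow> 'm"
  assumes G_sub: "subgroup G (GL sV)" and G_fin: "finite G"
    and \<rho>_hom: "\<rho> \<in> hom ((GL sV)\<lparr>carrier := G\<rparr>) (GL sM)"
begin

abbreviation n where "n \<equiv> card BV"
abbreviation m where "m \<equiv> card BM"
abbreviation \<Gamma> where "\<Gamma> \<equiv> (GL sV)\<lparr>carrier := G\<rparr>"

definition lin :: "('v \<Rightarrow> 'v) \<Rightarrow> nat \<Rightarrow> nat \<Rightarrow> 'k" where
  "lin g v b = V.co (inv_into UNIV g (bv b)) v"

definition rho :: "('v \<Rightarrow> 'v) \<Rightarrow> nat \<Rightarrow> nat \<Rightarrow> 'k" where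
  "rho g i j = M.co (\<rho> g (bm j)) i"

lemma G_props:
  assumes "g \<in> G"
  shows "bij g" "Vector_Spaces.linear sV sV g" "Vector_Spaces.linear sV sV (inv_into UNIV g)"
    "Vector_Spaces.linear sM sM (\<rho> g)"
proof -
  have g: "g \<in> carrier (GL sV)" using subgroup.subset[OF G_sub] assms by blast
  show "bij g" "Vector_Spaces.linear sV sV g" using g by (simp_all add: GL_def)
  show "Vector_Spaces.linear sV sV (inv_into UNIV g)" using inv_mem_GL[OF g] by (simp add: GL_def)
  have "\<rho> g \<in> carrier (GL sM)" using \<rho>_hom assms by (auto simp: hom_def Pi_iff)
  then show "Vector_Spaces.linear sM sM (\<rho> g)" by (simp add: GL_def)
qed

lemma group_\<Gamma>: "group \<Gamma>"
  by (rule subgroup.subgroup_is_group[OF G_sub group_GL[OF V.vector_space_axioms]])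

lemma \<rho>_mult: "g \<in> G \<Longrightarrow> h \<in> G \<Longrightarrow> \<rho> (g \<circ> h) x = \<rho> g (\<rho> h x)"
  using hom_mult[OF \<rho>_hom, of g h] by (simp add: GL_def)

lemma \<rho>_id: "\<rho> id x = x"
  using hom_one[OF \<rho>_hom group_\<Gamma> group_GL[OF M.vector_space_axioms]] by (simp add: GL_def)

lemma lin_apply: "g \<in> G \<Longrightarrow> V.co (inv_into UNIV g x) v = (\<Sum>b<n. V.co x b * lin g v b)"
  unfolding lin_def by (rule V.co_linear[OF G_props(3)])

lemma rho_apply: "g \<in> G \<Longrightarrow> M.co (\<rho> g x) i = (\<Sum>j<m. M.co x j * rho g i j)"
  unfolding rho_def by (rule M.co_linear[OF G_props(4)])

lemma lin_id: "v < n \<Longrightarrow> b < n \<Longrightarrow> lin id v b = (if b = v then 1 else 0)"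
  using V.co_basis[of b v] by (simp add: lin_def inv_id)

lemma delta_form: "v < n \<Longrightarrow> linear_form {..<n} (\<lambda>b. if b = v then 1 else 0) = (Var v :: (nat, 'k) mpoly)"
proof -
  assume v: "v < n"
  have "linear_form {..<n} (\<lambda>b. if b = v then 1 else 0) = (\<Sum>b<n. if b = v then Var v else (0 :: (nat, 'k) mpoly))"
    unfolding linear_form_eq by (intro sum.cong refl) (simp add: single_one)
  then show ?thesis using v by simp
qed

lemma linear_form_cong: "(\<And>b. b \<in> B \<Longrightarrow> l b = l' b) \<Longrightarrow> linear_form B l = linear_form B l'"
  unfolding linear_form_def by (intro sum.cong refl) simp

lemma action: "lin_action \<Gamma> n m lin rho"
proof (intro lin_action.intro lin_action_axioms.intro group_\<Gamma>)
  show "finite (carrier \<Gamma>)" using G_fin by simp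
  fix g h v assume gh: "g \<in> carrier \<Gamma>" "h \<in> carrier \<Gamma>" and v: "v < n"
  then have g: "g \<in> G" and h: "h \<in> G" by simp_all
  have inv: "inv_into UNIV (g \<circ> h) = inv_into UNIV h \<circ> inv_into UNIV g"
    by (rule o_inv_distrib[OF G_props(1)[OF g] G_props(1)[OF h]])
  have c: "lin (g \<circ> h) v c = (\<Sum>b<n. lin h v b * lin g b c)" for c
    using lin_apply[OF h, of "inv_into UNIV g (bv c)" v] by (simp add: lin_def inv mult.commute)
  have "subst (gvar n lin g) (gvar n lin h v) = (\<Sum>b<n. Const (lin h v b) * gvar n lin g b)"
    using v by (simp add: gvar_def linear_form_eq Cst.evalp_sum Cst.evalp_mult)
  also have "\<dots> = (\<Sum>b<n. \<Sum>c<n. Const (lin h v b * lin g b c) * Var c)"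
    by (intro sum.cong refl) (simp add: gvar_def linear_form_eq sum_distrib_left Const_mult mult.assoc)
  also have "\<dots> = (\<Sum>c<n. \<Sum>b<n. Const (lin h v b * lin g b c) * Var c)" by (rule sum.swap)
  also have "\<dots> = gvar n lin (g \<circ> h) v"
    using v by (simp add: gvar_def linear_form_eq c Const_sum sum_distrib_right)
  finally show "subst (gvar n lin g) (gvar n lin h v) = gvar n lin (g \<otimes>\<^bsub>\<Gamma>\<^esub> h) v" by (simp add: GL_def)
next
  fix v assume v: "v < n"
  have "linear_form {..<n} (lin id v) = linear_form {..<n} (\<lambda>b. if b = v then 1 else 0)"
    by (rule linear_form_cong) (use lin_id v in simp)
  then show "gvar n lin \<one>\<^bsub>\<Gamma>\<^esub> v = Var v" using v by (simp add: gvar_def GL_def delta_form)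
next
  fix g assume "g \<in> carrier \<Gamma>" and *: "\<And>v. v < n \<Longrightarrow> gvar n lin g v = Var v"
  then have g: "g \<in> G" by simp
  have l: "lin g v b = (if b = v then 1 else 0)" if "v < n" "b < n" for v b
    by (rule linear_form_coeffs[of "{..<n}"]) (use *[OF that(1)] that delta_form in \<open>simp_all add: gvar_def\<close>)
  have "inv_into UNIV g x = x" for x
  proof (rule V.co_ext)
    fix v assume v: "v < n"
    have "V.co (inv_into UNIV g x) v = (\<Sum>b<n. if b = v then V.co x v else 0)"
      unfolding lin_apply[OF g] by (intro sum.cong refl) (use l v in auto)
    then show "V.co (inv_into UNIV g x) v = V.co x v" using v by simp
  qed
  then have "g x = x" for x using G_props(1)[OF g] by (metis bij_inv_eq_iff)
  then show "g = \<one>\<^bsub>\<Gamma>\<^esub>" by (auto simp: GL_def)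
next
  fix g h i j assume "g \<in> carrier \<Gamma>" "h \<in> carrier \<Gamma>" and ij: "i < m" "j < m"
  then have g: "g \<in> G" and h: "h \<in> G" by simp_all
  have "rho (g \<circ> h) i j = (\<Sum>l<m. rho g i l * rho h l j)"
    using rho_apply[OF g, of "\<rho> h (bm j)" i] by (simp add: rho_def \<rho>_mult[OF g h] mult.commute)
  then show "rho (g \<otimes>\<^bsub>\<Gamma>\<^esub> h) i j = (\<Sum>l<m. rho g i l * rho h l j)" by (simp add: GL_def)
next
  fix i j assume "i < m" "j < m"
  then have "rho id i j = (if i = j then 1 else 0)" using M.co_basis[of j i] by (simp add: rho_def \<rho>_id)
  then show "rho \<one>\<^bsub>\<Gamma>\<^esub> i j = (if i = j then 1 else 0)" by (simp add: GL_def)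
qed

sublocale A: lin_action \<Gamma> n m lin rho
  by (rule action)

definition idx :: "'v \<Rightarrow> nat" where "idx = inv_into {..<n} bv"

lemma idx: "b \<in> BV \<Longrightarrow> idx b < n" "b \<in> BV \<Longrightarrow> bv (idx b) = b" "v < n \<Longrightarrow> idx (bv v) = v"
proof -
  show "idx b < n" if "b \<in> BV"
    using inv_into_into[of b bv "{..<n}"] that V.bs unfolding idx_def bij_betw_def by auto
  show "bv (idx b) = b" if "b \<in> BV"
    using f_inv_into_f[of b bv "{..<n}"] that V.bs unfolding idx_def bij_betw_def by auto
  show "idx (bv v) = v" if "v < n"
    using inv_into_f_f[of bv "{..<n}" v] that V.bs unfolding idx_def bij_betw_def by auto
qed

definition down :: "('v, 'k) mpoly \<Rightarrow> (nat, 'k) mpoly" where "down f = subst (\<lambda>b. Var (idx b)) f"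

definition up :: "(nat, 'k) mpoly \<Rightarrow> ('v, 'k) mpoly" where "up f = subst (\<lambda>i. Var (bv i)) f"

lemma down_simps: "down (f + h) = down f + down h" "down (f * h) = down f * down h" "down (Const c) = Const c"
  "down (\<Sum>i\<in>I. w i) = (\<Sum>i\<in>I. down (w i))" "down 0 = 0" "down (Var b) = Var (idx b)"
  by (simp_all add: down_def Cst.evalp_add Cst.evalp_mult Cst.evalp_sum)

lemma down_up: "f \<in> polys_over {..<n} \<Longrightarrow> down (up f) = f"
  unfolding down_def up_def subst_subst by (rule subst_id_on) (auto simp: idx)

lemma up_down: "f \<in> polys_over BV \<Longrightarrow> up (down f) = f"
  unfolding down_def up_def subst_subst by (rule subst_id_on) (auto simp: idx)

lemma down_over: "f \<in> polys_over BV \<Longrightarrow> down f \<in> polys_over {..<n}"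
  unfolding down_def by (rule subst_polys_over) (auto intro: polys_over_Var idx)

lemma up_over: "f \<in> polys_over {..<n} \<Longrightarrow> up f \<in> polys_over BV"
  unfolding up_def by (rule subst_polys_over) (auto intro: polys_over_Var V.bs_mem)

lemma homog_down: "f \<in> polys_over BV \<Longrightarrow> homog i (down f) \<longleftrightarrow> homog i f"
proof
  assume f: "f \<in> polys_over BV"
  show "homog i (down f)" if "homog i f"
    unfolding down_def by (rule subst_homog[OF that polys_over_UNIV]) simp
  show "homog i f" if "homog i (down f)"
  proof -
    have "homog i (up (down f))" unfolding up_def by (rule subst_homog[OF that polys_over_UNIV]) simp
    then show ?thesis by (simp add: up_down[OF f])
  qed
qed

lemma poly_act_eq: "poly_act sV BV g f = subst (\<lambda>b. linear_form BV (\<lambda>v. V.representation BV (inv_into UNIV g v) b)) f"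
  by (simp add: poly_act_def poly_act_monom_def evalp_def)

lemma poly_act_over: "f \<in> polys_over BV \<Longrightarrow> poly_act sV BV g f \<in> polys_over BV"
  unfolding poly_act_eq by (rule subst_polys_over) (auto intro: polys_over_linear_form)

lemma down_act:
  assumes f: "f \<in> polys_over BV"
  shows "down (poly_act sV BV g f) = A.act g (down f)"
proof -
  have "down (linear_form BV (\<lambda>v. V.representation BV (inv_into UNIV g v) b)) = A.act g (Var (idx b))" if b: "b \<in> BV" for b
  proof -
    have "down (linear_form BV (\<lambda>v. V.representation BV (inv_into UNIV g v) b)) =
        (\<Sum>v\<in>BV. Const (V.representation BV (inv_into UNIV g v) b) * Var (idx v))"
      unfolding linear_form_eq by (simp add: down_simps)
    also have "\<dots> = (\<Sum>v<n. Const (V.representation BV (inv_into UNIV g (bv v)) b) * Var (idx (bv v)))"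
      by (rule sum.reindex_bij_betw[OF V.bs, symmetric])
    also have "\<dots> = (\<Sum>v<n. Const (lin g (idx b) v) * Var v)"
      by (intro sum.cong refl) (simp add: lin_def V.co_def idx b)
    finally show ?thesis using idx(1)[OF b] by (simp add: A.act_def gvar_def linear_form_eq)
  qed
  then show ?thesis
    unfolding down_def A.act_def poly_act_eq subst_subst
    by (intro Cst.evalp_cong[OF f]) simp
qed

text \<open>The coordinates of a polynomial with values in \<open>M\<close>.\<close>

definition coord :: "nat \<Rightarrow> ('v, 'm) mpoly \<Rightarrow> ('v, 'k) mpoly" where
  "coord j F = Poly_Mapping.map (\<lambda>x. M.co x j) F"

lemma lookup_coord: "Poly_Mapping.lookup (coord j F) e = M.co (Poly_Mapping.lookup F e) j"
  by (simp add: coord_def Poly_Mapping.map.rep_eq when_def M.co_simps)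

lemma coord_simps:
  "coord j (F + H) = coord j F + coord j H" "coord j (coeff_scale sM c F) = Const c * coord j F" "coord j 0 = 0"
  "coord j (tensor sM p x) = Const (M.co x j) * p"
  by (rule poly_mapping_eqI, simp add: lookup_coord lookup_add M.co_simps M.lookup_coeff_scale M.lookup_tensor
      lookup_Const_times mult.commute[of "Poly_Mapping.lookup p _"])+

lemma coord_sum: "coord j (\<Sum>i\<in>I. F i) = (\<Sum>i\<in>I. coord j (F i))"
  by (induction I rule: infinite_finite_induct) (simp_all add: coord_simps)

lemma coord_ext: "(\<And>j. j < m \<Longrightarrow> coord j F = coord j H) \<Longrightarrow> F = H"
  by (rule poly_mapping_eqI, rule M.co_ext) (simp flip: lookup_coord)

lemma keys_coord: "e \<in> Poly_Mapping.keys F \<longleftrightarrow> (\<exists>j<m. e \<in> Poly_Mapping.keys (coord j F))"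
proof -
  have "Poly_Mapping.lookup F e = 0 \<longleftrightarrow> (\<forall>j<m. M.co (Poly_Mapping.lookup F e) j = 0)"
    using M.co_ext[of "Poly_Mapping.lookup F e" 0] by (auto simp: M.co_simps)
  then show ?thesis by (auto simp: in_keys_iff lookup_coord)
qed

lemma over_iff: "F \<in> polys_over BV \<longleftrightarrow> (\<forall>j<m. coord j F \<in> polys_over BV)"
  unfolding polys_over_def mem_Collect_eq Ball_def keys_coord[of _ F] by blast

lemma homog_iff: "homog i F \<longleftrightarrow> (\<forall>j<m. homog i (coord j F))"
  unfolding homog_def Ball_def keys_coord[of _ F] by blast

lemma coord_tensor_act:
  assumes g: "g \<in> G"
  shows "coord i (tensor_act sV BV sM \<rho> g F) = (\<Sum>j<m. Const (rho g i j) * poly_act sV BV g (coord j F))"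
proof -
  let ?p = "\<lambda>e. poly_act_monom sV BV g e" and ?K = "Poly_Mapping.keys F"
  have p1: "poly_act sV BV g (Poly_Mapping.single e 1) = ?p e" for e by (simp add: single_one)
  have "coord i (tensor_act sV BV sM \<rho> g F) = (\<Sum>e\<in>?K. Const (M.co (\<rho> g (Poly_Mapping.lookup F e)) i) * ?p e)"
    unfolding tensor_act_def p1 by (simp add: coord_sum coord_simps)
  also have "\<dots> = (\<Sum>e\<in>?K. \<Sum>j<m. Const (rho g i j) * (Const (Poly_Mapping.lookup (coord j F) e) * ?p e))"
    unfolding rho_apply[OF g] Const_sum sum_distrib_right
    by (intro sum.cong refl) (simp add: lookup_coord Const_mult mult_ac)
  also have "\<dots> = (\<Sum>j<m. \<Sum>e\<in>?K. Const (rho g i j) * (Const (Poly_Mapping.lookup (coord j F) e) * ?p e))"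
    by (rule sum.swap)
  also have "\<dots> = (\<Sum>j<m. Const (rho g i j) * poly_act sV BV g (coord j F))"
  proof (intro sum.cong refl)
    fix j assume "j \<in> {..<m}"
    then have "Poly_Mapping.keys (coord j F) \<subseteq> ?K" using keys_coord[of _ F] by blast
    then have "poly_act sV BV g (coord j F) = (\<Sum>e\<in>?K. Const (Poly_Mapping.lookup (coord j F) e) * ?p e)"
      by (intro poly_act_superset) simp_all
    then show "(\<Sum>e\<in>?K. Const (rho g i j) * (Const (Poly_Mapping.lookup (coord j F) e) * ?p e)) =
        Const (rho g i j) * poly_act sV BV g (coord j F)" by (simp add: sum_distrib_left)
  qed
  finally show ?thesis .
qed

definition \<Phi> :: "('v, 'm) mpoly \<Rightarrow> 'k pvec" where
  "\<Phi> F = (\<lambda>j. if j < m then down (coord j F) else 0)"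

lemma \<Phi>_inj:
  assumes "F \<in> polys_over BV" "H \<in> polys_over BV" "\<Phi> F = \<Phi> H"
  shows "F = H"
proof (rule coord_ext)
  fix j assume j: "j < m"
  have "up (down (coord j F)) = up (down (coord j H))" using fun_cong[OF assms(3), of j] j by (simp add: \<Phi>_def)
  then show "coord j F = coord j H" using assms(1,2) j by (simp add: over_iff up_down)
qed

lemma tensor_act_over: "g \<in> G \<Longrightarrow> F \<in> polys_over BV \<Longrightarrow> tensor_act sV BV sM \<rho> g F \<in> polys_over BV"
  unfolding over_iff coord_tensor_act
  by (auto intro!: polys_over_sum polys_over_mult poly_act_over)

lemma \<Phi>_act:
  assumes "g \<in> G" "F \<in> polys_over BV"
  shows "\<Phi> (tensor_act sV BV sM \<rho> g F) = A.T g (\<Phi> F)"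
proof (rule ext)
  fix i
  show "\<Phi> (tensor_act sV BV sM \<rho> g F) i = A.T g (\<Phi> F) i"
  proof (cases "i < m")
    case True
    have "\<Phi> (tensor_act sV BV sM \<rho> g F) i = down (\<Sum>j<m. Const (rho g i j) * poly_act sV BV g (coord j F))"
      using True by (simp only: \<Phi>_def coord_tensor_act[OF assms(1)] if_True)
    also have "\<dots> = (\<Sum>j<m. Const (rho g i j) * A.act g (\<Phi> F j))"
      unfolding down_simps(4)
    proof (intro sum.cong refl)
      fix j assume j: "j \<in> {..<m}"
      then have cj: "coord j F \<in> polys_over BV" using assms(2) unfolding over_iff by blast
      have \<Phi>j: "\<Phi> F j = down (coord j F)" using j by (simp add: \<Phi>_def)
      show "down (Const (rho g i j) * poly_act sV BV g (coord j F)) = Const (rho g i j) * A.act g (\<Phi> F j)"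
        unfolding \<Phi>j down_simps(2,3) down_act[OF cj] by (rule refl)
    qed
    also have "\<dots> = A.T g (\<Phi> F) i" using True by (simp only: A.T_def if_True)
    finally show ?thesis .
  qed (simp add: \<Phi>_def A.T_def)
qed

lemma covariants_iff:
  "F \<in> homogeneous_part (covariants sV BV G sM \<rho>) i \<longleftrightarrow> F \<in> polys_over BV \<and> \<Phi> F \<in> A.cfam n i"
proof (cases "F \<in> polys_over BV")
  case True
  have "tensor_act sV BV sM \<rho> g F = F \<longleftrightarrow> A.T g (\<Phi> F) = \<Phi> F" if "g \<in> G" for g
    using \<Phi>_inj[OF tensor_act_over[OF that True] True] \<Phi>_act[OF that True] by metis
  moreover have "\<Phi> F \<in> graded_free m n i \<longleftrightarrow> homog i F"
    using True by (auto simp: graded_free_def \<Phi>_def homog_iff over_iff homog_down intro: down_over)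
  moreover have "\<Phi> F \<in> A.vecs" by (simp add: A.vecs_def \<Phi>_def)
  ultimately show ?thesis
    using True by (auto simp: homogeneous_part_eq covariants_def A.cfam_def A.cov_def)
qed (simp add: homogeneous_part_eq covariants_def)

lemma dim_covariants:
  "vector_space.dim (coeff_scale sM) (homogeneous_part (covariants sV BV G sM \<rho>) i) = UU.dim (A.cfam n i)"
proof -
  let ?S = "homogeneous_part (covariants sV BV G sM \<rho>) i"
  interpret C: vector_space "coeff_scale sM :: 'k \<Rightarrow> ('v, 'm) mpoly \<Rightarrow> ('v, 'm) mpoly"
    by (rule M.vector_space_coeff_scale)
  have s: "\<Phi> (F + H) = \<Phi> F + \<Phi> H" "\<Phi> (coeff_scale sM c F) = scl c (\<Phi> F)" "\<Phi> 0 = 0" for F H c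
    by (auto simp: fun_eq_iff \<Phi>_def pv plus_fun_apply zero_fun_apply coord_simps down_simps)
  have lin: "Vector_Spaces.linear (coeff_scale sM) scl \<Phi>"
    by (rule homog_pvec_linear[where f = \<Phi>, OF C.vector_space_axioms s(1,2)])
  note cf = gfamD(1)[OF A.gfam_cfam, of n i]
  have S: "C.subspace ?S"
  proof (rule C.subspaceI)
    show "0 \<in> ?S"
      unfolding covariants_iff s using UU.subspace_0[OF cf] by (simp add: over_iff coord_simps)
    show "x + y \<in> ?S" if "x \<in> ?S" "y \<in> ?S" for x y
      using that UU.subspace_add[OF cf, of "\<Phi> x" "\<Phi> y"]
      unfolding covariants_iff s by (simp add: over_iff coord_simps polys_over_add)
    show "coeff_scale sM c x \<in> ?S" if "x \<in> ?S" for c x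
      using that UU.subspace_scale[OF cf, of "\<Phi> x" c]
      unfolding covariants_iff s by (simp add: over_iff coord_simps polys_over_mult)
  qed
  have inj: "inj_on \<Phi> ?S" by (rule inj_onI, rule \<Phi>_inj) (simp_all add: covariants_iff)
  have "A.cfam n i \<subseteq> \<Phi> ` ?S"
  proof
    fix w assume w: "w \<in> A.cfam n i"
    then have wg: "w \<in> graded_free m n i" by (simp add: A.cfam_def)
    define F where "F = (\<Sum>j<m. tensor sM (up (w j)) (bm j))"
    have cF: "coord l F = up (w l)" if "l < m" for l
    proof -
      have "coord l F = (\<Sum>j<m. if j = l then up (w l) else 0)"
        unfolding F_def coord_sum coord_simps
        by (intro sum.cong refl) (use M.co_basis[OF _ that] in \<open>simp add: single_one\<close>)
      then show ?thesis using that by simp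
    qed
    have "F \<in> polys_over BV" using wg by (auto simp: over_iff cF graded_free_def intro: up_over)
    moreover have "\<Phi> F = w" using wg by (auto simp: fun_eq_iff \<Phi>_def cF down_up graded_free_def)
    ultimately show "w \<in> \<Phi> ` ?S" using w by (intro image_eqI[of _ _ F]) (simp_all add: covariants_iff)
  qed
  moreover have "\<Phi> ` ?S \<subseteq> A.cfam n i" by (auto simp: covariants_iff)
  ultimately have "\<Phi> ` ?S = A.cfam n i" by blast
  then show ?thesis using dim_linear_image[OF lin S inj] by simp
qed

definition \<Psi> :: "('v, 'k) mpoly \<Rightarrow> 'k pvec" where
  "\<Psi> f = (\<lambda>j. if j = 0 then down f else 0)"

lemma invariants_iff:
  "f \<in> homogeneous_part (invariant_ring sV BV G) i \<longleftrightarrow> f \<in> polys_over BV \<and> \<Psi> f \<in> A.ifam n i"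
proof (cases "f \<in> polys_over BV")
  case True
  have "poly_act sV BV g f = f \<longleftrightarrow> A.act g (down f) = down f" for g
    using up_down[OF True] up_down[OF poly_act_over[OF True, of g]] down_act[OF True, of g] by metis
  moreover have "\<Psi> f \<in> graded_free 1 n i \<longleftrightarrow> homog i f"
    using homog_down[OF True] down_over[OF True] by (auto simp: graded_free_def \<Psi>_def)
  moreover have "\<Psi> f 0 = down f" by (simp add: \<Psi>_def)
  ultimately show ?thesis
    using True by (simp add: homogeneous_part_eq invariant_ring_def A.ifam_def A.invariant_def conj_commute)
qed (simp add: homogeneous_part_eq invariant_ring_def)

lemma dim_invariants:
  "vector_space.dim (coeff_scale (*)) (homogeneous_part (invariant_ring sV BV G) i) = UU.dim (A.ifam n i)"
proof -
  let ?S = "homogeneous_part (invariant_ring sV BV G) i"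
  have K: "vector_space ((*) :: 'k \<Rightarrow> 'k \<Rightarrow> 'k)" by unfold_locales (simp_all add: algebra_simps)
  interpret C: vector_space "coeff_scale (*) :: 'k \<Rightarrow> ('v, 'k) mpoly \<Rightarrow> ('v, 'k) mpoly"
    by (rule vector_space.vector_space_coeff_scale[OF K])
  have cs: "coeff_scale (*) c f = Const c * f" for c and f :: "('v, 'k) mpoly"
    by (simp add: coeff_scale_def mult_map_scale_conv_mult)
  have s: "\<Psi> (f + h) = \<Psi> f + \<Psi> h" "\<Psi> (coeff_scale (*) c f) = scl c (\<Psi> f)" "\<Psi> 0 = 0" for f h c
    unfolding fun_eq_iff \<Psi>_def cs by (simp_all add: scl_apply plus_fun_apply zero_fun_apply down_simps(1,2,3,5))
  have lin: "Vector_Spaces.linear (coeff_scale (*)) scl \<Psi>"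
    by (rule homog_pvec_linear[where f = \<Psi>, OF C.vector_space_axioms s(1,2)])
  have gB: "gfam 1 n (A.ifam n)"
    using lin_action.gfam_cfam[OF A.trivial_action, of n] unfolding A.trivial_cfam .
  note cf = gfamD(1)[OF gB, of i]
  have S: "C.subspace ?S"
  proof (rule C.subspaceI)
    show "0 \<in> ?S"
      unfolding invariants_iff s using UU.subspace_0[OF cf] by simp
    show "x + y \<in> ?S" if "x \<in> ?S" "y \<in> ?S" for x y
      using that UU.subspace_add[OF cf, of "\<Psi> x" "\<Psi> y"]
      unfolding invariants_iff s by (simp add: polys_over_add)
    show "coeff_scale (*) c x \<in> ?S" if "x \<in> ?S" for c x
      using that UU.subspace_scale[OF cf, of "\<Psi> x" c]
      unfolding invariants_iff s by (simp add: cs polys_over_mult)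
  qed
  have inj: "inj_on \<Psi> ?S"
  proof (rule inj_onI)
    fix f h assume fh: "f \<in> ?S" "h \<in> ?S" and e: "\<Psi> f = \<Psi> h"
    have "f \<in> polys_over BV" "h \<in> polys_over BV" using fh unfolding invariants_iff by simp_all
    then have "f = up (down f)" "h = up (down h)" by (simp_all only: up_down)
    moreover have "down f = down h" using fun_cong[OF e, of 0] by (simp add: \<Psi>_def)
    ultimately show "f = h" by metis
  qed
  have "A.ifam n i \<subseteq> \<Psi> ` ?S"
  proof
    fix w assume w: "w \<in> A.ifam n i"
    then have wg: "w \<in> graded_free 1 n i" by (simp add: A.ifam_def)
    have "up (w 0) \<in> polys_over BV" by (rule up_over) (use wg in \<open>simp add: graded_free_def\<close>)
    moreover have "\<Psi> (up (w 0)) = w" 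
    proof (rule ext)
      fix j
      have "w 0 \<in> polys_over {..<n}" "j \<noteq> 0 \<Longrightarrow> w j = 0" using wg by (simp_all add: graded_free_def)
      then show "\<Psi> (up (w 0)) j = w j" by (cases "j = 0") (simp_all add: \<Psi>_def down_up)
    qed
    ultimately show "w \<in> \<Psi> ` ?S" using w by (intro image_eqI[of _ _ "up (w 0)"]) (simp_all add: invariants_iff)
  qed
  moreover have "\<Psi> ` ?S \<subseteq> A.ifam n i" by (auto simp: invariants_iff)
  ultimately have im: "\<Psi> ` ?S = A.ifam n i" by blast
  show ?thesis using dim_linear_image[OF lin S inj] unfolding im by (rule sym)
qed

text \<open>The reflections are the nontrivial elements of the inertia groups of the forms.\<close>

lemma trivial_iff:
  assumes g: "g \<in> G"
  shows "A.trivial g \<longleftrightarrow> (\<forall>x. \<rho> g x = x)"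
proof
  assume triv: "A.trivial g"
  show "\<forall>x. \<rho> g x = x"
  proof (intro allI M.co_ext)
    fix x i assume i: "i < m"
    have "M.co (\<rho> g x) i = (\<Sum>j<m. if j = i then M.co x i else 0)"
      unfolding rho_apply[OF g] by (intro sum.cong refl) (use triv i in \<open>auto simp: A.trivial_def\<close>)
    then show "M.co (\<rho> g x) i = M.co x i" using i by simp
  qed
next
  assume "\<forall>x. \<rho> g x = x"
  then show "A.trivial g" unfolding A.trivial_def rho_def by (auto simp: M.co_basis)
qed

definition dev :: "('v \<Rightarrow> 'v) \<Rightarrow> nat \<Rightarrow> nat \<Rightarrow> 'k" where
  "dev g v b = lin g v b - (if b = v then 1 else 0)"

lemma dev_form: "v < n \<Longrightarrow> A.X g v - Var v = linear_form {..<n} (dev g v)"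
proof -
  assume v: "v < n"
  have "linear_form {..<n} (dev g v) = linear_form {..<n} (lin g v) - linear_form {..<n} (\<lambda>b. if b = v then 1 else 0)"
    unfolding A.linear_form_diff by (rule linear_form_cong) (simp add: dev_def)
  then show ?thesis using v by (simp add: gvar_def delta_form)
qed

lemma fn_dev: "g \<in> G \<Longrightarrow> v < n \<Longrightarrow> V.fn (dev g v) x = V.co (inv_into UNIV g x) v - V.co x v"
proof -
  assume g: "g \<in> G" and v: "v < n"
  have "V.fn (dev g v) x = (\<Sum>b<n. V.co x b * lin g v b) - (\<Sum>b<n. if b = v then V.co x v else 0)"
    unfolding V.fn_def sum_subtractf[symmetric] by (intro sum.cong refl) (auto simp: dev_def right_diff_distrib)
  then show ?thesis using v by (simp add: lin_apply[OF g])
qed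

lemma fixes_inv: "g \<in> G \<Longrightarrow> inv_into UNIV g x = x \<longleftrightarrow> g x = x"
  using G_props(1)[of g] by (metis bij_inv_eq_iff)

text \<open>The deviation of a conjugate of a coordinate function from itself is divisible by \<open>l\<close>; evaluated at a point
  of the hyperplane \<open>l = 0\<close> it vanishes, so the element fixes the hyperplane.\<close>

lemma inertia_reflection:
  assumes l: "l \<in> A.forms" and g: "g \<in> A.inertia l"
  shows "g \<in> {g \<in> G. \<exists>H. hyperplane sV H \<and> (\<forall>v\<in>H. g v = v)}"
proof -
  have gG: "g \<in> G" using A.inertia_carrier[OF g] by simp
  obtain g1 h1 v1 where l1: "l = A.X g1 v1 - A.X h1 v1" "v1 < n" "l \<noteq> 0" using l by (auto simp: A.forms_def)
  define a where "a = (\<lambda>b. lin g1 v1 b - lin h1 v1 b)"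
  have la: "l = linear_form {..<n} a" using l1 unfolding a_def by (simp add: gvar_def A.linear_form_diff)
  obtain b where b: "b < n" "a b \<noteq> 0"
    using l1(3) linear_form_nonzero_iff[of "{..<n}" a] unfolding la by auto
  have "g x = x" if x: "V.fn a x = 0" for x
  proof -
    interpret E: coeff_hom "\<lambda>c :: 'k. c" by unfold_locales simp_all
    have ev: "evalp (\<lambda>c. c) (V.co x) (linear_form {..<n} a') = V.fn a' x" for a'
      by (simp add: linear_form_eq E.evalp_sum E.evalp_mult V.fn_def mult.commute)
    have "inv_into UNIV g x = x"
    proof (rule V.co_ext)
      fix v assume v: "v < n"
      have "l dvd A.act g (Var v) - Var v" using g unfolding A.inertia_def by blast
      then have "l dvd linear_form {..<n} (dev g v)" using v by (simp add: A.act_simps dev_form)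
      then obtain q where q: "linear_form {..<n} (dev g v) = linear_form {..<n} a * q" unfolding la by (rule dvdE)
      have "V.fn (dev g v) x = V.fn a x * evalp (\<lambda>c. c) (V.co x) q"
        using arg_cong[OF q, of "evalp (\<lambda>c. c) (V.co x)"] by (simp add: E.evalp_mult ev)
      then show "V.co (inv_into UNIV g x) v = V.co x v" using x fn_dev[OF gG v, of x] by simp
    qed
    then show ?thesis using fixes_inv[OF gG] by simp
  qed
  then show ?thesis
    by (intro CollectI conjI gG exI[of _ "{x. V.fn a x = 0}"] V.hyperplane_kernel[where a = a, OF b] ballI) simp
qed

text \<open>All deviations of the coordinate functions vanish on the fixed hyperplane and hence are multiples of one of
  them, which is a difference of conjugates.\<close>

lemma reflection_inertia:
  assumes g: "g \<in> G" and H: "hyperplane sV H" "\<And>x. x \<in> H \<Longrightarrow> g x = x" and nid: "g \<noteq> id"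
  obtains l where "l \<in> A.forms" "g \<in> A.inertia l"
proof -
  have gc: "g \<in> carrier \<Gamma>" "\<one>\<^bsub>\<Gamma>\<^esub> \<in> carrier \<Gamma>" "g \<noteq> \<one>\<^bsub>\<Gamma>\<^esub>"
    using g nid group.is_monoid[OF group_\<Gamma>, THEN monoid.one_closed] by (simp_all add: GL_def)
  obtain v where v: "v < n" "A.X g v \<noteq> A.X \<one>\<^bsub>\<Gamma>\<^esub> v" by (rule A.X_neq[OF gc])
  let ?l = "A.X g v - A.X \<one>\<^bsub>\<Gamma>\<^esub> v"
  have l: "?l \<in> A.forms" 
    unfolding A.forms_def using gc v by (intro DiffI image_eqI[of _ _ "(g, \<one>\<^bsub>\<Gamma>\<^esub>, v)"]) auto
  have lf: "?l = linear_form {..<n} (dev g v)" unfolding A.gvar_one[OF v(1)] by (rule dev_form[OF v(1)])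
  have l0: "?l \<noteq> 0" using v(2) by simp
  obtain b where b: "b < n" "dev g v b \<noteq> 0"
    using l0 linear_form_nonzero_iff[of "{..<n}" "dev g v"] unfolding lf by auto
  have van: "V.fn (dev g w) x = 0" if "w < n" "x \<in> H" for w x
    using fn_dev[OF g that(1), of x] fixes_inv[OF g, of x] H(2)[OF that(2)] by simp
  have "?l dvd A.X g w - Var w" if w: "w < n" for w
  proof -
    obtain c where c: "\<forall>b<n. dev g w b = c * dev g v b"
      by (rule V.proportional_on_hyperplane[where a = "dev g v" and a' = "dev g w", OF H(1) b van[OF v(1)] van[OF w]])
    have "A.X g w - Var w = Const c * ?l"
      unfolding lf dev_form[OF w] linear_form_eq sum_distrib_left
      by (intro sum.cong refl) (simp add: c Const_mult mult.assoc)
    then show ?thesis by simp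
  qed
  then have "g \<in> A.inertia ?l" by (rule A.inertiaI[OF gc(1)])
  then show ?thesis by (rule that[OF l])
qed

lemma reflections_iff:
  "(\<forall>l\<in>A.forms. \<forall>g\<in>A.inertia l. A.trivial g) \<longleftrightarrow> (\<forall>w\<in>reflection_subgroup sV G. \<forall>x. \<rho> w x = x)"
proof
  let ?R = "{g \<in> G. \<exists>H. hyperplane sV H \<and> (\<forall>v\<in>H. g v = v)}"
  assume triv: "\<forall>l\<in>A.forms. \<forall>g\<in>A.inertia l. A.trivial g"
  have R: "\<forall>x. \<rho> g x = x" if gR: "g \<in> ?R" for g
  proof (cases "g = id")
    case False
    obtain H where g: "g \<in> G" and H: "hyperplane sV H" "\<And>x. x \<in> H \<Longrightarrow> g x = x" using gR by blast
    obtain l where "l \<in> A.forms" "g \<in> A.inertia l" by (rule reflection_inertia[OF g H False])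
    then show ?thesis using triv trivial_iff[OF g] by blast
  qed (simp add: \<rho>_id)
  have "w \<in> G \<and> (\<forall>x. \<rho> w x = x)" if "w \<in> generate (GL sV) ?R" for w
    using that
  proof (induction rule: generate.induct)
    case one
    have e: "\<one>\<^bsub>GL sV\<^esub> = id" unfolding GL_def by (rule monoid.simps(2))
    show ?case unfolding e using subgroup.one_closed[OF G_sub, unfolded e] \<rho>_id by blast
  next
    case (incl h)
    then show ?case using R by blast
  next
    case (inv h)
    then have h: "h \<in> G" and t: "\<forall>x. \<rho> h x = x" using R by blast+
    let ?h = "inv\<^bsub>GL sV\<^esub> h"
    have i: "?h \<in> G" by (rule subgroup.m_inv_closed[OF G_sub h])
    have "?h \<otimes>\<^bsub>GL sV\<^esub> h = \<one>\<^bsub>GL sV\<^esub>"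
      using group.l_inv[OF group_GL[OF V.vector_space_axioms]] subgroup.subset[OF G_sub] h by blast
    then have "?h \<circ> h = id" by (simp add: GL_def)
    then have "\<rho> ?h x = x" for x using \<rho>_mult[OF i h, of x] t \<rho>_id by simp
    then show ?case using i by blast
  next
    case (eng h1 h2)
    then have h: "h1 \<in> G" "h2 \<in> G" and t: "\<rho> h1 x = x" "\<rho> h2 x = x" for x by blast+
    have e: "h1 \<otimes>\<^bsub>GL sV\<^esub> h2 = h1 \<circ> h2" unfolding GL_def monoid.simps by (rule refl)
    have "h1 \<circ> h2 \<in> G" using subgroup.m_closed[OF G_sub h] unfolding e .
    moreover have "\<rho> (h1 \<circ> h2) x = x" for x unfolding \<rho>_mult[OF h] t by (rule refl)
    ultimately show ?case unfolding e by blast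
  qed
  then show "\<forall>w\<in>reflection_subgroup sV G. \<forall>x. \<rho> w x = x" unfolding reflection_subgroup_def by blast
next
  let ?R = "{g \<in> G. \<exists>H. hyperplane sV H \<and> (\<forall>v\<in>H. g v = v)}"
  assume triv: "\<forall>w\<in>reflection_subgroup sV G. \<forall>x. \<rho> w x = x"
  show "\<forall>l\<in>A.forms. \<forall>g\<in>A.inertia l. A.trivial g"
  proof (intro ballI)
    fix l g assume lg: "l \<in> A.forms" "g \<in> A.inertia l"
    have gR: "g \<in> ?R" by (rule inertia_reflection[OF lg])
    then have "g \<in> reflection_subgroup sV G" unfolding reflection_subgroup_def by (rule generate.incl)
    then show "A.trivial g" using triv trivial_iff[of g] gR by blast
  qed
qed

theorem s_invariant_covariants:
  "s_invariant sM (invariant_ring sV BV G) (covariants sV BV G sM \<rho>) \<in> \<nat> \<and>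
    (s_invariant sM (invariant_ring sV BV G) (covariants sV BV G sM \<rho>) = 0 \<longleftrightarrow>
      (\<forall>w\<in>reflection_subgroup sV G. \<forall>x. \<rho> w x = x))"
proof -
  obtain \<sigma> :: int where \<sigma>: "\<sigma> \<ge> 0" "\<sigma> = 0 \<longleftrightarrow> (\<forall>l\<in>A.forms. \<forall>g\<in>A.inertia l. A.trivial g)"
    "expansion_at_1 (fps_to_ratfun (Abs_fps (\<lambda>i. of_nat (UU.dim (A.cfam n i)))) /
        fps_to_ratfun (Abs_fps (\<lambda>i. of_nat (UU.dim (A.ifam n i))))) (of_nat m) (of_int \<sigma>)"
    by (rule A.covariants_expansion)
  have ex: "expansion_at_1 (hilbert_quotient sM (invariant_ring sV BV G) (covariants sV BV G sM \<rho>)) (of_nat m) (of_int \<sigma>)"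
    using \<sigma>(3) unfolding hilbert_quotient_def hilbert_series_def dim_covariants dim_invariants .
  have s: "s_invariant sM (invariant_ring sV BV G) (covariants sV BV G sM \<rho>) = of_int \<sigma>"
    unfolding s_invariant_def
  proof (rule the_equality)
    show "\<exists>r. expansion_at_1 (hilbert_quotient sM (invariant_ring sV BV G) (covariants sV BV G sM \<rho>)) r (of_int \<sigma>)"
      by (rule exI[where x = "of_nat m"], rule ex)
    show "s = of_int \<sigma>" if "\<exists>r. expansion_at_1 (hilbert_quotient sM (invariant_ring sV BV G) (covariants sV BV G sM \<rho>)) r s" for s
      using that expansion_at_1_unique(2)[OF _ ex] by blast
  qed
  have "(of_int \<sigma> :: rat) = of_nat (nat \<sigma>)" using \<sigma>(1) by simp
  then have "(of_int \<sigma> :: rat) \<in> \<nat>" by (metis of_nat_in_Nats)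
  then show ?thesis unfolding s reflections_iff[symmetric] \<sigma>(2)[symmetric] by simp
qed

end

theorem proposition3:
  fixes sV :: "'k::field \<Rightarrow> 'v::ab_group_add \<Rightarrow> 'v" and BV :: "'v set"
    and sM :: "'k \<Rightarrow> 'm::ab_group_add \<Rightarrow> 'm" and BM :: "'m set"
    and G :: "('v \<Rightarrow> 'v) set" and \<rho> :: "('v \<Rightarrow> 'v) \<Rightarrow> 'm \<Rightarrow> 'm"
  assumes V: "finite_dimensional_vector_space sV BV"
    and M: "finite_dimensional_vector_space sM BM"
    and G: "subgroup G (GL sV)" "finite G"
    and \<rho>: "\<rho> \<in> hom ((GL sV)\<lparr>carrier := G\<rparr>) (GL sM)"
  shows "s_invariant sM (invariant_ring sV BV G) (covariants sV BV G sM \<rho>) \<in> \<nat> \<and>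
    (s_invariant sM (invariant_ring sV BV G) (covariants sV BV G sM \<rho>) = 0 \<longleftrightarrow>
      (\<forall>w\<in>reflection_subgroup sV G. \<forall>m. \<rho> w m = m))"
proof -
  interpret V: finite_dimensional_vector_space sV BV by (rule V)
  interpret M: finite_dimensional_vector_space sM BM by (rule M)
  obtain bv where bv: "bij_betw bv {..<card BV} BV"
    using ex_bij_betw_nat_finite[OF V.finite_Basis] unfolding atLeast0LessThan by blast
  obtain bm where bm: "bij_betw bm {..<card BM} BM"
    using ex_bij_betw_nat_finite[OF M.finite_Basis] unfolding atLeast0LessThan by blast
  interpret linear_setup sV BV bv sM BM bm G \<rho>
    by (intro linear_setup.intro linear_setup_axioms.intro coords.intro coords_axioms.intro V M bv bm G \<rho>)
  show ?thesis by (rule s_invariant_covariants)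
qed


end
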